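(* Let $\alpha\in\mathcal{A}$ and assume that all non-trivial zeros $\rho_n$ of $\zeta(s)$ are simple and satisfy $1/\zeta'(\rho_n)=O(|\rho_n|^B)$ as $n\to\infty$ for some constant $B>0$. Let $m\in\mathbb{Z}$, $n\in\mathbb{N}_0$ and $\ell\in\mathbb{N}$ with $m+n=2\ell-1$. Then, as $\varepsilon\to0$ (with $\varepsilon>0$ small): if $m\geq 0$, $$\Phi_2(-m,-n+\varepsilon;1,\widetilde{\alpha})=\frac{1}{\varepsilon}\left\{(-1)^nD_{2\ell}\frac{m!\,n!}{(m+n+1)!}+\sum_{\substack{k=1\\k\ \text{even}}}^{n}(-1)^k\binom{n}{k}D_k\,\zeta(-m-n+k)\right\}+O(1);$$ if $m\leq -1$, $$\Phi_2(-m,-n+\varepsilon;1,\widetilde{\alpha})=\frac{2D_{2\ell}}{\varepsilon^2}\binom{n}{2\ell}+O(1/\varepsilon).$$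
   Context: $\zeta$ is the Riemann zeta function. For an arithmetic function $\alpha:\mathbb{N}\to\mathbb{C}$, $\Phi(s;\alpha)=\sum_{n\ge1}\alpha(n)n^{-s}$. $\mathcal{A}$ is the set of $\alpha$ such that (I) $\Phi(s;\alpha)$ converges absolutely for $\Re s>\delta=\delta(\alpha)>0$; (II) $\Phi(s;\alpha)$ continues meromorphically to $\mathbb{C}$, holomorphic except for at most a simple pole at $s=\delta$; (III) in any fixed strip $\sigma_1\le\sigma\le\sigma_2$, $\Phi(\sigma+it;\alpha)=O(|t|^A)$ as $|t|\to\infty$ for some constant $A\ge0$. The function $\widetilde{\alpha}$ is defined by $\Phi(s;\alpha)/\zeta(s)=\sum_{n\ge1}\widetilde{\alpha}(n)n^{-s}$, i.e. $\widetilde{\alpha}(n)=\sum_{d\mid n}\alpha(n/d)\mu(d)$ with $\mu$ the Möbius function. $\Phi_2(s_1,s_2;1,\widetilde{\alpha})=\sum_{m_1=1}^\infty\sum_{m_2=1}^\infty\frac{\widetilde{\alpha}(m_2)}{m_1^{s_1}(m_1+m_2)^{s_2}}$, absolutely convergent for $\Re s_2>\max\{1,\delta\}$, $\Re(s_1+s_2)>\max\{2,1+\delta\}$; under the stated assumption on zeros it is known to continue meromorphically to $\mathbb{C}^2$, and values above mean values of this continuation. For even $k\in\mathbb{N}$, $D_k=\frac{\Phi(-k;\alpha)}{\zeta'(-k)}=\frac{(-1)^{k/2}2(2\pi)^k\Phi(-k;\alpha)}{k!\,\zeta(k+1)}$. *)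

theory Defs
  imports
    "HOL-Complex_Analysis.Complex_Analysis"
    "HOL-Computational_Algebra.Squarefree"
    "HOL-Library.Landau_Symbols"
begin

text \<open>
  Arithmetic functions are functions of type \<open>nat \<Rightarrow> complex\<close> whose value at \<open>0\<close> is never used.
\<close>

definition dirichlet_term :: "(nat \<Rightarrow> complex) \<Rightarrow> complex \<Rightarrow> nat \<Rightarrow> complex" where
  "dirichlet_term \<alpha> s n = \<alpha> n / of_nat n powr s"

definition dirichlet_continuation :: "(nat \<Rightarrow> complex) \<Rightarrow> (complex \<Rightarrow> complex) \<Rightarrow> bool" where
  "dirichlet_continuation \<alpha> F \<longleftrightarrow>
     F nicely_meromorphic_on UNIV \<and>
     (\<exists>\<sigma>::real. \<forall>s. Re s > \<sigma> \<longrightarrow>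
        (\<lambda>n. norm (dirichlet_term \<alpha> s n)) summable_on {1..} \<and>
        F s = (\<Sum>\<^sub>\<infinity>n\<in>{1..}. dirichlet_term \<alpha> s n))"

text \<open>
  Such an \<open>F\<close> is unique if it exists, since \<open>nicely_meromorphic_on\<close> prescribes the value \<open>0\<close> at
  poles and the limit everywhere else.
\<close>

definition Phi :: "(nat \<Rightarrow> complex) \<Rightarrow> complex \<Rightarrow> complex" where
  "Phi \<alpha> = (THE F. dirichlet_continuation \<alpha> F)"

definition zeta :: "complex \<Rightarrow> complex" where
  "zeta = Phi (\<lambda>_. 1)"

text \<open>
  The point \<open>1\<close> has to be excluded because \<open>zeta 1 = 0\<close> by the convention for values at poles.
\<close>

definition nontrivial_zeta_zeros :: "complex set" where
  "nontrivial_zeta_zeros =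
     {\<rho>. \<rho> \<noteq> 1 \<and> zeta \<rho> = 0 \<and> (\<forall>k::nat. k \<ge> 1 \<longrightarrow> \<rho> \<noteq> - of_nat (2 * k))}"

text \<open>
  The class of coefficient functions. In the growth condition the bound is uniform in \<open>x\<close> on the
  strip, and the exponent may depend on the strip.
\<close>

definition dirichlet_class :: "(nat \<Rightarrow> complex) set" where
  "dirichlet_class = {\<alpha>. \<exists>\<delta>::real. \<delta> > 0 \<and>
     (\<forall>s. Re s > \<delta> \<longrightarrow> (\<lambda>n. norm (dirichlet_term \<alpha> s n)) summable_on {1..}) \<and>
     (\<exists>F. dirichlet_continuation \<alpha> F) \<and>
     Phi \<alpha> holomorphic_on (UNIV - {of_real \<delta>}) \<and>
     (is_pole (Phi \<alpha>) (of_real \<delta>) \<longrightarrow> zorder (Phi \<alpha>) (of_real \<delta>) = -1) \<and>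
     (\<forall>\<sigma>1 \<sigma>2. \<exists>A\<ge>0. \<exists>C T. \<forall>x\<in>{\<sigma>1..\<sigma>2}. \<forall>t. \<bar>t\<bar> \<ge> T \<longrightarrow>
        norm (Phi \<alpha> (Complex x t)) \<le> C * \<bar>t\<bar> powr A)}"

definition moebius :: "nat \<Rightarrow> int" where
  "moebius n = (if squarefree n then (-1) ^ card (prime_factors n) else 0)"

definition alpha_tilde :: "(nat \<Rightarrow> complex) \<Rightarrow> nat \<Rightarrow> complex" where
  "alpha_tilde \<alpha> n = (\<Sum>d | d dvd n. \<alpha> (n div d) * of_int (moebius d))"

definition D_coeff :: "(nat \<Rightarrow> complex) \<Rightarrow> nat \<Rightarrow> complex" where
  "D_coeff \<alpha> k = Phi \<alpha> (- of_nat k) / deriv zeta (- of_nat k)"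


text \<open>
  Holomorphic functions of two variables: the Frechet derivative exists and is complex linear.
\<close>

definition holomorphic2_on :: "(complex \<times> complex \<Rightarrow> complex) \<Rightarrow> (complex \<times> complex) set \<Rightarrow> bool"
    (infixl \<open>holomorphic2'_on\<close> 50) where
  "f holomorphic2_on U \<longleftrightarrow>
     (\<forall>p\<in>U. \<exists>a b. (f has_derivative (\<lambda>(u, v). a * u + b * v)) (at p within U))"

text \<open>
  Meromorphic functions on \<open>\<complex>\<^sup>2\<close>: locally a quotient of holomorphic functions whose denominator
  vanishes identically on no nonempty open set. The second conjunct fixes the values
  at removable singularities, so that the function is holomorphic off its polar set; the
  values on the polar set itself are arbitrary.
\<close>

definition nicely_meromorphic2 :: "(complex \<times> complex \<Rightarrow> complex) \<Rightarrow> bool" where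
  "nicely_meromorphic2 F \<longleftrightarrow>
     (\<forall>p. \<exists>V g h. open V \<and> p \<in> V \<and> g holomorphic2_on V \<and> h holomorphic2_on V \<and>
        V \<subseteq> closure {x\<in>V. h x \<noteq> 0} \<and> (\<forall>x\<in>V. h x \<noteq> 0 \<longrightarrow> F x = g x / h x)) \<and>
     (\<forall>V g. open V \<and> g holomorphic2_on V \<and> V \<subseteq> closure {x\<in>V. F x = g x} \<longrightarrow>
        (\<forall>x\<in>V. F x = g x))"

definition double_term ::
    "(nat \<Rightarrow> complex) \<Rightarrow> (nat \<Rightarrow> complex) \<Rightarrow> complex \<Rightarrow> complex \<Rightarrow> nat \<Rightarrow> nat \<Rightarrow> complex" where
  "double_term \<alpha>1 \<alpha>2 s1 s2 m1 m2 =
     \<alpha>1 m1 * \<alpha>2 m2 / (of_nat m1 powr s1 * of_nat (m1 + m2) powr s2)"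

text \<open>
  Two continuations agree off the polar set, whatever bound \<open>\<sigma>\<close> they come with.
\<close>

definition double_continuation ::
    "(nat \<Rightarrow> complex) \<Rightarrow> (nat \<Rightarrow> complex) \<Rightarrow> (complex \<times> complex \<Rightarrow> complex) \<Rightarrow> bool" where
  "double_continuation \<alpha>1 \<alpha>2 F \<longleftrightarrow>
     nicely_meromorphic2 F \<and>
     (\<exists>\<sigma>::real. \<forall>s1 s2. Re s2 > \<sigma> \<and> Re (s1 + s2) > \<sigma> \<longrightarrow>
        (\<lambda>(m1, m2). norm (double_term \<alpha>1 \<alpha>2 s1 s2 m1 m2)) summable_on ({1..} \<times> {1..}) \<and>
        F (s1, s2) = (\<Sum>\<^sub>\<infinity>m1\<in>{1..}. \<Sum>\<^sub>\<infinity>m2\<in>{1..}. double_term \<alpha>1 \<alpha>2 s1 s2 m1 m2))"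

definition Phi2 ::
    "complex \<Rightarrow> complex \<Rightarrow> (nat \<Rightarrow> complex) \<Rightarrow> (nat \<Rightarrow> complex) \<Rightarrow> complex" where
  "Phi2 s1 s2 \<alpha>1 \<alpha>2 = (SOME F. double_continuation \<alpha>1 \<alpha>2 F) (s1, s2)"

end

theory Submission
  imports Defs "HOL-Real_Asymp.Real_Asymp"
begin

text \<open>
  Write \<open>Q(s) = \<Phi>(s; \<alpha>) / \<zeta>(s)\<close>, \<open>P(t) = \<Sum>\<^sub>n \<alpha>~(n) e\<^bsup>-nt\<^esup>\<close> and \<open>L(s, t) = \<Sum>\<^sub>n n\<^bsup>-s\<^esup> e\<^bsup>-nt\<^esup>\<close>. In the domain of
  absolute convergence, \<open>\<Gamma>(s\<^sub>2) \<Phi>\<^sub>2(s\<^sub>1, s\<^sub>2)\<close> is the Mellin transform of \<open>t \<mapsto> P(t) L(s\<^sub>1, t)\<close> at \<open>s\<^sub>2\<close>. Inserting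
  \<open>L(s, t) = \<Gamma>(1 - s) t\<^bsup>s-1\<^esup> + \<Sum>\<^sub>k\<^sub><\<^sub>K \<zeta>(s - k) (-t)\<^bsup>k\<^esup> / k! + J\<^sub>K(s, t)\<close> and integrating term by term gives, for
  \<open>Re s\<^sub>1 < K\<close> and \<open>Re s\<^sub>2 > \<sigma> - K\<close>, the continuation
  \<open>\<Sum>\<^sub>k\<^sub><\<^sub>K binom(-s\<^sub>2, k) \<zeta>(s\<^sub>1 - k) Q(s\<^sub>2 + k) + \<Gamma>(s\<^sub>1 + s\<^sub>2 - 1) \<Gamma>(1 - s\<^sub>1) Q(s\<^sub>1 + s\<^sub>2 - 1) / \<Gamma>(s\<^sub>2)\<close>
  plus \<open>1 / \<Gamma>(s\<^sub>2)\<close> times a holomorphic function. Shifting no contour, it never meets the nontrivial zeros of \<open>\<zeta>\<close>.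
  The asserted expansions follow because \<open>Q\<close> has at most simple poles at the integers: at a nonpositive integer
  only at \<open>-k\<close> with \<open>k > 0\<close> even, with residue \<open>D\<^sub>k\<close>. The expansion of \<open>L\<close> rests on Lipschitz' formula for \<open>J\<^sub>0\<close>,
  which also yields the functional equation of \<open>\<zeta>\<close>.
\<close>

section \<open>Parametric integrals\<close>

text \<open>\<open>Phi2\<close> is a value of some continuation picked by \<open>SOME\<close>, so
  everything rests on one evaluation principle: every admissible continuation takes, at a point near
  which a holomorphic function represents it densely, the value of that function. Two obstacles
  shape the rest. The explicit formula has artificial poles on the lines s1 = 1, 2, ..., where those
  of Gamma(1 - s1) and zeta(s1 - k) cancel; it is used only off these lines and is rewritten without
  poles near them. And the points (-m, -n) lie on possible polar lines, so the values are computed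
  on boxes around (-m, -n + eps) that shrink with eps. The expansion of L is obtained by integration
  in t: as dL/dt = -L(s - 1, t), Lipschitz' formula for Re s < 0 is lifted one unit of Re s at a
  time, and each new constant of integration is recognised as zeta(s) in the limit t -> 0. The
  number K of terms is dictated by the growth of P at t = 0, at most a multiple of t^(-sigma), which
  the remainder J_K = O(t^K) has to compensate.\<close>

lemma holomorphic_on_ball_lipschitz:
  fixes f :: "complex \<Rightarrow> complex"
  assumes holo: "f holomorphic_on ball z r" and r: "r > 0"
    and bound: "\<And>w. w \<in> ball z r \<Longrightarrow> norm (f w) \<le> B"
    and x: "x \<in> ball z (r/2)" and y: "y \<in> ball z (r/2)"
  shows "norm (f x - f y) \<le> (4 * B / r) * norm (x - y)"
proof (rule field_differentiable_bound[OF convex_ball _ _ x y])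
  fix w assume w: "w \<in> ball z (r/2)"
  \<comment> \<open>Since r/2 + r/4 < r, Cauchy's estimate on the circle of radius r/4 stays where
    \<open>f\<close> is bounded by \<open>B\<close>; this is the origin of the factor 4 / r.\<close>
  have sub: "cball w (r/4) \<subseteq> ball z r"
  proof
    fix u assume "u \<in> cball w (r/4)"
    then have "dist z u \<le> dist z w + r/4" using dist_triangle[of z u w] by auto
    then show "u \<in> ball z r" using w r by auto
  qed
  have "w \<in> ball z r" using w r by auto
  then show "(f has_field_derivative deriv f w) (at w within ball z (r/2))"
    using holo holomorphic_derivI[OF holo] by (auto intro: DERIV_subset)
  have "norm ((deriv ^^ 1) f w) \<le> fact 1 * B / (r/4) ^ 1"
  proof (rule Cauchy_inequality)
    show "f holomorphic_on ball w (r/4)"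
      using sub ball_subset_cball holo holomorphic_on_subset by (metis subset_trans)
    show "continuous_on (cball w (r/4)) f"
      using sub holo holomorphic_on_subset holomorphic_on_imp_continuous_on by blast
    show "norm (f u) \<le> B" if "norm (w - u) = r/4" for u
      using that sub by (intro bound) (auto simp: dist_norm)
  qed (use r in auto)
  then show "norm (deriv f w) \<le> 4 * B / r" by (simp add: field_simps)
qed

text \<open>Dominated convergence for difference quotients: by the Lipschitz estimate a local
  majorant g of \<open>f\<close> majorises them too, as 4 g / r, so only \<open>f\<close> itself has
  to be dominated near each point.\<close>

lemma holomorphic_on_lebesgue_integral:
  fixes f :: "complex \<Rightarrow> 'a \<Rightarrow> complex"
  assumes U: "open U"
   and holo: "\<And>t. t \<in> space M \<Longrightarrow> (\<lambda>z. f z t) holomorphic_on U"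
   and meas: "\<And>z. z \<in> U \<Longrightarrow> f z \<in> borel_measurable M"
   and dom: "\<And>z. z \<in> U \<Longrightarrow> \<exists>r>0. \<exists>g. integrable M g \<and>
      (\<forall>w\<in>ball z r \<inter> U. \<forall>t\<in>space M. norm (f w t) \<le> g t)"
  shows "(\<lambda>z. \<integral>t. f z t \<partial>M) holomorphic_on U"
  unfolding holomorphic_on_open[OF U]
proof
  fix z assume z: "z \<in> U"
  from dom[OF z] obtain r0 g where r0: "r0 > 0" and g: "integrable M g"
    and gb: "\<And>w t. w \<in> ball z r0 \<inter> U \<Longrightarrow> t \<in> space M \<Longrightarrow> norm (f w t) \<le> g t" by metis
  obtain r1 where r1: "r1 > 0" "ball z r1 \<subseteq> U" using U z open_contains_ball by blast
  define r where "r = min r0 r1"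
  have r: "r > 0" "ball z r \<subseteq> U" "ball z r \<subseteq> ball z r0" using r0 r1 by (auto simp: r_def)
  have bd: "norm (f w t) \<le> g t" if "w \<in> ball z r" "t \<in> space M" for w t
    using that r by (intro gb) blast+
  have int: "integrable M (f w)" if "w \<in> ball z r" for w
  proof (rule Bochner_Integration.integrable_bound[OF g])
    show "f w \<in> borel_measurable M" using that r meas by auto
    show "AE t in M. norm (f w t) \<le> norm (g t)"
      using bd[OF that] by (intro AE_I2) (metis abs_ge_self order_trans real_norm_def)
  qed
  let ?D = "\<integral>t. deriv (\<lambda>z. f z t) z \<partial>M"
  have "((\<lambda>y. ((\<integral>t. f y t \<partial>M) - (\<integral>t. f z t \<partial>M)) / (y - z)) \<longlongrightarrow> ?D) (at z within ball z (r/2))"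
    unfolding tendsto_at_iff_sequentially
  proof safe
    fix X assume X: "\<forall>i. X i \<in> ball z (r/2) - {z}" "X \<longlonglongrightarrow> z"
    have Xr: "X i \<in> ball z r" "X i \<in> ball z (r/2)" "X i \<noteq> z" for i
      using X(1)[rule_format, of i] r by auto
    have lim: "(\<lambda>i. (f (X i) t - f z t) / (X i - z)) \<longlonglongrightarrow> deriv (\<lambda>z. f z t) z"
      if "t \<in> space M" for t
    proof -
      have "((\<lambda>z. f z t) has_field_derivative deriv (\<lambda>z. f z t) z) (at z)"
        using holo[OF that] U z holomorphic_derivI by blast
      then have "((\<lambda>y. (f y t - f z t) / (y - z)) \<longlongrightarrow> deriv (\<lambda>z. f z t) z) (at z)"
        by (simp add: has_field_derivative_iff)
      then show ?thesis
        using X(2) Xr(3) unfolding tendsto_at_iff_sequentially o_def by auto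
    qed
    have m: "(\<lambda>t. (f (X i) t - f z t) / (X i - z)) \<in> borel_measurable M" for i
      using meas[of "X i"] meas[OF z] Xr(1)[of i] r by (auto intro!: borel_measurable_divide borel_measurable_diff)
    have "(\<lambda>i. \<integral>t. (f (X i) t - f z t) / (X i - z) \<partial>M) \<longlonglongrightarrow> ?D"
    proof (rule integral_dominated_convergence[where w = "\<lambda>t. 4 * g t / r"])
      show "(\<lambda>t. deriv (\<lambda>z. f z t) z) \<in> borel_measurable M"
        by (rule borel_measurable_LIMSEQ_metric[OF m lim])
      show "integrable M (\<lambda>t. 4 * g t / r)" using g by auto
      show "AE t in M. norm ((f (X i) t - f z t) / (X i - z)) \<le> 4 * g t / r" for i
      proof (rule AE_I2)
        fix t assume t: "t \<in> space M"
        have "norm (f (X i) t - f z t) \<le> (4 * g t / r) * norm (X i - z)"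
          using holo[OF t] r bd t Xr
          by (intro holomorphic_on_ball_lipschitz[where z = z and r = r])
             (auto intro: holomorphic_on_subset)
        then show "norm ((f (X i) t - f z t) / (X i - z)) \<le> 4 * g t / r"
          using Xr(3)[of i] by (simp add: norm_divide divide_le_eq)
      qed
    qed (use m lim in auto)
    moreover have eq: "(\<integral>t. (f (X i) t - f z t) / (X i - z) \<partial>M) =
        ((\<integral>t. f (X i) t \<partial>M) - (\<integral>t. f z t \<partial>M)) / (X i - z)" for i
      using int[OF Xr(1)] int[of z] r by simp
    ultimately show "((\<lambda>y. ((\<integral>t. f y t \<partial>M) - (\<integral>t. f z t \<partial>M)) / (y - z)) \<circ> X) \<longlonglongrightarrow> ?D"
      by (simp only: o_def eq)
  qed
  moreover have "at z within ball z (r/2) = at z" using r by (intro at_within_open) auto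
  ultimately have "((\<lambda>z. \<integral>t. f z t \<partial>M) has_field_derivative ?D) (at z)"
    by (simp add: has_field_derivative_iff)
  then show "\<exists>f'. ((\<lambda>z. \<integral>t. f z t \<partial>M) has_field_derivative f') (at z)" by blast
qed

text \<open>A series is an integral over the counting measure on the naturals, so the result on
  parametric integrals applies.\<close>

lemma holomorphic_on_suminf_dominated:
  fixes f :: "complex \<Rightarrow> nat \<Rightarrow> complex"
  assumes U: "open U"
   and holo: "\<And>n. (\<lambda>z. f z n) holomorphic_on U"
   and dom: "\<And>z. z \<in> U \<Longrightarrow> \<exists>r>0. \<exists>g. summable g \<and> (\<forall>w\<in>ball z r \<inter> U. \<forall>n. norm (f w n) \<le> g n)"
  shows "(\<lambda>z. \<Sum>n. f z n) holomorphic_on U"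
proof -
  have dom': "\<exists>r>0. \<exists>g. integrable (count_space UNIV) g \<and>
      (\<forall>w\<in>ball z r \<inter> U. \<forall>t\<in>space (count_space UNIV). norm (f w t) \<le> g t)" if z: "z \<in> U" for z
  proof -
    from dom[OF z] obtain r g where r: "r > 0" "summable g" "\<And>w n. w\<in>ball z r \<inter> U \<Longrightarrow> norm (f w n) \<le> g n"
      by metis
    have "norm (g n) = g n" for n using order_trans[OF norm_ge_zero r(3)[of z n]] r(1) z by auto
    then show ?thesis using r by (intro exI[of _ r] conjI exI[of _ g]) (auto simp: integrable_count_space_nat_iff)
  qed
  have "(\<lambda>z. \<integral>n. f z n \<partial>count_space UNIV) holomorphic_on U"
    by (rule holomorphic_on_lebesgue_integral[OF U holo _ dom']) auto
  moreover have "(\<integral>n. f z n \<partial>count_space UNIV) = (\<Sum>n. f z n)" if z: "z \<in> U" for z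
  proof -
    from dom[OF z] obtain r g where r: "r > 0" "summable g" "\<And>w n. w\<in>ball z r \<inter> U \<Longrightarrow> norm (f w n) \<le> g n"
      by metis
    have "summable (\<lambda>n. norm (f z n))"
      using r z by (intro summable_comparison_test[OF _ r(2)]) auto
    then show ?thesis by (intro integral_count_space_nat) (simp add: integrable_count_space_nat_iff)
  qed
  ultimately show ?thesis by (simp cong: holomorphic_cong)
qed

section \<open>Holomorphic functions of two variables\<close>

lemma holomorphic2_onD:
  assumes "f holomorphic2_on U" "open U" "p \<in> U"
  obtains a b where "(f has_derivative (\<lambda>(u, v). a * u + b * v)) (at p)"
  using assms unfolding holomorphic2_on_def by (metis at_within_open)

lemma holomorphic2_on_subset: "f holomorphic2_on U \<Longrightarrow> V \<subseteq> U \<Longrightarrow> f holomorphic2_on V"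
  unfolding holomorphic2_on_def by (meson has_derivative_subset subsetD)

lemma holomorphic2_on_imp_continuous_on: "f holomorphic2_on U \<Longrightarrow> continuous_on U f"
  unfolding holomorphic2_on_def by (meson continuous_on_eq_continuous_within has_derivative_continuous)

lemma holomorphic2_on_const [intro]: "(\<lambda>_. c) holomorphic2_on U"
  unfolding holomorphic2_on_def
  by (intro ballI exI[of _ 0]) (auto simp: case_prod_unfold)

lemma holomorphic2_on_affine: "(\<lambda>(x, y). a * x + b * y + c) holomorphic2_on U"
  unfolding holomorphic2_on_def
  by (intro ballI exI[of _ a] exI[of _ b])
     (auto simp: case_prod_unfold intro!: derivative_eq_intros)

lemma holomorphic2_on_add:
  assumes "f holomorphic2_on U" "g holomorphic2_on U"
  shows "(\<lambda>x. f x + g x) holomorphic2_on U"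
  unfolding holomorphic2_on_def
proof
  fix p assume p: "p \<in> U"
  obtain a b c d where
    "(f has_derivative (\<lambda>(u, v). a * u + b * v)) (at p within U)"
    "(g has_derivative (\<lambda>(u, v). c * u + d * v)) (at p within U)"
    using assms p unfolding holomorphic2_on_def by meson
  from has_derivative_add[OF this]
  show "\<exists>a b. ((\<lambda>x. f x + g x) has_derivative (\<lambda>(u, v). a * u + b * v)) (at p within U)"
    by (intro exI[of _ "a + c"] exI[of _ "b + d"]) (simp add: case_prod_unfold algebra_simps)
qed

lemma holomorphic2_on_mult:
  assumes "f holomorphic2_on U" "g holomorphic2_on U"
  shows "(\<lambda>x. f x * g x) holomorphic2_on U"
  unfolding holomorphic2_on_def
proof
  fix p assume p: "p \<in> U"
  obtain a b c d where
    "(f has_derivative (\<lambda>(u, v). a * u + b * v)) (at p within U)"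
    "(g has_derivative (\<lambda>(u, v). c * u + d * v)) (at p within U)"
    using assms p unfolding holomorphic2_on_def by meson
  from has_derivative_mult[OF this]
  show "\<exists>a b. ((\<lambda>x. f x * g x) has_derivative (\<lambda>(u, v). a * u + b * v)) (at p within U)"
    by (intro exI[of _ "f p * c + a * g p"] exI[of _ "f p * d + b * g p"])
       (simp add: case_prod_unfold algebra_simps)
qed

lemma holomorphic2_on_compose:
  assumes f: "f holomorphic_on A" and A: "open A" and g: "g holomorphic2_on U" and "g ` U \<subseteq> A"
  shows "(\<lambda>x. f (g x)) holomorphic2_on U"
  unfolding holomorphic2_on_def
proof
  fix p assume p: "p \<in> U"
  obtain a b where d: "(g has_derivative (\<lambda>(u, v). a * u + b * v)) (at p within U)"
    using g p unfolding holomorphic2_on_def by meson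
  have "g p \<in> A" using p assms(4) by auto
  then have "(f has_field_derivative deriv f (g p)) (at (g p))"
    using holomorphic_derivI[OF f A] by blast
  then have "(f has_derivative (*) (deriv f (g p))) (at (g p))" by (simp add: has_field_derivative_def)
  from has_derivative_compose[OF d this]
  show "\<exists>a b. ((\<lambda>x. f (g x)) has_derivative (\<lambda>(u, v). a * u + b * v)) (at p within U)"
    by (intro exI[of _ "deriv f (g p) * a"] exI[of _ "deriv f (g p) * b"])
       (simp add: case_prod_unfold algebra_simps)
qed

lemma holomorphic2_on_compose_affine:
  assumes f: "f holomorphic_on A" and A: "open A"
    and sub: "\<And>x y. (x, y) \<in> U \<Longrightarrow> a * x + b * y + c \<in> A"
  shows "(\<lambda>(x, y). f (a * x + b * y + c)) holomorphic2_on U"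
proof -
  have "(\<lambda>p. f (case p of (x, y) \<Rightarrow> a * x + b * y + c)) holomorphic2_on U"
    by (rule holomorphic2_on_compose[OF f A holomorphic2_on_affine]) (use sub in auto)
  then show ?thesis by (simp add: case_prod_unfold)
qed

lemma holomorphic2_on_cong:
  "f holomorphic2_on U \<Longrightarrow> (\<And>x. x \<in> U \<Longrightarrow> f x = g x) \<Longrightarrow> g holomorphic2_on U"
  unfolding holomorphic2_on_def
proof
  fix p assume *: "\<forall>p\<in>U. \<exists>a b. (f has_derivative (\<lambda>(u, v). a * u + b * v)) (at p within U)"
    "\<And>x. x \<in> U \<Longrightarrow> f x = g x" "p \<in> U"
  then obtain a b where "(f has_derivative (\<lambda>(u, v). a * u + b * v)) (at p within U)" by meson
  then have "(g has_derivative (\<lambda>(u, v). a * u + b * v)) (at p within U)"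
    by (rule has_derivative_transform[rotated 2]) (use * in auto)
  then show "\<exists>a b. (g has_derivative (\<lambda>(u, v). a * u + b * v)) (at p within U)" by blast
qed

lemma holomorphic2_on_diff:
  assumes "f holomorphic2_on U" "g holomorphic2_on U"
  shows "(\<lambda>x. f x - g x) holomorphic2_on U"
  using holomorphic2_on_add[OF assms(1) holomorphic2_on_mult[OF holomorphic2_on_const[of "-1"] assms(2)]]
  by simp

lemma holomorphic2_on_divide:
  assumes "f holomorphic2_on U" "g holomorphic2_on U" "\<And>x. x \<in> U \<Longrightarrow> g x \<noteq> 0"
  shows "(\<lambda>x. f x / g x) holomorphic2_on U"
proof -
  have "inverse holomorphic_on (UNIV - {0::complex})" by (auto intro!: holomorphic_intros)
  then have "(\<lambda>x. inverse (g x)) holomorphic2_on U"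
    by (rule holomorphic2_on_compose) (use assms in auto)
  from holomorphic2_on_mult[OF assms(1) this] show ?thesis by (simp add: divide_inverse)
qed

lemma holomorphic2_on_sum:
  "(\<And>i. i \<in> I \<Longrightarrow> f i holomorphic2_on U) \<Longrightarrow> (\<lambda>x. \<Sum>i\<in>I. f i x) holomorphic2_on U"
  by (induction I rule: infinite_finite_induct) (auto intro: holomorphic2_on_add)

text \<open>Osgood's lemma, with local boundedness in place of continuity.\<close>

lemma holomorphic2_onI_separate:
  fixes f :: "complex \<times> complex \<Rightarrow> complex"
  assumes U: "open U"
    and bounded: "\<And>p. p \<in> U \<Longrightarrow> \<exists>V B. open V \<and> p \<in> V \<and> V \<subseteq> U \<and> (\<forall>x\<in>V. norm (f x) \<le> B)"
    and first: "\<And>a b. (a, b) \<in> U \<Longrightarrow> (\<lambda>z. f (z, b)) field_differentiable at a"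
    and second: "\<And>a b. (a, b) \<in> U \<Longrightarrow> (\<lambda>z. f (a, z)) field_differentiable at b"
  shows "f holomorphic2_on U"
  unfolding holomorphic2_on_def
proof
  fix p assume pU: "p \<in> U"
  obtain a b where p: "p = (a, b)" by force
  obtain V B where V: "open V" "p \<in> V" "V \<subseteq> U" and B: "\<And>x. x \<in> V \<Longrightarrow> norm (f x) \<le> B"
    using bounded[OF pU] by blast
  obtain A1 A2 where A: "open A1" "open A2" "a \<in> A1" "b \<in> A2" "A1 \<times> A2 \<subseteq> V"
    using V(1,2) p open_prod_elim by (metis mem_Sigma_iff)
  obtain r1 r2 where r12: "r1 > 0" "ball a r1 \<subseteq> A1" "r2 > 0" "ball b r2 \<subseteq> A2"
    using A open_contains_ball by meson
  define r where "r = min r1 r2"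
  have r: "r > 0" "ball a r \<subseteq> A1" "ball b r \<subseteq> A2" using r12 by (auto simp: r_def)
  have sub: "(x, y) \<in> V" if "x \<in> ball a r" "y \<in> ball b r" for x y
    using that r A(5) by blast
  have B0: "B \<ge> 0" using B[OF V(2)] norm_ge_zero order_trans by blast
  have hol1: "(\<lambda>z. f (z, y)) holomorphic_on ball a r" if "y \<in> ball b r" for y
    unfolding holomorphic_on_def using first sub that V by (blast intro: field_differentiable_at_within)
  have hol2: "(\<lambda>z. f (x, z)) holomorphic_on ball b r" if "x \<in> ball a r" for x
    unfolding holomorphic_on_def using second sub that V by (blast intro: field_differentiable_at_within)
  have lip1: "norm (f (x, y) - f (a, y)) \<le> 4 * B / r * norm (x - a)"
    if "x \<in> ball a (r/2)" "y \<in> ball b r" for x y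
    using holomorphic_on_ball_lipschitz[OF hol1[OF that(2)] r(1) _ that(1), of B a] B sub that r by auto
  \<comment> \<open>The Lipschitz estimate in y is applied to f(x, y) - f(a, y), which
    \<open>lip1\<close> bounds by a multiple of |x - a|. The mixed second difference is thus O(|x -
    a| |y - b|), and this turns the two partial derivatives into a total one.\<close>
  have lip2: "norm ((f (x, y) - f (a, y)) - (f (x, b) - f (a, b))) \<le> 16 * B / r^2 * norm (x - a) * norm (y - b)"
    if xy: "x \<in> ball a (r/2)" "y \<in> ball b (r/2)" for x y
  proof -
    have "norm ((f (x, y) - f (a, y)) - (f (x, b) - f (a, b))) \<le> 4 * (4 * B / r * norm (x - a)) / r * norm (y - b)"
    proof (rule holomorphic_on_ball_lipschitz[where z = b and r = r and f = "\<lambda>y. f (x, y) - f (a, y)"])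
      show "(\<lambda>y. f (x, y) - f (a, y)) holomorphic_on ball b r"
        using xy r by (intro holomorphic_on_diff hol2) auto
    qed (use r lip1 xy in auto)
    then show ?thesis by (simp add: field_simps power2_eq_square)
  qed
  obtain D1 where D1: "((\<lambda>z. f (z, b)) has_field_derivative D1) (at a)"
    using first pU p field_differentiable_def by blast
  obtain D2 where D2: "((\<lambda>z. f (a, z)) has_field_derivative D2) (at b)"
    using second pU p field_differentiable_def by blast
  have "(f has_derivative (\<lambda>(u, v). D1 * u + D2 * v)) (at p)"
    unfolding has_derivative_at_alt
  proof (intro conjI allI impI)
    show "bounded_linear (\<lambda>(u, v). D1 * u + D2 * v)"
      by (auto simp: case_prod_unfold intro!: bounded_linear_intros)
    fix e :: real assume e: "e > 0"
    then have e3: "e / 3 > 0" by simp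
    obtain d1 where d1: "d1 > 0" "\<And>x. norm (x - a) < d1 \<Longrightarrow> norm (f (x, b) - f (a, b) - D1 * (x - a)) \<le> e/3 * norm (x - a)"
      using D1 e3 unfolding has_field_derivative_def has_derivative_at_alt by meson
    obtain d2 where d2: "d2 > 0" "\<And>y. norm (y - b) < d2 \<Longrightarrow> norm (f (a, y) - f (a, b) - D2 * (y - b)) \<le> e/3 * norm (y - b)"
      using D2 e3 unfolding has_field_derivative_def has_derivative_at_alt by meson
    \<comment> \<open>The summand 1 keeps \<open>C\<close> positive even for \<open>B = 0\<close>,
      so that e / (3 C) is a valid radius.\<close>
    define C where "C = 16 * B / r^2 + 1"
    have C: "C > 0" "16 * B / r^2 \<le> C" using B0 r unfolding C_def by (auto intro!: add_nonneg_pos)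
    define d where "d = Min {d1, d2, r/2, e / (3 * C)}"
    have d: "d > 0" "d \<le> d1" "d \<le> d2" "d \<le> r/2" "d \<le> e / (3 * C)"
      using d1(1) d2(1) r e C by (auto simp: d_def)
    show "\<exists>d>0. \<forall>y. norm (y - p) < d \<longrightarrow> norm (f y - f p - (case y - p of (u, v) \<Rightarrow> D1 * u + D2 * v)) \<le> e * norm (y - p)"
    proof (intro exI[of _ d] conjI allI impI d)
      fix q assume q: "norm (q - p) < d"
      obtain x y where xy: "q = (x, y)" by force
      have n1: "norm (x - a) \<le> norm (q - p)" and n2: "norm (y - b) \<le> norm (q - p)"
        using norm_fst_le[of "x - a" "y - b"] norm_snd_le[of "y - b" "x - a"] by (auto simp: xy p)
      have in_balls: "x \<in> ball a (r/2)" "y \<in> ball b (r/2)"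
        using n1 n2 q d by (auto simp: dist_norm norm_minus_commute)
      have "norm ((f (x, y) - f (a, y)) - (f (x, b) - f (a, b))) \<le> 16 * B / r^2 * norm (x - a) * norm (y - b)"
        by (rule lip2[OF in_balls])
      also have "\<dots> \<le> C * norm (x - a) * norm (y - b)"
        using C by (intro mult_right_mono) auto
      also have "\<dots> \<le> C * (e / (3 * C)) * norm (q - p)"
        using n1 n2 q d C e by (intro mult_mono) auto
      also have "\<dots> = e/3 * norm (q - p)" using C by simp
      finally have t1: "norm ((f (x, y) - f (a, y)) - (f (x, b) - f (a, b))) \<le> e/3 * norm (q - p)" .
      have t2: "norm (f (x, b) - f (a, b) - D1 * (x - a)) \<le> e/3 * norm (q - p)"
        using d1(2)[of x] n1 q d e3 by (smt (verit) mult_left_mono)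
      have t3: "norm (f (a, y) - f (a, b) - D2 * (y - b)) \<le> e/3 * norm (q - p)"
        using d2(2)[of y] n2 q d e3 by (smt (verit) mult_left_mono)
      have "f q - f p - (case q - p of (u, v) \<Rightarrow> D1 * u + D2 * v) =
        ((f (x, y) - f (a, y)) - (f (x, b) - f (a, b))) + (f (x, b) - f (a, b) - D1 * (x - a))
        + (f (a, y) - f (a, b) - D2 * (y - b))" by (simp add: xy p)
      also have "norm \<dots> \<le> e/3 * norm (q - p) + e/3 * norm (q - p) + e/3 * norm (q - p)"
        by (intro norm_triangle_mono t1 t2 t3)
      finally show "norm (f q - f p - (case q - p of (u, v) \<Rightarrow> D1 * u + D2 * v)) \<le> e * norm (q - p)"
        by simp
    qed
  qed
  then show "\<exists>a b. (f has_derivative (\<lambda>(u, v). a * u + b * v)) (at p within U)"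
    using has_derivative_at_withinI by blast
qed

text \<open>Reduction to the complex line through \<open>x\<close> and a point of \<open>W\<close>:
  its part in the convex \<open>U\<close> is convex, hence connected, and the one-variable identity
  theorem applies.\<close>

lemma holomorphic2_on_eq_zero_convex:
  fixes f :: "complex \<times> complex \<Rightarrow> complex"
  assumes f: "f holomorphic2_on U" and U: "open U" "convex U"
    and W: "open W" "W \<noteq> {}" "W \<subseteq> U" "\<And>x. x \<in> W \<Longrightarrow> f x = 0" and x: "x \<in> U"
  shows "f x = 0"
proof -
  obtain q where q: "q \<in> W" using W by blast
  define L where "L = (\<lambda>z::complex. (fst q + z * (fst x - fst q), snd q + z * (snd x - snd q)))"
  have contL: "continuous_on UNIV L" unfolding L_def by (intro continuous_intros)
  have holL: "(\<lambda>z. f (L z)) holomorphic_on (L -` U)"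
    unfolding holomorphic_on_def
  proof
    fix z assume z: "z \<in> L -` U"
    obtain a b where d: "(f has_derivative (\<lambda>(u, v). a * u + b * v)) (at (L z))"
      using holomorphic2_onD[OF f U(1), of "L z"] z by blast
    have "(L has_derivative (\<lambda>h. (h * (fst x - fst q), h * (snd x - snd q)))) (at z)"
      unfolding L_def by (auto intro!: derivative_eq_intros)
    from has_derivative_compose[OF this d]
    have "((\<lambda>z. f (L z)) has_field_derivative (a * (fst x - fst q) + b * (snd x - snd q))) (at z)"
      unfolding has_field_derivative_def
      by (rule has_derivative_eq_rhs) (auto simp: algebra_simps fun_eq_iff)
    then show "(\<lambda>z. f (L z)) field_differentiable at z within L -` U"
      using field_differentiable_at_within field_differentiable_def by blast
  qed
  have conv: "convex (L -` U)"
  proof (rule convexI)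
    fix s t and u v :: real assume st: "s \<in> L -` U" "t \<in> L -` U" "0 \<le> u" "0 \<le> v" "u + v = 1"
    have uv: "of_real u + of_real v = (1::complex)" using st(5) by (metis of_real_1 of_real_add)
    have "u *\<^sub>R L s + v *\<^sub>R L t \<in> U" using st U(2) by (auto simp: convex_def)
    moreover have "u *\<^sub>R L s + v *\<^sub>R L t = L (u *\<^sub>R s + v *\<^sub>R t)"
    proof -
      have "of_real u * (c + s * d) + of_real v * (c + t * d) = c + (of_real u * s + of_real v * t) * d"
        for c d using uv by algebra
      then show ?thesis by (simp add: L_def scaleR_conv_of_real)
    qed
    ultimately show "u *\<^sub>R s + v *\<^sub>R t \<in> L -` U" by simp
  qed
  have op: "open (L -` U)" "open (L -` W)"
    using contL U(1) W(1) by (auto simp: continuous_on_open_vimage)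
  have L01: "L 0 = q" "L 1 = x" by (auto simp: L_def)
  have "f (L 1) = (\<lambda>_. 0) (1::complex)"
  proof (rule analytic_continuation_open[of "L -` W" "L -` U" "\<lambda>z. f (L z)" "\<lambda>_. 0"])
    have "0 \<in> L -` W" using L01 q by simp
    then show "L -` W \<noteq> {}" by blast
    show "connected (L -` U)" using conv by (rule convex_connected)
    show "1 \<in> L -` U" using L01 x by simp
    show "L -` W \<subseteq> L -` U" using W(3) by blast
    show "f (L z) = 0" if "z \<in> L -` W" for z using W(4) that by blast
  qed (use op holL in simp_all)
  then show ?thesis by (simp add: L01)
qed

section \<open>Meromorphic functions of two variables\<close>

text \<open>For open \<open>V\<close> this means that every nonempty open subset of \<open>V\<close>
  contains a point with \<open>P\<close>; with \<open>P\<close> the nonvanishing of a denominator it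
  is the condition in \<open>nicely_meromorphic2\<close>.\<close>

definition dense_in :: "('a::topological_space \<Rightarrow> bool) \<Rightarrow> 'a set \<Rightarrow> bool" where
  "dense_in P V \<longleftrightarrow> V \<subseteq> closure {x\<in>V. P x}"

lemma dense_inI:
  assumes "\<And>W. open W \<Longrightarrow> W \<subseteq> V \<Longrightarrow> W \<noteq> {} \<Longrightarrow> \<exists>x\<in>W. P x" "open V"
  shows "dense_in P V"
  unfolding dense_in_def
proof
  fix x assume x: "x \<in> V"
  show "x \<in> closure {x\<in>V. P x}"
    unfolding closure_iff_nhds_not_empty
  proof safe
    fix A W assume A: "W \<subseteq> A" "open W" "x \<in> W" "{x\<in>V. P x} \<inter> A = {}"
    have "\<exists>y\<in>W \<inter> V. P y" using A x assms(2) by (intro assms(1)) auto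
    then show False using A by blast
  qed
qed

lemma dense_inD:
  assumes "dense_in P V" "open W" "W \<subseteq> V" "W \<noteq> {}"
  shows "\<exists>x\<in>W. P x"
  using assms open_Int_closure_eq_empty[of W "{x\<in>V. P x}"] unfolding dense_in_def by blast

lemma dense_in_subset: "dense_in P V \<Longrightarrow> open W \<Longrightarrow> W \<subseteq> V \<Longrightarrow> dense_in P W"
  by (rule dense_inI) (meson dense_inD subset_trans)

lemma dense_in_mono: "dense_in P V \<Longrightarrow> (\<And>x. x \<in> V \<Longrightarrow> P x \<Longrightarrow> Q x) \<Longrightarrow> dense_in Q V"
  unfolding dense_in_def using closure_mono[of "{x\<in>V. P x}" "{x\<in>V. Q x}"] by blast

text \<open>Two dense sets can be disjoint, hence the openness of one of them; in the applications
  it is the nonvanishing set of a denominator.\<close>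

lemma dense_in_conj:
  assumes "dense_in P V" "dense_in Q V" "open V" "open {x\<in>V. P x}"
  shows "dense_in (\<lambda>x. P x \<and> Q x) V"
proof (rule dense_inI)
  fix W assume W: "open W" "W \<subseteq> V" "W \<noteq> {}"
  have "\<exists>x\<in>W. P x" using dense_inD[OF assms(1)] W by blast
  then have "W \<inter> {x\<in>V. P x} \<noteq> {}" using W by blast
  then have "\<exists>x\<in>W \<inter> {x\<in>V. P x}. Q x"
    using W assms by (intro dense_inD[OF assms(2)]) auto
  then show "\<exists>x\<in>W. P x \<and> Q x" by blast
qed fact

lemma open_nonzero_holomorphic2:
  "h holomorphic2_on V \<Longrightarrow> open V \<Longrightarrow> open {x\<in>V. h x \<noteq> 0}"
  using continuous_open_preimage[OF holomorphic2_on_imp_continuous_on, of h V "- {0}"]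
  by (auto simp: vimage_def Int_def)

lemma dense_in_eq_imp_eq:
  fixes f g :: "'a::topological_space \<Rightarrow> complex"
  assumes "dense_in (\<lambda>x. f x = g x) V" "continuous_on V f" "continuous_on V g" "open V" "x \<in> V"
  shows "f x = g x"
proof (rule ccontr)
  assume ne: "f x \<noteq> g x"
  have "open (V \<inter> (\<lambda>x. f x - g x) -` (- {0}))"
    by (rule continuous_open_preimage) (use assms in \<open>auto intro!: continuous_intros\<close>)
  moreover have "x \<in> V \<inter> (\<lambda>x. f x - g x) -` (- {0})" using ne assms(5) by simp
  ultimately have "\<exists>y\<in>V \<inter> (\<lambda>x. f x - g x) -` (- {0}). f y = g y"
    by (intro dense_inD[OF assms(1)]) blast+
  then show False by auto
qed

text \<open>The quotient condition on one fixed open set, with no demand on values at zeros of the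
  denominator, so that sums and products can be formed on a common domain.\<close>

definition quot2_on :: "(complex \<times> complex \<Rightarrow> complex) \<Rightarrow> (complex \<times> complex) set \<Rightarrow> bool" where
  "quot2_on F V \<longleftrightarrow> open V \<and> (\<exists>g h. g holomorphic2_on V \<and> h holomorphic2_on V \<and>
     dense_in (\<lambda>x. h x \<noteq> 0) V \<and> (\<forall>x\<in>V. h x \<noteq> 0 \<longrightarrow> F x = g x / h x))"

lemma quot2_onE:
  assumes "quot2_on F V"
  obtains g h where "open V" "g holomorphic2_on V" "h holomorphic2_on V"
    "dense_in (\<lambda>x. h x \<noteq> 0) V" "open {x\<in>V. h x \<noteq> 0}" "\<And>x. x \<in> V \<Longrightarrow> h x \<noteq> 0 \<Longrightarrow> F x = g x / h x"
proof -
  from assms obtain g h where *: "open V" "g holomorphic2_on V" "h holomorphic2_on V"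
    "dense_in (\<lambda>x. h x \<noteq> 0) V" "\<And>x. x \<in> V \<Longrightarrow> h x \<noteq> 0 \<Longrightarrow> F x = g x / h x"
    unfolding quot2_on_def by blast
  show thesis by (rule that[OF *(1-4) open_nonzero_holomorphic2[OF *(3,1)] *(5)])
qed

lemma quot2_onI:
  assumes "open V" "g holomorphic2_on V" "h holomorphic2_on V" "dense_in (\<lambda>x. h x \<noteq> 0) V"
    "\<And>x. x \<in> V \<Longrightarrow> h x \<noteq> 0 \<Longrightarrow> F x = g x / h x"
  shows "quot2_on F V"
  using assms unfolding quot2_on_def by blast

lemma quot2_on_subset: "quot2_on F V \<Longrightarrow> open W \<Longrightarrow> W \<subseteq> V \<Longrightarrow> quot2_on F W"
  unfolding quot2_on_def by (blast intro: dense_in_subset holomorphic2_on_subset)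

lemma quot2_on_holomorphic: "F holomorphic2_on V \<Longrightarrow> open V \<Longrightarrow> quot2_on F V"
  by (rule quot2_onI[where g = F and h = "\<lambda>_. 1"]) (auto intro!: dense_inI)

lemma quot2_on_add:
  assumes "quot2_on F V" "quot2_on G V"
  shows "quot2_on (\<lambda>x. F x + G x) V"
proof -
  obtain g h where 1: "open V" "g holomorphic2_on V" "h holomorphic2_on V"
    "dense_in (\<lambda>x. h x \<noteq> 0) V" "open {x\<in>V. h x \<noteq> 0}" "\<And>x. x \<in> V \<Longrightarrow> h x \<noteq> 0 \<Longrightarrow> F x = g x / h x"
    by (rule quot2_onE[OF assms(1)]) blast
  obtain g' h' where 2: "open V" "g' holomorphic2_on V" "h' holomorphic2_on V"
    "dense_in (\<lambda>x. h' x \<noteq> 0) V" "open {x\<in>V. h' x \<noteq> 0}" "\<And>x. x \<in> V \<Longrightarrow> h' x \<noteq> 0 \<Longrightarrow> G x = g' x / h' x"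
    by (rule quot2_onE[OF assms(2)]) blast
  show ?thesis
    by (rule quot2_onI[where g = "\<lambda>x. g x * h' x + g' x * h x" and h = "\<lambda>x. h x * h' x"])
       (use 1 2 dense_in_conj[OF 1(4) 2(4) 1(1,5)] in
         \<open>auto intro!: holomorphic2_on_add holomorphic2_on_mult simp: add_frac_eq\<close>)
qed

lemma quot2_on_mult:
  assumes "quot2_on F V" "quot2_on G V"
  shows "quot2_on (\<lambda>x. F x * G x) V"
proof -
  obtain g h where 1: "open V" "g holomorphic2_on V" "h holomorphic2_on V"
    "dense_in (\<lambda>x. h x \<noteq> 0) V" "open {x\<in>V. h x \<noteq> 0}" "\<And>x. x \<in> V \<Longrightarrow> h x \<noteq> 0 \<Longrightarrow> F x = g x / h x"
    by (rule quot2_onE[OF assms(1)]) blast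
  obtain g' h' where 2: "open V" "g' holomorphic2_on V" "h' holomorphic2_on V"
    "dense_in (\<lambda>x. h' x \<noteq> 0) V" "open {x\<in>V. h' x \<noteq> 0}" "\<And>x. x \<in> V \<Longrightarrow> h' x \<noteq> 0 \<Longrightarrow> G x = g' x / h' x"
    by (rule quot2_onE[OF assms(2)]) blast
  show ?thesis
    by (rule quot2_onI[where g = "\<lambda>x. g x * g' x" and h = "\<lambda>x. h x * h' x"])
       (use 1 2 dense_in_conj[OF 1(4) 2(4) 1(1,5)] in \<open>auto intro!: holomorphic2_on_mult\<close>)
qed

lemma quot2_on_sum:
  "finite I \<Longrightarrow> open V \<Longrightarrow> (\<And>i. i \<in> I \<Longrightarrow> quot2_on (F i) V) \<Longrightarrow> quot2_on (\<lambda>x. \<Sum>i\<in>I. F i x) V"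
proof (induction I rule: finite_induct)
  case empty
  then show ?case by (simp add: quot2_on_holomorphic holomorphic2_on_const)
next
  case (insert i I)
  then show ?case using quot2_on_add[of "F i" V] by simp
qed

text \<open>Along a direction (u, v) with a u + b v = 1 the argument of \<open>D\<close> moves with
  unit speed, and the zeros of \<open>D\<close> are isolated; a small step in this direction
  therefore leaves them.\<close>

lemma dense_in_nonzero_affine:
  fixes D :: "complex \<Rightarrow> complex"
  assumes D: "D holomorphic_on UNIV" and nz: "D x0 \<noteq> 0" and ab: "a \<noteq> 0 \<or> b \<noteq> 0" and V: "open V"
  shows "dense_in (\<lambda>p. D (a * fst p + b * snd p + c) \<noteq> 0) V"
proof (rule dense_inI[OF _ V])
  let ?L = "\<lambda>p. a * fst p + b * snd p + c"
  fix W :: "(complex \<times> complex) set" assume W: "open W" "W \<subseteq> V" "W \<noteq> {}"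
  obtain x y where xy: "(x, y) \<in> W" using W(3) by auto
  obtain u v where uv: "a * u + b * v = 1"
  proof (cases "a = 0")
    case True
    with ab that[of 0 "1/b"] show ?thesis by auto
  next
    case False
    with that[of "1/a" 0] show ?thesis by auto
  qed
  show "\<exists>p\<in>W. D (?L p) \<noteq> 0"
  proof (cases "D (?L (x, y)) = 0")
    case False
    then show ?thesis using xy by (intro bexI[of _ "(x, y)"]) auto
  next
    case True
    obtain r where r: "r > 0" "\<And>z. z \<in> ball (?L (x, y)) r - {?L (x, y)} \<Longrightarrow> D z \<noteq> 0"
      using isolated_zeros[OF D open_UNIV connected_UNIV UNIV_I True UNIV_I nz] by metis
    have "((\<lambda>t::complex. (x + t * u, y + t * v)) \<longlongrightarrow> (x + 0 * u, y + 0 * v)) (at 0)"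
      by (intro tendsto_intros)
    then have "\<forall>\<^sub>F t in at 0. (x + t * u, y + t * v) \<in> W"
      using W(1) xy by (auto dest: topological_tendstoD)
    moreover have "\<forall>\<^sub>F t in at (0::complex). t \<in> ball 0 r - {0}"
      using r(1) by (intro eventually_at_in_open) auto
    ultimately obtain t where t: "(x + t * u, y + t * v) \<in> W" "t \<in> ball 0 r - {0}"
      using eventually_happens[OF eventually_conj] by (metis (no_types, lifting) at_neq_bot)
    have "?L (x + t * u, y + t * v) = ?L (x, y) + t * (a * u + b * v)" by (simp add: algebra_simps)
    then have "?L (x + t * u, y + t * v) \<in> ball (?L (x, y)) r - {?L (x, y)}"
      using t(2) uv by (simp add: dist_norm)
    then show ?thesis using r(2) t(1) by blast
  qed
qed

text \<open>Apart from the Mellin remainder, every factor of the continuation is a one-variable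
  meromorphic function of an affine form in s1 and s2.\<close>

lemma quot2_on_affine:
  fixes N D :: "complex \<Rightarrow> complex"
  assumes N: "N holomorphic_on UNIV" and D: "D holomorphic_on UNIV" and nz: "D x0 \<noteq> 0"
    and F: "\<And>x. D x \<noteq> 0 \<Longrightarrow> f x = N x / D x" and ab: "a \<noteq> 0 \<or> b \<noteq> 0" and V: "open V"
  shows "quot2_on (\<lambda>p. f (a * fst p + b * snd p + c)) V"
proof (rule quot2_onI[OF V])
  show "(\<lambda>p. N (a * fst p + b * snd p + c)) holomorphic2_on V"
    using holomorphic2_on_compose_affine[OF N, of V a b c] by (simp add: case_prod_unfold)
  show "(\<lambda>p. D (a * fst p + b * snd p + c)) holomorphic2_on V"
    using holomorphic2_on_compose_affine[OF D, of V a b c] by (simp add: case_prod_unfold)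
  show "dense_in (\<lambda>p. D (a * fst p + b * snd p + c) \<noteq> 0) V"
    by (rule dense_in_nonzero_affine[OF D nz ab V])
qed (use F V in auto)

text \<open>Where \<open>h\<close> is nonzero, \<open>F\<close> equals the continuous g / h, so a
  dense equality with the continuous \<open>g'\<close> extends to every such point.\<close>

lemma quot2_on_eq_holomorphic:
  assumes h: "h holomorphic2_on V" "open V" and g: "g holomorphic2_on V"
    and F: "\<And>x. x \<in> V \<Longrightarrow> h x \<noteq> 0 \<Longrightarrow> F x = g x / h x"
    and g': "g' holomorphic2_on V'" "open V'" "V' \<subseteq> V" "dense_in (\<lambda>x. F x = g' x) V'"
    and x: "x \<in> V'" "h x \<noteq> 0"
  shows "F x = g' x"
proof -
  let ?W = "V' \<inter> {x\<in>V. h x \<noteq> 0}"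
  have W: "open ?W" using open_nonzero_holomorphic2[OF h] g'(2) by blast
  have "dense_in (\<lambda>x. g x / h x = g' x) ?W"
    by (rule dense_in_mono[OF dense_in_subset[OF g'(4) W]]) (use F in auto)
  then have "g x / h x = g' x"
  proof (rule dense_in_eq_imp_eq)
    show "continuous_on ?W (\<lambda>x. g x / h x)"
      by (intro holomorphic2_on_imp_continuous_on holomorphic2_on_divide)
         (use g h g' in \<open>auto intro: holomorphic2_on_subset\<close>)
    show "continuous_on ?W g'"
      by (intro holomorphic2_on_imp_continuous_on holomorphic2_on_subset[OF g'(1)]) auto
  qed (use W x g' in auto)
  moreover have "x \<in> V" using g'(3) x(1) by blast
  ultimately show ?thesis using F x(2) by simp
qed

text \<open>
  The set of points near which \<open>F\<close> and \<open>G\<close> agree densely is open, and it is closed by the identity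
  theorem for the numerator of \<open>F - G\<close>.
\<close>

lemma quot2_on_dense_eq:
  assumes F: "\<And>p. \<exists>V. p \<in> V \<and> quot2_on F V" and G: "\<And>p. \<exists>V. p \<in> V \<and> quot2_on G V"
    and W: "open W" "W \<noteq> {}" "\<And>x. x \<in> W \<Longrightarrow> F x = G x" and V: "open V"
  shows "dense_in (\<lambda>x. F x = G x) V"
proof -
  define S where "S = {p. \<exists>V. open V \<and> p \<in> V \<and> dense_in (\<lambda>x. F x = G x) V}"
  have "open S"
    unfolding S_def by (subst open_subopen) blast
  moreover have "closed S"
    unfolding closed_def
  proof (subst open_subopen, intro ballI)
    fix p assume "p \<in> - S"
    then have p: "p \<notin> S" by simp
    obtain VF where VF: "p \<in> VF" "quot2_on F VF" using F by blast
    obtain VG where VG: "p \<in> VG" "quot2_on G VG" using G by blast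
    have "open (VF \<inter> VG)" "p \<in> VF \<inter> VG" using VF VG by (auto simp: quot2_on_def)
    then obtain r where r: "r > 0" "ball p r \<subseteq> VF \<inter> VG" using open_contains_ball by blast
    let ?B = "ball p r"
    have "quot2_on F ?B" using quot2_on_subset[OF VF(2)] r by auto
    then obtain g h where 1: "g holomorphic2_on ?B" "h holomorphic2_on ?B"
      "dense_in (\<lambda>x. h x \<noteq> 0) ?B" "open {x\<in>?B. h x \<noteq> 0}" "\<And>x. x \<in> ?B \<Longrightarrow> h x \<noteq> 0 \<Longrightarrow> F x = g x / h x"
      by (elim quot2_onE) blast
    have "quot2_on G ?B" using quot2_on_subset[OF VG(2)] r by auto
    then obtain g' h' where 2: "g' holomorphic2_on ?B" "h' holomorphic2_on ?B"
      "dense_in (\<lambda>x. h' x \<noteq> 0) ?B" "open {x\<in>?B. h' x \<noteq> 0}" "\<And>x. x \<in> ?B \<Longrightarrow> h' x \<noteq> 0 \<Longrightarrow> G x = g' x / h' x"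
      by (elim quot2_onE) blast
    have D: "dense_in (\<lambda>x. h x \<noteq> 0 \<and> h' x \<noteq> 0) ?B"
      using dense_in_conj[OF 1(3) 2(3) open_ball 1(4)] .
    \<comment> \<open>Cross-multiplied difference: holomorphic on the whole ball and, where both
      denominators are nonzero, zero exactly when \<open>F\<close> and \<open>G\<close>
      agree.\<close>
    let ?d = "\<lambda>x. g x * h' x - g' x * h x"
    have hol: "?d holomorphic2_on ?B"
      by (intro holomorphic2_on_diff holomorphic2_on_mult 1 2)
    have "?B \<inter> S = {}"
    proof (rule ccontr)
      assume "?B \<inter> S \<noteq> {}"
      then obtain q V where q: "q \<in> ?B" "open V" "q \<in> V" "dense_in (\<lambda>x. F x = G x) V"
        unfolding S_def by blast
      have op: "open (V \<inter> ?B)" using q by auto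
      have "dense_in (\<lambda>x. ?d x = 0) (V \<inter> ?B)"
      proof (rule dense_inI[OF _ op])
        fix U assume U: "open U" "U \<subseteq> V \<inter> ?B" "U \<noteq> {}"
        let ?U = "U \<inter> {x\<in>?B. h x \<noteq> 0} \<inter> {x\<in>?B. h' x \<noteq> 0}"
        have "?U \<noteq> {}" using dense_inD[OF D U(1) _ U(3)] U(2) by blast
        moreover have "open ?U" using U 1(4) 2(4) by blast
        ultimately obtain x where "x \<in> ?U" "F x = G x"
          using dense_inD[OF q(4), of ?U] U by blast
        then show "\<exists>x\<in>U. ?d x = 0"
          using 1(5)[of x] 2(5)[of x] by (intro bexI[of _ x]) (auto simp: field_simps)
      qed
      then have "?d x = 0" if "x \<in> V \<inter> ?B" for x
        by (rule dense_in_eq_imp_eq)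
           (use that op hol in \<open>auto intro!: holomorphic2_on_imp_continuous_on intro: holomorphic2_on_subset\<close>)
      then have "?d x = 0" if "x \<in> ?B" for x
        using holomorphic2_on_eq_zero_convex[OF hol open_ball convex_ball op _ _ _ that] q by blast
      then have "dense_in (\<lambda>x. F x = G x) ?B"
        by (intro dense_in_mono[OF D]) (use 1(5) 2(5) in \<open>simp add: frac_eq_eq\<close>)
      then have "p \<in> S" unfolding S_def using r(1) open_ball by (metis (mono_tags, lifting) centre_in_ball mem_Collect_eq)
      with p show False by simp
    qed
    then show "\<exists>T. open T \<and> p \<in> T \<and> T \<subseteq> - S" using r(1) by (intro exI[of _ ?B]) auto
  qed
  moreover have "W \<subseteq> S"
    unfolding S_def using W by (auto intro!: exI[of _ W] dense_inI)
  ultimately have S: "S = UNIV" using W(2) connected_UNIV unfolding connected_clopen by auto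
  show ?thesis
  proof (rule dense_inI[OF _ V])
    fix U assume U: "open U" "U \<subseteq> V" "U \<noteq> {}"
    then obtain p where p: "p \<in> U" by blast
    obtain V' where V': "open V'" "p \<in> V'" "dense_in (\<lambda>x. F x = G x) V'" using S unfolding S_def by blast
    then show "\<exists>x\<in>U. F x = G x"
      using dense_inD[OF V'(3), of "U \<inter> V'"] U p by blast
  qed
qed

section \<open>Filling removable singularities, and uniqueness of continuations\<close>

text \<open>At a genuine pole no suitable \<open>g\<close> exists and the chosen value is arbitrary,
  as \<open>nicely_meromorphic2\<close> permits.\<close>

definition fill_removable :: "(complex \<times> complex \<Rightarrow> complex) \<Rightarrow> complex \<times> complex \<Rightarrow> complex" where
  "fill_removable G p = (SOME c. \<exists>V g. open V \<and> p \<in> V \<and> g holomorphic2_on V \<and>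
     dense_in (\<lambda>x. G x = g x) V \<and> c = g p)"

text \<open>Independence of the choice: two candidates both equal \<open>G\<close> wherever the
  local denominator is nonzero, hence on a dense set, and being continuous they agree at
  \<open>p\<close>.\<close>

lemma fill_removable_eq:
  assumes G: "\<And>p. \<exists>V. p \<in> V \<and> quot2_on G V"
    and V: "open V" "p \<in> V" "g holomorphic2_on V" "dense_in (\<lambda>x. G x = g x) V"
  shows "fill_removable G p = g p"
  unfolding fill_removable_def
proof (rule some_equality)
  show "\<exists>V ga. open V \<and> p \<in> V \<and> ga holomorphic2_on V \<and> dense_in (\<lambda>x. G x = ga x) V \<and> g p = ga p"
    using V by blast
  fix c assume "\<exists>V g. open V \<and> p \<in> V \<and> g holomorphic2_on V \<and> dense_in (\<lambda>x. G x = g x) V \<and> c = g p"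
  then obtain V' g' where V': "open V'" "p \<in> V'" "g' holomorphic2_on V'" "dense_in (\<lambda>x. G x = g' x) V'" "c = g' p"
    by blast
  obtain U0 where "p \<in> U0" "quot2_on G U0" using G by blast
  then obtain gU h where U0: "open U0" "p \<in> U0" "gU holomorphic2_on U0" "h holomorphic2_on U0"
    "dense_in (\<lambda>x. h x \<noteq> 0) U0" "\<And>x. x \<in> U0 \<Longrightarrow> h x \<noteq> 0 \<Longrightarrow> G x = gU x / h x"
    by (elim quot2_onE) blast
  let ?W = "U0 \<inter> V \<inter> V'"
  have W: "open ?W" "p \<in> ?W" using U0 V V' by auto
  have hW: "gU holomorphic2_on ?W" "h holomorphic2_on ?W" "g holomorphic2_on ?W" "g' holomorphic2_on ?W"
    using U0 V V' by (auto intro: holomorphic2_on_subset)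
  have "dense_in (\<lambda>x. g' x = g x) ?W"
  proof (rule dense_in_mono[OF dense_in_subset[OF U0(5) W(1)]])
    fix x assume x: "x \<in> ?W" "h x \<noteq> 0"
    have "G x = g x"
      by (rule quot2_on_eq_holomorphic[OF hW(2) W(1) hW(1) _ hW(3) W(1) order_refl _ x])
         (use U0 dense_in_subset[OF V(4) W(1)] in auto)
    moreover have "G x = g' x"
      by (rule quot2_on_eq_holomorphic[OF hW(2) W(1) hW(1) _ hW(4) W(1) order_refl _ x])
         (use U0 dense_in_subset[OF V'(4) W(1)] in auto)
    ultimately show "g' x = g x" by simp
  qed blast
  then have "g' p = g p"
    by (rule dense_in_eq_imp_eq) (use hW W holomorphic2_on_imp_continuous_on in auto)
  then show "c = g p" using V' by simp
qed

lemma fill_removable_regular: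
  assumes G: "\<And>p. \<exists>V. p \<in> V \<and> quot2_on G V"
    and V: "open V" "g holomorphic2_on V" "h holomorphic2_on V" "\<And>x. x \<in> V \<Longrightarrow> h x \<noteq> 0 \<Longrightarrow> G x = g x / h x"
    and x: "x \<in> V" "h x \<noteq> 0"
  shows "fill_removable G x = G x"
proof -
  let ?W = "{x\<in>V. h x \<noteq> 0}"
  have op: "open ?W" using open_nonzero_holomorphic2[OF V(3,1)] .
  have "fill_removable G x = g x / h x"
  proof (rule fill_removable_eq[OF G op, where g = "\<lambda>x. g x / h x"])
    show "(\<lambda>x. g x / h x) holomorphic2_on ?W"
      by (intro holomorphic2_on_divide) (auto intro: holomorphic2_on_subset[OF V(2)] holomorphic2_on_subset[OF V(3)])
    show "dense_in (\<lambda>x. G x = g x / h x) ?W"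
      by (rule dense_inI[OF _ op]) (use V(4) in blast)
  qed (use x in simp)
  then show ?thesis using V(4) x by simp
qed

text \<open>For the second clause of the definition, dense agreement of the filled function with
  \<open>g\<close> passes to \<open>G\<close> itself off the zeros of the denominator, where filling
  changes nothing; \<open>fill_removable_eq\<close> then gives the value at every point.\<close>

lemma nicely_meromorphic2_fill_removable:
  assumes G: "\<And>p. \<exists>V. p \<in> V \<and> quot2_on G V"
  shows "nicely_meromorphic2 (fill_removable G)"
  unfolding nicely_meromorphic2_def
proof (intro conjI allI)
  fix p
  obtain V where "p \<in> V" "quot2_on G V" using G by blast
  then obtain g h where V: "open V" "p \<in> V" "g holomorphic2_on V" "h holomorphic2_on V"
    "dense_in (\<lambda>x. h x \<noteq> 0) V" "\<And>x. x \<in> V \<Longrightarrow> h x \<noteq> 0 \<Longrightarrow> G x = g x / h x"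
    by (elim quot2_onE) blast
  have reg: "fill_removable G x = g x / h x" if "x \<in> V" "h x \<noteq> 0" for x
    using fill_removable_regular[OF G V(1,3,4,6) that] V(6)[OF that] by simp
  show "\<exists>V g h. open V \<and> p \<in> V \<and> g holomorphic2_on V \<and> h holomorphic2_on V \<and>
     V \<subseteq> closure {x \<in> V. h x \<noteq> 0} \<and> (\<forall>x\<in>V. h x \<noteq> 0 \<longrightarrow> fill_removable G x = g x / h x)"
    by (rule exI[of _ V], rule exI[of _ g], rule exI[of _ h], intro conjI ballI impI)
       (use V(1-4) V(5)[unfolded dense_in_def] reg in \<open>assumption | simp\<close>)+
next
  fix V g
  show "open V \<and> g holomorphic2_on V \<and> V \<subseteq> closure {x \<in> V. fill_removable G x = g x} \<longrightarrow>
    (\<forall>x\<in>V. fill_removable G x = g x)"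
  proof (intro impI ballI)
    fix x assume *: "open V \<and> g holomorphic2_on V \<and> V \<subseteq> closure {x \<in> V. fill_removable G x = g x}" "x \<in> V"
    obtain U0 where "x \<in> U0" "quot2_on G U0" using G by blast
    then obtain g1 h where U0: "open U0" "x \<in> U0" "g1 holomorphic2_on U0" "h holomorphic2_on U0"
      "dense_in (\<lambda>x. h x \<noteq> 0) U0" "\<And>x. x \<in> U0 \<Longrightarrow> h x \<noteq> 0 \<Longrightarrow> G x = g1 x / h x"
      by (elim quot2_onE) blast
    let ?W = "U0 \<inter> V"
    have W: "open ?W" "x \<in> ?W" using * U0 by auto
    have hol: "g holomorphic2_on ?W" using * by (auto intro: holomorphic2_on_subset)
    have reg: "fill_removable G y = G y" if "y \<in> ?W" "h y \<noteq> 0" for y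
      using fill_removable_regular[OF G U0(1,3,4,6)] that by blast
    have d: "dense_in (\<lambda>x. fill_removable G x = g x) ?W"
    proof (rule dense_in_subset[OF _ W(1)])
      show "dense_in (\<lambda>x. fill_removable G x = g x) V" using * unfolding dense_in_def by simp
    qed simp
    have "dense_in (\<lambda>x. G x = g x) ?W"
    proof (rule dense_in_mono[OF dense_in_subset[OF U0(5) W(1)]])
      fix y assume y: "y \<in> ?W" "h y \<noteq> 0"
      have "fill_removable G y = g y"
        by (rule quot2_on_eq_holomorphic[OF U0(4,1,3) _ hol W(1) _ d y])
           (use U0 fill_removable_regular[OF G U0(1,3,4,6)] in auto)
      then show "G y = g y" using reg[OF y] by simp
    qed blast
    then show "fill_removable G x = g x"
      by (rule fill_removable_eq[OF G W hol])
  qed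
qed

lemma nicely_meromorphic2_quot2_on:
  assumes "nicely_meromorphic2 F"
  shows "\<exists>V. p \<in> V \<and> quot2_on F V"
proof -
  obtain V g h where "open V" "p \<in> V" "g holomorphic2_on V" "h holomorphic2_on V"
    "V \<subseteq> closure {x\<in>V. h x \<noteq> 0}" "\<forall>x\<in>V. h x \<noteq> 0 \<longrightarrow> F x = g x / h x"
    using assms unfolding nicely_meromorphic2_def by blast
  then have "quot2_on F V" by (intro quot2_onI[of V g h]) (auto simp: dense_in_def)
  with \<open>p \<in> V\<close> show ?thesis by blast
qed

text \<open>This rule computes a value of an unspecified continuation: agreement with a model
  \<open>G\<close> on one open set spreads densely over the whole space, and near \<open>x\<close>
  the model may be replaced by a holomorphic \<open>g\<close> that represents it densely.\<close>

lemma nicely_meromorphic2_eqI: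
  assumes F: "nicely_meromorphic2 F" and G: "\<And>p. \<exists>V. p \<in> V \<and> quot2_on G V"
    and W: "open W" "W \<noteq> {}" "\<And>x. x \<in> W \<Longrightarrow> F x = G x"
    and V: "open V" "g holomorphic2_on V" "dense_in (\<lambda>x. G x = g x) V" "x \<in> V"
  shows "F x = g x"
proof -
  obtain U0 where "x \<in> U0" "quot2_on G U0" using G by blast
  then obtain g1 h where U0: "open U0" "x \<in> U0" "g1 holomorphic2_on U0" "h holomorphic2_on U0"
    "dense_in (\<lambda>x. h x \<noteq> 0) U0" "open {x\<in>U0. h x \<noteq> 0}" "\<And>x. x \<in> U0 \<Longrightarrow> h x \<noteq> 0 \<Longrightarrow> G x = g1 x / h x"
    by (elim quot2_onE) blast
  let ?W = "U0 \<inter> V"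
  have oW: "open ?W" using U0 V by auto
  have FG: "dense_in (\<lambda>x. F x = G x) ?W"
    by (rule quot2_on_dense_eq[OF nicely_meromorphic2_quot2_on[OF F] G W oW])
  have hol: "g holomorphic2_on ?W" using V by (auto intro: holomorphic2_on_subset)
  have o: "{x\<in>?W. h x \<noteq> 0} = ?W \<inter> {x\<in>U0. h x \<noteq> 0}" by auto
  have "dense_in (\<lambda>x. h x \<noteq> 0 \<and> F x = G x) ?W"
    using dense_in_conj[OF dense_in_subset[OF U0(5) oW] FG oW] U0(6) oW unfolding o by blast
  then have "dense_in (\<lambda>x. F x = g x) ?W"
  proof (rule dense_in_mono)
    fix y assume y: "y \<in> ?W" "h y \<noteq> 0 \<and> F y = G y"
    have "G y = g y"
      by (rule quot2_on_eq_holomorphic[OF U0(4,1,3,7) hol oW _ dense_in_subset[OF V(3) oW]])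
         (use y in auto)
    then show "F y = g y" using y by simp
  qed
  then have "open ?W \<and> g holomorphic2_on ?W \<and> ?W \<subseteq> closure {x\<in>?W. F x = g x}"
    using oW hol by (simp add: dense_in_def)
  \<comment> \<open>The clause of \<open>nicely_meromorphic2\<close> on removable singularities
    turns dense agreement into agreement at every point.\<close>
  then have "\<forall>x\<in>?W. F x = g x"
    using F[unfolded nicely_meromorphic2_def, THEN conjunct2, THEN spec, THEN spec] by (rule rev_mp)
  then show ?thesis using U0(2) V(4) by simp
qed

section \<open>Lipschitz' formula\<close>

definition pos_lborel :: "real measure" where
  "pos_lborel = restrict_space lborel {0<..}"

lemma space_pos_lborel [simp]: "space pos_lborel = {0<..}"
  by (simp add: pos_lborel_def space_restrict_space)

lemma measurable_ident_pos_lborel [measurable]: "(\<lambda>x. x) \<in> borel_measurable pos_lborel"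
  unfolding pos_lborel_def by (intro measurable_restrict_space1) auto

lemma borel_measurable_pos_lborel_continuous:
  fixes f :: "real \<Rightarrow> 'a::topological_space"
  assumes "continuous_on {0<..} f"
  shows "f \<in> borel_measurable pos_lborel"
proof -
  have "sets pos_lborel = sets (restrict_space borel {0<..})"
    unfolding pos_lborel_def by (intro sets_restrict_space_cong) auto
  with borel_measurable_continuous_on_restrict[OF assms] show ?thesis
    by (simp cong: measurable_cong_sets)
qed

lemma sigma_finite_pos_lborel: "sigma_finite_measure pos_lborel"
  unfolding pos_lborel_def by (intro sigma_finite_measure_restrict_space) (auto intro: lborel.sigma_finite_measure_axioms)

lemma integrable_pos_lborel_iff:
  fixes f :: "real \<Rightarrow> 'a::{banach, second_countable_topology}"
  shows "integrable pos_lborel f \<longleftrightarrow> set_integrable lborel {0<..} f"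
  unfolding pos_lborel_def set_integrable_def by (rule integrable_restrict_space) auto

lemma integral_pos_lborel:
  fixes f :: "real \<Rightarrow> 'a::{banach, second_countable_topology}"
  shows "integral\<^sup>L pos_lborel f = (LINT x:{0<..}|lborel. f x)"
  unfolding pos_lborel_def set_lebesgue_integral_def by (rule integral_restrict_space) auto

text \<open>Substitution of x u for u in Euler's integral.\<close>

lemma
  fixes z :: complex and x :: real
  assumes z: "Re z > 0" and x: "x > 0"
  shows integrable_Gamma_laplace:
      "integrable pos_lborel (\<lambda>u. of_real u powr (z - 1) * of_real (exp (- (x * u))))"
    and integral_Gamma_laplace:
      "(\<integral>u. of_real u powr (z - 1) * of_real (exp (- (x * u))) \<partial>pos_lborel) = Gamma z / of_real x powr z"
proof -
  let ?f = "\<lambda>u::real. (of_real u powr (z - 1) / of_real (exp u) :: complex)"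
  have cont: "continuous_on {0<..} ?f" by (intro continuous_intros) auto
  have meas: "(\<lambda>u. indicator {0<..} u *\<^sub>R ?f u) \<in> borel_measurable borel"
    by (rule borel_measurable_continuous_on_indicator[OF _ cont]) auto
  \<comment> \<open>The integrability of Euler's integral comes for the completed measure; Borel
    measurability of the integrand brings it down to \<open>lborel\<close>.\<close>
  have int: "set_integrable lborel {0<..} ?f"
    using absolutely_integrable_Gamma_integral'[OF z] meas
    unfolding set_integrable_def by (subst (asm) integrable_completion) auto
  have val: "(LINT x:{0<..}|lborel. ?f x) = Gamma z"
    using set_borel_integral_eq_integral(2)[OF int] Gamma_integral_complex'[OF z] by (simp add: integral_unique)
  define g where "g = (\<lambda>u. indicator {0<..} u *\<^sub>R (of_real u powr (z - 1) * complex_of_real (exp (- (x * u)))))"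
  have eq: "indicator {0<..} (0 + x * u) *\<^sub>R ?f (0 + x * u) = of_real x powr (z - 1) * g u" for u
  proof (cases "u > 0")
    case True
    then have "(complex_of_real x * complex_of_real u) powr (z - 1) = of_real x powr (z - 1) * of_real u powr (z - 1)"
      using x by (intro powr_times_real) auto
    then show ?thesis using True x by (simp add: g_def exp_minus field_simps)
  next
    case False
    then show ?thesis using x by (simp add: g_def indicator_def zero_less_mult_iff)
  qed
  have nz: "complex_of_real x powr (z - 1) \<noteq> 0" using x by auto
  have "integrable lborel (\<lambda>u. indicator {0<..} (0 + x * u) *\<^sub>R ?f (0 + x * u))"
    using int x unfolding set_integrable_def by (intro lborel_integrable_real_affine) auto
  then have "integrable lborel (\<lambda>u. inverse (of_real x powr (z - 1)) * (of_real x powr (z - 1) * g u))"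
    unfolding eq by (rule integrable_mult_right)
  then have "integrable lborel g"
    using nz by (simp add: mult.assoc[symmetric])
  then show "integrable pos_lborel (\<lambda>u. of_real u powr (z - 1) * complex_of_real (exp (- (x * u))))"
    by (simp add: integrable_pos_lborel_iff set_integrable_def g_def)
  have "Gamma z = \<bar>x\<bar> *\<^sub>R (LINT u|lborel. indicator {0<..} (0 + x * u) *\<^sub>R ?f (0 + x * u))"
    using val x unfolding set_lebesgue_integral_def by (subst lborel_integral_real_affine[symmetric]) auto
  also have "\<dots> = of_real x * of_real x powr (z - 1) *
integral\<^sup>L lborel g"
    unfolding eq using x by (simp add: scaleR_conv_of_real)
  also have "of_real x * of_real x powr (z - 1) = complex_of_real x powr z"
    using x by (simp add: powr_diff)
  finally show "(\<integral>u. of_real u powr (z - 1) * of_real (exp (- (x * u))) \<partial>pos_lborel) = Gamma z / of_real x powr z"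
    using x by (simp add: integral_pos_lborel set_lebesgue_integral_def g_def)
qed

lemma
  fixes a x :: real
  assumes a: "a > 0" and x: "x > 0"
  shows integrable_Gamma_laplace_real: "integrable pos_lborel (\<lambda>u. u powr (a - 1) * exp (- (x * u)))"
    and integral_Gamma_laplace_real:
      "(\<integral>u. u powr (a - 1) * exp (- (x * u)) \<partial>pos_lborel) = Gamma a / x powr a"
proof -
  have eq: "of_real u powr (of_real a - 1) * complex_of_real (exp (- (x * u))) =
      of_real (u powr (a - 1) * exp (- (x * u)))" if "u \<in> space pos_lborel" for u
    using that powr_of_real[of u "a - 1"] by simp
  have "integrable pos_lborel (\<lambda>u. complex_of_real (u powr (a - 1) * exp (- (x * u))))"
    using integrable_Gamma_laplace[of "of_real a" x] a x
      Bochner_Integration.integrable_cong[OF refl eq, of pos_lborel] by simp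
  then show int: "integrable pos_lborel (\<lambda>u. u powr (a - 1) * exp (- (x * u)))"
    by (simp only: complex_of_real_integrable_eq)
  have "complex_of_real (\<integral>u. u powr (a - 1) * exp (- (x * u)) \<partial>pos_lborel) =
     (\<integral>u. of_real u powr (of_real a - 1) * complex_of_real (exp (- (x * u))) \<partial>pos_lborel)"
    unfolding integral_complex_of_real[symmetric]
    by (intro Bochner_Integration.integral_cong refl) (use eq in auto)
  also have "\<dots> = of_real (Gamma a / x powr a)"
    using integral_Gamma_laplace[of "of_real a" x] a x by (simp add: Gamma_complex_of_real powr_of_real)
  finally show "(\<integral>u. u powr (a - 1) * exp (- (x * u)) \<partial>pos_lborel) = Gamma a / x powr a"
    by (simp only: of_real_eq_iff)
qed

lemma nn_integral_Gamma_laplace: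
  fixes a x :: real
  assumes "a > 0" "x > 0"
  shows "(\<integral>\<^sup>+u. ennreal (u powr (a - 1) * exp (- (x * u))) \<partial>pos_lborel) = ennreal (Gamma a / x powr a)"
  using nn_integral_eq_integral[OF integrable_Gamma_laplace_real[OF assms]] integral_Gamma_laplace_real[OF assms]
  by auto

text \<open>Since 1 / (w + u)^2 is the integral of x exp(- x (w + u)) over x > 0, Tonelli's theorem
  reduces the claim to two Gamma integrals; the integrand being nonnegative, integrability comes
  with the value.\<close>

lemma
  fixes a w :: real
  assumes a: "0 < a" "a < 2" and w: "w > 0"
  shows integrable_Beta_kernel: "integrable pos_lborel (\<lambda>u. u powr (a - 1) / (w + u)^2)"
    and integral_Beta_kernel:
      "(\<integral>u. u powr (a - 1) / (w + u)^2 \<partial>pos_lborel) = Gamma a * Gamma (2 - a) * w powr (a - 2)"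
proof -
  interpret sigma_finite_measure pos_lborel by (rule sigma_finite_pos_lborel)
  interpret pair_sigma_finite pos_lborel pos_lborel ..
  let ?f = "\<lambda>u x. ennreal (u powr (a - 1) * (x * exp (- (x * (w + u)))))"
  have "(\<integral>\<^sup>+u. \<integral>\<^sup>+x. ?f u x \<partial>pos_lborel \<partial>pos_lborel) = (\<integral>\<^sup>+x. \<integral>\<^sup>+u. ?f u x \<partial>pos_lborel \<partial>pos_lborel)"
    by (rule Fubini'[symmetric]) measurable
  also have "(\<integral>\<^sup>+u. \<integral>\<^sup>+x. ?f u x \<partial>pos_lborel \<partial>pos_lborel) = (\<integral>\<^sup>+u. ennreal (u powr (a - 1) / (w + u)^2) \<partial>pos_lborel)"
  proof (rule nn_integral_cong)
    fix u assume "u \<in> space pos_lborel"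
    then have u: "u > 0" by simp
    have "(\<integral>\<^sup>+x. ?f u x \<partial>pos_lborel) =
       (\<integral>\<^sup>+x. ennreal (u powr (a - 1)) * ennreal (x powr (2 - 1) * exp (- ((w + u) * x))) \<partial>pos_lborel)"
      by (intro nn_integral_cong) (simp add: ennreal_mult' mult.commute)
    also have "\<dots> = ennreal (u powr (a - 1)) * ennreal (Gamma 2 / (w + u) powr 2)"
      using w u nn_integral_Gamma_laplace[of 2 "w + u"] by (subst nn_integral_cmult) auto
    also have "\<dots> = ennreal (u powr (a - 1) / (w + u)^2)"
      using w u Gamma_fact[of 1, where ?'a = real] by (simp add: ennreal_mult'[symmetric] powr_numeral)
    finally show "(\<integral>\<^sup>+x. ?f u x \<partial>pos_lborel) = ennreal (u powr (a - 1) / (w + u)^2)" .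
  qed
  also have "(\<integral>\<^sup>+x. \<integral>\<^sup>+u. ?f u x \<partial>pos_lborel \<partial>pos_lborel) =
     (\<integral>\<^sup>+x. ennreal (Gamma a) * ennreal (x powr ((2 - a) - 1) * exp (- (w * x))) \<partial>pos_lborel)"
  proof (rule nn_integral_cong)
    fix x assume "x \<in> space pos_lborel"
    then have x: "x > 0" by simp
    have "(\<integral>\<^sup>+u. ?f u x \<partial>pos_lborel) =
       (\<integral>\<^sup>+u. ennreal (x * exp (- (w * x))) * ennreal (u powr (a - 1) * exp (- (x * u))) \<partial>pos_lborel)"
    proof (rule nn_integral_cong)
      fix u
      have "exp (- (x * (w + u))) = exp (- (w * x)) * exp (- (x * u))"
        by (simp add: exp_add[symmetric] algebra_simps)
      then show "?f u x = ennreal (x * exp (- (w * x))) * ennreal (u powr (a - 1) * exp (- (x * u)))"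
        using x by (simp add: ennreal_mult'[symmetric] mult_ac)
    qed
    also have "\<dots> = ennreal (x * exp (- (w * x))) * ennreal (Gamma a / x powr a)"
      using a x by (subst nn_integral_cmult) (auto simp: nn_integral_Gamma_laplace)
    also have "\<dots> = ennreal (Gamma a) * ennreal (x powr ((2 - a) - 1) * exp (- (w * x)))"
      using a x by (simp add: ennreal_mult'[symmetric] Gamma_real_pos powr_diff field_simps)
    finally show "(\<integral>\<^sup>+u. ?f u x \<partial>pos_lborel) = ennreal (Gamma a) * ennreal (x powr ((2 - a) - 1) * exp (- (w * x)))" .
  qed
  also have "\<dots> = ennreal (Gamma a) * ennreal (Gamma (2 - a) / w powr (2 - a))"
    using a w nn_integral_Gamma_laplace[of "2 - a" w] by (subst nn_integral_cmult) auto
  also have "\<dots> = ennreal (Gamma a * Gamma (2 - a) * w powr (a - 2))"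
    using a w by (simp add: ennreal_mult'[symmetric] Gamma_real_pos powr_diff field_simps)
  finally have *: "(\<integral>\<^sup>+u. ennreal (u powr (a - 1) / (w + u)^2) \<partial>pos_lborel) = ennreal (Gamma a * Gamma (2 - a) * w powr (a - 2))" .
  have pos: "Gamma a > 0" "Gamma (2 - a) > 0" using a by (auto intro: Gamma_real_pos)
  have "integrable pos_lborel (\<lambda>u. u powr (a - 1) / (w + u)^2) \<and>
    (\<integral>u. u powr (a - 1) / (w + u)^2 \<partial>pos_lborel) = Gamma a * Gamma (2 - a) * w powr (a - 2)"
    by (subst nn_integral_eq_integrable[symmetric]) (use * pos in \<open>auto\<close>)
  then show "integrable pos_lborel (\<lambda>u. u powr (a - 1) / (w + u)^2)"
     "(\<integral>u. u powr (a - 1) / (w + u)^2 \<partial>pos_lborel) = Gamma a * Gamma (2 - a) * w powr (a - 2)" by auto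
qed

lemma borel_measurable_Beta_kernel_complex:
  assumes "Re w > 0"
  shows "(\<lambda>u. of_real (u powr (a - 1)) / (w + of_real u)^2) \<in> borel_measurable pos_lborel"
proof (rule borel_measurable_pos_lborel_continuous)
  have "w + of_real u \<noteq> 0" if "u > 0" for u using assms that by (auto simp: complex_eq_iff)
  then show "continuous_on {0<..} (\<lambda>u. of_real (u powr (a - 1)) / (w + of_real u)^2)"
    by (intro continuous_intros) auto
qed

text \<open>Analytic continuation in \<open>w\<close> from the positive reals, where the real
  version applies, to the right half-plane.\<close>

lemma integral_Beta_kernel_complex:
  fixes a :: real and w :: complex
  assumes a: "0 < a" "a < 2" and w: "Re w > 0"
  shows "(\<integral>u. of_real (u powr (a - 1)) / (w + of_real u)^2 \<partial>pos_lborel) =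
     Gamma (of_real a) * Gamma (2 - of_real a) * w powr (of_real a - 2)"
proof -
  let ?S = "{w. Re w > 0}"
  let ?I = "\<lambda>w. \<integral>u. of_real (u powr (a - 1)) / (w + of_real u)^2 \<partial>pos_lborel"
  let ?g = "\<lambda>w. Gamma (of_real a) * Gamma (2 - of_real a) * w powr (of_real a - 2)"
  have opS: "open ?S" by (rule open_halfspace_Re_gt)
  have hol: "?I holomorphic_on ?S"
  proof (rule holomorphic_on_lebesgue_integral[OF opS])
    fix u assume u: "u \<in> space pos_lborel"
    have "w + of_real u \<noteq> 0" if "w \<in> ?S" for w
      using that u by (auto simp: complex_eq_iff)
    then show "(\<lambda>w. of_real (u powr (a - 1)) / (w + of_real u)^2) holomorphic_on ?S"
      by (intro holomorphic_intros) auto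
  next
    show "(\<lambda>u. of_real (u powr (a - 1)) / (w + of_real u)^2) \<in> borel_measurable pos_lborel" if "w \<in> ?S" for w
      using that by (intro borel_measurable_Beta_kernel_complex) auto
    fix w0 assume "w0 \<in> ?S"
    then have w0: "Re w0 > 0" by simp
    show "\<exists>r>0. \<exists>g. integrable pos_lborel g \<and> (\<forall>w\<in>ball w0 r \<inter> ?S. \<forall>u\<in>space pos_lborel.
        norm (of_real (u powr (a - 1)) / (w + of_real u)^2) \<le> g u)"
    \<comment> \<open>On this ball Re w exceeds Re w0 / 2, so the real Beta kernel at Re w0 / 2 is a
      majorant.\<close>
    proof (intro exI[of _ "Re w0 / 2"] conjI exI[of _ "\<lambda>u. u powr (a - 1) / (Re w0 / 2 + u)^2"] ballI)
      show "integrable pos_lborel (\<lambda>u. u powr (a - 1) / (Re w0 / 2 + u)^2)"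
        using a w0 by (intro integrable_Beta_kernel) auto
      fix w u assume wu: "w \<in> ball w0 (Re w0 / 2) \<inter> ?S" "u \<in> space pos_lborel"
      have "\<bar>Re (w0 - w)\<bar> < Re w0 / 2"
        using wu abs_Re_le_cmod[of "w0 - w"] by (auto simp: dist_norm)
      then have "Re (w0 - w) < Re w0 / 2" by linarith
      then have "Re w0 / 2 + u \<le> Re (w + of_real u)" by auto
      also have "\<dots> \<le> norm (w + of_real u)" by (rule complex_Re_le_cmod)
      finally have "(Re w0 / 2 + u)^2 \<le> norm (w + of_real u)^2" using w0 wu by (intro power_mono) auto
      moreover have "(Re w0 / 2 + u)^2 > 0" using w0 wu by auto
      ultimately show "norm (of_real (u powr (a - 1)) / (w + of_real u)^2) \<le> u powr (a - 1) / (Re w0 / 2 + u)^2"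
        by (auto simp: norm_divide norm_power intro!: divide_left_mono mult_pos_pos)
    qed (use w0 in auto)
  qed
  have "?I w - ?g w = 0"
  proof (rule analytic_continuation[where f = "\<lambda>w. ?I w - ?g w" and S = ?S and U = "of_real ` {0<..}" and \<xi> = 1])
    show "(\<lambda>w. ?I w - ?g w) holomorphic_on ?S"
      by (intro holomorphic_intros hol) (auto simp: complex_nonpos_Reals_iff)
    show "connected ?S" by (intro convex_connected convex_halfspace_Re_gt)
    show "1 islimpt complex_of_real ` {0<..}"
    proof -
      have "(\<lambda>n. 1 + 1 / of_nat (Suc n)) \<longlonglongrightarrow> 1 + (0 :: complex)"
        by (intro tendsto_intros LIMSEQ_Suc[OF lim_1_over_n])
      moreover have "1 + 1 / of_nat (Suc n) \<in> complex_of_real ` {0<..} - {1}" for n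
        by (auto intro!: image_eqI[of _ _ "1 + 1 / real (Suc n)"] simp: add_pos_pos simp del: of_nat_Suc)
      ultimately show ?thesis
        unfolding islimpt_sequential by (intro exI[of _ "\<lambda>n. 1 + 1 / of_nat (Suc n)"]) (simp del: of_nat_Suc)
    qed
    fix v :: complex assume "v \<in> of_real ` {0<..}"
    then obtain x where x: "v = of_real x" "x > 0" by auto
    have "?I v = (\<integral>u. of_real (u powr (a - 1) / (x + u)^2) \<partial>pos_lborel)"
      unfolding x by simp
    also have "\<dots> = of_real (Gamma a * Gamma (2 - a) * x powr (a - 2))"
      by (simp only: integral_complex_of_real integral_Beta_kernel[OF a x(2)])
    also have "\<dots> = ?g v"
      using x Gamma_complex_of_real[of "2 - a"] powr_of_real[of x "a - 2"] by (simp add: Gamma_complex_of_real)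
    finally show "?I v - ?g v = 0" by simp
  qed (use w opS in auto)
  then show ?thesis by simp
qed

text \<open>The logarithmic derivative of the reflection formula, differentiated once more.\<close>

lemma trigamma_reflection:
  fixes z :: complex
  assumes z: "z \<notin> \<int>"
  shows "Polygamma 1 z + Polygamma 1 (1 - z) = (of_real pi / sin (of_real pi * z))^2"
proof -
  let ?S = "- (\<int> :: complex set)"
  have op: "open ?S" by (simp add: open_Compl closed_Ints)
  have sn: "sin (of_real pi * w) \<noteq> 0" if "w \<in> ?S" for w :: complex
    using that by (auto simp: sin_eq_0 mult.commute)
  have n1: "w \<notin> \<int>\<^sub>\<le>\<^sub>0" "1 - w \<notin> \<int>\<^sub>\<le>\<^sub>0" if "w \<in> ?S" for w :: complex
    using that nonpos_Ints_Int minus_in_Ints_iff Ints_diff[of 1 "1 - w"] by (auto dest: nonpos_Ints_Int)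
  have dig: "Digamma (1 - w) - Digamma w = of_real pi * cos (of_real pi * w) / sin (of_real pi * w)"
    if w: "w \<in> ?S" for w :: complex
  proof -
    have "((\<lambda>w. Gamma w * Gamma (1 - w)) has_field_derivative
       (Gamma w * Digamma w * Gamma (1 - w) - Gamma w * (Gamma (1 - w) * Digamma (1 - w)))) (at w)"
      using n1[OF w] by (auto intro!: derivative_eq_intros)
    moreover have "((\<lambda>w. of_real pi / sin (of_real pi * w)) has_field_derivative
       (- (of_real pi * (of_real pi * cos (of_real pi * w))) / (sin (of_real pi * w))^2)) (at w)"
      using sn[OF w] by (auto intro!: derivative_eq_intros simp: power2_eq_square)
    moreover have "(\<lambda>w::complex. Gamma w * Gamma (1 - w)) = (\<lambda>w. of_real pi / sin (of_real pi * w))"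
      by (auto simp: Gamma_reflection_complex)
    ultimately have "Gamma w * Digamma w * Gamma (1 - w) - Gamma w * (Gamma (1 - w) * Digamma (1 - w)) =
       - (of_real pi * (of_real pi * cos (of_real pi * w))) / (sin (of_real pi * w))^2"
      using DERIV_unique by metis
    then have "(Gamma w * Gamma (1 - w)) * (Digamma (1 - w) - Digamma w) =
       (of_real pi * (of_real pi * cos (of_real pi * w))) / (sin (of_real pi * w))^2"
      by (simp add: algebra_simps)
    then have "of_real pi / sin (of_real pi * w) * (Digamma (1 - w) - Digamma w) =
       of_real pi / sin (of_real pi * w) * (of_real pi * cos (of_real pi * w) / sin (of_real pi * w))"
      unfolding Gamma_reflection_complex by (simp add: power2_eq_square)
    then show ?thesis using sn[OF w] by (subst (asm) mult_left_cancel) auto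
  qed
  have "((\<lambda>w. Digamma (1 - w) - Digamma w) has_field_derivative (- Polygamma 1 (1 - z) - Polygamma 1 z)) (at z)"
    using n1[of z] z by (auto intro!: derivative_eq_intros)
  moreover have "((\<lambda>w. of_real pi * cos (of_real pi * w) / sin (of_real pi * w)) has_field_derivative
       (- ((of_real pi / sin (of_real pi * z))^2))) (at z)"
  proof -
    have sc: "(sin (of_real pi * z))^2 + (cos (of_real pi * z))^2 = 1" by (rule sin_cos_squared_add)
    have "((\<lambda>w. of_real pi * cos (of_real pi * w) / sin (of_real pi * w)) has_field_derivative
       ((of_real pi * - (of_real pi * sin (of_real pi * z))) * sin (of_real pi * z) - of_real pi * cos (of_real pi * z) * (of_real pi * cos (of_real pi * z)))
        / (sin (of_real pi * z) * sin (of_real pi * z))) (at z)"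
      using sn[of z] z by (auto intro!: derivative_eq_intros)
    also have "((of_real pi * - (of_real pi * sin (of_real pi * z))) * sin (of_real pi * z) - of_real pi * cos (of_real pi * z) * (of_real pi * cos (of_real pi * z)))
       = - (of_real pi ^ 2 * ((sin (of_real pi * z))^2 + (cos (of_real pi * z))^2))"
      by algebra
    finally show ?thesis unfolding sc by (simp add: power_divide power2_eq_square)
  qed
  ultimately have d: "((\<lambda>w. Digamma (1 - w) - Digamma w) has_field_derivative (- Polygamma 1 (1 - z) - Polygamma 1 z)) (at z)"
    "((\<lambda>w. of_real pi * cos (of_real pi * w) / sin (of_real pi * w)) has_field_derivative
       (- ((of_real pi / sin (of_real pi * z))^2))) (at z)" by blast+
  have "((\<lambda>w. of_real pi * cos (of_real pi * w) / sin (of_real pi * w)) has_field_derivative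
       (- Polygamma 1 (1 - z) - Polygamma 1 z)) (at z)"
    by (rule has_field_derivative_transform_within_open[OF d(1) op]) (use z dig in auto)
  with d(2) have "- Polygamma 1 (1 - z) - Polygamma 1 z = - ((of_real pi / sin (of_real pi * z))^2)"
    by (rule DERIV_unique[rotated])
  then show ?thesis by (simp add: algebra_simps)
qed

text \<open>The partial fraction expansion of 1 / (4 sinh^2 (t/2)) over its double poles 2 pi i k,
  with the pole at 0 moved to the right-hand side. It is the trigamma reflection formula at z = t /
  (2 pi i), whose two trigamma series run over the poles of either sign.\<close>

lemma inverse_sinh_squared_pfd:
  fixes t :: real
  assumes t: "t > 0"
  defines "w k \<equiv> 2 * of_real pi * \<i> * of_nat (Suc k)"
  shows "(\<lambda>k. 1 / (of_real t + w k)^2 + 1 / (of_real t - w k)^2) sums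
     (exp (- of_real t) / (1 - exp (- of_real t))^2 - 1 / (of_real t)^2 :: complex)"
proof -
  define c :: complex where "c = 2 * of_real pi * \<i>"
  have c: "c \<noteq> 0" by (simp add: c_def)
  define z where "z = of_real t / c"
  have z0: "z = Complex 0 (- t / (2 * pi))" by (simp add: z_def c_def complex_eq_iff Re_divide Im_divide power2_eq_square)
  have zI: "z \<notin> \<int>" using t by (auto elim!: Ints_cases simp: z0 complex_eq_iff)
  have zn: "z \<noteq> 0" "1 - z \<noteq> 0" using zI by auto
  have "(\<lambda>k. inverse ((z + of_nat k)^2)) sums Polygamma 1 z"
    using Polygamma_LIMSEQ[OF zn(1), of 1] by (simp add: numeral_2_eq_2)
  then have s1: "(\<lambda>k. inverse ((z + of_nat (Suc k))^2)) sums (Polygamma 1 z - inverse (z^2))"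
    by (subst sums_Suc_iff) simp
  have s2: "(\<lambda>k. inverse ((1 - z + of_nat k)^2)) sums Polygamma 1 (1 - z)"
    using Polygamma_LIMSEQ[OF zn(2), of 1] by (simp add: numeral_2_eq_2)
  have "(\<lambda>k. (inverse ((z + of_nat (Suc k))^2) + inverse ((1 - z + of_nat k)^2)) / c^2) sums
     (((of_real pi / sin (of_real pi * z))^2 - inverse (z^2)) / c^2)"
    using sums_divide[OF sums_add[OF s1 s2], of "c^2"] trigamma_reflection[OF zI] by (simp add: algebra_simps)
  moreover have "(inverse ((z + of_nat (Suc k))^2) + inverse ((1 - z + of_nat k)^2)) / c^2 =
     1 / (of_real t + w k)^2 + 1 / (of_real t - w k)^2" for k
  proof -
    have 1: "of_real t + w k = c * (z + of_nat (Suc k))" using c by (simp add: w_def z_def c_def field_simps)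
    have 2: "of_real t - w k = - (c * (1 - z + of_nat k))" using c by (simp add: w_def z_def c_def field_simps)
    show ?thesis unfolding 1 2 by (simp add: power_mult_distrib inverse_eq_divide add_divide_distrib mult.commute)
  qed
  moreover have "((of_real pi / sin (of_real pi * z))^2 - inverse (z^2)) / c^2 =
     exp (- of_real t) / (1 - exp (- of_real t))^2 - 1 / (of_real t)^2"
  proof -
    let ?e = "exp (- (of_real t :: complex) / 2)"
    have e0: "?e \<noteq> 0" by simp
    have ee: "exp (- of_real t) = ?e^2" by (simp add: exp_double[symmetric] power2_eq_square exp_add[symmetric])
    have iz: "\<i> * (of_real pi * z) = of_real t / 2" by (simp add: z_def c_def)
    have "sin (of_real pi * z) = - (\<i> * ((exp (of_real t / 2) - ?e) / 2))"
      unfolding sin_exp_eq mult.assoc iz by (simp add: field_simps iz)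
    also have "exp (of_real t / 2) = 1 / ?e" by (simp add: exp_minus field_simps)
    finally have s: "sin (of_real pi * z) = - (\<i> * ((1 / ?e - ?e) / 2))" .
    have "sin (of_real pi * z)^2 = - ((1 / ?e - ?e)^2 / 4)" unfolding s by (simp add: power_mult_distrib power_divide)
    also have "(1 / ?e - ?e) = (1 - ?e^2) / ?e" using e0 by (simp add: field_simps power2_eq_square)
    finally have s2: "sin (of_real pi * z)^2 = - ((1 - ?e^2)^2 / (4 * ?e^2))" by (simp add: power_divide)
    have c2: "c^2 = - (4 * of_real pi ^ 2)" by (simp add: c_def power_mult_distrib)
    have "(of_real pi / sin (of_real pi * z))^2 / c^2 = ?e^2 / (1 - ?e^2)^2"
      unfolding power_divide s2 c2 by (simp add: divide_simps)
    moreover have "inverse (z^2) / c^2 = 1 / (of_real t)^2" using c by (simp add: z_def power_divide)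
    ultimately show ?thesis unfolding ee diff_divide_distrib by simp
  qed
  ultimately show ?thesis by simp
qed

section \<open>The polylogarithm series and Lipschitz' formula for Re s < 0\<close>

lemma summable_powr_exp:
  fixes x :: real
  assumes "x > 0"
  shows "summable (\<lambda>n. real (Suc n) powr a * exp (- (real (Suc n) * x)))"
proof (rule summable_comparison_test_bigo)
  show "summable (\<lambda>n. norm (1 / real n ^ 2))"
    using inverse_power_summable[of 2, where ?'a = real] by (simp add: inverse_eq_divide)
  show "(\<lambda>n. real (Suc n) powr a * exp (- (real (Suc n) * x))) \<in> O(\<lambda>n. 1 / real n ^ 2)"
    using assms by real_asymp
qed

text \<open>The polylogarithm Li_s(exp(- w)); for w = t it is the L(s, t) of the overview, and for
  Re w > 0 it converges for every s.\<close>

definition expzeta :: "complex \<Rightarrow> complex \<Rightarrow> complex" where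
  "expzeta s w = (\<Sum>n. of_nat (Suc n) powr (-s) * exp (- (of_nat (Suc n) * w)))"

lemma norm_expzeta_term:
  "norm (of_nat (Suc n) powr (-s) * exp (- (of_nat (Suc n) * w))) =
     real (Suc n) powr (- Re s) * exp (- (real (Suc n) * Re w))"
  by (simp add: norm_mult norm_powr_real_powr del: of_nat_Suc)

lemma summable_norm_expzeta:
  "Re w > 0 \<Longrightarrow> summable (\<lambda>n. norm (of_nat (Suc n) powr (-s) * exp (- (of_nat (Suc n) * w))))"
  unfolding norm_expzeta_term by (rule summable_powr_exp)

lemma holomorphic_on_expzeta:
  assumes w: "Re w > 0"
  shows "(\<lambda>s. expzeta s w) holomorphic_on UNIV"
  unfolding expzeta_def
proof (rule holomorphic_on_suminf_dominated)
  fix z :: complex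
  show "\<exists>r>0. \<exists>g. summable g \<and> (\<forall>s\<in>ball z r \<inter> UNIV. \<forall>n.
      norm (of_nat (Suc n) powr (-s) * exp (- (of_nat (Suc n) * w))) \<le> g n)"
  proof (intro exI[of _ 1] conjI ballI allI exI[of _ "\<lambda>n. real (Suc n) powr (1 - Re z) * exp (- (real (Suc n) * Re w))"])
    show "summable (\<lambda>n. real (Suc n) powr (1 - Re z) * exp (- (real (Suc n) * Re w)))"
      using w by (rule summable_powr_exp)
    fix s n assume "s \<in> ball z 1 \<inter> UNIV"
    then have "- Re s \<le> 1 - Re z" using abs_Re_le_cmod[of "z - s"] by (auto simp: dist_norm)
    then show "norm (of_nat (Suc n) powr (-s) * exp (- (of_nat (Suc n) * w))) \<le>
        real (Suc n) powr (1 - Re z) * exp (- (real (Suc n) * Re w))"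
      unfolding norm_expzeta_term by (intro mult_right_mono powr_mono) auto
  qed auto
qed (auto intro!: holomorphic_intros)

text \<open>Termwise differentiation lowers \<open>s\<close> by one; this relation later drives the
  induction that carries the expansion from Re s < 0 to larger real parts.\<close>

lemma has_field_derivative_expzeta:
  assumes w: "Re w > 0"
  shows "(expzeta s has_field_derivative - expzeta (s - 1) w) (at w)"
proof -
  define S where "S = {v. Re v > Re w / 2}"
  let ?f = "\<lambda>n v. of_nat (Suc n) powr (-s) * exp (- (of_nat (Suc n) * v)) :: complex"
  let ?f' = "\<lambda>n v. - (of_nat (Suc n) powr (-(s - 1)) * exp (- (of_nat (Suc n) * v))) :: complex"
  have wS: "w \<in> S" using w by (simp add: S_def)
  have op: "open S" unfolding S_def by (rule open_halfspace_Re_gt)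
  have "(\<lambda>n. norm (?f n w)) = (\<lambda>n. norm (of_nat (Suc n) powr (-s) * exp (- (of_nat (Suc n) * w))))" ..
  have "((\<lambda>v. \<Sum>n. ?f n v) has_field_derivative (\<Sum>n. ?f' n w)) (at w)"
  proof (rule has_field_derivative_series'(2)[where S = S and x0 = w])
    show "convex S" unfolding S_def by (rule convex_halfspace_Re_gt)
    show "(?f n has_field_derivative ?f' n v) (at v within S)" for n v
    proof -
      have "of_nat (Suc n) * of_nat (Suc n) powr (-s) = (of_nat (Suc n) powr (-(s - 1)) :: complex)"
        by (simp add: powr_add powr_diff powr_minus field_simps del: of_nat_Suc)
      then show ?thesis
        by (auto intro!: derivative_eq_intros simp: mult_ac simp del: of_nat_Suc)
    qed
    show "uniformly_convergent_on S (\<lambda>n v. \<Sum>i<n. ?f' i v)"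
    proof (rule Weierstrass_m_test')
      show "norm (?f' n v) \<le> real (Suc n) powr (- Re (s - 1)) * exp (- (real (Suc n) * (Re w / 2)))"
        if "v \<in> S" for n v
        unfolding norm_minus_cancel norm_expzeta_term using that by (intro mult_left_mono) (auto simp: S_def)
      show "summable (\<lambda>n. real (Suc n) powr (- Re (s - 1)) * exp (- (real (Suc n) * (Re w / 2))))"
        using w by (intro summable_powr_exp) auto
    qed
    show "summable (\<lambda>n. ?f n w)"
      by (rule summable_norm_cancel[OF summable_norm_expzeta[OF w]])
  qed (use wS op in \<open>auto simp: interior_open\<close>)
  moreover have "(\<Sum>n. ?f' n w) = - expzeta (s - 1) w"
    unfolding expzeta_def by (intro suminf_minus summable_norm_cancel[OF summable_norm_expzeta[OF w]])
  ultimately show ?thesis unfolding expzeta_def by simp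
qed

text \<open>The sum of (t + 2 pi i k)^(s-1) over all nonzero integers k, with k and -k paired; it
  converges absolutely for Re s < 0.\<close>

definition lipschitz_sum :: "complex \<Rightarrow> real \<Rightarrow> complex" where
  "lipschitz_sum s t = (\<Sum>k. (of_real t + 2 * of_real pi * \<i> * of_nat (Suc k)) powr (s - 1) +
     (of_real t - 2 * of_real pi * \<i> * of_nat (Suc k)) powr (s - 1))"

text \<open>The principal argument is at most pi in modulus, so the imaginary part of the exponent
  costs at most exp(pi |Im w|).\<close>

lemma norm_powr_le_exp:
  "norm (z powr w) \<le> norm z powr Re w * exp (pi * \<bar>Im w\<bar>)"
proof -
  have "\<bar>- (Im w * Arg z)\<bar> \<le> \<bar>Im w\<bar> * pi"
    using mpi_less_Arg[of z] Arg_le_pi[of z] by (simp add: abs_mult mult_left_mono)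
  then show ?thesis
    unfolding norm_powr_complex by (intro mult_left_mono) (auto simp: mult.commute)
qed

lemma norm_lipschitz_term:
  fixes t :: real
  assumes s: "Re s < 1" and t: "t \<ge> 0" and z: "z = of_real t + 2 * of_real pi * \<i> * of_nat (Suc k) \<or>
    z = of_real t - 2 * of_real pi * \<i> * of_nat (Suc k)"
  shows "norm (z powr (s - 1)) \<le> real (Suc k) powr (Re s - 1) * exp (pi * \<bar>Im s\<bar>)"
proof -
  have "real (Suc k) \<le> 2 * pi * real (Suc k)"
    using pi_gt3 mult_right_mono[of 1 "2 * pi" "real (Suc k)"] by simp
  also have "\<dots> \<le> \<bar>Im z\<bar>" using z by auto
  also have "\<dots> \<le> norm z" by (rule abs_Im_le_cmod)
  finally have "norm z powr (Re s - 1) \<le> real (Suc k) powr (Re s - 1)"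
    using s by (intro powr_mono2') auto
  then show ?thesis
    using norm_powr_le_exp[of z "s - 1"] by (auto intro: order_trans mult_right_mono)
qed

lemma summable_powr_Suc: "a < -1 \<Longrightarrow> summable (\<lambda>k. real (Suc k) powr a)"
  using summable_Suc_iff[of "\<lambda>k. real k powr a"] summable_real_powr_iff by blast

lemma norm_lipschitz_pair:
  assumes s: "Re s < 1" and t: "t \<ge> 0"
  shows "norm ((of_real t + 2 * of_real pi * \<i> * of_nat (Suc k)) powr (s - 1) +
     (of_real t - 2 * of_real pi * \<i> * of_nat (Suc k)) powr (s - 1)) \<le>
     2 * exp (pi * \<bar>Im s\<bar>) * real (Suc k) powr (Re s - 1)"
proof -
  let ?p = "of_real t + 2 * of_real pi * \<i> * of_nat (Suc k) :: complex"
  let ?m = "of_real t - 2 * of_real pi * \<i> * of_nat (Suc k) :: complex"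
  have p: "norm (?p powr (s - 1)) \<le> real (Suc k) powr (Re s - 1) * exp (pi * \<bar>Im s\<bar>)"
    by (rule norm_lipschitz_term[OF s t disjI1[OF refl]])
  have m: "norm (?m powr (s - 1)) \<le> real (Suc k) powr (Re s - 1) * exp (pi * \<bar>Im s\<bar>)"
    by (rule norm_lipschitz_term[OF s t disjI2[OF refl]])
  have "norm (?p powr (s - 1) + ?m powr (s - 1)) \<le>
      real (Suc k) powr (Re s - 1) * exp (pi * \<bar>Im s\<bar>) + real (Suc k) powr (Re s - 1) * exp (pi * \<bar>Im s\<bar>)"
    by (rule norm_triangle_mono[OF p m])
  also have "\<dots> = 2 * exp (pi * \<bar>Im s\<bar>) * real (Suc k) powr (Re s - 1)"
    by (simp del: of_nat_Suc)
  finally show ?thesis .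
qed

text \<open>The series of n exp(- n (t + u)) is integrated against u^(a-1) in two ways: its own
  terms give Gamma(a) n^(1-a) exp(- n t), and the terms of its partial fraction expansion are Beta
  kernels. Here a > 0 secures convergence at u = 0, and a < 1 the convergence of the sum over the
  poles.\<close>

lemma lipschitz_formula_real:
  fixes a t :: real
  assumes a: "0 < a" "a < 1" and t: "t > 0"
  shows "expzeta (of_real a - 1) (of_real t) =
    Gamma (2 - of_real a) * (of_real t powr (of_real a - 2) + lipschitz_sum (of_real a - 1) t)"
proof -
  let ?S = "\<lambda>u. exp (- of_real (t + u)) / (1 - exp (- of_real (t + u)))^2 :: complex"
  have Ga: "Gamma a > 0" "Gamma (2 - a) > 0" using a by (auto intro: Gamma_real_pos)
  have Gac: "Gamma (of_real a :: complex) = of_real (Gamma a)" "Gamma (2 - of_real a :: complex) = of_real (Gamma (2 - a))"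
    using Gamma_complex_of_real[of "2 - a"] by (simp_all add: Gamma_complex_of_real)
  define f where "f n u = complex_of_real (real (Suc n) * exp (- (real (Suc n) * t)) * (u powr (a - 1) * exp (- (real (Suc n) * u))))"
    for n u
  have intf: "integrable pos_lborel (f n)" for n
    unfolding f_def using a by (intro integrable_of_real integrable_mult_right integrable_Gamma_laplace_real) auto
  have valf: "(\<integral>u. f n u \<partial>pos_lborel) = Gamma (of_real a) * (of_nat (Suc n) powr (-(of_real a - 1)) * exp (- (of_nat (Suc n) * of_real t)))" for n
  proof -
    have p: "complex_of_real (real (Suc n) powr (1 - a)) = of_nat (Suc n) powr (-(of_real a - 1))"
      using powr_of_real[of "real (Suc n)" "1 - a"] by simp
    have e: "complex_of_real (exp (- (real (Suc n) * t))) = exp (- (of_nat (Suc n) * of_real t))"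
      using exp_of_real[of "- (real (Suc n) * t)", where ?'a = complex] by simp
    have "(\<integral>u. f n u \<partial>pos_lborel) = of_real (real (Suc n) * exp (- (real (Suc n) * t)) * (Gamma a / real (Suc n) powr a))"
      unfolding f_def integral_complex_of_real using a by (subst integral_mult_right_zero, subst integral_Gamma_laplace_real) auto
    also have "real (Suc n) * exp (- (real (Suc n) * t)) * (Gamma a / real (Suc n) powr a) =
        Gamma a * (real (Suc n) powr (1 - a) * exp (- (real (Suc n) * t)))"
      by (simp add: powr_diff del: of_nat_Suc)
    finally show ?thesis by (simp only: of_real_mult e p Gac)
  qed
  have normf: "(\<integral>u. norm (f n u) \<partial>pos_lborel) = Gamma a * (real (Suc n) powr (1 - a) * exp (- (real (Suc n) * t)))" for n
  proof -
    have "norm (f n u) = real (Suc n) * exp (- (real (Suc n) * t)) * (u powr (a - 1) * exp (- (real (Suc n) * u)))" for u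
      by (simp only: f_def norm_of_real) simp
    then have "(\<integral>u. norm (f n u) \<partial>pos_lborel) = real (Suc n) * exp (- (real (Suc n) * t)) * (Gamma a / real (Suc n) powr a)"
      using a by (simp add: integral_Gamma_laplace_real del: of_nat_Suc)
    then show ?thesis by (simp add: powr_diff field_simps del: of_nat_Suc)
  qed
  have sumf: "f n u = of_real (u powr (a - 1)) * (of_nat (Suc n) * exp (- of_real (t + u)) ^ Suc n)" for n u
  proof -
    have "exp (- complex_of_real (t + u)) ^ Suc n = of_real (exp (- (real (Suc n) * t)) * exp (- (real (Suc n) * u)))"
      by (subst exp_of_nat_mult[symmetric]) (simp add: exp_of_real[symmetric] exp_add[symmetric] algebra_simps)
    then show ?thesis by (simp add: f_def mult_ac del: of_nat_Suc power_Suc)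
  qed
  have e1: "norm (exp (- complex_of_real (t + u))) < 1" if "u > 0" for u using that t by simp
  have sumsf: "(\<lambda>n. f n u) sums (of_real (u powr (a - 1)) * ?S u)" if u: "u > 0" for u
    using sums_mult[OF geometric_deriv_sums[OF e1[OF u]], of "of_real (u powr (a - 1)) * exp (- complex_of_real (t + u))"]
    by (simp add: sumf mult_ac del: of_nat_Suc)
  have summf: "summable (\<lambda>n. norm (f n u))" if u: "u > 0" for u
  proof -
    have "summable (\<lambda>n. u powr (a - 1) * (real (Suc n) powr 1 * exp (- (real (Suc n) * (t + u)))))"
      using t u by (intro summable_mult summable_powr_exp) auto
    moreover have "norm (f n u) = u powr (a - 1) * (real (Suc n) powr 1 * exp (- (real (Suc n) * (t + u))))" for n
      by (simp only: f_def norm_of_real) (simp add: distrib_left exp_add[symmetric] abs_mult del: of_nat_Suc)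
    ultimately show ?thesis by simp
  qed
  note S1 = integrable_suminf[OF intf] sums_integral[OF intf]
  have AEf: "AE u in pos_lborel. summable (\<lambda>n. norm (f n u))" by (intro AE_I2) (use summf in simp)
  have snf: "summable (\<lambda>n. \<integral>u. norm (f n u) \<partial>pos_lborel)"
    unfolding normf using t by (intro summable_mult summable_powr_exp)
  have eqf: "(\<Sum>n. f n u) = of_real (u powr (a - 1)) * ?S u" if "u \<in> space pos_lborel" for u
    using sumsf that by (simp add: sums_iff)
  have int1: "integrable pos_lborel (\<lambda>u. of_real (u powr (a - 1)) * ?S u)"
  proof -
    have "integrable pos_lborel (\<lambda>u. \<Sum>n. f n u) = integrable pos_lborel (\<lambda>u. of_real (u powr (a - 1)) * ?S u)"
      by (intro Bochner_Integration.integrable_cong refl eqf)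
    then show ?thesis using S1(1)[OF AEf snf] by (rule iffD1)
  qed
  have "(\<integral>u. (\<Sum>n. f n u) \<partial>pos_lborel) = (\<integral>u. of_real (u powr (a - 1)) * ?S u \<partial>pos_lborel)"
    by (intro Bochner_Integration.integral_cong refl eqf)
  then have "(\<lambda>n. \<integral>u. f n u \<partial>pos_lborel) sums (\<integral>u. of_real (u powr (a - 1)) * ?S u \<partial>pos_lborel)"
    using S1(2)[OF AEf snf] by (simp only:)
  then have val1: "(\<integral>u. of_real (u powr (a - 1)) * ?S u \<partial>pos_lborel) = Gamma (of_real a) * expzeta (of_real a - 1) (of_real t)"
    unfolding valf expzeta_def using suminf_mult[OF summable_norm_cancel[OF summable_norm_expzeta[of "of_real t" "of_real a - 1"]]] t
    by (simp add: sums_iff)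

  \<comment> \<open>Second evaluation of the same integral, over the poles 2 pi i k.\<close>
  define W where "W k = 2 * of_real pi * \<i> * of_nat (Suc k)" for k
  define h where "h k u = complex_of_real (u powr (a - 1)) / ((of_real t + W k) + of_real u)^2 +
     complex_of_real (u powr (a - 1)) / ((of_real t - W k) + of_real u)^2" for k u
  have ReW: "Re (of_real t + W k) > 0" "Re (of_real t - W k) > 0" for k using t by (auto simp: W_def)
  \<comment> \<open>The imaginary part of \<open>z\<close> is at least k + 1 in modulus and the real
    part of z + u at least u; with (k + 1 + u)^2 <= 2 ((k + 1)^2 + u^2) this gives a real Beta
    kernel as majorant.\<close>
  have bound: "norm (complex_of_real (u powr (a - 1)) / (z + of_real u)^2) \<le> 2 * (u powr (a - 1) / (real (Suc k) + u)^2)"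
    if u: "u > 0" and z: "z = of_real t + W k \<or> z = of_real t - W k" for u z k
  proof -
    have "real (Suc k) \<le> 2 * pi * real (Suc k)"
      using pi_gt3 mult_right_mono[of 1 "2 * pi" "real (Suc k)"] by simp
    then have "real (Suc k) \<le> \<bar>Im z\<bar>" using z by (auto simp: W_def)
    then have "(real (Suc k))^2 \<le> (Im z)^2" using abs_le_square_iff[of "real (Suc k)" "Im z"] by simp
    moreover have "u^2 \<le> (t + u)^2" using t u by (intro power_mono) auto
    moreover have "(norm (z + of_real u))^2 = (t + u)^2 + (Im z)^2"
      using z by (auto simp: cmod_power2 W_def)
    moreover have "(real (Suc k) + u)^2 \<le> 2 * ((real (Suc k))^2 + u^2)"
      using sum_squares_bound[of "real (Suc k)" u] by (simp add: power2_sum)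
    ultimately have *: "(real (Suc k) + u)^2 / 2 \<le> (norm (z + of_real u))^2" by simp
    have "norm (complex_of_real (u powr (a - 1)) / (z + of_real u)^2) = u powr (a - 1) / (norm (z + of_real u))^2"
      by (simp add: norm_divide norm_power)
    also have "\<dots> \<le> u powr (a - 1) / ((real (Suc k) + u)^2 / 2)"
      using * u by (intro divide_left_mono mult_pos_pos) (auto intro: order_less_le_trans[OF _ *])
    finally show ?thesis by (simp add: mult.commute)
  qed
  have a2: "a < 2" using a by simp
  have intp: "integrable pos_lborel (\<lambda>u. complex_of_real (u powr (a - 1)) / (z + of_real u)^2)"
    if z: "z = of_real t + W k \<or> z = of_real t - W k" for z k
  proof (rule Bochner_Integration.integrable_bound)
    show "integrable pos_lborel (\<lambda>u. 2 * (u powr (a - 1) / (real (Suc k) + u)^2))"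
      using a by (intro integrable_mult_right integrable_Beta_kernel) auto
    show "(\<lambda>u. complex_of_real (u powr (a - 1)) / (z + of_real u)^2) \<in> borel_measurable pos_lborel"
      using z ReW[of k] by (intro borel_measurable_Beta_kernel_complex) auto
    show "AE u in pos_lborel. norm (complex_of_real (u powr (a - 1)) / (z + of_real u)^2) \<le> norm (2 * (u powr (a - 1) / (real (Suc k) + u)^2))"
      using bound[OF _ z] by (intro AE_I2) (auto intro: order_trans)
  qed
  have inth: "integrable pos_lborel (h k)" for k
    unfolding h_def by (intro Bochner_Integration.integrable_add intp[of _ k]) auto
  have valh: "(\<integral>u. h k u \<partial>pos_lborel) = Gamma (of_real a) * Gamma (2 - of_real a) *
      ((of_real t + W k) powr (of_real a - 1 - 1) + (of_real t - W k) powr (of_real a - 1 - 1))" for k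
  proof -
    have e: "complex_of_real a - 1 - 1 = of_real a - 2" by simp
    have "(\<integral>u. h k u \<partial>pos_lborel) = (\<integral>u. complex_of_real (u powr (a - 1)) / ((of_real t + W k) + of_real u)^2 \<partial>pos_lborel) +
       (\<integral>u. complex_of_real (u powr (a - 1)) / ((of_real t - W k) + of_real u)^2 \<partial>pos_lborel)"
      unfolding h_def by (rule Bochner_Integration.integral_add; rule intp[of _ k]) simp_all
    also have "\<dots> = Gamma (of_real a) * Gamma (2 - of_real a) * (of_real t + W k) powr (of_real a - 2) +
       Gamma (of_real a) * Gamma (2 - of_real a) * (of_real t - W k) powr (of_real a - 2)"
      by (simp only: integral_Beta_kernel_complex[OF a(1) a2 ReW(1)] integral_Beta_kernel_complex[OF a(1) a2 ReW(2)])
    finally show ?thesis unfolding e by (simp only: distrib_left)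
  qed
  have nh: "norm (h k u) \<le> 4 * (u powr (a - 1) / (real (Suc k) + u)^2)" if "u > 0" for k u
  proof -
    have "norm (h k u) \<le> 2 * (u powr (a - 1) / (real (Suc k) + u)^2) + 2 * (u powr (a - 1) / (real (Suc k) + u)^2)"
      unfolding h_def by (intro norm_triangle_mono bound that) auto
    then show ?thesis by simp
  qed
  have intn: "(\<integral>u. norm (h k u) \<partial>pos_lborel) \<le> 4 * (Gamma a * Gamma (2 - a) * real (Suc k) powr (a - 2))" for k
  proof -
    have "(\<integral>u. norm (h k u) \<partial>pos_lborel) \<le> (\<integral>u. 4 * (u powr (a - 1) / (real (Suc k) + u)^2) \<partial>pos_lborel)"
      using a nh by (intro integral_mono integrable_norm inth integrable_mult_right integrable_Beta_kernel) auto
    moreover have "(\<integral>u. u powr (a - 1) / (real (Suc k) + u)^2 \<partial>pos_lborel) =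
        Gamma a * Gamma (2 - a) * real (Suc k) powr (a - 2)"
      by (rule integral_Beta_kernel[OF a(1) a2]) simp
    ultimately show ?thesis by (simp only: integral_mult_right_zero)
  qed
  have sk: "summable (\<lambda>k. \<integral>u. norm (h k u) \<partial>pos_lborel)"
  proof (rule summable_comparison_test)
    show "\<exists>N. \<forall>n\<ge>N. norm (\<integral>u. norm (h n u) \<partial>pos_lborel) \<le> 4 * (Gamma a * Gamma (2 - a) * real (Suc n) powr (a - 2))"
    proof (intro exI[of _ 0] allI impI)
      fix n
      have "0 \<le> (\<integral>u. norm (h n u) \<partial>pos_lborel)" by (rule Bochner_Integration.integral_nonneg) simp
      then show "norm (\<integral>u. norm (h n u) \<partial>pos_lborel) \<le> 4 * (Gamma a * Gamma (2 - a) * real (Suc n) powr (a - 2))"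
        using intn[of n] by (simp only: real_norm_def abs_of_nonneg)
    qed
    show "summable (\<lambda>n. 4 * (Gamma a * Gamma (2 - a) * real (Suc n) powr (a - 2)))"
      using a by (intro summable_mult summable_powr_Suc) auto
  qed
  have AEh: "AE u in pos_lborel. summable (\<lambda>k. norm (h k u))"
  proof (rule AE_I2)
    fix u assume "u \<in> space pos_lborel"
    then have u: "u > 0" by simp
    show "summable (\<lambda>k. norm (h k u))"
    proof (rule summable_comparison_test)
      have le: "4 * (u powr (a - 1) / (real (Suc k) + u)^2) \<le> 4 * u powr (a - 1) * real (Suc k) powr (-2)" for k
      proof -
        have "(real (Suc k))^2 \<le> (real (Suc k) + u)^2" using u by (intro power_mono) auto
        then have "u powr (a - 1) / (real (Suc k) + u)^2 \<le> u powr (a - 1) / (real (Suc k))^2"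
          using u by (intro divide_left_mono mult_pos_pos) (auto intro!: zero_less_power add_pos_pos simp del: of_nat_Suc)
        then show ?thesis by (simp add: powr_minus powr_numeral divide_inverse del: of_nat_Suc)
      qed
      have "norm (norm (h n u)) \<le> 4 * u powr (a - 1) * real (Suc n) powr (-2)" for n
        using order_trans[OF nh[OF u] le[of n]] by (simp only: real_norm_def abs_norm_cancel)
      then show "\<exists>N. \<forall>n\<ge>N. norm (norm (h n u)) \<le> 4 * u powr (a - 1) * real (Suc n) powr (-2)"
        by blast
      show "summable (\<lambda>n. 4 * u powr (a - 1) * real (Suc n) powr (-2))"
        by (intro summable_mult summable_powr_Suc) auto
    qed
  qed
  \<comment> \<open>The pole at 0 is not among the \<open>W k\<close>; its kernel integrates to the
    isolated power of t in the formula.\<close>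
  have eqh: "(\<Sum>k. h k u) = of_real (u powr (a - 1)) * ?S u - of_real (u powr (a - 1)) / (of_real t + of_real u)^2"
    if "u \<in> space pos_lborel" for u
  proof -
    have tu: "t + u > 0" using that t by simp
    have "(\<lambda>k. of_real (u powr (a - 1)) * (1 / (of_real (t + u) + W k)^2 + 1 / (of_real (t + u) - W k)^2)) sums
       (of_real (u powr (a - 1)) * (?S u - 1 / (of_real (t + u))^2))"
      unfolding W_def by (rule sums_mult[OF inverse_sinh_squared_pfd[OF tu]])
    then have "(\<lambda>k. h k u) sums (of_real (u powr (a - 1)) * ?S u - of_real (u powr (a - 1)) / (of_real t + of_real u)^2)"
      unfolding h_def by (simp add: algebra_simps)
    then show ?thesis by (simp add: sums_iff)
  qed
  have int0: "integrable pos_lborel (\<lambda>u. complex_of_real (u powr (a - 1)) / (of_real t + of_real u)^2)"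
  proof -
    have "integrable pos_lborel (\<lambda>u. complex_of_real (u powr (a - 1) / (t + u)^2))"
      by (intro integrable_of_real integrable_Beta_kernel a a2 t)
    then show ?thesis by simp
  qed
  have B0: "(\<integral>u. complex_of_real (u powr (a - 1)) / (of_real t + of_real u)^2 \<partial>pos_lborel) =
      Gamma (of_real a) * Gamma (2 - of_real a) * of_real t powr (of_real a - 2)"
    by (rule integral_Beta_kernel_complex[OF a(1) a2]) (use t in simp)
  have "(\<integral>u. (\<Sum>k. h k u) \<partial>pos_lborel) =
      (\<integral>u. of_real (u powr (a - 1)) * ?S u - of_real (u powr (a - 1)) / (of_real t + of_real u)^2 \<partial>pos_lborel)"
    by (intro Bochner_Integration.integral_cong refl eqh)
  then have "(\<lambda>k. \<integral>u. h k u \<partial>pos_lborel) sums (\<integral>u. of_real (u powr (a - 1)) * ?S u - of_real (u powr (a - 1)) / (of_real t + of_real u)^2 \<partial>pos_lborel)"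
    using sums_integral[OF inth AEh sk] by (simp only:)
  also have "(\<integral>u. of_real (u powr (a - 1)) * ?S u - of_real (u powr (a - 1)) / (of_real t + of_real u)^2 \<partial>pos_lborel) =
     Gamma (of_real a) * expzeta (of_real a - 1) (of_real t) - Gamma (of_real a) * Gamma (2 - of_real a) * of_real t powr (of_real a - 2)"
    by (subst Bochner_Integration.integral_diff[OF int1 int0]) (simp only: val1 B0)
  finally have *: "(\<lambda>k. Gamma (of_real a) * Gamma (2 - of_real a) *
      ((of_real t + W k) powr (of_real a - 1 - 1) + (of_real t - W k) powr (of_real a - 1 - 1))) sums
     (Gamma (of_real a) * expzeta (of_real a - 1) (of_real t) - Gamma (of_real a) * Gamma (2 - of_real a) * of_real t powr (of_real a - 2))"
    unfolding valh .
  have nz: "Gamma (of_real a) * Gamma (2 - of_real a) \<noteq> (0::complex)" using Gac Ga by simp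
  from sums_divide[OF *, of "Gamma (of_real a) * Gamma (2 - of_real a)"] nz
  have "lipschitz_sum (of_real a - 1) t = (Gamma (of_real a) * expzeta (of_real a - 1) (of_real t) - Gamma (of_real a) * Gamma (2 - of_real a) * of_real t powr (of_real a - 2)) / (Gamma (of_real a) * Gamma (2 - of_real a))"
    unfolding lipschitz_sum_def W_def by (simp add: sums_iff)
  then have "Gamma (of_real a) * expzeta (of_real a - 1) (of_real t) =
      Gamma (of_real a) * (Gamma (2 - of_real a) * (of_real t powr (of_real a - 2) + lipschitz_sum (of_real a - 1) t))"
    using nz by (simp add: field_simps)
  then show ?thesis using nz by simp
qed

lemma holomorphic_on_lipschitz_sum:
  assumes t: "t \<ge> 0"
  shows "(\<lambda>s. lipschitz_sum s t) holomorphic_on {s. Re s < 0}"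
  unfolding lipschitz_sum_def
proof (rule holomorphic_on_suminf_dominated)
  show "open {s. Re s < 0}" by (rule open_halfspace_Re_lt)
  fix z assume "z \<in> {s. Re s < 0}"
  then have z: "Re z < 0" by simp
  let ?E = "2 * exp (pi * (\<bar>Im z\<bar> + \<bar>Re z\<bar>))"
  show "\<exists>r>0. \<exists>g. summable g \<and> (\<forall>s\<in>ball z r \<inter> {s. Re s < 0}. \<forall>k.
     norm ((of_real t + 2 * of_real pi * \<i> * of_nat (Suc k)) powr (s - 1) +
     (of_real t - 2 * of_real pi * \<i> * of_nat (Suc k)) powr (s - 1)) \<le> g k)"
  proof (intro exI[of _ "- Re z / 2"] conjI ballI allI exI[of _ "\<lambda>k. ?E * real (Suc k) powr (Re z / 2 - 1)"])
    show "summable (\<lambda>k. ?E * real (Suc k) powr (Re z / 2 - 1))"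
      using z by (intro summable_mult summable_powr_Suc) auto
    fix s k assume s: "s \<in> ball z (- Re z / 2) \<inter> {s. Re s < 0}"
    then have s0: "Re s < 0" and d: "norm (z - s) < - Re z / 2" by (auto simp: dist_norm)
    have "\<bar>Re z - Re s\<bar> < - Re z / 2" using d abs_Re_le_cmod[of "z - s"] by simp
    then have re: "Re s - 1 \<le> Re z / 2 - 1" by linarith
    have "\<bar>Im z - Im s\<bar> < - Re z / 2" using d abs_Im_le_cmod[of "z - s"] by simp
    then have im: "\<bar>Im s\<bar> \<le> \<bar>Im z\<bar> + \<bar>Re z\<bar>" using z by linarith
    have s1: "Re s < 1" using s0 by simp
    have "2 * exp (pi * \<bar>Im s\<bar>) * real (Suc k) powr (Re s - 1) \<le> ?E * real (Suc k) powr (Re z / 2 - 1)"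
      using re im by (intro mult_mono powr_mono) auto
    then show "norm ((of_real t + 2 * of_real pi * \<i> * of_nat (Suc k)) powr (s - 1) +
       (of_real t - 2 * of_real pi * \<i> * of_nat (Suc k)) powr (s - 1)) \<le> ?E * real (Suc k) powr (Re z / 2 - 1)"
      by (rule order_trans[OF norm_lipschitz_pair[OF s1 t]])
  qed (use z in simp)
qed (auto intro!: holomorphic_intros)

lemma Gamma_one_minus_holomorphic: "(\<lambda>s::complex. Gamma (1 - s)) holomorphic_on {s. Re s < 1}"
  by (intro holomorphic_intros) (auto elim!: nonpos_Ints_cases simp: complex_eq_iff)

text \<open>Analytic continuation in \<open>s\<close> from the real interval (-1, 0) to the
  half-plane, on which both sides are holomorphic.\<close>

lemma lipschitz_formula:
  fixes s :: complex and t :: real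
  assumes s: "Re s < 0" and t: "t > 0"
  shows "expzeta s (of_real t) = Gamma (1 - s) * (of_real t powr (s - 1) + lipschitz_sum s t)"
proof -
  let ?S = "{s. Re s < 0}"
  let ?d = "\<lambda>s. expzeta s (of_real t) - Gamma (1 - s) * (of_real t powr (s - 1) + lipschitz_sum s t)"
  define U where "U = (\<lambda>a. complex_of_real a - 1) ` {0<..<1}"
  have "?d s = 0"
  proof (rule analytic_continuation[where f = ?d and S = ?S and U = U and \<xi> = "-1/2"])
    show "?d holomorphic_on ?S"
      by (intro holomorphic_intros holomorphic_on_lipschitz_sum
          holomorphic_on_subset[OF holomorphic_on_expzeta] holomorphic_on_subset[OF Gamma_one_minus_holomorphic])
         (use t in auto)
    show "open ?S" by (rule open_halfspace_Re_lt)
    show "connected ?S" by (intro convex_connected convex_halfspace_Re_lt)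
    show "U \<subseteq> ?S" by (auto simp: U_def)
    show "-1/2 islimpt U"
    proof -
      \<comment> \<open>The divisor 3 keeps a = 1/2 + 1 / (3 (n + 1)) inside (0, 1).\<close>
      have "(\<lambda>n. - 1/2 + 1 / of_nat (Suc n) / 3) \<longlonglongrightarrow> -1/2 + 0 / (3 :: complex)"
        by (intro tendsto_intros LIMSEQ_Suc[OF lim_1_over_n]) simp
      moreover have "- 1/2 + 1 / of_nat (Suc n) / 3 \<in> U - {-1/2}" for n
      proof -
        define x where "x = 1 / real (Suc n)"
        have "0 < x" "x \<le> 1" by (auto simp: x_def)
        then have "1/2 + x / 3 \<in> {0<..<1}" by simp
        then have "1/2 + 1 / real (Suc n) / 3 \<in> {0<..<1}" by (simp only: x_def)
        then have "- 1/2 + 1 / of_nat (Suc n) / 3 \<in> U"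
          unfolding U_def by (rule image_eqI[rotated]) (simp del: of_nat_Suc)
        moreover have "- 1/2 + 1 / of_nat (Suc n) / 3 \<noteq> (-1/2 :: complex)"
          by (simp del: of_nat_Suc)
        ultimately show ?thesis by blast
      qed
      ultimately show ?thesis
        unfolding islimpt_sequential by (intro exI[of _ "\<lambda>n. - 1/2 + 1 / of_nat (Suc n) / 3"]) (simp del: of_nat_Suc)
    qed
    fix v assume "v \<in> U"
    then obtain a where a: "v = of_real a - 1" "0 < a" "a < 1" by (auto simp: U_def)
    have e: "1 - v = 2 - of_real a" "v - 1 = of_real a - 2" using a by simp_all
    show "?d v = 0"
      unfolding e using lipschitz_formula_real[OF a(2,3) t] by (simp add: a(1))
  qed (use s in auto)
  then show ?thesis by simp
qed

section \<open>Remainders of the expansion at t = 0\<close>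

definition lipschitz_rem :: "complex \<Rightarrow> real \<Rightarrow> complex" where
  "lipschitz_rem s t = Gamma (1 - s) * lipschitz_sum s t"

lemma holomorphic_on_lipschitz_rem:
  "t \<ge> 0 \<Longrightarrow> (\<lambda>s. lipschitz_rem s t) holomorphic_on {s. Re s < 0}"
  unfolding lipschitz_rem_def
  by (intro holomorphic_intros holomorphic_on_lipschitz_sum holomorphic_on_subset[OF Gamma_one_minus_holomorphic]) auto

text \<open>The endpoint t = 0 is included because the iterated integrals start there and the value
  there gives the functional equation. At t = 0 the bases of the powers are nonzero and purely
  imaginary, hence off the branch cut.\<close>

lemma continuous_on_lipschitz_rem:
  assumes s: "Re s < 0"
  shows "continuous_on {0..} (lipschitz_rem s)"
proof -
  let ?f = "\<lambda>k t. (of_real t + 2 * of_real pi * \<i> * of_nat (Suc k)) powr (s - 1) +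
     (of_real t - 2 * of_real pi * \<i> * of_nat (Suc k)) powr (s - 1)"
  have s1: "Re s < 1" using s by simp
  have "uniform_limit {0..} (\<lambda>n t. \<Sum>k<n. ?f k t) (\<lambda>t. \<Sum>k. ?f k t) sequentially"
  proof (rule Weierstrass_m_test)
    show "norm (?f k t) \<le> 2 * exp (pi * \<bar>Im s\<bar>) * real (Suc k) powr (Re s - 1)" if "t \<in> {0..}" for k t
      by (rule norm_lipschitz_pair[OF s1]) (use that in simp)
    show "summable (\<lambda>k. 2 * exp (pi * \<bar>Im s\<bar>) * real (Suc k) powr (Re s - 1))"
      using s by (intro summable_mult summable_powr_Suc) auto
  qed
  moreover have "continuous_on {0..} (\<lambda>t. \<Sum>k<n. ?f k t)" for n
    by (intro continuous_on_sum continuous_on_add continuous_on_powr_complex continuous_intros)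
       (auto simp: complex_eq_iff)
  ultimately have "continuous_on {0..} (\<lambda>t. \<Sum>k. ?f k t)"
    by (intro uniform_limit_theorem[of _ _ sequentially]) auto
  then show ?thesis
    unfolding lipschitz_rem_def lipschitz_sum_def by (intro continuous_intros)
qed

text \<open>The bound is uniform in all t >= 0 and local in \<open>s\<close>, so that it survives
  the iterated integrations and later supplies majorants for the Mellin integrals.\<close>

lemma lipschitz_rem_bounded:
  assumes s0: "Re s0 < 0"
  obtains r B where "r > 0" "B \<ge> 0" "\<And>s. s \<in> ball s0 r \<Longrightarrow> Re s < 0"
    "\<And>s t. s \<in> ball s0 r \<Longrightarrow> t \<ge> 0 \<Longrightarrow> norm (lipschitz_rem s t) \<le> B"
proof -
  define r where "r = - Re s0 / 2"
  have r: "r > 0" using s0 by (simp add: r_def)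
  have near: "Re s \<le> Re s0 / 2" "\<bar>Im s\<bar> \<le> \<bar>Im s0\<bar> + r" if "s \<in> cball s0 r" for s
  proof -
    have d: "norm (s0 - s) \<le> r" using that by (simp add: dist_norm)
    have "\<bar>Re s0 - Re s\<bar> \<le> r" using d abs_Re_le_cmod[of "s0 - s"] by simp
    then show "Re s \<le> Re s0 / 2" unfolding r_def by linarith
    have "\<bar>Im s0 - Im s\<bar> \<le> r" using d abs_Im_le_cmod[of "s0 - s"] by simp
    then show "\<bar>Im s\<bar> \<le> \<bar>Im s0\<bar> + r" by linarith
  qed
  have "continuous_on (cball s0 r) (\<lambda>s. Gamma (1 - s))"
    using near(1) s0
    by (intro holomorphic_on_imp_continuous_on holomorphic_on_subset[OF Gamma_one_minus_holomorphic]) fastforce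
  then have "bounded ((\<lambda>s. Gamma (1 - s)) ` cball s0 r)"
    by (intro compact_imp_bounded compact_continuous_image) auto
  then obtain G where "\<forall>y\<in>(\<lambda>s. Gamma (1 - s)) ` cball s0 r. norm y \<le> G"
    unfolding bounded_iff by blast
  then have G: "norm (Gamma (1 - s)) \<le> G" if "s \<in> cball s0 r" for s using that by blast
  define E where "E = 2 * exp (pi * (\<bar>Im s0\<bar> + r))"
  define S where "S = (\<Sum>k. E * real (Suc k) powr (Re s0 / 2 - 1))"
  have sm: "summable (\<lambda>k. E * real (Suc k) powr (Re s0 / 2 - 1))"
    using s0 by (intro summable_mult summable_powr_Suc) auto
  have ls: "norm (lipschitz_sum s t) \<le> S" if s: "s \<in> ball s0 r" and t: "t \<ge> 0" for s t
  proof -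
    have n: "Re s \<le> Re s0 / 2" "\<bar>Im s\<bar> \<le> \<bar>Im s0\<bar> + r" using near s by auto
    then have s1: "Re s < 1" using s0 by linarith
    have le: "norm ((of_real t + 2 * of_real pi * \<i> * of_nat (Suc k)) powr (s - 1) +
      (of_real t - 2 * of_real pi * \<i> * of_nat (Suc k)) powr (s - 1)) \<le> E * real (Suc k) powr (Re s0 / 2 - 1)" for k
    proof (rule order_trans[OF norm_lipschitz_pair[OF s1 t]])
      show "2 * exp (pi * \<bar>Im s\<bar>) * real (Suc k) powr (Re s - 1) \<le> E * real (Suc k) powr (Re s0 / 2 - 1)"
        unfolding E_def using n by (intro mult_mono powr_mono) auto
    qed
    show ?thesis unfolding lipschitz_sum_def S_def by (rule norm_suminf_le[OF le sm])
  qed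
  have S0: "S \<ge> 0" unfolding S_def by (intro suminf_nonneg sm) (simp add: E_def)
  have G0: "G \<ge> 0" using G[of s0] r norm_ge_zero order_trans by (metis centre_in_cball less_imp_le)
  show thesis
  proof (rule that[of r "G * S"])
    show "norm (lipschitz_rem s t) \<le> G * S" if "s \<in> ball s0 r" "t \<ge> 0" for s t
      unfolding lipschitz_rem_def norm_mult using that G[of s] ls S0 G0 by (intro mult_mono) auto
    show "Re s < 0" if "s \<in> ball s0 r" for s
      using near(1)[of s] that s0 by simp
  qed (use r S0 G0 in auto)
qed

text \<open>As the t-derivative of L(s, t) is - L(s - 1, t), the remainder of order K + 1 at
  \<open>s\<close> is an antiderivative of minus the remainder of order K at s - 1. Starting the
  integral at 0 makes it vanish there, which leaves the whole constant term to zeta(s).\<close>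

primrec expzeta_rem :: "nat \<Rightarrow> complex \<Rightarrow> real \<Rightarrow> complex" where
  "expzeta_rem 0 s t = lipschitz_rem s t"
| "expzeta_rem (Suc K) s t = - integral {0..t} (\<lambda>u. expzeta_rem K (s - 1) u)"

lemma continuous_on_indefinite_integral:
  fixes f :: "real \<Rightarrow> complex"
  assumes f: "continuous_on {0..} f"
  shows "continuous_on {0..} (\<lambda>t. integral {0..t} f)"
  unfolding continuous_on_eq_continuous_within
proof
  fix t :: real assume t: "t \<in> {0..}"
  have "continuous_on {0..t+1} (\<lambda>t. integral {0..t} f)"
    by (intro indefinite_integral_continuous_1 integrable_continuous_interval continuous_on_subset[OF f]) auto
  then have "continuous (at t within {0..t+1}) (\<lambda>t. integral {0..t} f)"
    using t by (simp add: continuous_on_eq_continuous_within)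
  moreover have "at t within {0..t+1} = at t within {0..}"
    by (rule at_within_nhd[where S = "{..<t+1}"]) auto
  ultimately show "continuous (at t within {0..}) (\<lambda>t. integral {0..t} f)" by simp
qed

lemma continuous_on_expzeta_rem:
  "Re s < real K \<Longrightarrow> continuous_on {0..} (expzeta_rem K s)"
proof (induction K arbitrary: s)
  case 0
  then have "continuous_on {0..} (lipschitz_rem s)" by (intro continuous_on_lipschitz_rem) simp
  then show ?case by simp
next
  case (Suc K)
  have "continuous_on {0..} (expzeta_rem K (s - 1))" by (rule Suc.IH) (use Suc.prems in simp)
  then show ?case by (auto intro!: continuous_on_minus continuous_on_indefinite_integral)
qed

text \<open>Each integration from 0 gains a factor t. The bound covers all t >= 0, so one estimate
  serves both ends of the Mellin integral.\<close>

lemma expzeta_rem_bounded: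
  assumes "Re s0 < real K"
  shows "\<exists>r>0. \<exists>B\<ge>0. \<forall>s\<in>ball s0 r. Re s < real K \<and> (\<forall>t\<ge>0. norm (expzeta_rem K s t) \<le> B * t ^ K)"
  using assms
proof (induction K arbitrary: s0)
  case 0
  then have "Re s0 < 0" by simp
  then obtain r B where "r > 0" "B \<ge> 0" "\<And>s. s \<in> ball s0 r \<Longrightarrow> Re s < 0"
    "\<And>s t. s \<in> ball s0 r \<Longrightarrow> t \<ge> 0 \<Longrightarrow> norm (lipschitz_rem s t) \<le> B"
    using lipschitz_rem_bounded by blast
  then show ?case
    by (intro exI[of _ r]) (rule conjI, assumption, intro exI[of _ B], auto)
next
  case (Suc K)
  have "Re (s0 - 1) < real K" using Suc.prems by simp
  from Suc.IH[OF this] obtain r B where r: "r > 0" "B \<ge> 0"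
    and *: "\<And>s. s \<in> ball (s0 - 1) r \<Longrightarrow> Re s < real K"
      "\<And>s t. s \<in> ball (s0 - 1) r \<Longrightarrow> t \<ge> 0 \<Longrightarrow> norm (expzeta_rem K s t) \<le> B * t ^ K" by blast
  show ?case
  proof (rule exI[of _ r], rule conjI[OF r(1)], rule exI[of _ B], rule conjI[OF r(2)], intro ballI conjI allI impI)
    fix s assume "s \<in> ball s0 r"
    then have s: "s - 1 \<in> ball (s0 - 1) r" by (simp add: dist_norm)
    from *(1)[OF s] show re: "Re s < real (Suc K)" by simp
    fix t :: real assume t: "t \<ge> 0"
    have "norm (integral {0..t} (expzeta_rem K (s - 1))) \<le> B * t ^ K * (t - 0)"
    proof (rule integral_bound[OF t])
      show "continuous_on {0..t} (expzeta_rem K (s - 1))"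
        by (rule continuous_on_subset[OF continuous_on_expzeta_rem[OF *(1)[OF s]]]) auto
      show "norm (expzeta_rem K (s - 1) u) \<le> B * t ^ K" if "u \<in> {0..t}" for u
      proof (rule order_trans[OF *(2)[OF s]])
        show "B * u ^ K \<le> B * t ^ K" using that r(2) by (intro mult_left_mono power_mono) auto
      qed (use that in simp)
    qed
    then show "norm (expzeta_rem (Suc K) s t) \<le> B * t ^ Suc K" by (simp add: mult_ac)
  qed
qed

text \<open>Induction on \<open>K\<close>: the interval [0, t] has finite measure, so a local
  constant bound is a majorant and the result on parametric integrals applies.\<close>

lemma holomorphic_on_expzeta_rem:
  "t \<ge> 0 \<Longrightarrow> (\<lambda>s. expzeta_rem K s t) holomorphic_on {s. Re s < real K}"
proof (induction K arbitrary: t)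
  case 0
  then show ?case using holomorphic_on_lipschitz_rem by simp
next
  case (Suc K)
  let ?M = "lebesgue_on {0..t}" and ?U = "{s. Re s < real (Suc K)}"
  have lt: "Re (s - 1) < real K" if "s \<in> ?U" for s using that by simp
  have meas: "expzeta_rem K (s - 1) \<in> borel_measurable ?M" if "s \<in> ?U" for s
    by (intro continuous_imp_measurable_on_sets_lebesgue continuous_on_subset[OF continuous_on_expzeta_rem[OF lt[OF that]]]) auto
  have bd: "\<exists>r>0. \<exists>B\<ge>0. \<forall>w\<in>ball s r \<inter> ?U. \<forall>u\<in>space ?M. norm (expzeta_rem K (w - 1) u) \<le> B"
    if s: "s \<in> ?U" for s
  proof -
    obtain r B where r: "r > 0" "B \<ge> 0"
      and *: "\<And>w u. w \<in> ball (s - 1) r \<Longrightarrow> u \<ge> 0 \<Longrightarrow> norm (expzeta_rem K w u) \<le> B * u ^ K"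
      using expzeta_rem_bounded[OF lt[OF s]] by blast
    show ?thesis
    proof (rule exI[of _ r], rule conjI[OF r(1)], rule exI[of _ "B * t ^ K"], intro conjI ballI)
      show "0 \<le> B * t ^ K" using r(2) Suc.prems by simp
      fix w u assume w: "w \<in> ball s r \<inter> ?U" and u: "u \<in> space ?M"
      have wb: "w - 1 \<in> ball (s - 1) r" using w by (simp add: dist_norm)
      have u0: "0 \<le> u" "u \<le> t" using u by (auto simp: space_restrict_space)
      have "B * u ^ K \<le> B * t ^ K" using u0 r(2) by (intro mult_left_mono power_mono) auto
      with *[OF wb u0(1)] show "norm (expzeta_rem K (w - 1) u) \<le> B * t ^ K" by (rule order_trans)
    qed
  qed
  have fin: "finite_measure ?M" by (rule finite_measure_lebesgue_on) (use lmeasurable_cbox[of 0 t] in simp)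
  have "(\<lambda>s. \<integral>u. expzeta_rem K (s - 1) u \<partial>?M) holomorphic_on ?U"
  proof (rule holomorphic_on_lebesgue_integral)
    show "open ?U" by (rule open_halfspace_Re_lt)
    show "(\<lambda>s. expzeta_rem K (s - 1) u) holomorphic_on ?U" if "u \<in> space ?M" for u
    proof -
      have u: "u \<ge> 0" using that by (simp add: space_restrict_space)
      have "((\<lambda>s. expzeta_rem K s u) \<circ> (\<lambda>s. s - 1)) holomorphic_on ?U"
        by (rule holomorphic_on_compose_gen[OF _ Suc.IH[OF u]]) (auto intro!: holomorphic_intros)
      then show ?thesis by (simp add: o_def)
    qed
    show "\<exists>r>0. \<exists>g. integrable ?M g \<and> (\<forall>w\<in>ball s r \<inter> ?U. \<forall>u\<in>space ?M. norm (expzeta_rem K (w - 1) u) \<le> g u)"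
      if s: "s \<in> ?U" for s
    proof -
      obtain r B where "r > 0" "\<forall>w\<in>ball s r \<inter> ?U. \<forall>u\<in>space ?M. norm (expzeta_rem K (w - 1) u) \<le> B"
        using bd[OF s] by blast
      moreover have "integrable ?M (\<lambda>_. B)" by (rule finite_measure.integrable_const[OF fin])
      ultimately show ?thesis by (intro exI[of _ r] conjI exI[of _ "\<lambda>_. B"]) auto
    qed
  qed (use meas in auto)
  moreover have "(\<integral>u. expzeta_rem K (s - 1) u \<partial>?M) = - expzeta_rem (Suc K) s t" if s: "s \<in> ?U" for s
  proof -
    obtain r B where B: "r > 0" "\<forall>w\<in>ball s r \<inter> ?U. \<forall>u\<in>space ?M. norm (expzeta_rem K (w - 1) u) \<le> B"
      using bd[OF s] by blast
    have "integrable ?M (expzeta_rem K (s - 1))"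
    proof (rule finite_measure.integrable_const_bound[OF fin])
      show "AE u in ?M. norm (expzeta_rem K (s - 1) u) \<le> B"
        by (rule AE_I2) (use B s in auto)
    qed (rule meas[OF s])
    then show ?thesis by (simp add: lebesgue_integral_eq_integral)
  qed
  ultimately have "(\<lambda>s. - expzeta_rem (Suc K) s t) holomorphic_on ?U"
    by (rule holomorphic_transform)
  then have "(\<lambda>s. - (- expzeta_rem (Suc K) s t)) holomorphic_on ?U" by (rule holomorphic_on_minus)
  then show ?case by (simp only: minus_minus)
qed

lemma has_vector_derivative_expzeta_rem:
  assumes s: "Re s < real (Suc K)" and t: "t > 0"
  shows "(expzeta_rem (Suc K) s has_vector_derivative - expzeta_rem K (s - 1) t) (at t)"
proof -
  have c: "continuous_on {0..t+1} (expzeta_rem K (s - 1))"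
    by (rule continuous_on_subset[OF continuous_on_expzeta_rem]) (use s in auto)
  have "((\<lambda>t. integral {0..t} (expzeta_rem K (s - 1))) has_vector_derivative expzeta_rem K (s - 1) t) (at t within {0..t+1})"
    by (rule integral_has_vector_derivative[OF c]) (use t in auto)
  moreover have "at t within {0..t+1} = at t" using t by (intro at_within_Icc_at) auto
  ultimately have "((\<lambda>t. - integral {0..t} (expzeta_rem K (s - 1))) has_vector_derivative - expzeta_rem K (s - 1) t) (at t)"
    by (auto intro: has_vector_derivative_minus)
  moreover have "expzeta_rem (Suc K) s = (\<lambda>t. - integral {0..t} (expzeta_rem K (s - 1)))"
    by (rule ext) simp
  ultimately show ?thesis by (simp only:)
qed

lemma expzeta_rem_tendsto_0:
  assumes "Re s < real K" "K > 0"
  shows "(expzeta_rem K s \<longlongrightarrow> 0) (at_right 0)"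
proof -
  obtain r B where r: "r > 0" and B: "\<And>w t. w \<in> ball s r \<Longrightarrow> t \<ge> 0 \<Longrightarrow> norm (expzeta_rem K w t) \<le> B * t ^ K"
    using expzeta_rem_bounded[OF assms(1)] by blast
  show ?thesis
  proof (rule Lim_null_comparison)
    show "\<forall>\<^sub>F t in at_right 0. norm (expzeta_rem K s t) \<le> B * t ^ K"
      using eventually_at_right_less[of 0] by eventually_elim (use B[of s] r in auto)
    have "((\<lambda>t. B * t ^ K) \<longlongrightarrow> B * 0 ^ K) (at_right 0)" by (intro tendsto_intros)
    moreover have "B * 0 ^ K = 0" using assms(2) by (simp add: zero_power)
    ultimately show "((\<lambda>t. B * t ^ K) \<longlongrightarrow> 0) (at_right 0)" by (simp only:)
  qed
qed

section \<open>The Riemann zeta function\<close>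

text \<open>
  The constant term of the expansion of \<open>expzeta s t\<close> as \<open>t \<rightarrow> 0\<close> continues \<open>\<zeta>(s)\<close>: first to
  \<open>Re s < 1\<close>, then to \<open>Re s < 2\<close>, where it meets the Dirichlet series.
\<close>

definition zeta_left :: "complex \<Rightarrow> complex" where
  "zeta_left s = expzeta s 1 - Gamma (1 - s) - expzeta_rem 1 s 1"

text \<open>The first branch solves the expansion of order 2 at t = 1 for its constant term; the
  linear term there is - zeta(s - 1), for which \<open>zeta_left\<close> is already at hand.\<close>

definition zeta_cont :: "complex \<Rightarrow> complex" where
  "zeta_cont s = (if Re s < 2 then expzeta s 1 - Gamma (1 - s) + zeta_left (s - 1) - expzeta_rem 2 s 1
     else \<Sum>n. of_nat (Suc n) powr (-s))"

text \<open>This is (s - 1) zeta(s) with the pole removed by hand: (s - 1) times - Gamma(1 - s)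
  becomes Gamma(2 - s), which is regular at s = 1.\<close>

definition zeta_num :: "complex \<Rightarrow> complex" where
  "zeta_num s = (if Re s < 2 then (s - 1) * (expzeta s 1 + zeta_left (s - 1) - expzeta_rem 2 s 1) + Gamma (2 - s)
     else (s - 1) * (\<Sum>n. of_nat (Suc n) powr (-s)))"

text \<open>The coefficient function \<open>Z\<close> is a parameter because the coefficients are
  recognised as values of zeta only in the course of the induction.\<close>

definition expzeta_expansion :: "nat \<Rightarrow> (complex \<Rightarrow> complex) \<Rightarrow> complex \<Rightarrow> real \<Rightarrow> complex" where
  "expzeta_expansion K Z s t = Gamma (1 - s) * of_real t powr (s - 1) +
     (\<Sum>k<K. Z (s - of_nat k) * (- of_real t) ^ k / fact k) + expzeta_rem K s t"

lemma has_vector_derivative_zero_pos: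
  fixes D :: "real \<Rightarrow> complex"
  assumes "\<And>t. t > 0 \<Longrightarrow> (D has_vector_derivative 0) (at t)"
  obtains c where "\<And>t. t > 0 \<Longrightarrow> D t = c"
proof -
  have d: "(D has_vector_derivative 0) (at t within {0<..})" if "t \<in> {0<..}" for t
    using assms[of t] that has_vector_derivative_at_within by auto
  have cv: "convex {0::real<..}" by (rule convex_real_interval)
  obtain c where "\<And>t. t \<in> {0<..} \<Longrightarrow> D t = c"
    using has_vector_derivative_zero_constant[OF cv d] by blast
  with that show thesis by simp
qed

text \<open>By the expansion of order K at s - 1 both sides have the same derivative in t, so they
  differ by a constant \<open>c\<close>, identified separately. The condition on 1 - s excludes s =
  1, 2, ..., the poles of Gamma(1 - s).\<close>

lemma expzeta_expansion_step:
  assumes s: "Re s < real (Suc K)" "1 - s \<notin> \<int>\<^sub>\<le>\<^sub>0"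
    and prev: "\<And>t. t > 0 \<Longrightarrow> expzeta (s - 1) (of_real t) = expzeta_expansion K Z (s - 1) t"
  shows "\<exists>c. \<forall>t>0. expzeta s (of_real t) = Gamma (1 - s) * of_real t powr (s - 1) + c +
     (\<Sum>k<K. Z (s - 1 - of_nat k) * (- of_real t) ^ Suc k / fact (Suc k)) + expzeta_rem (Suc K) s t"
proof -
  define f where "f z = expzeta s z - Gamma (1 - s) * z powr (s - 1) -
     (\<Sum>k<K. Z (s - 1 - of_nat k) * (- z) ^ Suc k / fact (Suc k))" for z
  have "((\<lambda>t. f (of_real t) - expzeta_rem (Suc K) s t) has_vector_derivative 0) (at t)" if t: "t > 0" for t
  proof -
    have Re: "Re (of_real t) > 0" using t by simp
    have p: "complex_of_real t \<notin> \<real>\<^sub>\<le>\<^sub>0" using t by (simp add: complex_nonpos_Reals_iff)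
    have "((\<lambda>z. Z (s - 1 - of_nat k) * (- z) ^ Suc k / fact (Suc k)) has_field_derivative
        - (Z (s - 1 - of_nat k) * (- of_real t) ^ k / fact k)) (at (of_real t))" for k
      by (auto intro!: derivative_eq_intros simp: divide_simps simp del: power_Suc of_nat_Suc)
    then have "(f has_field_derivative (- expzeta (s - 1) (of_real t) -
        Gamma (1 - s) * ((s - 1) * of_real t powr (s - 1 - 1)) -
        (\<Sum>k<K. - (Z (s - 1 - of_nat k) * (- of_real t) ^ k / fact k)))) (at (of_real t))"
      unfolding f_def
      by (intro DERIV_diff DERIV_cmult DERIV_sum has_field_derivative_expzeta[OF Re] has_field_derivative_powr[OF p])
    then have "((\<lambda>t. f (of_real t)) has_vector_derivative (- expzeta (s - 1) (of_real t) -
        Gamma (1 - s) * ((s - 1) * of_real t powr (s - 1 - 1)) -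
        (\<Sum>k<K. - (Z (s - 1 - of_nat k) * (- of_real t) ^ k / fact k)))) (at t)"
      by (rule has_vector_derivative_real_field)
    from has_vector_derivative_diff[OF this has_vector_derivative_expzeta_rem[OF s(1) t]]
    have "((\<lambda>t. f (of_real t) - expzeta_rem (Suc K) s t) has_vector_derivative
       (- expzeta (s - 1) (of_real t) - Gamma (1 - s) * ((s - 1) * of_real t powr (s - 1 - 1)) -
        (\<Sum>k<K. - (Z (s - 1 - of_nat k) * (- of_real t) ^ k / fact k)) - (- expzeta_rem K (s - 1) t))) (at t)" .
    moreover have G: "Gamma (1 - (s - 1)) = (1 - s) * Gamma (1 - s)"
      using Gamma_plus1[OF s(2)] by (simp add: algebra_simps)
    have "- expzeta (s - 1) (of_real t) - Gamma (1 - s) * ((s - 1) * of_real t powr (s - 1 - 1)) -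
        (\<Sum>k<K. - (Z (s - 1 - of_nat k) * (- of_real t) ^ k / fact k)) - (- expzeta_rem K (s - 1) t) = 0"
      unfolding prev[OF t] expzeta_expansion_def sum_negf G by (simp add: algebra_simps)
    ultimately show ?thesis by simp
  qed
  then obtain c where c: "\<And>t. t > 0 \<Longrightarrow> f (of_real t) - expzeta_rem (Suc K) s t = c"
    using has_vector_derivative_zero_pos by blast
  show ?thesis
  proof (intro exI[of _ c] allI impI)
    fix t :: real assume "t > 0"
    from c[OF this] show "expzeta s (of_real t) = Gamma (1 - s) * of_real t powr (s - 1) + c +
     (\<Sum>k<K. Z (s - 1 - of_nat k) * (- of_real t) ^ Suc k / fact (Suc k)) + expzeta_rem (Suc K) s t"
      unfolding f_def by (simp only: algebra_simps)
  qed
qed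

lemma tendsto_polynomial_0:
  "((\<lambda>t::real. \<Sum>k<K. a k * (- complex_of_real t) ^ Suc k / fact (Suc k)) \<longlongrightarrow> 0) (at_right 0)"
proof -
  have "((\<lambda>t::real. \<Sum>k<K. a k * (- complex_of_real t) ^ Suc k / fact (Suc k)) \<longlongrightarrow>
     (\<Sum>k<K. a k * (- complex_of_real 0) ^ Suc k / fact (Suc k))) (at_right 0)"
    by (intro tendsto_intros) (simp_all del: fact_Suc)
  then show ?thesis by simp
qed

text \<open>The finite part of L(s, t) at t = 0. Being unique, it identifies constants of
  integration that arise from different expansions.\<close>

definition expzeta_limit :: "complex \<Rightarrow> complex \<Rightarrow> bool" where
  "expzeta_limit s c \<longleftrightarrow>
     ((\<lambda>t. expzeta s (of_real t) - Gamma (1 - s) * of_real t powr (s - 1)) \<longlongrightarrow> c) (at_right 0)"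

lemma expzeta_limit_unique: "expzeta_limit s c \<Longrightarrow> expzeta_limit s d \<Longrightarrow> c = d"
  unfolding expzeta_limit_def by (rule tendsto_unique[of "at_right 0"]) auto

lemma expzeta_limit_step:
  assumes "\<And>t. t > 0 \<Longrightarrow> expzeta s (of_real t) = Gamma (1 - s) * of_real t powr (s - 1) + c +
     (\<Sum>k<K. a k * (- of_real t) ^ Suc k / fact (Suc k)) + expzeta_rem (Suc K) s t"
    and "Re s < real (Suc K)"
  shows "expzeta_limit s c"
proof -
  have "((\<lambda>t. c + (\<Sum>k<K. a k * (- of_real t) ^ Suc k / fact (Suc k)) + expzeta_rem (Suc K) s t) \<longlongrightarrow> c + 0 + 0) (at_right 0)"
    by (intro tendsto_add tendsto_const tendsto_polynomial_0 expzeta_rem_tendsto_0 assms(2)) simp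
  moreover have "\<forall>\<^sub>F t in at_right 0. c + (\<Sum>k<K. a k * (- of_real t) ^ Suc k / fact (Suc k)) + expzeta_rem (Suc K) s t =
      expzeta s (of_real t) - Gamma (1 - s) * of_real t powr (s - 1)"
    using eventually_at_right_less[of 0] by eventually_elim (simp add: assms(1) del: power_Suc expzeta_rem.simps)
  ultimately show ?thesis unfolding expzeta_limit_def using tendsto_cong by fastforce
qed

lemma expzeta_limit_expansion:
  assumes "\<And>t. t > 0 \<Longrightarrow> expzeta s (of_real t) = expzeta_expansion (Suc K) Z s t" "Re s < real (Suc K)"
  shows "expzeta_limit s (Z s)"
proof (rule expzeta_limit_step[OF _ assms(2)])
  show "expzeta s (of_real t) = Gamma (1 - s) * of_real t powr (s - 1) + Z s +
     (\<Sum>k<K. Z (s - of_nat (Suc k)) * (- of_real t) ^ Suc k / fact (Suc k)) + expzeta_rem (Suc K) s t" if "t > 0" for t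
    unfolding assms(1)[OF that] expzeta_expansion_def by (subst sum.lessThan_Suc_shift) (simp del: power_Suc of_nat_Suc expzeta_rem.simps)
qed

text \<open>For Re s > 1 the series converges uniformly up to t = 0 and the singular power t^(s-1)
  tends to 0.\<close>

lemma expzeta_limit_series:
  assumes s: "Re s > 1"
  shows "expzeta_limit s (\<Sum>n. of_nat (Suc n) powr (-s))"
proof -
  let ?f = "\<lambda>n t. of_nat (Suc n) powr (-s) * exp (- (of_nat (Suc n) * complex_of_real t))"
  have "uniform_limit {0..} (\<lambda>m t. \<Sum>n<m. ?f n t) (\<lambda>t. \<Sum>n. ?f n t) sequentially"
  proof (rule Weierstrass_m_test)
    show "norm (?f n t) \<le> real (Suc n) powr (- Re s)" if "t \<in> {0..}" for n t
      unfolding norm_expzeta_term using that by (simp add: mult_left_le del: of_nat_Suc)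
    show "summable (\<lambda>n. real (Suc n) powr (- Re s))" using s by (intro summable_powr_Suc) auto
  qed
  moreover have "continuous_on {0..} (\<lambda>t. \<Sum>n<m. ?f n t)" for m
    by (intro continuous_intros)
  ultimately have "continuous_on {0..} (\<lambda>t. \<Sum>n. ?f n t)"
    by (intro uniform_limit_theorem[of _ _ sequentially]) auto
  then have "\<forall>x\<in>{0..}. ((\<lambda>t. expzeta s (of_real t)) \<longlongrightarrow> expzeta s (of_real x)) (at x within {0..})"
    unfolding continuous_on_def expzeta_def .
  then have "((\<lambda>t. expzeta s (of_real t)) \<longlongrightarrow> expzeta s (of_real 0)) (at 0 within {0..})"
    by (rule bspec) simp
  then have 1: "((\<lambda>t. expzeta s (of_real t)) \<longlongrightarrow> expzeta s (of_real 0)) (at_right 0)"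
    by (rule tendsto_within_subset) auto
  have "((\<lambda>t. complex_of_real t powr (s - 1)) \<longlongrightarrow> 0) (at_right 0)"
    using s by (intro tendsto_powr_complex_0[where b = "s - 1"] tendsto_eq_intros) auto
  from tendsto_diff[OF 1 tendsto_mult_left[OF this, of "Gamma (1 - s)"]]
  show ?thesis by (simp add: expzeta_limit_def expzeta_def del: of_nat_Suc)
qed

lemma expzeta_eq_expansion_0:
  assumes "Re s < 0" "t > 0"
  shows "expzeta s (of_real t) = expzeta_expansion 0 Z s t"
  using lipschitz_formula[OF assms] by (simp add: expzeta_expansion_def lipschitz_rem_def distrib_left)

lemma expzeta_eq_expansion_1:
  assumes s: "Re s < 1" and t: "t > 0"
  shows "expzeta s (of_real t) = expzeta_expansion 1 zeta_left s t"
proof -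
  have n: "1 - s \<notin> \<int>\<^sub>\<le>\<^sub>0" using s by (auto elim!: nonpos_Ints_cases simp: complex_eq_iff)
  have s': "Re s < real (Suc 0)" using s by simp
  have prev: "expzeta (s - 1) (of_real t) = expzeta_expansion 0 (\<lambda>_. 0) (s - 1) t" if "t > 0" for t
    using s that by (intro expzeta_eq_expansion_0) auto
  obtain c where "\<forall>t>0. expzeta s (of_real t) = Gamma (1 - s) * of_real t powr (s - 1) + c +
     (\<Sum>k<0. 0 * (- of_real t) ^ Suc k / fact (Suc k)) + expzeta_rem (Suc 0) s t"
    using expzeta_expansion_step[OF s' n prev] by (rule exE)
  note c = this[rule_format]
  have "c = zeta_left s" using c[of 1] unfolding zeta_left_def One_nat_def by (simp del: expzeta_rem.simps)
  then show ?thesis using c[OF t] unfolding expzeta_expansion_def One_nat_def by (simp del: expzeta_rem.simps)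
qed

lemma not_nonpos_Ints_shift: "1 - s \<notin> \<int>\<^sub>\<le>\<^sub>0 \<Longrightarrow> 1 - (s - 1) \<notin> \<int>\<^sub>\<le>\<^sub>0" for s :: complex
proof
  assume 1: "1 - s \<notin> \<int>\<^sub>\<le>\<^sub>0" "1 - (s - 1) \<in> \<int>\<^sub>\<le>\<^sub>0"
  then obtain n :: int where "1 - (s - 1) = of_int n" "n \<le> 0" by (elim nonpos_Ints_cases)
  then have "1 - s = of_int (n - 1)" "n - 1 \<le> 0" by (auto simp: algebra_simps)
  then show False using 1(1) nonpos_Ints_of_int by metis
qed

lemma
  assumes s: "Re s < 2" "1 - s \<notin> \<int>\<^sub>\<le>\<^sub>0"
  shows expzeta_eq_expansion_2: "t > 0 \<Longrightarrow> expzeta s (of_real t) = Gamma (1 - s) * of_real t powr (s - 1) + zeta_cont s +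
     (\<Sum>k<1. zeta_left (s - 1 - of_nat k) * (- of_real t) ^ Suc k / fact (Suc k)) + expzeta_rem 2 s t"
    and expzeta_limit_zeta_cont_2: "expzeta_limit s (zeta_cont s)"
proof -
  have s': "Re s < real (Suc 1)" using s by simp
  have prev: "expzeta (s - 1) (of_real t) = expzeta_expansion 1 zeta_left (s - 1) t" if "t > 0" for t
    using s that by (intro expzeta_eq_expansion_1) auto
  obtain c where "\<forall>t>0. expzeta s (of_real t) = Gamma (1 - s) * of_real t powr (s - 1) + c +
     (\<Sum>k<1. zeta_left (s - 1 - of_nat k) * (- of_real t) ^ Suc k / fact (Suc k)) + expzeta_rem (Suc 1) s t"
    using expzeta_expansion_step[OF s' s(2) prev] by (rule exE)
  note c = this[rule_format]
  have two: "Suc 1 = 2" by simp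
  have "c = zeta_cont s" using c[of 1] s unfolding zeta_cont_def two by (simp del: expzeta_rem.simps)
  note c = c[unfolded this]
  show "t > 0 \<Longrightarrow> expzeta s (of_real t) = Gamma (1 - s) * of_real t powr (s - 1) + zeta_cont s +
     (\<Sum>k<1. zeta_left (s - 1 - of_nat k) * (- of_real t) ^ Suc k / fact (Suc k)) + expzeta_rem 2 s t"
    using c[of t] unfolding two .
  show "expzeta_limit s (zeta_cont s)" by (rule expzeta_limit_step[OF c s'])
qed

text \<open>Both are the finite part of the same function at t = 0, read off from expansions of
  order 2 and 1.\<close>

lemma zeta_cont_eq_zeta_left:
  assumes "Re s < 1"
  shows "zeta_cont s = zeta_left s"
proof (rule expzeta_limit_unique)
  have n: "1 - s \<notin> \<int>\<^sub>\<le>\<^sub>0" using assms by (auto elim!: nonpos_Ints_cases simp: complex_eq_iff)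
  show "expzeta_limit s (zeta_cont s)" using assms n by (intro expzeta_limit_zeta_cont_2) auto
  show "expzeta_limit s (zeta_left s)"
  proof (rule expzeta_limit_expansion[of s 0])
    show "expzeta s (of_real t) = expzeta_expansion (Suc 0) zeta_left s t" if "t > 0" for t
      using expzeta_eq_expansion_1[OF assms that] by (simp only: One_nat_def)
  qed (use assms in simp)
qed

lemma zeta_cont_series:
  assumes "Re s > 1"
  shows "zeta_cont s = (\<Sum>n. of_nat (Suc n) powr (-s))"
proof (cases "Re s < 2")
  case True
  have "1 - s \<notin> \<int>\<^sub>\<le>\<^sub>0"
  proof
    assume "1 - s \<in> \<int>\<^sub>\<le>\<^sub>0"
    then obtain n :: int where "1 - s = of_int n" by (elim nonpos_Ints_cases)
    then have "Re s = 1 - of_int n" by (auto simp: complex_eq_iff)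
    then show False using assms True by auto
  qed
  then show ?thesis
    by (rule expzeta_limit_unique[OF expzeta_limit_zeta_cont_2[OF True] expzeta_limit_series[OF assms]])
qed (simp add: zeta_cont_def)

text \<open>Each step integrates the expansion at s - 1 and identifies the new constant by its
  finite part: for Re s < K the previous expansion at \<open>s\<close> supplies it, and otherwise Re
  s >= K >= 2 puts \<open>s\<close> in the range of the Dirichlet series.\<close>

theorem expzeta_eq_expansion:
  assumes "Re s < real K" "K \<ge> 2" "1 - s \<notin> \<int>\<^sub>\<le>\<^sub>0" "t > 0"
  shows "expzeta s (of_real t) = expzeta_expansion K zeta_cont s t"
  using assms(2,1,3,4)
proof (induction K arbitrary: s t rule: dec_induct)
  case base
  have "(\<Sum>k<2. zeta_cont (s - of_nat k) * (- of_real t) ^ k / fact k) = zeta_cont s - zeta_left (s - 1) * of_real t"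
    using base by (simp add: eval_nat_numeral zeta_cont_eq_zeta_left)
  then show ?case
    using expzeta_eq_expansion_2[of s t] base
    by (simp add: expzeta_expansion_def del: expzeta_rem.simps)
next
  case (step K)
  have prev: "expzeta (s - 1) (of_real t) = expzeta_expansion K zeta_cont (s - 1) t" if "t > 0" for t
    using step that by (intro step.IH not_nonpos_Ints_shift) auto
  obtain c where "\<forall>t>0. expzeta s (of_real t) = Gamma (1 - s) * of_real t powr (s - 1) + c +
     (\<Sum>k<K. zeta_cont (s - 1 - of_nat k) * (- of_real t) ^ Suc k / fact (Suc k)) + expzeta_rem (Suc K) s t"
    using expzeta_expansion_step[OF step.prems(1,2) prev] by (rule exE)
  note c = this[rule_format]
  have lim: "expzeta_limit s c" by (rule expzeta_limit_step[OF c step.prems(1)])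
  have "expzeta_limit s (zeta_cont s)"
  proof (cases "Re s < real K")
    case True
    obtain K' where K': "K = Suc K'" using step.hyps by (cases K) auto
    show ?thesis
    proof (rule expzeta_limit_expansion[of s K'])
      show "expzeta s (of_real t) = expzeta_expansion (Suc K') zeta_cont s t" if "t > 0" for t
        using step.IH[OF True step.prems(2) that] by (simp only: K')
    qed (use True K' in simp)
  next
    case False
    then have "Re s > 1" using step.hyps by simp
    then show ?thesis using expzeta_limit_series zeta_cont_series by simp
  qed
  with lim have cz: "c = zeta_cont s" by (rule expzeta_limit_unique)
  have "expzeta_expansion (Suc K) zeta_cont s t = Gamma (1 - s) * of_real t powr (s - 1) + zeta_cont s +
     (\<Sum>k<K. zeta_cont (s - 1 - of_nat k) * (- of_real t) ^ Suc k / fact (Suc k)) + expzeta_rem (Suc K) s t"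
    unfolding expzeta_expansion_def
    by (subst sum.lessThan_Suc_shift) (simp add: algebra_simps del: power_Suc expzeta_rem.simps)
  then show ?case using c[OF step.prems(3)] cz by simp
qed

section \<open>The entire function (s - 1) zeta(s), the functional equation, and zeta at the
  integers\<close>

lemma summable_zeta_series:
  "Re s > 1 \<Longrightarrow> summable (\<lambda>n. norm (of_nat (Suc n) powr (-s) :: complex))"
  by (simp add: norm_powr_real_powr summable_powr_Suc del: of_nat_Suc)

lemma holomorphic_on_zeta_series:
  "(\<lambda>s. \<Sum>n. of_nat (Suc n) powr (-s) :: complex) holomorphic_on {s. Re s > 1}"
proof (rule holomorphic_on_suminf_dominated)
  show "open {s. Re s > 1}" by (rule open_halfspace_Re_gt)
  fix z assume "z \<in> {s. Re s > 1}"
  then have z: "Re z > 1" by simp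
  show "\<exists>r>0. \<exists>g. summable g \<and> (\<forall>s\<in>ball z r \<inter> {s. Re s > 1}. \<forall>n. norm (of_nat (Suc n) powr (-s) :: complex) \<le> g n)"
  proof (intro exI[of _ "(Re z - 1) / 2"] conjI ballI allI exI[of _ "\<lambda>n. real (Suc n) powr (- ((Re z + 1) / 2))"])
    show "summable (\<lambda>n. real (Suc n) powr (- ((Re z + 1) / 2)))" using z by (intro summable_powr_Suc) auto
    fix s n assume "s \<in> ball z ((Re z - 1) / 2) \<inter> {s. Re s > 1}"
    then have "norm (z - s) < (Re z - 1) / 2" by (simp add: dist_norm)
    then have "\<bar>Re z - Re s\<bar> < (Re z - 1) / 2" using abs_Re_le_cmod[of "z - s"] by simp
    then have "- Re s \<le> - ((Re z + 1) / 2)" unfolding abs_less_iff by (simp add: field_simps)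
    then have "real (Suc n) powr (- Re s) \<le> real (Suc n) powr (- ((Re z + 1) / 2))" by (intro powr_mono) auto
    then show "norm (of_nat (Suc n) powr (-s) :: complex) \<le> real (Suc n) powr (- ((Re z + 1) / 2))"
      by (simp add: norm_powr_real_powr del: of_nat_Suc)
  qed (use z in simp)
qed (auto intro!: holomorphic_intros)

lemma zeta_num_eq:
  assumes "s \<noteq> 1"
  shows "zeta_num s = (s - 1) * zeta_cont s"
proof (cases "Re s < 2")
  case True
  have n: "1 - s \<notin> \<int>\<^sub>\<le>\<^sub>0"
  proof
    assume "1 - s \<in> \<int>\<^sub>\<le>\<^sub>0"
    then obtain n :: int where n: "1 - s = of_int n" "n \<le> 0" by (elim nonpos_Ints_cases)
    then have "Re s = 1 - of_int n" by (auto simp: complex_eq_iff)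
    then have "n > -1" using True by auto
    then have "n = 0" using n by auto
    then show False using n assms by simp
  qed
  have "Gamma (2 - s) = (1 - s) * Gamma (1 - s)"
    using Gamma_plus1[OF n] by (simp add: algebra_simps)
  then show ?thesis using True by (simp add: zeta_num_def zeta_cont_def algebra_simps del: expzeta_rem.simps)
qed (simp add: zeta_num_def zeta_cont_def)

lemma zeta_num_1 [simp]: "zeta_num 1 = 1"
  by (simp add: zeta_num_def del: expzeta_rem.simps)

lemma holomorphic_on_zeta_left: "zeta_left holomorphic_on {s. Re s < 1}"
  unfolding zeta_left_def
  by (intro holomorphic_intros holomorphic_on_subset[OF holomorphic_on_expzeta] Gamma_one_minus_holomorphic
       holomorphic_on_subset[OF holomorphic_on_expzeta_rem]) auto

text \<open>Two overlapping half-planes: the explicit formula is holomorphic to the left of 2 and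
  the Dirichlet series to the right of 1, and on the common strip both describe
  \<open>zeta_num\<close>.\<close>

lemma holomorphic_on_zeta_num: "zeta_num holomorphic_on UNIV"
proof -
  have sh: "(\<lambda>s. zeta_left (s - 1)) holomorphic_on {s. Re s < 2}"
  proof -
    have "(zeta_left \<circ> (\<lambda>s. s - 1)) holomorphic_on {s. Re s < 2}"
      by (rule holomorphic_on_compose_gen[OF _ holomorphic_on_zeta_left]) (auto intro!: holomorphic_intros)
    then show ?thesis by (simp add: o_def)
  qed
  have g: "(\<lambda>s::complex. Gamma (2 - s)) holomorphic_on {s. Re s < 2}"
    by (intro holomorphic_intros) (auto elim!: nonpos_Ints_cases simp: complex_eq_iff)
  have "(\<lambda>s. (s - 1) * (expzeta s 1 + zeta_left (s - 1) - expzeta_rem 2 s 1) + Gamma (2 - s)) holomorphic_on {s. Re s < 2}"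
    by (intro holomorphic_intros sh g holomorphic_on_subset[OF holomorphic_on_expzeta]
         holomorphic_on_subset[OF holomorphic_on_expzeta_rem]) auto
  then have 1: "zeta_num holomorphic_on {s. Re s < 2}"
    by (rule holomorphic_transform) (simp add: zeta_num_def)
  have "(\<lambda>s. (s - 1) * (\<Sum>n. of_nat (Suc n) powr (-s))) holomorphic_on {s. Re s > 1}"
    by (intro holomorphic_intros holomorphic_on_zeta_series)
  then have 2: "zeta_num holomorphic_on {s. Re s > 1}"
  proof (rule holomorphic_transform)
    fix s :: complex assume "s \<in> {s. Re s > 1}"
    then have "Re s > 1" "s \<noteq> 1" by auto
    then show "(s - 1) * (\<Sum>n. of_nat (Suc n) powr (-s)) = zeta_num s"
      by (simp add: zeta_num_eq zeta_cont_series)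
  qed
  have "zeta_num holomorphic_on {s. Re s < 2} \<union> {s. Re s > 1}"
    by (intro holomorphic_on_Un 1 2 open_halfspace_Re_lt open_halfspace_Re_gt)
  moreover have "{s. Re s < 2} \<union> {s. Re s > 1} = UNIV" by auto
  ultimately show ?thesis by simp
qed

text \<open>For Re s < 0 the finite part of L(s, t) is J_0(s, 0), a sum of powers of 2 pi i k over
  nonzero k, and this is a multiple of the Dirichlet series at 1 - s.\<close>

lemma zeta_functional_equation:
  assumes s: "Re s < 0"
  shows "zeta_cont s = 2 * Gamma (1 - s) * of_real (2 * pi) powr (s - 1) * cos (of_real pi * (s - 1) / 2) * zeta_cont (1 - s)"
proof -
  have n: "1 - s \<notin> \<int>\<^sub>\<le>\<^sub>0" using s by (auto elim!: nonpos_Ints_cases simp: complex_eq_iff)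
  have "(lipschitz_rem s \<longlongrightarrow> lipschitz_rem s 0) (at 0 within {0..})"
    using continuous_on_lipschitz_rem[OF s] by (auto simp: continuous_on_def)
  then have lim: "(lipschitz_rem s \<longlongrightarrow> lipschitz_rem s 0) (at_right 0)"
    by (rule tendsto_within_subset) auto
  have "expzeta_limit s (lipschitz_rem s 0)"
    unfolding expzeta_limit_def
  proof (rule Lim_transform_eventually[OF lim])
    show "\<forall>\<^sub>F t in at_right 0. lipschitz_rem s t = expzeta s (of_real t) - Gamma (1 - s) * of_real t powr (s - 1)"
      using eventually_at_right_less[of 0]
      by eventually_elim (simp add: lipschitz_formula[OF s] lipschitz_rem_def algebra_simps)
  qed
  moreover have "expzeta_limit s (zeta_cont s)" by (rule expzeta_limit_zeta_cont_2) (use s n in auto)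
  ultimately have "zeta_cont s = lipschitz_rem s 0" by (metis expzeta_limit_unique)
  also have "\<dots> = Gamma (1 - s) * lipschitz_sum s 0" by (simp only: lipschitz_rem_def)
  also have "lipschitz_sum s 0 = (\<Sum>k. of_real (2 * pi) powr (s - 1) * (2 * cos (of_real pi * (s - 1) / 2)) * of_nat (Suc k) powr (- (1 - s)))"
    unfolding lipschitz_sum_def
  proof (rule suminf_cong)
    fix k
    define x where "x = 2 * pi * real (Suc k)"
    have x: "x > 0" by (simp add: x_def)
    have c: "2 * of_real pi * \<i> * of_nat (Suc k) = of_real x * \<i>" by (simp add: x_def)
    \<comment> \<open>On the imaginary axis the principal arguments are pi/2 and - pi/2; the two
      resulting exponentials add up to twice a cosine.\<close>
    have L1: "Ln (of_real x * \<i>) = of_real (ln x) + \<i> * of_real pi / 2"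
      using x Ln_times_of_real[of x \<i>] by (simp add: Ln_of_real)
    have L2: "Ln (- (of_real x * \<i>)) = of_real (ln x) + - (\<i> * of_real pi / 2)"
      using x Ln_times_of_real[of x "- \<i>"] by (simp add: Ln_of_real)
    have p1: "(of_real x * \<i>) powr (s - 1) = of_real x powr (s - 1) * exp ((s - 1) * (\<i> * of_real pi / 2))"
      using x by (simp add: powr_def L1 Ln_of_real distrib_left exp_add)
    have p2: "(- (of_real x * \<i>)) powr (s - 1) = of_real x powr (s - 1) * exp ((s - 1) * (- (\<i> * of_real pi / 2)))"
      using x by (simp only: powr_def L2 distrib_left exp_add) (simp add: Ln_of_real)
    have "of_real x powr (s - 1) = of_real (2 * pi) powr (s - 1) * of_nat (Suc k) powr (s - 1)"
      unfolding x_def of_real_mult by (subst powr_times_real) auto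
    moreover have "exp ((s - 1) * (\<i> * of_real pi / 2)) + exp ((s - 1) * (- (\<i> * of_real pi / 2))) = 2 * cos (of_real pi * (s - 1) / 2)"
      by (simp add: cos_exp_eq mult_ac)
    ultimately show "(of_real 0 + 2 * of_real pi * \<i> * of_nat (Suc k)) powr (s - 1) +
        (of_real 0 - 2 * of_real pi * \<i> * of_nat (Suc k)) powr (s - 1) =
       of_real (2 * pi) powr (s - 1) * (2 * cos (of_real pi * (s - 1) / 2)) * of_nat (Suc k) powr (- (1 - s))"
      unfolding c using p1 p2 by (simp add: algebra_simps del: of_nat_Suc) (simp add: distrib_left[symmetric] del: of_nat_Suc)
  qed
  also have "\<dots> = of_real (2 * pi) powr (s - 1) * (2 * cos (of_real pi * (s - 1) / 2)) * (\<Sum>k. of_nat (Suc k) powr (- (1 - s)))"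
    using s by (intro suminf_mult summable_norm_cancel[OF summable_zeta_series]) auto
  also have "(\<Sum>k. of_nat (Suc k) powr (- (1 - s))) = zeta_cont (1 - s)"
    using s by (subst zeta_cont_series) auto
  finally show ?thesis by (simp add: mult_ac)
qed

lemma zeta_cont_real_nonzero:
  assumes "x > 1"
  shows "zeta_cont (of_real x) \<noteq> 0"
proof -
  have sm: "summable (\<lambda>n. real (Suc n) powr (-x))" using assms by (intro summable_powr_Suc) auto
  have "zeta_cont (of_real x) = (\<Sum>n. of_real (real (Suc n) powr (-x)))"
    using assms powr_of_real[of "real (Suc n)" "-x" for n] by (simp add: zeta_cont_series)
  also have "\<dots> = of_real (\<Sum>n. real (Suc n) powr (-x))" by (rule suminf_of_real[OF sm, symmetric])
  moreover have "(\<Sum>n. real (Suc n) powr (-x)) > 0" by (intro suminf_pos sm) auto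
  ultimately show ?thesis by simp
qed

text \<open>At s = - n with n odd the cosine in the functional equation is 1 or -1, and no other
  factor vanishes.\<close>

lemma zeta_cont_neg_odd_nonzero:
  assumes "odd n"
  shows "zeta_cont (- of_nat n) \<noteq> 0"
proof -
  obtain m where m: "n = 2 * m + 1" using assms by (elim oddE)
  have s: "Re (- of_nat n :: complex) < 0" using m by simp
  have 1: "zeta_cont (1 - (- of_nat n)) \<noteq> 0"
    using zeta_cont_real_nonzero[of "1 + real n"] m by simp
  have "of_real pi * (- of_nat n - 1) / 2 = (- of_real (pi * real (m + 1)) :: complex)"
    by (simp add: m field_simps)
  then have 2: "cos (of_real pi * (- of_nat n - 1) / 2) \<noteq> (0::complex)"
    by (simp only: cos_minus cos_of_real cos_npi2) simp
  have 3: "Gamma (1 - (- of_nat n)) \<noteq> (0::complex)"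
    using Gamma_fact[of n, where ?'a = complex] by simp
  show ?thesis using 1 2 3 by (subst zeta_functional_equation[OF s]) simp
qed

text \<open>In the functional equation the cosine has a simple zero at - 2 j while the remaining
  factor \<open>?g\<close> is nonzero there, so only one term of the product rule survives.\<close>

lemma zeta_neg_even:
  assumes "j \<ge> 1"
  obtains d where "d \<noteq> 0" "(zeta_cont has_field_derivative d) (at (- of_nat (2 * j)))" "zeta_cont (- of_nat (2 * j)) = 0"
proof -
  let ?a = "- of_nat (2 * j) :: complex"
  let ?g = "\<lambda>s. 2 * Gamma (1 - s) * of_real (2 * pi) powr (s - 1) * zeta_cont (1 - s)"
  have s: "Re ?a < 0" using assms by simp
  have op: "open {s. Re s < 0}" by (rule open_halfspace_Re_lt)
  have arg: "of_real pi * (?a - 1) / 2 = - (of_real (pi * real j + pi / 2))" by (simp add: field_simps)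
  have c0: "cos (of_real pi * (?a - 1) / 2) = 0"
    unfolding arg cos_minus cos_of_real by (simp add: cos_add)
  have s0: "sin (of_real pi * (?a - 1) / 2) \<noteq> 0"
    unfolding arg sin_minus sin_of_real by (simp add: sin_add cos_npi2)
  have hol: "(\<lambda>s. zeta_cont (1 - s)) holomorphic_on {s. Re s < 0}"
  proof -
    have "(\<lambda>s. zeta_num (1 - s) / (1 - s - 1)) holomorphic_on {s. Re s < 0}"
      by (intro holomorphic_intros holomorphic_on_compose_gen[OF _ holomorphic_on_zeta_num, unfolded o_def]) auto
    then show ?thesis
    proof (rule holomorphic_transform)
      fix s :: complex assume "s \<in> {s. Re s < 0}"
      then have "s \<noteq> 0" "1 - s \<noteq> 1" by (auto simp: complex_eq_iff)
      then show "zeta_num (1 - s) / (1 - s - 1) = zeta_cont (1 - s)" by (simp add: zeta_num_eq)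
    qed
  qed
  have "?g holomorphic_on {s. Re s < 0}"
    by (intro holomorphic_intros hol holomorphic_on_subset[OF Gamma_one_minus_holomorphic]) auto
  then obtain g' where g': "(?g has_field_derivative g') (at ?a)"
    using op s holomorphic_derivI by blast
  have "((\<lambda>s. ?g s * cos (of_real pi * (s - 1) / 2)) has_field_derivative
     (g' * cos (of_real pi * (?a - 1) / 2) + - sin (of_real pi * (?a - 1) / 2) * (of_real pi / 2) * ?g ?a)) (at ?a)"
    by (rule DERIV_mult[OF g']) (auto intro!: derivative_eq_intros)
  then have d: "((\<lambda>s. ?g s * cos (of_real pi * (s - 1) / 2)) has_field_derivative
     (- sin (of_real pi * (?a - 1) / 2) * (of_real pi / 2) * ?g ?a)) (at ?a)" by (simp only: c0) simp
  have "(zeta_cont has_field_derivative (- sin (of_real pi * (?a - 1) / 2) * (of_real pi / 2) * ?g ?a)) (at ?a)"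
    by (rule has_field_derivative_transform_within_open[OF d op])
       (use s zeta_functional_equation in \<open>auto simp: mult_ac\<close>)
  moreover have "?g ?a \<noteq> 0"
  proof -
    have "zeta_cont (1 - ?a) \<noteq> 0" using zeta_cont_real_nonzero[of "1 + real (2 * j)"] assms by simp
    moreover have "Gamma (1 - ?a) \<noteq> 0"
      using Gamma_fact[of "2 * j", where ?'a = complex] by simp
    ultimately show ?thesis by simp
  qed
  moreover have "zeta_cont ?a = 0"
    by (subst zeta_functional_equation[OF s]) (simp only: c0, simp)
  ultimately show thesis using s0 by (intro that) auto
qed

text \<open>The point 0 lies on the boundary of the range of the functional equation. As s tends to
  0 from the left, the zero of the cosine cancels the pole of zeta(1 - s), and the limit is
  nonzero.\<close>

lemma zeta_cont_0_nonzero: "zeta_cont 0 \<noteq> 0"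
proof -
  have c1: "isCont zeta_num z" for z
    using holomorphic_on_zeta_num holomorphic_on_imp_continuous_on continuous_on_eq_continuous_at open_UNIV by blast
  let ?l = "\<lambda>s. (s - 1) * (2 * Gamma (1 - s) * of_real (2 * pi) powr (s - 1) * (- (sin (of_real pi * s / 2) / s)) * zeta_num (1 - s))"
  have f: "filterlim (\<lambda>x. - complex_of_real x) (at 0) (at_right 0)"
    unfolding filterlim_at
  proof (intro conjI)
    show "\<forall>\<^sub>F x in at_right 0. - complex_of_real x \<in> UNIV \<and> - complex_of_real x \<noteq> 0"
      using eventually_at_right_less[of 0] by eventually_elim auto
    have "((\<lambda>x. - complex_of_real x) \<longlongrightarrow> - of_real 0) (at_right 0)" by (intro tendsto_intros)
    then show "((\<lambda>x. - complex_of_real x) \<longlongrightarrow> 0) (at_right 0)" by simp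
  qed
  have "((\<lambda>s. sin (of_real pi * s / 2)) has_field_derivative (of_real pi / 2)) (at (0::complex))"
    by (auto intro!: derivative_eq_intros)
  then have T1: "((\<lambda>s. sin (of_real pi * s / 2) / s) \<longlongrightarrow> complex_of_real pi / 2) (at 0)"
    by (simp add: has_field_derivative_iff)
  have T2: "((\<lambda>s. 2 * Gamma (1 - s) * of_real (2 * pi) powr (s - 1)) \<longlongrightarrow> 2 * Gamma (1 - 0) * complex_of_real (2 * pi) powr (0 - 1)) (at 0)"
    by (intro tendsto_intros) (auto simp: complex_nonpos_Reals_iff, use pi_gt_zero in linarith)
  have T3: "((\<lambda>s. zeta_num (1 - s)) \<longlongrightarrow> zeta_num (1 - 0)) (at 0)"
    by (intro isCont_tendsto_compose[OF c1] tendsto_intros)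
  have "(?l \<longlongrightarrow> (0 - 1) * (2 * Gamma (1 - 0) * of_real (2 * pi) powr (0 - 1) * (- (of_real pi / 2)) * zeta_num (1 - 0))) (at 0)"
    by (rule tendsto_mult[OF tendsto_diff[OF tendsto_ident_at tendsto_const]
          tendsto_mult[OF tendsto_mult[OF T2 tendsto_minus[OF T1]] T3]])
  then have "((\<lambda>x. ?l (- of_real x)) \<longlongrightarrow> (0 - 1) * (2 * Gamma (1 - 0) * of_real (2 * pi) powr (0 - 1) * (- (of_real pi / 2)) * zeta_num (1 - 0))) (at_right 0)"
    by (rule filterlim_compose[OF _ f])
  moreover have "\<forall>\<^sub>F x in at_right 0. ?l (- complex_of_real x) = zeta_num (- of_real x)"
    using eventually_at_right_less[of 0]
  proof eventually_elim
    case (elim x)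
    let ?s = "- complex_of_real x"
    have s: "Re ?s < 0" "?s \<noteq> 1" "1 - ?s \<noteq> 1" "?s \<noteq> 0" using elim by (auto simp: complex_eq_iff)
    have "cos (of_real pi * (?s - 1) / 2) = sin (of_real pi * ?s / 2)"
    proof -
      have e: "of_real pi * (?s - 1) / 2 = of_real pi * ?s / 2 - of_real (pi / 2)" by (simp add: field_simps)
      have h: "cos (of_real (pi / 2) :: complex) = 0" "sin (of_real (pi / 2) :: complex) = 1"
        by (simp_all only: cos_of_real sin_of_real cos_pi_half sin_pi_half of_real_0 of_real_1)
      show ?thesis unfolding e cos_diff h by simp
    qed
    moreover have "zeta_cont (1 - ?s) = - (zeta_num (1 - ?s) / ?s)" using zeta_num_eq[OF s(3)] s(4) by (simp add: field_simps)
    ultimately show ?case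
      unfolding zeta_num_eq[OF s(2)] zeta_functional_equation[OF s(1)] by simp
  qed
  ultimately have e1: "((\<lambda>x. zeta_num (- of_real x)) \<longlongrightarrow> (0 - 1) * (2 * Gamma (1 - 0) * of_real (2 * pi) powr (0 - 1) * (- (of_real pi / 2)) * zeta_num (1 - 0))) (at_right 0)"
    by (rule Lim_transform_eventually)
  have e2: "((\<lambda>x. zeta_num (- of_real x)) \<longlongrightarrow> zeta_num 0) (at_right 0)"
    using c1[of 0] filterlim_compose[OF _ f] unfolding isCont_def by blast
  have "zeta_num 0 = (0 - 1) * (2 * Gamma (1 - 0) * of_real (2 * pi) powr (0 - 1) * (- (of_real pi / 2)) * zeta_num (1 - 0))"
    by (rule tendsto_unique[OF trivial_limit_at_right_real e2 e1])
  then have "zeta_num 0 \<noteq> 0" by simp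
  then show ?thesis using zeta_num_eq[of 0] by auto
qed

section \<open>Dirichlet series\<close>

lemma bij_betw_Suc_atLeast_1: "bij_betw Suc UNIV {1..}"
  unfolding bij_betw_def by (auto simp: image_iff) (metis Suc_le_D One_nat_def)

lemma summable_on_from_1_iff:
  fixes f :: "nat \<Rightarrow> complex"
  shows "(\<lambda>n. norm (f n)) summable_on {1..} \<longleftrightarrow> summable (\<lambda>n. norm (f (Suc n)))"
  using summable_on_reindex_bij_betw[OF bij_betw_Suc_atLeast_1, of "\<lambda>n. norm (f n)"]
    summable_on_UNIV_nonneg_real_iff[of "\<lambda>n. norm (f (Suc n))"] by simp

lemma infsum_from_1:
  fixes f :: "nat \<Rightarrow> complex"
  assumes "summable (\<lambda>n. norm (f (Suc n)))"
  shows "(\<Sum>\<^sub>\<infinity>n\<in>{1..}. f n) = (\<Sum>n. f (Suc n))"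
proof -
  have "(\<Sum>\<^sub>\<infinity>n\<in>{1..}. f n) = (\<Sum>\<^sub>\<infinity>n. f (Suc n))"
    using infsum_reindex_bij_betw[OF bij_betw_Suc_atLeast_1, of f] by simp
  also have "\<dots> = (\<Sum>n. f (Suc n))"
    using norm_summable_imp_has_sum[OF assms summable_sums[OF summable_norm_cancel[OF assms]]] by (rule infsumI)
  finally show ?thesis .
qed

lemma norm_dirichlet_term:
  "norm (dirichlet_term \<alpha> s (Suc n)) = norm (\<alpha> (Suc n)) * real (Suc n) powr (- Re s)"
  by (simp add: dirichlet_term_def norm_mult norm_inverse norm_powr_real_powr powr_minus divide_inverse del: of_nat_Suc)

lemma summable_dirichlet_mono:
  assumes "summable (\<lambda>n. norm (\<alpha> (Suc n)) * real (Suc n) powr (- x))" "x \<le> y"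
  shows "summable (\<lambda>n. norm (\<alpha> (Suc n)) * real (Suc n) powr (- y))"
proof (rule summable_comparison_test'[OF assms(1), of 0])
  fix n
  have "real (Suc n) powr (- y) \<le> real (Suc n) powr (- x)" using assms(2) by (intro powr_mono) auto
  then show "norm (norm (\<alpha> (Suc n)) * real (Suc n) powr (- y)) \<le> norm (\<alpha> (Suc n)) * real (Suc n) powr (- x)"
    by (simp add: mult_left_mono del: of_nat_Suc)
qed

text \<open>The difference vanishes on a half-plane, hence everywhere once its singularities are
  removed. So \<open>F\<close> and \<open>G\<close> agree on a punctured neighbourhood of each
  point, and \<open>nicely_meromorphic_on\<close> determines the value at the point from
  there.\<close>

lemma dirichlet_continuation_unique:
  assumes F: "dirichlet_continuation \<alpha> F" and G: "dirichlet_continuation \<alpha> G"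
  shows "F = G"
proof
  fix z
  obtain a where a: "\<And>s. Re s > a \<Longrightarrow> F s = (\<Sum>\<^sub>\<infinity>n\<in>{1..}. dirichlet_term \<alpha> s n)"
    using F unfolding dirichlet_continuation_def by blast
  obtain b where b: "\<And>s. Re s > b \<Longrightarrow> G s = (\<Sum>\<^sub>\<infinity>n\<in>{1..}. dirichlet_term \<alpha> s n)"
    using G unfolding dirichlet_continuation_def by blast
  have nF: "F nicely_meromorphic_on UNIV" and nG: "G nicely_meromorphic_on UNIV"
    using F G unfolding dirichlet_continuation_def by auto
  define D where "D = (\<lambda>s. F s - G s)"
  have mD: "D meromorphic_on UNIV"
    using nF nG unfolding D_def nicely_meromorphic_on_def by (intro meromorphic_intros) auto
  have iso: "isolated_singularity_at D w" for w
    using mD meromorphic_on_isolated_singularity meromorphic_on_subset subset_UNIV by blast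
  define c where "c = complex_of_real (max a b + 1)"
  define H where "H = {s. Re s > max a b}"
  have H: "open H" unfolding H_def by (rule open_halfspace_Re_gt)
  have "c \<in> H" unfolding H_def c_def by (simp add: max_def)
  note H = H this
  have "\<forall>\<^sub>F s in at c. D s = 0"
    using eventually_at_in_open'[OF H] by eventually_elim (auto simp: H_def D_def a b)
  then have "\<forall>\<^sub>F s in at c. remove_sings D s = 0"
    using eventually_remove_sings_eq_at[OF iso[of c]] by eventually_elim simp
  then have fr: "\<exists>\<^sub>F s in at c. remove_sings D s = 0"
    by (rule eventually_frequently[rotated]) simp
  have zero: "remove_sings D w = 0" for w
    by (rule frequently_eq_meromorphic_imp_constant[OF fr remove_sings_nicely_meromorphic[OF mD]]) auto
  have ev: "\<forall>\<^sub>F w in at z. F w = G w"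
    using eventually_remove_sings_eq_at[OF iso[of z]]
  proof eventually_elim
    case (elim w)
    then have "D w = 0" using zero[of w] by simp
    then show ?case by (simp add: D_def)
  qed
  have pole: "is_pole F z \<longleftrightarrow> is_pole G z" by (rule is_pole_cong[OF ev refl])
  have cF: "is_pole F z \<and> F z = 0 \<or> F \<midarrow>z\<rightarrow> F z" and cG: "is_pole G z \<and> G z = 0 \<or> G \<midarrow>z\<rightarrow> G z"
    using nF nG unfolding nicely_meromorphic_on_def by auto
  show "F z = G z"
  proof (cases "is_pole F z")
    case True
    have "\<not> F \<midarrow>z\<rightarrow> F z" "\<not> G \<midarrow>z\<rightarrow> G z"
      using True pole not_tendsto_and_filterlim_at_infinity[of "at z"] unfolding is_pole_def by auto
    then show ?thesis using cF cG by simp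
  next
    case False
    then have "F \<midarrow>z\<rightarrow> F z" "G \<midarrow>z\<rightarrow> G z" using cF cG pole by auto
    moreover have "F \<midarrow>z\<rightarrow> G z" using calculation(2) ev by (simp add: tendsto_cong)
    ultimately show ?thesis by (metis LIM_unique)
  qed
qed

lemma Phi_eqI: "dirichlet_continuation \<alpha> F \<Longrightarrow> Phi \<alpha> = F"
  unfolding Phi_def using dirichlet_continuation_unique by blast

lemma dirichlet_continuation_zeta: "dirichlet_continuation (\<lambda>_. 1) (\<lambda>s. zeta_num s / (s - 1))"
  unfolding dirichlet_continuation_def
proof (intro conjI exI allI impI)
  let ?z = "\<lambda>s. zeta_num s / (s - 1)"
  have an: "zeta_num analytic_on A" for A
    using holomorphic_on_zeta_num analytic_on_open analytic_on_subset open_UNIV by blast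
  show "?z nicely_meromorphic_on UNIV"
    unfolding nicely_meromorphic_on_def
  proof (intro conjI ballI)
    show "?z meromorphic_on UNIV"
      by (intro meromorphic_intros analytic_on_imp_meromorphic_on an)
    fix s :: complex
    show "is_pole ?z s \<and> ?z s = 0 \<or> ?z \<midarrow>s\<rightarrow> ?z s"
    proof (cases "s = 1")
      case True
      have "zeta_num \<midarrow>1\<rightarrow> zeta_num 1"
        using analytic_at_imp_isCont[OF an[of "{1}"]] unfolding isCont_def .
      moreover have "filterlim (\<lambda>s. s - 1) (at 0) (at (1::complex))"
      proof (rule filterlim_atI)
        have "((\<lambda>s. s - 1) \<longlongrightarrow> 1 - 1) (at (1::complex))" by (intro tendsto_intros)
        then show "((\<lambda>s. s - 1) \<longlongrightarrow> 0) (at (1::complex))" by simp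
        show "\<forall>\<^sub>F s in at 1. s - 1 \<noteq> (0::complex)" by (simp add: eventually_at_filter)
      qed
      ultimately have "is_pole ?z 1"
        unfolding is_pole_def by (intro filterlim_divide_at_infinity) auto
      \<comment> \<open>Division by zero gives 0 at s = 1, which is the value prescribed at a
        pole.\<close>
      then show ?thesis using True by simp
    next
      case False
      have "isCont ?z s"
        using False analytic_at_imp_isCont[OF an] by (intro continuous_intros) auto
      then show ?thesis by (simp add: isCont_def)
    qed
  qed
  fix s :: complex assume s: "Re s > 1"
  have e: "dirichlet_term (\<lambda>_. 1) s (Suc n) = of_nat (Suc n) powr (-s)" for n
    by (simp add: dirichlet_term_def powr_minus divide_inverse del: of_nat_Suc)
  show sm: "(\<lambda>n. norm (dirichlet_term (\<lambda>_. 1) s n)) summable_on {1..}"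
    unfolding summable_on_from_1_iff e by (rule summable_zeta_series[OF s])
  have "s \<noteq> 1" using s by auto
  then show "zeta_num s / (s - 1) = (\<Sum>\<^sub>\<infinity>n\<in>{1..}. dirichlet_term (\<lambda>_. 1) s n)"
    using sm s unfolding summable_on_from_1_iff
    by (subst infsum_from_1) (auto simp: e zeta_num_eq zeta_cont_series)
qed

lemma zeta_eq: "zeta = (\<lambda>s. zeta_num s / (s - 1))"
  unfolding zeta_def by (rule Phi_eqI[OF dirichlet_continuation_zeta])

lemma zeta_eq_zeta_cont: "s \<noteq> 1 \<Longrightarrow> zeta s = zeta_cont s"
  by (simp add: zeta_eq zeta_num_eq)

section \<open>The Moebius function and Dirichlet convolution\<close>

lemma moebius_mult_prime:
  assumes p: "prime p" and d: "\<not> p dvd d" "d > 0"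
  shows "moebius (p * d) = - moebius d"
proof -
  have cop: "coprime p d" using p d(1) by (rule prime_imp_coprime)
  have sq: "squarefree (p * d) \<longleftrightarrow> squarefree d"
    using squarefree_mult_coprime[OF cop] squarefree_prime[OF p] squarefree_multD(2) by blast
  have "prime_factors (p * d) = insert p (prime_factors d)"
    using p d by (subst prime_factors_product) (auto simp: prime_prime_factors)
  moreover have "p \<notin> prime_factors d" using d by auto
  ultimately show ?thesis using sq by (simp add: moebius_def)
qed

lemma moebius_mult_prime_square:
  assumes "prime p" "p dvd d"
  shows "moebius (p * d) = 0"
proof -
  have "p ^ 2 dvd p * d" using assms(2) by (simp add: power2_eq_square mult_dvd_mono)
  then have "\<not> squarefree (p * d)" using assms(1) unfolding squarefree_def by (metis not_prime_unit)
  then show ?thesis by (simp add: moebius_def)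
qed

text \<open>For a prime p dividing n, each divisor d not divisible by p cancels against p d, and
  divisors divisible by p^2 contribute 0.\<close>

lemma sum_moebius:
  assumes n: "n > 0"
  shows "(\<Sum>d | d dvd n. moebius d) = (if n = 1 then 1 else 0)"
proof (cases "n = 1")
  case True
  then show ?thesis by (simp add: moebius_def)
next
  case False
  then obtain p where p: "prime p" "p dvd n" using prime_factor_nat by blast
  have p0: "p > 0" using p prime_gt_0_nat by blast
  have fin: "finite {d. d dvd n}" using n by simp
  let ?A = "{d. d dvd n \<and> p * d dvd n}"
  have split: "{d. d dvd n} = {d. d dvd n \<and> \<not> p dvd d} \<union> (\<lambda>d. p * d) ` ?A"
    by (auto simp: image_iff dvd_def intro: dvd_mult_right)
  have "(\<Sum>d | d dvd n. moebius d) = (\<Sum>d | d dvd n \<and> \<not> p dvd d. moebius d) + (\<Sum>d\<in>(\<lambda>d. p * d) ` ?A. moebius d)"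
    by (subst split, rule sum.union_disjoint) (use fin in \<open>auto intro: finite_subset[OF _ fin]\<close>)
  also have "(\<Sum>d\<in>(\<lambda>d. p * d) ` ?A. moebius d) = (\<Sum>d\<in>?A. moebius (p * d))"
    by (rule sum.reindex[unfolded o_def]) (use p0 in \<open>auto simp: inj_on_def\<close>)
  also have "\<dots> = (\<Sum>d | d dvd n \<and> \<not> p dvd d. - moebius d)"
  proof (rule sum.mono_neutral_cong_right)
    show "finite ?A" by (rule finite_subset[OF _ fin]) auto
    show "{d. d dvd n \<and> \<not> p dvd d} \<subseteq> ?A"
    proof safe
      fix d assume "d dvd n" "\<not> p dvd d"
      then show "p * d dvd n" using p divides_mult[of p n d] prime_imp_coprime by blast
    qed
    show "\<forall>d\<in>?A - {d. d dvd n \<and> \<not> p dvd d}. moebius (p * d) = 0"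
      using moebius_mult_prime_square[OF p(1)] by auto
    show "moebius (p * d) = - moebius d" if "d \<in> {d. d dvd n \<and> \<not> p dvd d}" for d
      using that n by (intro moebius_mult_prime p) (auto intro!: Nat.gr0I)
  qed
  finally show ?thesis using False by (simp add: sum_negf)
qed

text \<open>The product is a sum over pairs (d, e), regrouped by n = d e along the bijection (d, e)
  -> (n, d); absolute convergence over the pairs justifies the regrouping.\<close>

lemma dirichlet_product:
  fixes a b :: "nat \<Rightarrow> complex"
  assumes a: "summable (\<lambda>n. norm (dirichlet_term a s (Suc n)))" and b: "summable (\<lambda>n. norm (dirichlet_term b s (Suc n)))"
  defines "c \<equiv> \<lambda>n. \<Sum>d | d dvd n. a (n div d) * b d"
  shows "summable (\<lambda>n. norm (dirichlet_term c s (Suc n)))"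
    and "(\<Sum>n. dirichlet_term c s (Suc n)) = (\<Sum>n. dirichlet_term a s (Suc n)) * (\<Sum>n. dirichlet_term b s (Suc n))"
proof -
  let ?N = "{1::nat..}"
  let ?D = "\<lambda>n. {d. d dvd (n::nat)}"
  have a': "(\<lambda>n. norm (dirichlet_term a s n)) summable_on ?N" and b': "(\<lambda>n. norm (dirichlet_term b s n)) summable_on ?N"
    using a b by (simp_all only: summable_on_from_1_iff)
  define f where "f = (\<lambda>(d, e). dirichlet_term b s d * dirichlet_term a s e)"
  define g where "g = (\<lambda>(n, d). dirichlet_term b s d * dirichlet_term a s (n div d))"
  have f: "(\<lambda>x. norm (f x)) summable_on ?N \<times> ?N"
    unfolding Infinite_Sum.abs_summable_on_Sigma_iff
  proof (intro conjI ballI)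
    show "(\<lambda>e. norm (f (d, e))) summable_on ?N" for d
      using a' by (simp add: f_def norm_mult summable_on_cmult_right)
    have e: "(\<lambda>d. norm (infsum (\<lambda>e. norm (f (d, e))) ?N)) =
        (\<lambda>d. norm (dirichlet_term b s d) * norm (infsum (\<lambda>e. norm (dirichlet_term a s e)) ?N))"
      by (simp add: f_def norm_mult infsum_cmult_right' abs_mult)
    show "(\<lambda>d. norm (infsum (\<lambda>e. norm (f (d, e))) ?N)) summable_on ?N"
      unfolding e by (rule summable_on_cmult_left[OF b'])
  qed
  have bij: "bij_betw (\<lambda>(d, e). (d * e, d)) (?N \<times> ?N) (Sigma ?N ?D)"
    by (rule bij_betw_byWitness[where f' = "\<lambda>(n, d). (d, n div d)"])
       (auto simp: Suc_le_eq dvd_div_eq_0_iff intro!: Nat.gr0I elim!: dvdE)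
  have fg: "f x = g ((\<lambda>(d, e). (d * e, d)) x)" if "x \<in> ?N \<times> ?N" for x
    using that by (auto simp: f_def g_def)
  have gs: "(\<lambda>x. norm (g x)) summable_on Sigma ?N ?D"
    using f summable_on_reindex_bij_betw[OF bij, of "\<lambda>x. norm (g x)"] fg
    by (metis (mono_tags, lifting) summable_on_cong)
  have inner: "infsum (\<lambda>d. g (n, d)) (?D n) = dirichlet_term c s n" if n: "n \<in> ?N" for n
  proof -
    have fin: "finite (?D n)" using n by simp
    have t: "g (n, d) = (a (n div d) * b d) / of_nat n powr s" if d: "d dvd n" for d
    proof -
      obtain e where e: "n = d * e" using d by (elim dvdE)
      have pos: "d > 0" "e > 0" using n e by (auto intro!: Nat.gr0I)
      have "(of_nat d * of_nat e :: complex) powr s = of_nat d powr s * of_nat e powr s"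
        by (intro powr_times_real) auto
      then show ?thesis using pos by (simp add: g_def dirichlet_term_def e)
    qed
    have "infsum (\<lambda>d. g (n, d)) (?D n) = (\<Sum>d\<in>?D n. g (n, d))" using fin by simp
    also have "\<dots> = (\<Sum>d\<in>?D n. (a (n div d) * b d) / of_nat n powr s)" using t by (intro sum.cong) auto
    finally show ?thesis by (simp add: dirichlet_term_def c_def sum_divide_distrib)
  qed
  have "(\<lambda>n. norm (infsum (\<lambda>d. norm (g (n, d))) (?D n))) summable_on ?N"
    using gs unfolding Infinite_Sum.abs_summable_on_Sigma_iff by blast
  then have "(\<lambda>n. norm (dirichlet_term c s n)) summable_on ?N"
  proof (rule Infinite_Sum.abs_summable_on_comparison_test)
    fix n assume n: "n \<in> ?N"
    have "norm (dirichlet_term c s n) \<le> infsum (\<lambda>d. norm (g (n, d))) (?D n)"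
      unfolding inner[OF n, symmetric] using n by (intro norm_infsum_bound) (simp add: summable_on_finite)
    then show "norm (dirichlet_term c s n) \<le> norm (infsum (\<lambda>d. norm (g (n, d))) (?D n))" by simp
  qed
  then show c: "summable (\<lambda>n. norm (dirichlet_term c s (Suc n)))" by (simp only: summable_on_from_1_iff)
  have "infsum (dirichlet_term c s) ?N = infsum (\<lambda>n. infsum (\<lambda>d. g (n, d)) (?D n)) ?N"
    using inner by (intro infsum_cong) auto
  also have "\<dots> = infsum g (Sigma ?N ?D)"
    by (rule infsum_Sigma_banach[OF abs_summable_summable[OF gs]])
  also have "\<dots> = infsum f (?N \<times> ?N)"
    using infsum_reindex_bij_betw[OF bij, of g] fg by (metis (mono_tags, lifting) infsum_cong)
  also have "\<dots> = infsum (\<lambda>d. infsum (\<lambda>e. f (d, e)) ?N) ?N"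
    by (rule infsum_Sigma_banach[OF abs_summable_summable[OF f], symmetric])
  also have "\<dots> = infsum (dirichlet_term b s) ?N * infsum (dirichlet_term a s) ?N"
    by (simp add: f_def infsum_cmult_right' infsum_cmult_left')
  finally show "(\<Sum>n. dirichlet_term c s (Suc n)) = (\<Sum>n. dirichlet_term a s (Suc n)) * (\<Sum>n. dirichlet_term b s (Suc n))"
    unfolding infsum_from_1[OF a] infsum_from_1[OF b] infsum_from_1[OF c] by (simp only: mult.commute)
qed

lemma summable_moebius:
  assumes "Re s > 1"
  shows "summable (\<lambda>n. norm (dirichlet_term (\<lambda>n. of_int (moebius n)) s (Suc n)))"
proof (rule summable_comparison_test'[of "\<lambda>n. real (Suc n) powr (- Re s)" 0])
  show "summable (\<lambda>n. real (Suc n) powr (- Re s))" using assms by (intro summable_powr_Suc) auto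
  fix n
  have "\<bar>real_of_int (moebius (Suc n))\<bar> \<le> 1" by (auto simp: moebius_def power_abs)
  then show "norm (norm (dirichlet_term (\<lambda>n. of_int (moebius n)) s (Suc n))) \<le> real (Suc n) powr (- Re s)"
    unfolding norm_dirichlet_term by (simp add: mult_left_le_one_le del: of_nat_Suc)
qed

lemma zeta_series_moebius:
  assumes s: "Re s > 1"
  shows "zeta s * (\<Sum>n. dirichlet_term (\<lambda>n. of_int (moebius n)) s (Suc n)) = 1"
proof -
  have e: "dirichlet_term (\<lambda>_. 1) s (Suc n) = of_nat (Suc n) powr (-s)" for n
    by (simp add: dirichlet_term_def powr_minus divide_inverse del: of_nat_Suc)
  have s1: "s \<noteq> 1" using s by auto
  have "(\<lambda>n. \<Sum>d | d dvd Suc n. 1 * of_int (moebius d) :: complex) = (\<lambda>n. of_int (if n = 0 then 1 else 0))"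
  proof
    fix n
    show "(\<Sum>d | d dvd Suc n. 1 * of_int (moebius d) :: complex) = of_int (if n = 0 then 1 else 0)"
      using sum_moebius[of "Suc n"] by (simp flip: of_int_sum)
  qed
  then have "dirichlet_term (\<lambda>n. \<Sum>d | d dvd n. 1 * of_int (moebius d)) s (Suc n) = (if n = 0 then 1 else 0)" for n
    unfolding dirichlet_term_def by (metis (mono_tags, lifting) One_nat_def div_by_1 divide_eq_0_iff of_int_0 of_int_1 of_nat_1 powr_one_eq_one)
  then have "(\<Sum>n. dirichlet_term (\<lambda>n. \<Sum>d | d dvd n. 1 * of_int (moebius d)) s (Suc n)) = (\<Sum>n. if n = 0 then 1 else 0)"
    by simp
  also have "\<dots> = (1::complex)" using suminf_finite[of "{0::nat}" "\<lambda>n. if n = 0 then 1 else 0 :: complex"] by simp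
  finally have "1 = (\<Sum>n. dirichlet_term (\<lambda>_. 1) s (Suc n)) * (\<Sum>n. dirichlet_term (\<lambda>n. of_int (moebius n)) s (Suc n))"
    using dirichlet_product(2)[of "\<lambda>_. 1" s "\<lambda>n. of_int (moebius n)"] summable_moebius[OF s] summable_zeta_series[OF s]
    by (simp only: e)
  then show ?thesis by (simp only: e zeta_eq_zeta_cont[OF s1] zeta_cont_series[OF s])
qed

section \<open>The quotient Phi / zeta and its poles at the integers\<close>

definition quot_series :: "(nat \<Rightarrow> complex) \<Rightarrow> complex \<Rightarrow> complex" where
  "quot_series \<alpha> s = Phi \<alpha> s / zeta s"

lemma dirichlet_classE:
  assumes "\<alpha> \<in> dirichlet_class"
  obtains \<delta> where "\<delta> > 0" "dirichlet_continuation \<alpha> (Phi \<alpha>)" "Phi \<alpha> holomorphic_on UNIV - {of_real \<delta>}"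
    "is_pole (Phi \<alpha>) (of_real \<delta>) \<Longrightarrow> zorder (Phi \<alpha>) (of_real \<delta>) = -1"
proof -
  obtain \<delta> F where "\<delta> > 0" "dirichlet_continuation \<alpha> F" "Phi \<alpha> holomorphic_on UNIV - {of_real \<delta>}"
    "is_pole (Phi \<alpha>) (of_real \<delta>) \<longrightarrow> zorder (Phi \<alpha>) (of_real \<delta>) = -1"
    using assms unfolding dirichlet_class_def by blast
  with Phi_eqI that show thesis by metis
qed

text \<open>At a simple pole (s - delta) Phi(s) has a limit, and without a pole Phi itself has one
  by the convention on values; either way the singularity of the product is removable.\<close>

lemma Phi_simple_pole_factor:
  assumes "\<alpha> \<in> dirichlet_class"
  obtains \<delta> X where "\<delta> > 0" "X holomorphic_on UNIV" "\<And>s. s \<noteq> of_real \<delta> \<Longrightarrow> Phi \<alpha> s = X s / (s - of_real \<delta>)"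
proof -
  obtain \<delta> where d: "\<delta> > 0" "dirichlet_continuation \<alpha> (Phi \<alpha>)" "Phi \<alpha> holomorphic_on UNIV - {of_real \<delta>}"
    "is_pole (Phi \<alpha>) (of_real \<delta>) \<Longrightarrow> zorder (Phi \<alpha>) (of_real \<delta>) = -1"
    using dirichlet_classE[OF assms] by blast
  define c where "c = complex_of_real \<delta>"
  let ?g = "\<lambda>s. (s - c) * Phi \<alpha> s"
  have nm: "Phi \<alpha> nicely_meromorphic_on UNIV" using d(2) unfolding dirichlet_continuation_def by blast
  have g0: "(\<lambda>s. (s - c) * ?g s) \<midarrow>c\<rightarrow> 0"
  proof (cases "is_pole (Phi \<alpha>) c")
    case False
    then have "Phi \<alpha> \<midarrow>c\<rightarrow> Phi \<alpha> c" using nm unfolding nicely_meromorphic_on_def by auto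
    then have "(\<lambda>s. (s - c) * ?g s) \<midarrow>c\<rightarrow> (c - c) * ((c - c) * Phi \<alpha> c)" by (intro tendsto_intros)
    then show ?thesis by simp
  next
    case True
    have mero: "Phi \<alpha> meromorphic_on {c}"
      using nm meromorphic_on_subset unfolding nicely_meromorphic_on_def by blast
    have "\<exists>\<^sub>F w in at c. Phi \<alpha> w \<noteq> 0"
      using non_zero_neighbour_pole[OF True] by (intro eventually_frequently) auto
    then obtain r where r: "r > 0" "zor_poly (Phi \<alpha>) c holomorphic_on cball c r"
      "\<And>w. w \<in> cball c r - {c} \<Longrightarrow> Phi \<alpha> w = zor_poly (Phi \<alpha>) c w * (w - c) powi zorder (Phi \<alpha>) c"
      using zorder_exist[of "Phi \<alpha>" c] meromorphic_on_isolated_singularity[OF mero] meromorphic_on_not_essential[OF mero]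
      by (metis singletonI)
    have z: "zorder (Phi \<alpha>) c = -1" using d(4) True by (simp add: c_def)
    have "isCont (zor_poly (Phi \<alpha>) c) c"
      using holomorphic_on_imp_continuous_on[OF r(2)] r(1) continuous_on_interior by fastforce
    then have "(\<lambda>s. (s - c) * zor_poly (Phi \<alpha>) c s) \<midarrow>c\<rightarrow> (c - c) * zor_poly (Phi \<alpha>) c c"
      unfolding isCont_def by (intro tendsto_intros)
    moreover have "\<forall>\<^sub>F s in at c. (s - c) * zor_poly (Phi \<alpha>) c s = (s - c) * ?g s"
      using eventually_at_in_open[of "ball c r" c] r(1)
      by (auto elim!: eventually_mono simp: r(3) z power_int_minus)
    ultimately show ?thesis by (simp add: tendsto_cong)
  qed
  have "?g holomorphic_on UNIV - {c}" using d(3) by (intro holomorphic_intros) (auto simp: c_def)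
  then obtain X where X: "X holomorphic_on UNIV" "\<And>s. s \<in> UNIV - {c} \<Longrightarrow> X s = ?g s"
    using holomorphic_on_extend_lim[of ?g UNIV c] g0 by auto
  show thesis
    by (rule that[OF d(1) X(1)]) (use X(2) in \<open>auto simp: c_def\<close>)
qed

text \<open>Phi = X / (s - delta) and zeta = \<open>zeta_num\<close> / (s - 1) give an entire
  numerator and denominator; the witness to the right of 1 and of delta lies where zeta is
  nonzero.\<close>

lemma quot_series_eq_quotient:
  assumes "\<alpha> \<in> dirichlet_class"
  obtains N D x0 where "N holomorphic_on UNIV" "D holomorphic_on UNIV" "D x0 \<noteq> 0"
    "\<And>s. D s \<noteq> 0 \<Longrightarrow> quot_series \<alpha> s = N s / D s"
proof -
  obtain \<delta> X where X: "\<delta> > 0" "X holomorphic_on UNIV" "\<And>s. s \<noteq> of_real \<delta> \<Longrightarrow> Phi \<alpha> s = X s / (s - of_real \<delta>)"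
    using Phi_simple_pole_factor[OF assms] by blast
  show thesis
  proof (rule that[of "\<lambda>s. X s * (s - 1)" "\<lambda>s. (s - of_real \<delta>) * zeta_num s" "of_real (max 1 \<delta> + 1)"])
    define x where "x = max 1 \<delta> + 1"
    have x: "x > 1" "x > \<delta>" by (auto simp: x_def)
    then have "of_real x \<noteq> (1::complex)" "of_real x \<noteq> complex_of_real \<delta>" by simp_all
    then show "(of_real (max 1 \<delta> + 1) - of_real \<delta>) * zeta_num (of_real (max 1 \<delta> + 1)) \<noteq> 0"
      using zeta_num_eq[of "of_real x"] zeta_cont_real_nonzero[OF x(1)] unfolding x_def[symmetric] by simp
    show "quot_series \<alpha> s = X s * (s - 1) / ((s - of_real \<delta>) * zeta_num s)" if "(s - of_real \<delta>) * zeta_num s \<noteq> 0" for s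
      using that X(3)[of s] by (simp add: quot_series_def zeta_eq)
  qed (auto intro!: holomorphic_intros X holomorphic_on_zeta_num)
qed

text \<open>For j >= 1 zeta has no zero, so only the pole of Phi at delta can occur. For j <= 0 Phi
  is regular because delta > 0, and zeta vanishes only at negative even j, to first order, which
  yields the residue Phi(j) / zeta'(j). Where there is no such pole, \<open>\<Psi>\<close> carries
  an explicit factor z and vanishes at 0.\<close>

lemma quot_series_at_int:
  fixes j :: int
  assumes \<alpha>: "\<alpha> \<in> dirichlet_class"
  obtains \<Psi> r where "r > 0" "\<Psi> holomorphic_on ball 0 r"
    "\<And>z. z \<in> ball 0 r \<Longrightarrow> z \<noteq> 0 \<Longrightarrow> quot_series \<alpha> (of_int j + z) = \<Psi> z / z"
    "j \<le> 0 \<Longrightarrow> \<Psi> 0 = (if j < 0 \<and> even j then D_coeff \<alpha> (nat (-j)) else 0)"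
proof -
  obtain \<delta> X where X: "\<delta> > 0" "X holomorphic_on UNIV" "\<And>s. s \<noteq> of_real \<delta> \<Longrightarrow> Phi \<alpha> s = X s / (s - of_real \<delta>)"
    using Phi_simple_pole_factor[OF \<alpha>] by blast
  have sh: "(\<lambda>z. f (of_int j + z)) holomorphic_on A" if "f holomorphic_on UNIV" for f :: "complex \<Rightarrow> complex" and A
  proof -
    have "(\<lambda>z. of_int j + z) holomorphic_on A" by (intro holomorphic_intros)
    from holomorphic_on_compose_gen[OF this that] show ?thesis by (simp add: o_def)
  qed
  have near: "\<exists>r>0. \<forall>z\<in>ball 0 r. h (of_int j + z) \<noteq> 0" if hol: "h holomorphic_on UNIV" and nz: "h (of_int j) \<noteq> 0" for h :: "complex \<Rightarrow> complex"
  proof -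
    have cont: "isCont h (of_int j)"
      using hol holomorphic_on_imp_continuous_on continuous_on_eq_continuous_at open_UNIV by blast
    obtain r where "r > 0" "\<And>y. dist (of_int j) y < r \<Longrightarrow> h y \<noteq> 0"
      using continuous_at_avoid[OF cont nz] by blast
    then show ?thesis by (intro exI[of _ r]) (auto simp: dist_norm)
  qed
  show thesis
  proof (cases "j \<ge> 1")
    case True
    have nz: "zeta_num (of_int j) \<noteq> 0"
    proof (cases "j = 1")
      case False
      then show ?thesis
        using True zeta_num_eq[of "of_int j"] zeta_cont_real_nonzero[of "of_int j"] by auto
    qed simp
    obtain r where r: "r > 0" "\<And>z. z \<in> ball 0 r \<Longrightarrow> zeta_num (of_int j + z) \<noteq> 0"
      using near[OF holomorphic_on_zeta_num nz] by blast
    show thesis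
    proof (cases "of_real \<delta> = (of_int j :: complex)")
      case eq: True
      show thesis
      proof (rule that[of r "\<lambda>z. X (of_int j + z) * (of_int j + z - 1) / zeta_num (of_int j + z)"])
        show "(\<lambda>z. X (of_int j + z) * (of_int j + z - 1) / zeta_num (of_int j + z)) holomorphic_on ball 0 r"
          using r(2) by (intro holomorphic_intros sh X(2) holomorphic_on_zeta_num) auto
        show "quot_series \<alpha> (of_int j + z) = X (of_int j + z) * (of_int j + z - 1) / zeta_num (of_int j + z) / z"
          if "z \<in> ball 0 r" "z \<noteq> 0" for z
          using that X(3)[of "of_int j + z"] r(2) by (simp add: quot_series_def zeta_eq eq)
      qed (use r True in auto)
    next
      case ne: False
      have "(\<lambda>s. s - complex_of_real \<delta>) holomorphic_on UNIV" by (intro holomorphic_intros)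
      then obtain r' where r': "r' > 0" "\<And>z. z \<in> ball 0 r' \<Longrightarrow> of_int j + z - complex_of_real \<delta> \<noteq> 0"
        using near[of "\<lambda>s. s - complex_of_real \<delta>"] ne by auto
      let ?P = "\<lambda>z. z * (X (of_int j + z) * (of_int j + z - 1) / ((of_int j + z - complex_of_real \<delta>) * zeta_num (of_int j + z)))"
      show thesis
      proof (rule that[of "min r r'" ?P])
        show "?P holomorphic_on ball 0 (min r r')"
          using r(2) r'(2) by (intro holomorphic_intros sh X(2) holomorphic_on_zeta_num) auto
        show "quot_series \<alpha> (of_int j + z) = ?P z / z" if "z \<in> ball 0 (min r r')" "z \<noteq> 0" for z
          using that X(3)[of "of_int j + z"] r(2)[of z] r'(2)[of z] by (simp add: quot_series_def zeta_eq)
      qed (use r r' True in auto)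
    qed
  next
    case False
    then have j0: "j \<le> 0" by simp
    have dn: "of_int j + z - complex_of_real \<delta> \<noteq> 0" if "norm z < \<delta>" for z
    proof
      assume "of_int j + z - complex_of_real \<delta> = 0"
      then have "Re z = \<delta> - of_int j" by (simp add: complex_eq_iff)
      then show False using abs_Re_le_cmod[of z] that j0 by linarith
    qed
    have j1: "of_int j \<noteq> (1::complex)" using j0 by auto
    have PhiX: "Phi \<alpha> (of_int j + z) = X (of_int j + z) / (of_int j + z - of_real \<delta>)" if "norm z < \<delta>" for z
      by (rule X(3)) (use dn[OF that] in auto)
    show thesis
    proof (cases "j < 0 \<and> even j")
      case neg_even: False
      have "zeta_cont (of_int j) \<noteq> 0"
      proof (cases "j = 0")
        case False
        then have o: "odd (nat (-j))" "of_int j = - (of_nat (nat (-j)) :: complex)"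
          using neg_even j0 by (auto simp: even_nat_iff)
        show ?thesis unfolding o(2) by (rule zeta_cont_neg_odd_nonzero[OF o(1)])
      qed (simp add: zeta_cont_0_nonzero)
      then have nz: "zeta_num (of_int j) \<noteq> 0" using zeta_num_eq[OF j1] j1 by simp
      obtain r where r: "r > 0" "\<And>z. z \<in> ball 0 r \<Longrightarrow> zeta_num (of_int j + z) \<noteq> 0"
        using near[OF holomorphic_on_zeta_num nz] by blast
      let ?P = "\<lambda>z. z * (X (of_int j + z) * (of_int j + z - 1) / ((of_int j + z - complex_of_real \<delta>) * zeta_num (of_int j + z)))"
      show thesis
      proof (rule that[of "min r \<delta>" ?P])
        show "?P holomorphic_on ball 0 (min r \<delta>)"
          using r(2) dn by (intro holomorphic_intros sh X(2) holomorphic_on_zeta_num) auto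
        show "quot_series \<alpha> (of_int j + z) = ?P z / z" if "z \<in> ball 0 (min r \<delta>)" "z \<noteq> 0" for z
          using that PhiX[of z] by (simp add: quot_series_def zeta_eq)
      qed (use r X(1) neg_even in auto)
    next
      case neg_even: True
      define k where "k = nat (-j) div 2"
      have k: "k \<ge> 1" "of_int j = - (of_nat (2 * k) :: complex)" "nat (-j) = 2 * k"
        using neg_even by (auto simp: k_def even_nat_iff)
      obtain d where d: "d \<noteq> 0" "(zeta_cont has_field_derivative d) (at (of_int j))" "zeta_cont (of_int j) = 0"
        using zeta_neg_even[OF k(1)] unfolding k(2) by blast
      have zc0: "zeta_num (of_int j) = 0" using zeta_num_eq[OF j1] d(3) by simp
      have zd: "(zeta has_field_derivative d) (at (of_int j))"
      proof (rule has_field_derivative_transform_within_open[OF d(2), of "- {1}"])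
        show "zeta_cont s = zeta s" if "s \<in> - {1}" for s using that zeta_eq_zeta_cont by auto
      qed (use j1 in auto)
      \<comment> \<open>The simple zero of \<open>zeta_num\<close> at j is divided out; the
        derivative is the value that makes the quotient holomorphic at z = 0.\<close>
      define q where "q z = (if z = 0 then deriv zeta_num (of_int j) else zeta_num (of_int j + z) / z)" for z
      have nd: "(zeta_num has_field_derivative (of_int j - 1) * d) (at (of_int j))"
      proof -
        have "((\<lambda>s. (s - 1) * zeta s) has_field_derivative (1 * zeta (of_int j) + d * (of_int j - 1))) (at (of_int j))"
          by (rule DERIV_mult[OF _ zd]) (auto intro!: derivative_eq_intros)
        then have "((\<lambda>s. (s - 1) * zeta s) has_field_derivative (of_int j - 1) * d) (at (of_int j))"
          using zc0 by (simp add: zeta_eq mult.commute)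
        then show ?thesis
          by (rule has_field_derivative_transform_within_open[of _ _ _ "- {1}"]) (use j1 in \<open>auto simp: zeta_eq\<close>)
      qed
      have q0: "q 0 = (of_int j - 1) * d" using nd by (simp add: q_def DERIV_imp_deriv)
      have qh: "q holomorphic_on UNIV"
      proof -
        have "(\<lambda>z. if z = 0 then deriv (\<lambda>z. zeta_num (of_int j + z)) 0 else ((\<lambda>z. zeta_num (of_int j + z)) z - zeta_num (of_int j + 0)) / (z - 0)) holomorphic_on UNIV"
          by (rule pole_lemma_open[OF sh[OF holomorphic_on_zeta_num] open_UNIV])
        moreover have "((\<lambda>z. zeta_num (of_int j + z)) has_field_derivative (of_int j - 1) * d) (at 0)"
          using nd DERIV_shift[of zeta_num "(of_int j - 1) * d" 0 "of_int j"] by (simp add: add.commute)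
        then have "deriv (\<lambda>z. zeta_num (of_int j + z)) 0 = deriv zeta_num (of_int j)"
          using nd by (simp add: DERIV_imp_deriv)
        ultimately show ?thesis unfolding q_def using zc0 by (simp cong: if_cong)
      qed
      have "q 0 \<noteq> 0" using q0 d(1) j1 by simp
      moreover have "isCont q 0"
        using qh holomorphic_on_imp_continuous_on continuous_on_eq_continuous_at open_UNIV by blast
      ultimately obtain r where r: "r > 0" "\<And>y. dist 0 y < r \<Longrightarrow> q y \<noteq> 0"
        using continuous_at_avoid[of 0 q 0] by metis
      let ?P = "\<lambda>z. X (of_int j + z) * (of_int j + z - 1) / ((of_int j + z - complex_of_real \<delta>) * q z)"
      show thesis
      proof (rule that[of "min r \<delta>" ?P])
        show "?P holomorphic_on ball 0 (min r \<delta>)"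
          using r(2) dn by (intro holomorphic_intros sh X(2) holomorphic_on_subset[OF qh]) auto
        show "quot_series \<alpha> (of_int j + z) = ?P z / z" if "z \<in> ball 0 (min r \<delta>)" "z \<noteq> 0" for z
          using that PhiX[of z] by (simp add: quot_series_def zeta_eq q_def)
        have "D_coeff \<alpha> (nat (-j)) = Phi \<alpha> (of_int j) / d"
          unfolding D_coeff_def k(3) using DERIV_imp_deriv[OF zd] by (simp add: k(2))
        also have "\<dots> = ?P 0" using PhiX[of 0] X(1) j1 by (simp add: q0)
        finally show "?P 0 = (if j < 0 \<and> even j then D_coeff \<alpha> (nat (-j)) else 0)" using neg_even by simp
      qed (use r X(1) in auto)
    qed
  qed
qed

text \<open>The threshold exceeds 1 and the bound beyond which the series for Phi converges, so the
  Dirichlet product with the Moebius series applies; taking it at least 2 provides room for later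
  estimates.\<close>

lemma alpha_tilde_series:
  assumes "\<alpha> \<in> dirichlet_class"
  obtains \<sigma> where "\<sigma> \<ge> 2"
    "summable (\<lambda>n. norm (alpha_tilde \<alpha> (Suc n)) * real (Suc n) powr (- \<sigma>))"
    "\<And>s. Re s \<ge> \<sigma> \<Longrightarrow> (\<Sum>n. dirichlet_term (alpha_tilde \<alpha>) s (Suc n)) = quot_series \<alpha> s"
proof -
  obtain \<delta> where d: "dirichlet_continuation \<alpha> (Phi \<alpha>)" using dirichlet_classE[OF assms] by metis
  then obtain \<sigma>0 where s0: "\<And>s. Re s > \<sigma>0 \<Longrightarrow> (\<lambda>n. norm (dirichlet_term \<alpha> s n)) summable_on {1..}"
     "\<And>s. Re s > \<sigma>0 \<Longrightarrow> Phi \<alpha> s = (\<Sum>\<^sub>\<infinity>n\<in>{1..}. dirichlet_term \<alpha> s n)"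
    unfolding dirichlet_continuation_def by blast
  define \<sigma> where "\<sigma> = max 2 (\<sigma>0 + 1)"
  have at: "alpha_tilde \<alpha> = (\<lambda>n. \<Sum>d | d dvd n. \<alpha> (n div d) * of_int (moebius d))"
    by (rule ext) (simp add: alpha_tilde_def)
  have conv: "summable (\<lambda>n. norm (dirichlet_term (alpha_tilde \<alpha>) s (Suc n)))"
    "(\<Sum>n. dirichlet_term (alpha_tilde \<alpha>) s (Suc n)) = quot_series \<alpha> s" if s: "Re s \<ge> \<sigma>" for s
  proof -
    have s1: "Re s > 1" "Re s > \<sigma>0" using s by (auto simp: \<sigma>_def)
    have a: "summable (\<lambda>n. norm (dirichlet_term \<alpha> s (Suc n)))" using s0(1)[OF s1(2)] by (simp only: summable_on_from_1_iff)
    show "summable (\<lambda>n. norm (dirichlet_term (alpha_tilde \<alpha>) s (Suc n)))"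
      unfolding at by (rule dirichlet_product(1)[OF a summable_moebius[OF s1(1)]])
    have "(\<Sum>n. dirichlet_term (alpha_tilde \<alpha>) s (Suc n)) = Phi \<alpha> s * (\<Sum>n. dirichlet_term (\<lambda>n. of_int (moebius n)) s (Suc n))"
      unfolding at dirichlet_product(2)[OF a summable_moebius[OF s1(1)]] using s0(2)[OF s1(2)] infsum_from_1[OF a] by simp
    also have "\<dots> = quot_series \<alpha> s"
      using zeta_series_moebius[OF s1(1)] unfolding quot_series_def by (metis mult.commute mult_zero_left nonzero_eq_divide_eq times_divide_eq_right zero_neq_one mult.assoc mult_1_right)
    finally show "(\<Sum>n. dirichlet_term (alpha_tilde \<alpha>) s (Suc n)) = quot_series \<alpha> s" .
  qed
  show thesis
  proof (rule that[of \<sigma>])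
    show "summable (\<lambda>n. norm (alpha_tilde \<alpha> (Suc n)) * real (Suc n) powr (- \<sigma>))"
      using conv(1)[of "of_real \<sigma>"] unfolding norm_dirichlet_term by simp
  qed (use conv in \<open>auto simp: \<sigma>_def\<close>)
qed

section \<open>Mellin transforms\<close>

text \<open>Osgood's lemma: holomorphy in each variable comes from the one-variable result, local
  boundedness from the integral of the local majorant.\<close>

lemma holomorphic2_on_lebesgue_integral:
  fixes f :: "complex \<times> complex \<Rightarrow> 'a \<Rightarrow> complex"
  assumes U: "open U"
    and first: "\<And>t b. t \<in> space M \<Longrightarrow> (\<lambda>z. f (z, b) t) holomorphic_on {z. (z, b) \<in> U}"
    and second: "\<And>t a. t \<in> space M \<Longrightarrow> (\<lambda>z. f (a, z) t) holomorphic_on {z. (a, z) \<in> U}"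
    and meas: "\<And>p. p \<in> U \<Longrightarrow> f p \<in> borel_measurable M"
    and dom: "\<And>p. p \<in> U \<Longrightarrow> \<exists>r>0. \<exists>g. integrable M g \<and> (\<forall>q\<in>ball p r \<inter> U. \<forall>t\<in>space M. norm (f q t) \<le> g t)"
  shows "(\<lambda>p. \<integral>t. f p t \<partial>M) holomorphic2_on U"
proof (rule holomorphic2_onI_separate[OF U])
  fix p assume p: "p \<in> U"
  obtain r g where r: "r > 0" "integrable M g" "\<And>q t. q\<in>ball p r \<inter> U \<Longrightarrow> t \<in> space M \<Longrightarrow> norm (f q t) \<le> g t"
    using dom[OF p] by blast
  have "norm (\<integral>t. f q t \<partial>M) \<le> (\<integral>t. g t \<partial>M)" if q: "q \<in> ball p r \<inter> U" for q
  proof -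
    have "integrable M (f q)"
    proof (rule Bochner_Integration.integrable_bound[OF r(2)])
      show "f q \<in> borel_measurable M" using q meas by blast
      show "AE t in M. norm (f q t) \<le> norm (g t)"
        using r(3)[OF q] by (intro AE_I2) (metis abs_ge_self order_trans real_norm_def)
    qed
    note int = this
    have "norm (\<integral>t. f q t \<partial>M) \<le> (\<integral>t. norm (f q t) \<partial>M)" by (rule integral_norm_bound)
    also have "\<dots> \<le> (\<integral>t. g t \<partial>M)"
      by (rule integral_mono[OF integrable_norm[OF int] r(2) r(3)[OF q]])
    finally show ?thesis .
  qed
  then show "\<exists>V B. open V \<and> p \<in> V \<and> V \<subseteq> U \<and> (\<forall>x\<in>V. norm (\<integral>t. f x t \<partial>M) \<le> B)"
    using U p r(1) by (intro exI[of _ "ball p r \<inter> U"] exI[of _ "\<integral>t. g t \<partial>M"]) auto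
next
  fix a b assume ab: "(a, b) \<in> U"
  have op1: "open {z. (z, b) \<in> U}"
    using continuous_open_vimage[OF U, of "\<lambda>z. (z, b)"] by (auto simp: vimage_def intro!: continuous_intros)
  have op2: "open {z. (a, z) \<in> U}"
    using continuous_open_vimage[OF U, of "\<lambda>z. (a, z)"] by (auto simp: vimage_def intro!: continuous_intros)
  have "(\<lambda>z. \<integral>t. f (z, b) t \<partial>M) holomorphic_on {z. (z, b) \<in> U}"
  proof (rule holomorphic_on_lebesgue_integral[OF op1 first])
    fix z assume "z \<in> {z. (z, b) \<in> U}"
    then have z: "(z, b) \<in> U" by simp
    show "f (z, b) \<in> borel_measurable M" by (rule meas[OF z])
    obtain r g where r: "r > 0" "integrable M g" "\<And>q t. q\<in>ball (z, b) r \<inter> U \<Longrightarrow> t \<in> space M \<Longrightarrow> norm (f q t) \<le> g t"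
      using dom[OF z] by blast
    have "(w, b) \<in> ball (z, b) r" if "w \<in> ball z r" for w using that by (simp add: dist_Pair_Pair)
    then show "\<exists>r>0. \<exists>g. integrable M g \<and> (\<forall>w\<in>ball z r \<inter> {z. (z, b) \<in> U}. \<forall>t\<in>space M. norm (f (w, b) t) \<le> g t)"
      using r by blast
  qed
  then show "(\<lambda>z. \<integral>t. f (z, b) t \<partial>M) field_differentiable at a"
    using op1 ab by (auto simp: holomorphic_on_open field_differentiable_def)
  have "(\<lambda>z. \<integral>t. f (a, z) t \<partial>M) holomorphic_on {z. (a, z) \<in> U}"
  proof (rule holomorphic_on_lebesgue_integral[OF op2 second])
    fix z assume "z \<in> {z. (a, z) \<in> U}"
    then have z: "(a, z) \<in> U" by simp
    show "f (a, z) \<in> borel_measurable M" by (rule meas[OF z])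
    obtain r g where r: "r > 0" "integrable M g" "\<And>q t. q\<in>ball (a, z) r \<inter> U \<Longrightarrow> t \<in> space M \<Longrightarrow> norm (f q t) \<le> g t"
      using dom[OF z] by blast
    have "(a, w) \<in> ball (a, z) r" if "w \<in> ball z r" for w using that by (simp add: dist_Pair_Pair)
    then show "\<exists>r>0. \<exists>g. integrable M g \<and> (\<forall>w\<in>ball z r \<inter> {z. (a, z) \<in> U}. \<forall>t\<in>space M. norm (f (a, w) t) \<le> g t)"
      using r by blast
  qed
  then show "(\<lambda>z. \<integral>t. f (a, z) t \<partial>M) field_differentiable at b"
    using op2 ab by (auto simp: holomorphic_on_open field_differentiable_def)
qed

text \<open>Majorises t^x for a whole band of exponents at once: the lower end controls t <= 1, the
  upper end t > 1.\<close>

lemma powr_le_add_powr: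
  fixes t :: real
  assumes "t > 0" "a \<le> x" "x \<le> b"
  shows "t powr x \<le> t powr a + t powr b"
proof (cases "t \<le> 1")
  case True
  then have "t powr x \<le> t powr a" using assms by (intro powr_mono') auto
  then show ?thesis by (simp add: add_increasing2)
next
  case False
  then have "t powr x \<le> t powr b" using assms by (intro powr_mono) auto
  then show ?thesis by (simp add: add_increasing)
qed

text \<open>The inequality x / b <= exp(x / b), raised to the power b.\<close>

lemma powr_mult_exp_le:
  fixes x b :: real
  assumes "x > 0" "b > 0"
  shows "x powr b * exp (- x) \<le> b powr b"
proof -
  have "x / b \<le> exp (x / b)" using exp_ge_add_one_self[of "x / b"] by linarith
  then have "(x / b) powr b \<le> exp (x / b) powr b" using assms by (intro powr_mono2) auto
  also have "\<dots> = exp x" using assms by (simp add: powr_def)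
  finally show ?thesis using assms by (simp add: powr_divide exp_minus field_simps)
qed

lemma norm_Pair_le_ball:
  fixes a b x y :: complex
  assumes "(x, y) \<in> ball (a, b) r"
  shows "x \<in> ball a r" "y \<in> ball b r"
  using assms norm_fst_le[of "a - x" "b - y"] norm_snd_le[of "b - y" "a - x"]
  by (auto simp: dist_norm)

section \<open>Mellin transforms of the exponential sum and of the remainders\<close>

text \<open>The coefficients enter through absolute convergence at one real point
  \<open>\<sigma>\<close> and the values \<open>Q\<close> of the series to the right of it. The
  bound \<open>\<sigma>\<close> >= 2 gives 2 \<open>\<sigma>\<close> - 1 >= \<open>\<sigma>\<close>
  + 1, the margin for perturbing both variables inside \<open>series_domain\<close>.\<close>

locale dirichlet_coeffs =
  fixes c :: "nat \<Rightarrow> complex" and \<sigma> :: real and Q :: "complex \<Rightarrow> complex"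
  assumes sigma_ge: "\<sigma> \<ge> 2"
    and summable_c: "summable (\<lambda>n. norm (c (Suc n)) * real (Suc n) powr (- \<sigma>))"
    and Q_series: "\<And>s. Re s \<ge> \<sigma> \<Longrightarrow> (\<Sum>n. dirichlet_term c s (Suc n)) = Q s"
begin

definition expsum :: "real \<Rightarrow> complex" where
  "expsum t = (\<Sum>n. c (Suc n) * of_real (exp (- (real (Suc n) * t))))"

definition expsum_abs :: "real \<Rightarrow> real" where
  "expsum_abs t = (\<Sum>n. norm (c (Suc n)) * exp (- (real (Suc n) * t)))"

text \<open>With x = n t, the bound on x^sigma exp(- x) compares the series with t^(-sigma) times
  the absolute Dirichlet series at sigma.\<close>

lemma summable_expsum_abs:
  assumes t: "t > 0"
  shows "summable (\<lambda>n. norm (c (Suc n)) * exp (- (real (Suc n) * t)))"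
proof (rule summable_comparison_test'[where N = 0])
  let ?C = "(\<sigma> / t) powr \<sigma> * t powr \<sigma> * t powr (- \<sigma>)"
  show "summable (\<lambda>n. (\<sigma> powr \<sigma> * t powr (- \<sigma>)) * (norm (c (Suc n)) * real (Suc n) powr (- \<sigma>)))"
    by (intro summable_mult summable_c)
  fix n
  let ?x = "real (Suc n) * t"
  have "?x powr \<sigma> * exp (- ?x) \<le> \<sigma> powr \<sigma>" using t sigma_ge by (intro powr_mult_exp_le) auto
  then have "exp (- ?x) \<le> \<sigma> powr \<sigma> * ?x powr (- \<sigma>)"
    using t by (simp add: powr_minus field_simps del: of_nat_Suc)
  also have "?x powr (- \<sigma>) = real (Suc n) powr (- \<sigma>) * t powr (- \<sigma>)" using t by (simp add: powr_mult del: of_nat_Suc)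
  finally have "norm (c (Suc n)) * exp (- ?x) \<le> norm (c (Suc n)) * (\<sigma> powr \<sigma> * (real (Suc n) powr (- \<sigma>) * t powr (- \<sigma>)))"
    by (intro mult_left_mono) auto
  then show "norm (norm (c (Suc n)) * exp (- ?x)) \<le> (\<sigma> powr \<sigma> * t powr (- \<sigma>)) * (norm (c (Suc n)) * real (Suc n) powr (- \<sigma>))"
    by (simp add: mult_ac del: of_nat_Suc)
qed

lemma norm_expsum_le: "t > 0 \<Longrightarrow> norm (expsum t) \<le> expsum_abs t"
  unfolding expsum_def expsum_abs_def
  by (rule norm_suminf_le[OF _ summable_expsum_abs]) (simp_all add: norm_mult del: of_nat_Suc)

lemma expsum_abs_nonneg: "t > 0 \<Longrightarrow> expsum_abs t \<ge> 0"
  using norm_expsum_le[of t] norm_ge_zero order_trans by blast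

lemma measurable_expsum [measurable]: "expsum \<in> borel_measurable pos_lborel"
proof -
  have m: "(\<lambda>t. c (Suc n) * of_real (exp (- (real (Suc n) * t)))) \<in> borel_measurable pos_lborel" for n
    by (rule borel_measurable_pos_lborel_continuous) (intro continuous_intros)
  show ?thesis unfolding expsum_def by (rule borel_measurable_suminf[OF m])
qed

text \<open>Term by term the Gamma integral gives Gamma(z) n^(-z). The integrals of the absolute
  values sum to Gamma(Re z) times the absolute Dirichlet series, which justifies the exchange and
  also makes the majorant \<open>expsum_abs\<close> integrable.\<close>

lemma
  assumes z: "Re z \<ge> \<sigma>"
  shows integrable_mellin: "integrable pos_lborel (\<lambda>t. of_real t powr (z - 1) * expsum t)"
    and integral_mellin: "(\<integral>t. of_real t powr (z - 1) * expsum t \<partial>pos_lborel) = Gamma z * Q z"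
    and integrable_mellin_abs: "integrable pos_lborel (\<lambda>t. t powr (Re z - 1) * expsum_abs t)"
proof -
  have z0: "Re z > 0" using z sigma_ge by simp
  let ?f = "\<lambda>n t. c (Suc n) * (of_real t powr (z - 1) * complex_of_real (exp (- (real (Suc n) * t))))"
  let ?g = "\<lambda>n t. norm (c (Suc n)) * (t powr (Re z - 1) * exp (- (real (Suc n) * t)))"
  have nf: "norm (?f n t) = ?g n t" if "t > 0" for n t
    using that by (simp add: norm_mult norm_powr_real_powr del: of_nat_Suc)
  have intf: "integrable pos_lborel (?f n)" for n
    by (intro integrable_mult_right integrable_Gamma_laplace z0) simp
  have intg: "integrable pos_lborel (?g n)" for n
    by (intro integrable_mult_right integrable_Gamma_laplace_real z0) simp
  have valg: "(\<integral>t. ?g n t \<partial>pos_lborel) = Gamma (Re z) * (norm (c (Suc n)) * real (Suc n) powr (- Re z))" for n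
    using integral_Gamma_laplace_real[OF z0, of "real (Suc n)"]
    by (simp add: powr_minus divide_inverse mult_ac del: of_nat_Suc)
  have valnf: "(\<integral>t. norm (?f n t) \<partial>pos_lborel) = (\<integral>t. ?g n t \<partial>pos_lborel)" for n
    by (intro Bochner_Integration.integral_cong refl nf) simp
  have sm: "summable (\<lambda>n. norm (c (Suc n)) * real (Suc n) powr (- Re z))"
    by (rule summable_dirichlet_mono[OF summable_c z])
  have sg: "summable (\<lambda>n. \<integral>t. ?g n t \<partial>pos_lborel)" unfolding valg by (intro summable_mult sm)
  have sumg: "(\<Sum>n. ?g n t) = t powr (Re z - 1) * expsum_abs t" if "t > 0" for t
    unfolding expsum_abs_def using suminf_mult[OF summable_expsum_abs[OF that], of "t powr (Re z - 1)"]
    by (simp add: mult_ac del: of_nat_Suc)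
  have smg: "summable (\<lambda>n. ?g n t)" if "t > 0" for t
    using summable_mult[OF summable_expsum_abs[OF that], of "t powr (Re z - 1)"] by (simp add: mult_ac del: of_nat_Suc)
  have ng: "norm (?g n t) = ?g n t" for n t by simp
  have AEg: "AE t in pos_lborel. summable (\<lambda>n. norm (?g n t))"
    unfolding ng by (intro AE_I2 smg) simp
  have "integrable pos_lborel (\<lambda>t. \<Sum>n. ?g n t)"
    by (rule integrable_suminf[OF intg AEg]) (unfold ng, rule sg)
  moreover have "integrable pos_lborel (\<lambda>t. \<Sum>n. ?g n t) = integrable pos_lborel (\<lambda>t. t powr (Re z - 1) * expsum_abs t)"
    by (intro Bochner_Integration.integrable_cong refl sumg) simp
  ultimately show "integrable pos_lborel (\<lambda>t. t powr (Re z - 1) * expsum_abs t)" by (rule iffD1[rotated])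
  have sumf: "(\<Sum>n. ?f n t) = of_real t powr (z - 1) * expsum t" if "t > 0" for t
  proof -
    have "summable (\<lambda>n. norm (c (Suc n) * complex_of_real (exp (- (real (Suc n) * t)))))"
      using summable_expsum_abs[OF that] by (simp add: norm_mult del: of_nat_Suc)
    then have "summable (\<lambda>n. c (Suc n) * complex_of_real (exp (- (real (Suc n) * t))))"
      by (rule summable_norm_cancel)
    from suminf_mult[OF this, of "of_real t powr (z - 1)"] show ?thesis
      unfolding expsum_def by (simp only: mult_ac)
  qed
  have AEf: "AE t in pos_lborel. summable (\<lambda>n. norm (?f n t))"
  proof (rule AE_I2)
    fix t assume "t \<in> space pos_lborel"
    then have t: "t > 0" by simp
    show "summable (\<lambda>n. norm (?f n t))" unfolding nf[OF t] by (rule smg[OF t])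
  qed
  have sf: "summable (\<lambda>n. \<integral>t. norm (?f n t) \<partial>pos_lborel)" unfolding valnf by (rule sg)
  have "integrable pos_lborel (\<lambda>t. \<Sum>n. ?f n t) = integrable pos_lborel (\<lambda>t. of_real t powr (z - 1) * expsum t)"
    by (intro Bochner_Integration.integrable_cong refl sumf) simp
  with integrable_suminf[OF intf AEf sf] show "integrable pos_lborel (\<lambda>t. of_real t powr (z - 1) * expsum t)"
    by (rule iffD1[rotated])
  have "(\<integral>t. of_real t powr (z - 1) * expsum t \<partial>pos_lborel) = (\<integral>t. (\<Sum>n. ?f n t) \<partial>pos_lborel)"
    by (intro Bochner_Integration.integral_cong refl sumf[symmetric]) simp
  also have "\<dots> = (\<Sum>n. \<integral>t. ?f n t \<partial>pos_lborel)" by (rule integral_suminf[OF intf AEf sf])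
  also have "(\<lambda>n. \<integral>t. ?f n t \<partial>pos_lborel) = (\<lambda>n. Gamma z * dirichlet_term c z (Suc n))"
  proof
    fix n
    have "(\<integral>t. of_real t powr (z - 1) * complex_of_real (exp (- (real (Suc n) * t))) \<partial>pos_lborel) = Gamma z / of_real (real (Suc n)) powr z"
      by (rule integral_Gamma_laplace[OF z0]) simp
    then show "(\<integral>t. ?f n t \<partial>pos_lborel) = Gamma z * dirichlet_term c z (Suc n)"
      by (simp add: dirichlet_term_def del: of_nat_Suc)
  qed
  also have "(\<Sum>n. Gamma z * dirichlet_term c z (Suc n)) = Gamma z * Q z"
  proof -
    have "summable (\<lambda>n. dirichlet_term c z (Suc n))"
      by (rule summable_norm_cancel) (unfold norm_dirichlet_term, rule sm)
    then show ?thesis using Q_series[OF z] by (simp add: suminf_mult)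
  qed
  finally show "(\<integral>t. of_real t powr (z - 1) * expsum t \<partial>pos_lborel) = Gamma z * Q z" .
qed

lemma integrable_mellin_abs_real:
  "x \<ge> \<sigma> \<Longrightarrow> integrable pos_lborel (\<lambda>t. t powr (x - 1) * expsum_abs t)"
  using integrable_mellin_abs[of "of_real x"] by simp

definition mellin_rem :: "nat \<Rightarrow> complex \<times> complex \<Rightarrow> complex" where
  "mellin_rem K p = (\<integral>t. of_real t powr (snd p - 1) * expsum t * expzeta_rem K (fst p) t \<partial>pos_lborel)"

text \<open>Re s1 < K is the range of the remainder of order K. As that is O(t^K), the integrand is
  dominated by a multiple of t^(Re s2 + K - 1) \<open>expsum_abs\<close> t, integrable once Re s2 +
  K >= \<open>\<sigma>\<close>; the strict inequality leaves room for a neighbourhood.\<close>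

definition rem_domain :: "nat \<Rightarrow> (complex \<times> complex) set" where
  "rem_domain K = {p. Re (fst p) < real K \<and> Re (snd p) > \<sigma> - real K}"

lemma open_rem_domain [simp]: "open (rem_domain K)"
  unfolding rem_domain_def by (intro open_Collect_conj open_Collect_less continuous_intros)

lemma rem_domain_mono: "rem_domain K \<subseteq> rem_domain (Suc K)"
  unfolding rem_domain_def by auto

lemma measurable_mellin_integrand:
  assumes "continuous_on {0<..} h"
  shows "(\<lambda>t. of_real t powr z * expsum t * h t) \<in> borel_measurable pos_lborel"
proof -
  have "(\<lambda>t. complex_of_real t powr z) \<in> borel_measurable pos_lborel"
    by (rule borel_measurable_pos_lborel_continuous) (intro continuous_intros; auto)
  moreover have "h \<in> borel_measurable pos_lborel" by (rule borel_measurable_pos_lborel_continuous[OF assms])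
  ultimately show ?thesis by measurable
qed

lemma
  shows mellin_rem_dominated: "p \<in> rem_domain K \<Longrightarrow> \<exists>r>0. \<exists>g. integrable pos_lborel g \<and>
      (\<forall>q\<in>ball p r \<inter> rem_domain K. \<forall>t\<in>space pos_lborel.
        norm (of_real t powr (snd q - 1) * expsum t * expzeta_rem K (fst q) t) \<le> g t)"
    and measurable_mellin_rem: "p \<in> rem_domain K \<Longrightarrow>
      (\<lambda>t. of_real t powr (snd p - 1) * expsum t * expzeta_rem K (fst p) t) \<in> borel_measurable pos_lborel"
proof -
  assume p: "p \<in> rem_domain K"
  then have p': "Re (fst p) < real K" "Re (snd p) + real K > \<sigma>" by (auto simp: rem_domain_def)
  have "continuous_on {0<..} (expzeta_rem K (fst p))"
    by (rule continuous_on_subset[OF continuous_on_expzeta_rem[OF p'(1)]]) auto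
  then show "(\<lambda>t. of_real t powr (snd p - 1) * expsum t * expzeta_rem K (fst p) t) \<in> borel_measurable pos_lborel"
    by (rule measurable_mellin_integrand)
  obtain r0 B where r0: "r0 > 0" "B \<ge> 0"
    and B: "\<And>s t. s \<in> ball (fst p) r0 \<Longrightarrow> t \<ge> 0 \<Longrightarrow> norm (expzeta_rem K s t) \<le> B * t ^ K"
    using expzeta_rem_bounded[OF p'(1)] by blast
  \<comment> \<open>With this radius the lowest total exponent occurring near \<open>p\<close> is
    still at least \<open>\<sigma>\<close>.\<close>
  define r where "r = min r0 (Re (snd p) + real K - \<sigma>)"
  have r: "r > 0" "r \<le> r0" "Re (snd p) + real K - r \<ge> \<sigma>" using r0 p' by (auto simp: r_def)
  define a b where "a = Re (snd p) + real K - r" and "b = Re (snd p) + real K + r"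
  define g where "g t = B * (t powr (a - 1) * expsum_abs t + t powr (b - 1) * expsum_abs t)" for t
  have "integrable pos_lborel g"
    unfolding g_def using r by (intro integrable_mult_right Bochner_Integration.integrable_add integrable_mellin_abs_real) (auto simp: a_def b_def)
  moreover have "norm (of_real t powr (snd q - 1) * expsum t * expzeta_rem K (fst q) t) \<le> g t"
    if q: "q \<in> ball p r" and t: "t \<in> space pos_lborel" for q t
  proof -
    have t0: "t > 0" using t by simp
    have q12: "fst q \<in> ball (fst p) r" "snd q \<in> ball (snd p) r"
      using norm_Pair_le_ball[of "fst q" "snd q" "fst p" "snd p" r] q by simp_all
    have "\<bar>Re (snd p) - Re (snd q)\<bar> < r"
      using q12(2) abs_Re_le_cmod[of "snd p - snd q"] by (simp add: dist_norm)
    then have ab: "a - 1 \<le> Re (snd q) - 1 + real K" "Re (snd q) - 1 + real K \<le> b - 1"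
      by (auto simp: a_def b_def)
    have "norm (of_real t powr (snd q - 1) * expsum t * expzeta_rem K (fst q) t) =
        t powr (Re (snd q) - 1) * norm (expsum t) * norm (expzeta_rem K (fst q) t)"
      using t0 by (simp add: norm_mult norm_powr_real_powr)
    also have "\<dots> \<le> t powr (Re (snd q) - 1) * expsum_abs t * (B * t ^ K)"
      using norm_expsum_le[OF t0] B[of "fst q" t] q12(1) r(2) t0 expsum_abs_nonneg[OF t0]
      by (intro mult_mono mult_left_mono mult_nonneg_nonneg) auto
    also have "\<dots> = B * (t powr (Re (snd q) - 1 + real K) * expsum_abs t)"
      using t0 by (simp add: powr_add powr_realpow)
    also have "\<dots> \<le> B * ((t powr (a - 1) + t powr (b - 1)) * expsum_abs t)"
      using powr_le_add_powr[OF t0 ab] r0(2) expsum_abs_nonneg[OF t0] by (intro mult_left_mono mult_right_mono)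
    finally show ?thesis unfolding g_def by (simp add: distrib_right)
  qed
  ultimately show "\<exists>r>0. \<exists>g. integrable pos_lborel g \<and> (\<forall>q\<in>ball p r \<inter> rem_domain K. \<forall>t\<in>space pos_lborel.
      norm (of_real t powr (snd q - 1) * expsum t * expzeta_rem K (fst q) t) \<le> g t)"
    using r(1) by blast
qed

lemma integrable_mellin_rem:
  assumes p: "p \<in> rem_domain K"
  shows "integrable pos_lborel (\<lambda>t. of_real t powr (snd p - 1) * expsum t * expzeta_rem K (fst p) t)"
proof -
  obtain r g where r: "r > 0" "integrable pos_lborel g" "\<And>q t. q\<in>ball p r \<inter> rem_domain K \<Longrightarrow> t\<in>space pos_lborel \<Longrightarrow>
      norm (of_real t powr (snd q - 1) * expsum t * expzeta_rem K (fst q) t) \<le> g t"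
    using mellin_rem_dominated[OF p] by blast
  show ?thesis
  proof (rule Bochner_Integration.integrable_bound[OF r(2) measurable_mellin_rem[OF p]])
    show "AE t in pos_lborel. norm (of_real t powr (snd p - 1) * expsum t * expzeta_rem K (fst p) t) \<le> norm (g t)"
    proof (rule AE_I2)
      fix t assume "t \<in> space pos_lborel"
      then have "norm (of_real t powr (snd p - 1) * expsum t * expzeta_rem K (fst p) t) \<le> g t"
        by (intro r(3)) (use r(1) p in auto)
      then show "norm (of_real t powr (snd p - 1) * expsum t * expzeta_rem K (fst p) t) \<le> norm (g t)" by simp
    qed
  qed
qed

lemma holomorphic2_on_mellin_rem: "mellin_rem K holomorphic2_on rem_domain K"
  unfolding mellin_rem_def
proof (rule holomorphic2_on_lebesgue_integral[OF open_rem_domain])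
  fix t b assume t: "t \<in> space pos_lborel"
  have "(\<lambda>z. expzeta_rem K z t) holomorphic_on {z. (z, b) \<in> rem_domain K}"
    by (rule holomorphic_on_subset[OF holomorphic_on_expzeta_rem]) (use t in \<open>auto simp: rem_domain_def\<close>)
  then show "(\<lambda>z. of_real t powr (snd (z, b) - 1) * expsum t * expzeta_rem K (fst (z, b)) t) holomorphic_on {z. (z, b) \<in> rem_domain K}"
    by (simp only: fst_conv snd_conv) (intro holomorphic_intros)
next
  fix t a assume t: "t \<in> space pos_lborel"
  show "(\<lambda>z. of_real t powr (snd (a, z) - 1) * expsum t * expzeta_rem K (fst (a, z)) t) holomorphic_on {z. (a, z) \<in> rem_domain K}"
    by (simp only: fst_conv snd_conv) (intro holomorphic_intros)
qed (use mellin_rem_dominated measurable_mellin_rem in auto)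

section \<open>The double series in its domain of absolute convergence\<close>

text \<open>The factor 2 is a margin: Re s2 and Re (s1 + s2 - 1) both exceed
  \<open>\<sigma>\<close>, so every Mellin integral of the expansion converges here.\<close>

definition series_domain :: "(complex \<times> complex) set" where
  "series_domain = {p. Re (snd p) > 2 * \<sigma> \<and> Re (fst p + snd p) > 2 * \<sigma>}"

lemma open_series_domain [simp]: "open series_domain"
  unfolding series_domain_def by (intro open_Collect_conj open_Collect_less continuous_intros)

definition expzeta_abs :: "real \<Rightarrow> real \<Rightarrow> real" where
  "expzeta_abs a t = (\<Sum>n. real (Suc n) powr (- a) * exp (- (real (Suc n) * t)))"

lemma norm_expzeta_le: "t > 0 \<Longrightarrow> Re s \<ge> a \<Longrightarrow> norm (expzeta s (of_real t)) \<le> expzeta_abs a t"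
  unfolding expzeta_def expzeta_abs_def
proof (rule norm_suminf_le)
  assume t: "t > 0" "Re s \<ge> a"
  show "summable (\<lambda>n. real (Suc n) powr (- a) * exp (- (real (Suc n) * t)))" by (rule summable_powr_exp[OF t(1)])
  show "norm (of_nat (Suc n) powr (- s) * exp (- (of_nat (Suc n) * complex_of_real t))) \<le> real (Suc n) powr (- a) * exp (- (real (Suc n) * t))" for n
    unfolding norm_expzeta_term using t(2) by (intro mult_mono powr_mono) auto
qed

text \<open>The exponential is traded for powers of n: in t^(b-1) = t^(b-sigma) t^(sigma-1) the
  first factor makes (n t)^(b-sigma) exp(- n t) bounded, which gains n^(-(b-sigma)), and the second
  leaves the integrable t^(sigma-1) \<open>expsum_abs\<close> t. So a + b > sigma + 1 suffices for
  the sum over n.\<close>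

lemma double_integrand_bound:
  assumes b: "b > \<sigma>" and t: "t > 0"
  shows "real (Suc n) powr (- a) * (t powr (b - 1) * (exp (- (real (Suc n) * t)) * expsum_abs t)) \<le>
    (b - \<sigma>) powr (b - \<sigma>) * real (Suc n) powr (- (a + b - \<sigma>)) * (t powr (\<sigma> - 1) * expsum_abs t)"
proof -
  let ?x = "real (Suc n) * t"
  have "?x powr (b - \<sigma>) * exp (- ?x) \<le> (b - \<sigma>) powr (b - \<sigma>)" using b t by (intro powr_mult_exp_le) auto
  then have "real (Suc n) powr (- (a + b - \<sigma>)) * (?x powr (b - \<sigma>) * exp (- ?x)) * (t powr (\<sigma> - 1) * expsum_abs t) \<le>
     real (Suc n) powr (- (a + b - \<sigma>)) * (b - \<sigma>) powr (b - \<sigma>) * (t powr (\<sigma> - 1) * expsum_abs t)"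
    using expsum_abs_nonneg[OF t] by (intro mult_left_mono mult_right_mono) auto
  moreover have "?x powr (b - \<sigma>) = real (Suc n) powr (b - \<sigma>) * t powr (b - \<sigma>)" using t by (simp add: powr_mult del: of_nat_Suc)
  moreover have "t powr (b - 1) = t powr (b - \<sigma>) * t powr (\<sigma> - 1)" using t by (simp add: powr_add[symmetric])
  moreover have "real (Suc n) powr (- a) = real (Suc n) powr (- (a + b - \<sigma>)) * real (Suc n) powr (b - \<sigma>)"
    by (simp add: powr_add[symmetric] del: of_nat_Suc)
  ultimately show ?thesis by (simp add: mult_ac del: of_nat_Suc)
qed

lemma
  assumes b: "b > \<sigma>" and ab: "a + b > \<sigma> + 1"
  shows integrable_double_abs: "integrable pos_lborel (\<lambda>t. t powr (b - 1) * expsum_abs t * expzeta_abs a t)"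
    and summable_double_abs: "summable (\<lambda>n. \<integral>t. real (Suc n) powr (- a) * (t powr (b - 1) * (exp (- (real (Suc n) * t)) * expsum_abs t)) \<partial>pos_lborel)"
    and integrable_double_term: "integrable pos_lborel (\<lambda>t. real (Suc n) powr (- a) * (t powr (b - 1) * (exp (- (real (Suc n) * t)) * expsum_abs t)))"
proof -
  let ?g = "\<lambda>n t. real (Suc n) powr (- a) * (t powr (b - 1) * (exp (- (real (Suc n) * t)) * expsum_abs t))"
  let ?C = "\<lambda>n. (b - \<sigma>) powr (b - \<sigma>) * real (Suc n) powr (- (a + b - \<sigma>))"
  have ib: "integrable pos_lborel (\<lambda>t. t powr (b - 1) * expsum_abs t)" using b by (intro integrable_mellin_abs_real) simp
  have i0: "integrable pos_lborel (\<lambda>t. t powr (\<sigma> - 1) * expsum_abs t)" by (intro integrable_mellin_abs_real) simp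
  have nn: "?g n t \<ge> 0" if "t > 0" for n t using expsum_abs_nonneg[OF that] by simp
  have int: "integrable pos_lborel (?g n)" for n
  proof (rule Bochner_Integration.integrable_bound[OF integrable_mult_right[OF ib]])
    have "(\<lambda>t. exp (- (real (Suc n) * t))) \<in> borel_measurable pos_lborel"
      by (rule borel_measurable_pos_lborel_continuous) (intro continuous_intros)
    from borel_measurable_times[OF borel_measurable_const borel_measurable_times[OF this borel_measurable_integrable[OF ib]]]
    have "(\<lambda>t. real (Suc n) powr (- a) * (exp (- (real (Suc n) * t)) * (t powr (b - 1) * expsum_abs t))) \<in> borel_measurable pos_lborel" .
    then show "?g n \<in> borel_measurable pos_lborel" by (simp only: mult.left_commute)
    show "AE t in pos_lborel. norm (?g n t) \<le> norm (real (Suc n) powr (- a) * (t powr (b - 1) * expsum_abs t))"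
    proof (rule AE_I2)
      fix t assume "t \<in> space pos_lborel"
      then have t: "t > 0" by simp
      have "exp (- (real (Suc n) * t)) * expsum_abs t \<le> expsum_abs t"
        using t expsum_abs_nonneg[OF t] by (intro mult_left_le_one_le) auto
      then show "norm (?g n t) \<le> norm (real (Suc n) powr (- a) * (t powr (b - 1) * expsum_abs t))"
        using nn[OF t] expsum_abs_nonneg[OF t] by (simp add: mult_left_mono abs_mult del: of_nat_Suc)
    qed
  qed
  then show "integrable pos_lborel (?g n)" .
  have le: "(\<integral>t. ?g n t \<partial>pos_lborel) \<le> ?C n * (\<integral>t. t powr (\<sigma> - 1) * expsum_abs t \<partial>pos_lborel)" for n
  proof -
    have "(\<integral>t. ?g n t \<partial>pos_lborel) \<le> (\<integral>t. ?C n * (t powr (\<sigma> - 1) * expsum_abs t) \<partial>pos_lborel)"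
      by (rule integral_mono[OF int integrable_mult_right[OF i0] double_integrand_bound[OF b]]) simp
    then show ?thesis by simp
  qed
  have pos: "(\<integral>t. ?g n t \<partial>pos_lborel) \<ge> 0" for n
    by (rule Bochner_Integration.integral_nonneg) (use nn in simp)
  show sm: "summable (\<lambda>n. \<integral>t. ?g n t \<partial>pos_lborel)"
  proof (rule summable_comparison_test'[where N = 0])
    show "summable (\<lambda>n. ?C n * (\<integral>t. t powr (\<sigma> - 1) * expsum_abs t \<partial>pos_lborel))"
      using ab by (intro summable_mult2 summable_mult summable_powr_Suc) auto
    show "norm (\<integral>t. ?g n t \<partial>pos_lborel) \<le> ?C n * (\<integral>t. t powr (\<sigma> - 1) * expsum_abs t \<partial>pos_lborel)" for n
      using le[of n] pos[of n] by (simp only: real_norm_def abs_of_nonneg)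
  qed
  have sums: "(\<lambda>n. ?g n t) sums (t powr (b - 1) * expsum_abs t * expzeta_abs a t)" if t: "t > 0" for t
    using sums_mult[OF summable_sums[OF summable_powr_exp[OF t, of "-a"]], of "t powr (b - 1) * expsum_abs t"]
    unfolding expzeta_abs_def by (simp add: mult_ac del: of_nat_Suc)
  have AE: "AE t in pos_lborel. summable (\<lambda>n. norm (?g n t))"
  proof (rule AE_I2)
    fix t assume "t \<in> space pos_lborel"
    then have t: "t > 0" by simp
    show "summable (\<lambda>n. norm (?g n t))"
      using sums_summable[OF sums[OF t]] nn[OF t] by (simp only: real_norm_def abs_of_nonneg)
  qed
  have "(\<integral>t. norm (?g n t) \<partial>pos_lborel) = (\<integral>t. ?g n t \<partial>pos_lborel)" for n
    by (intro Bochner_Integration.integral_cong refl) (use nn in simp)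
  then have "summable (\<lambda>n. \<integral>t. norm (?g n t) \<partial>pos_lborel)" using sm by (simp only:)
  from integrable_suminf[OF int AE this]
  have "integrable pos_lborel (\<lambda>t. \<Sum>n. ?g n t)" .
  moreover have "integrable pos_lborel (\<lambda>t. \<Sum>n. ?g n t) = integrable pos_lborel (\<lambda>t. t powr (b - 1) * expsum_abs t * expzeta_abs a t)"
    by (intro Bochner_Integration.integrable_cong refl sums_unique[OF sums, symmetric]) simp
  ultimately show "integrable pos_lborel (\<lambda>t. t powr (b - 1) * expsum_abs t * expzeta_abs a t)" by (rule iffD1[rotated])
qed

definition mellin_double :: "complex \<times> complex \<Rightarrow> complex" where
  "mellin_double p = (\<integral>t. of_real t powr (snd p - 1) * expsum t * expzeta (fst p) (of_real t) \<partial>pos_lborel)"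

lemma continuous_on_expzeta: "continuous_on {0<..} (\<lambda>t. expzeta s (complex_of_real t))"
proof -
  have "continuous_on {w. Re w > 0} (expzeta s)"
    by (intro continuous_at_imp_continuous_on ballI DERIV_isCont[OF has_field_derivative_expzeta]) simp
  then have "continuous_on {0<..} (expzeta s \<circ> complex_of_real)"
    by (intro continuous_on_compose continuous_intros) (auto intro: continuous_on_subset)
  then show ?thesis by (simp add: o_def)
qed

lemma holomorphic2_on_mellin_double: "mellin_double holomorphic2_on series_domain"
  unfolding mellin_double_def
proof (rule holomorphic2_on_lebesgue_integral[OF open_series_domain])
  fix t b assume t: "t \<in> space pos_lborel"
  have "(\<lambda>z. expzeta z (of_real t)) holomorphic_on {z. (z, b) \<in> series_domain}"
    by (rule holomorphic_on_subset[OF holomorphic_on_expzeta]) (use t in auto)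
  then show "(\<lambda>z. of_real t powr (snd (z, b) - 1) * expsum t * expzeta (fst (z, b)) (of_real t)) holomorphic_on {z. (z, b) \<in> series_domain}"
    by (simp only: fst_conv snd_conv) (intro holomorphic_intros)
next
  fix t a assume t: "t \<in> space pos_lborel"
  show "(\<lambda>z. of_real t powr (snd (a, z) - 1) * expsum t * expzeta (fst (a, z)) (of_real t)) holomorphic_on {z. (a, z) \<in> series_domain}"
    by (simp only: fst_conv snd_conv) (intro holomorphic_intros)
next
  fix p assume p: "p \<in> series_domain"
  show "(\<lambda>t. of_real t powr (snd p - 1) * expsum t * expzeta (fst p) (of_real t)) \<in> borel_measurable pos_lborel"
    by (rule measurable_mellin_integrand[OF continuous_on_expzeta])
  \<comment> \<open>Moving both variables by at most 1/2 lowers Re (s1 + s2) by at most 1, and 2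
    \<open>\<sigma>\<close> - 1 >= \<open>\<sigma>\<close> + 1.\<close>
  define r where "r = (1/2 :: real)"
  define a b1 b2 where "a = Re (fst p) - r" and "b1 = Re (snd p) - r" and "b2 = Re (snd p) + r"
  have ab: "b1 > \<sigma>" "b2 > \<sigma>" "a + b1 > \<sigma> + 1" "a + b2 > \<sigma> + 1"
    using p sigma_ge by (auto simp: series_domain_def a_def b1_def b2_def r_def)
  define g where "g t = t powr (b1 - 1) * expsum_abs t * expzeta_abs a t + t powr (b2 - 1) * expsum_abs t * expzeta_abs a t" for t
  have "integrable pos_lborel g"
    unfolding g_def using ab by (intro Bochner_Integration.integrable_add integrable_double_abs)
  moreover have "norm (of_real t powr (snd q - 1) * expsum t * expzeta (fst q) (of_real t)) \<le> g t"
    if q: "q \<in> ball p r" and t: "t \<in> space pos_lborel" for q t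
  proof -
    have t0: "t > 0" using t by simp
    have q12: "fst q \<in> ball (fst p) r" "snd q \<in> ball (snd p) r"
      using norm_Pair_le_ball[of "fst q" "snd q" "fst p" "snd p" r] q by simp_all
    have "\<bar>Re (snd p) - Re (snd q)\<bar> < r"
      using q12(2) abs_Re_le_cmod[of "snd p - snd q"] by (simp add: dist_norm)
    then have e: "b1 - 1 \<le> Re (snd q) - 1" "Re (snd q) - 1 \<le> b2 - 1" by (auto simp: b1_def b2_def)
    have "\<bar>Re (fst p) - Re (fst q)\<bar> < r"
      using q12(1) abs_Re_le_cmod[of "fst p - fst q"] by (simp add: dist_norm)
    then have f: "Re (fst q) \<ge> a" by (auto simp: a_def)
    have za: "norm (expzeta (fst q) (of_real t)) \<le> expzeta_abs a t" by (rule norm_expzeta_le[OF t0 f])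
    then have za0: "expzeta_abs a t \<ge> 0" using norm_ge_zero order_trans by blast
    have "norm (of_real t powr (snd q - 1) * expsum t * expzeta (fst q) (of_real t)) =
        t powr (Re (snd q) - 1) * norm (expsum t) * norm (expzeta (fst q) (of_real t))"
      using t0 by (simp add: norm_mult norm_powr_real_powr)
    also have "\<dots> \<le> (t powr (b1 - 1) + t powr (b2 - 1)) * expsum_abs t * expzeta_abs a t"
      using norm_expsum_le[OF t0] za za0 expsum_abs_nonneg[OF t0] powr_le_add_powr[OF t0 e]
      by (intro mult_mono mult_nonneg_nonneg) auto
    finally show ?thesis unfolding g_def by (simp add: distrib_right)
  qed
  moreover have "r > 0" by (simp add: r_def)
  ultimately show "\<exists>r>0. \<exists>g. integrable pos_lborel g \<and> (\<forall>q\<in>ball p r \<inter> series_domain. \<forall>t\<in>space pos_lborel.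
      norm (of_real t powr (snd q - 1) * expsum t * expzeta (fst q) (of_real t)) \<le> g t)" by blast
qed

text \<open>The power (m1 + m2)^(-b) is split into exponents b - sigma and sigma; estimating the
  first part by m1 and the second by m2 gives a product of two convergent series.\<close>

lemma double_term_summable:
  assumes p: "(s1, s2) \<in> series_domain"
  shows "(\<lambda>(m1, m2). norm (double_term (\<lambda>_. 1) c s1 s2 m1 m2)) summable_on ({1..} \<times> {1..})"
proof -
  define a b where "a = Re s1" and "b = Re s2"
  have ab: "b > \<sigma>" "a + b > \<sigma> + 1" using p sigma_ge by (auto simp: series_domain_def a_def b_def)
  define u where "u = (\<lambda>m::nat. complex_of_real (real m powr (- (a + b - \<sigma>))))"
  define v where "v = (\<lambda>m::nat. complex_of_real (norm (c m) * real m powr (- \<sigma>)))"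
  have "summable (\<lambda>n. norm (u (Suc n)))"
    using ab by (simp add: u_def summable_powr_Suc del: of_nat_Suc)
  then have u: "(\<lambda>m. norm (u m)) summable_on {1..}" by (simp only: summable_on_from_1_iff)
  have "summable (\<lambda>n. norm (v (Suc n)))"
    using summable_c by (simp add: v_def abs_mult norm_mult del: of_nat_Suc)
  then have v: "(\<lambda>m. norm (v m)) summable_on {1..}" by (simp only: summable_on_from_1_iff)
  have prod: "(\<lambda>x. norm ((\<lambda>(m1, m2). u m1 * v m2) x)) summable_on {1..} \<times> {1..}"
    unfolding Infinite_Sum.abs_summable_on_Sigma_iff
  proof (intro conjI ballI)
    show "(\<lambda>m2. norm ((\<lambda>(m1, m2). u m1 * v m2) (m1, m2))) summable_on {1..}" for m1
      using v by (simp add: norm_mult summable_on_cmult_right)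
    have e: "(\<lambda>m1. norm (infsum (\<lambda>m2. norm ((\<lambda>(m1, m2). u m1 * v m2) (m1, m2))) {1..})) =
        (\<lambda>m1. norm (u m1) * norm (infsum (\<lambda>m2. norm (v m2)) {1..}))"
      by (simp add: norm_mult infsum_cmult_right' abs_mult)
    show "(\<lambda>m1. norm (infsum (\<lambda>m2. norm ((\<lambda>(m1, m2). u m1 * v m2) (m1, m2))) {1..})) summable_on {1..}"
      unfolding e by (rule summable_on_cmult_left[OF u])
  qed
  have le: "norm (double_term (\<lambda>_. 1) c s1 s2 m1 m2) \<le> norm (u m1 * v m2)" if m: "m1 \<in> {1..}" "m2 \<in> {1..}" for m1 m2
  proof -
    have m0: "real m1 > 0" "real m2 > 0" using m by auto
    have "norm (double_term (\<lambda>_. 1) c s1 s2 m1 m2) = norm (c m2) * (real m1 powr (- a) * real (m1 + m2) powr (- b))"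
      by (simp add: double_term_def norm_mult norm_inverse norm_powr_real_powr a_def b_def powr_minus divide_inverse del: of_nat_add)
    also have "real (m1 + m2) powr (- b) = real (m1 + m2) powr (- (b - \<sigma>)) * real (m1 + m2) powr (- \<sigma>)"
      by (simp add: powr_add[symmetric] del: of_nat_add)
    also have "norm (c m2) * (real m1 powr (- a) * (real (m1 + m2) powr (- (b - \<sigma>)) * real (m1 + m2) powr (- \<sigma>))) \<le>
        norm (c m2) * (real m1 powr (- a) * (real m1 powr (- (b - \<sigma>)) * real m2 powr (- \<sigma>)))"
      using m0 ab sigma_ge by (intro mult_left_mono mult_mono powr_mono2') auto
    also have "real m1 powr (- a) * (real m1 powr (- (b - \<sigma>)) * real m2 powr (- \<sigma>)) = real m1 powr (- (a + b - \<sigma>)) * real m2 powr (- \<sigma>)"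
    proof -
      have e: "- (a + b - \<sigma>) = - a + - (b - \<sigma>)" by simp
      show ?thesis unfolding e powr_add by (simp only: mult.assoc)
    qed
    finally show ?thesis by (simp add: u_def v_def norm_mult abs_mult mult_ac)
  qed
  have "(\<lambda>x. norm ((\<lambda>(m1, m2). double_term (\<lambda>_. 1) c s1 s2 m1 m2) x)) summable_on {1..} \<times> {1..}"
    by (rule Infinite_Sum.abs_summable_on_comparison_test[OF prod]) (use le in auto)
  then show ?thesis by (simp add: case_prod_unfold)
qed

text \<open>Gamma(s2) (m1 + m2)^(-s2) is the integral of t^(s2-1) exp(- (m1 + m2) t); summation over
  m2 under the integral produces exp(- m1 t) times \<open>expsum\<close>. Writing
  \<open>rGamma\<close> keeps the prefactor entire in s2.\<close>

lemma double_series_inner: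
  assumes s2: "Re s2 > 2 * \<sigma>"
  shows "(\<Sum>\<^sub>\<infinity>m2\<in>{1..}. double_term (\<lambda>_. 1) c s1 s2 (Suc n) m2) =
    rGamma s2 * (\<integral>t. of_nat (Suc n) powr (- s1) * (of_real t powr (s2 - 1) * (of_real (exp (- (real (Suc n) * t))) * expsum t)) \<partial>pos_lborel)"
proof -
  have s0: "Re s2 > 0" "Re s2 \<ge> \<sigma>" using s2 sigma_ge by auto
  have G: "rGamma s2 * Gamma s2 = 1"
  proof -
    have "s2 \<notin> \<int>\<^sub>\<le>\<^sub>0" using s0(1) by (auto elim!: nonpos_Ints_cases)
    then show ?thesis by (simp add: rGamma_inverse_Gamma Gamma_eq_zero_iff)
  qed
  define x where "x k = real (Suc n + Suc k)" for k
  have x: "x k > 0" "x k \<ge> real (Suc k)" for k by (auto simp: x_def)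
  let ?f = "\<lambda>k t. c (Suc k) * (of_real t powr (s2 - 1) * complex_of_real (exp (- (x k * t))))"
  have nf: "norm (?f k t) = norm (c (Suc k)) * (t powr (Re s2 - 1) * exp (- (x k * t)))" if "t > 0" for k t
    using that by (simp add: norm_mult norm_powr_real_powr)
  have intf: "integrable pos_lborel (?f k)" for k
    by (intro integrable_mult_right integrable_Gamma_laplace s0 x)
  have valf: "(\<integral>t. ?f k t \<partial>pos_lborel) = c (Suc k) * (Gamma s2 / of_real (x k) powr s2)" for k
    using integral_Gamma_laplace[OF s0(1) x(1)[of k]] by simp
  have valn: "(\<integral>t. norm (?f k t) \<partial>pos_lborel) = norm (c (Suc k)) * (Gamma (Re s2) / x k powr Re s2)" for k
  proof -
    have "(\<integral>t. norm (?f k t) \<partial>pos_lborel) = (\<integral>t. norm (c (Suc k)) * (t powr (Re s2 - 1) * exp (- (x k * t))) \<partial>pos_lborel)"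
      by (intro Bochner_Integration.integral_cong refl nf) simp
    then show ?thesis using integral_Gamma_laplace_real[OF s0(1) x(1)[of k]] by simp
  qed
  have Gp: "Gamma (Re s2) > 0" using s0 by (intro Gamma_real_pos) auto
  have bnd: "norm (c (Suc k)) * (1 / x k powr Re s2) \<le> norm (c (Suc k)) * real (Suc k) powr (- \<sigma>)" for k
  proof -
    have "x k powr (- Re s2) \<le> real (Suc k) powr (- Re s2)"
      using x[of k] s0 by (intro powr_mono2') auto
    also have "\<dots> \<le> real (Suc k) powr (- \<sigma>)" using s0 by (intro powr_mono) auto
    finally show ?thesis by (intro mult_left_mono) (auto simp: powr_minus divide_inverse)
  qed
  have sn: "summable (\<lambda>k. \<integral>t. norm (?f k t) \<partial>pos_lborel)"
    unfolding valn
  proof (rule summable_comparison_test'[where N = 0])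
    show "summable (\<lambda>k. Gamma (Re s2) * (norm (c (Suc k)) * real (Suc k) powr (- \<sigma>)))" by (intro summable_mult summable_c)
    show "norm (norm (c (Suc k)) * (Gamma (Re s2) / x k powr Re s2)) \<le> Gamma (Re s2) * (norm (c (Suc k)) * real (Suc k) powr (- \<sigma>))" for k
      using mult_left_mono[OF bnd[of k], of "Gamma (Re s2)"] Gp by (simp add: abs_mult mult_ac)
  qed
  have sums: "(\<lambda>k. ?f k t) sums (of_real t powr (s2 - 1) * (of_real (exp (- (real (Suc n) * t))) * expsum t))"
    and AEs: "summable (\<lambda>k. norm (?f k t))" if t: "t > 0" for t
  proof -
    have e: "exp (- (x k * t)) = exp (- (real (Suc n) * t)) * exp (- (real (Suc k) * t))" for k
      by (simp add: x_def exp_add[symmetric] algebra_simps)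
    have "summable (\<lambda>k. norm (c (Suc k) * complex_of_real (exp (- (real (Suc k) * t)))))"
      using summable_expsum_abs[OF t] by (simp add: norm_mult del: of_nat_Suc)
    note sm = this summable_norm_cancel[OF this]
    from sums_mult[OF summable_sums[OF sm(2)], of "of_real t powr (s2 - 1) * of_real (exp (- (real (Suc n) * t)))"]
    show "(\<lambda>k. ?f k t) sums (of_real t powr (s2 - 1) * (of_real (exp (- (real (Suc n) * t))) * expsum t))"
      unfolding expsum_def e of_real_mult by (simp only: mult_ac)
    have "norm (?f k t) = (t powr (Re s2 - 1) * exp (- (real (Suc n) * t))) * (norm (c (Suc k) * complex_of_real (exp (- (real (Suc k) * t)))))" for k
      unfolding e using t by (simp add: norm_mult norm_powr_real_powr del: of_nat_Suc)
    then show "summable (\<lambda>k. norm (?f k t))" using summable_mult[OF sm(1)] by (simp only:)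
  qed
  have AE: "AE t in pos_lborel. summable (\<lambda>k. norm (?f k t))" by (intro AE_I2 AEs) simp
  have val: "(\<Sum>k. \<integral>t. ?f k t \<partial>pos_lborel) = (\<integral>t. of_real t powr (s2 - 1) * (of_real (exp (- (real (Suc n) * t))) * expsum t) \<partial>pos_lborel)"
    unfolding integral_suminf[OF intf AE sn, symmetric]
    by (intro Bochner_Integration.integral_cong refl sums_unique[OF sums, symmetric]) simp
  have dt: "double_term (\<lambda>_. 1) c s1 s2 (Suc n) (Suc k) = of_nat (Suc n) powr (- s1) * rGamma s2 * (\<integral>t. ?f k t \<partial>pos_lborel)" for k
  proof -
    have "of_nat (Suc n) powr (- s1) * rGamma s2 * (c (Suc k) * (Gamma s2 / of_real (x k) powr s2)) =
       (rGamma s2 * Gamma s2) * (of_nat (Suc n) powr (- s1) * (c (Suc k) / of_real (x k) powr s2))" by simp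
    also have "\<dots> = double_term (\<lambda>_. 1) c s1 s2 (Suc n) (Suc k)"
      unfolding G by (simp add: double_term_def x_def powr_minus divide_inverse del: of_nat_Suc)
    finally show ?thesis unfolding valf by simp
  qed
  have smd: "summable (\<lambda>k. \<integral>t. ?f k t \<partial>pos_lborel)"
    by (rule sums_summable[OF sums_integral[OF intf AE sn]])
  have smn: "summable (\<lambda>k. norm (double_term (\<lambda>_. 1) c s1 s2 (Suc n) (Suc k)))"
  proof (rule summable_comparison_test'[where N = 0])
    show "summable (\<lambda>k. norm (of_nat (Suc n) powr (- s1) * rGamma s2) * (\<integral>t. norm (?f k t) \<partial>pos_lborel))" by (intro summable_mult sn)
    show "norm (norm (double_term (\<lambda>_. 1) c s1 s2 (Suc n) (Suc k))) \<le> norm (of_nat (Suc n) powr (- s1) * rGamma s2) * (\<integral>t. norm (?f k t) \<partial>pos_lborel)" for k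
      unfolding dt norm_mult[of "of_nat (Suc n) powr (- s1) * rGamma s2"] using integral_norm_bound[of pos_lborel "?f k"]
      by (simp add: mult_left_mono norm_mult del: of_nat_Suc)
  qed
  have pull: "(\<integral>t. of_nat (Suc n) powr (- s1) * (of_real t powr (s2 - 1) * (of_real (exp (- (real (Suc n) * t))) * expsum t)) \<partial>pos_lborel) =
     of_nat (Suc n) powr (- s1) * (\<integral>t. of_real t powr (s2 - 1) * (of_real (exp (- (real (Suc n) * t))) * expsum t) \<partial>pos_lborel)"
    by (rule integral_mult_right_zero)
  show ?thesis
    unfolding infsum_from_1[OF smn] dt suminf_mult[OF smd] val pull
    by (simp only: mult_ac)
qed

text \<open>Second exchange: the sum over m1 turns exp(- m1 t) into L(s1, t), with the majorants of
  \<open>summable_double_abs\<close>.\<close>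

lemma double_series_eq:
  assumes p: "(s1, s2) \<in> series_domain"
  shows "(\<Sum>\<^sub>\<infinity>m1\<in>{1..}. \<Sum>\<^sub>\<infinity>m2\<in>{1..}. double_term (\<lambda>_. 1) c s1 s2 m1 m2) = rGamma s2 * mellin_double (s1, s2)"
proof -
  define a b where "a = Re s1" and "b = Re s2"
  have ab: "b > \<sigma>" "a + b > \<sigma> + 1" and b2: "Re s2 > 2 * \<sigma>"
    using p sigma_ge by (auto simp: series_domain_def a_def b_def)
  let ?f = "\<lambda>n t. of_nat (Suc n) powr (- s1) * (of_real t powr (s2 - 1) * (complex_of_real (exp (- (real (Suc n) * t))) * expsum t))"
  let ?g = "\<lambda>n t. real (Suc n) powr (- a) * (t powr (b - 1) * (exp (- (real (Suc n) * t)) * expsum_abs t))"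
  have nf: "norm (?f n t) \<le> ?g n t" if t: "t > 0" for n t
    using norm_expsum_le[OF t] t
    by (simp add: norm_mult norm_powr_real_powr a_def b_def mult_left_mono del: of_nat_Suc)
  have mf: "?f n \<in> borel_measurable pos_lborel" for n
  proof -
    have "continuous_on {0<..} (\<lambda>t. of_nat (Suc n) powr (- s1) * complex_of_real (exp (- (real (Suc n) * t))))"
      by (intro continuous_intros)
    from measurable_mellin_integrand[OF this, of "s2 - 1"] show ?thesis by (simp only: mult_ac)
  qed
  have intf: "integrable pos_lborel (?f n)" for n
  proof (rule Bochner_Integration.integrable_bound[OF integrable_double_term[OF ab] mf])
    show "AE t in pos_lborel. norm (?f n t) \<le> norm (?g n t)"
    proof (rule AE_I2)
      fix t assume "t \<in> space pos_lborel"
      then have "norm (?f n t) \<le> ?g n t" by (intro nf) simp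
      also have "?g n t \<le> norm (?g n t)" unfolding real_norm_def by (rule abs_ge_self)
      finally show "norm (?f n t) \<le> norm (?g n t)" .
    qed
  qed
  have intle: "(\<integral>t. norm (?f n t) \<partial>pos_lborel) \<le> (\<integral>t. ?g n t \<partial>pos_lborel)" for n
    by (rule integral_mono[OF integrable_norm[OF intf] integrable_double_term[OF ab] nf]) simp
  have sn: "summable (\<lambda>n. \<integral>t. norm (?f n t) \<partial>pos_lborel)"
  proof (rule summable_comparison_test'[OF summable_double_abs[OF ab], of 0])
    fix n
    have "(\<integral>t. norm (?f n t) \<partial>pos_lborel) \<ge> 0" by (rule Bochner_Integration.integral_nonneg) simp
    then show "norm (\<integral>t. norm (?f n t) \<partial>pos_lborel) \<le> (\<integral>t. ?g n t \<partial>pos_lborel)"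
      using intle[of n] by (simp only: real_norm_def abs_of_nonneg)
  qed
  have sums: "(\<lambda>n. ?f n t) sums (of_real t powr (s2 - 1) * expsum t * expzeta s1 (of_real t))"
    and AEs: "summable (\<lambda>n. norm (?f n t))" if t: "t > 0" for t
  proof -
    have e: "complex_of_real (exp (- (real (Suc n) * t))) = exp (- (of_nat (Suc n) * of_real t))" for n
      using exp_of_real[of "- (real (Suc n) * t)", where ?'a = complex] by simp
    have Re: "Re (complex_of_real t) > 0" using t by simp
    note sm = summable_norm_expzeta[OF Re, of s1] summable_norm_cancel[OF summable_norm_expzeta[OF Re, of s1]]
    from sums_mult[OF summable_sums[OF sm(2)], of "of_real t powr (s2 - 1) * expsum t"]
    show "(\<lambda>n. ?f n t) sums (of_real t powr (s2 - 1) * expsum t * expzeta s1 (of_real t))"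
      unfolding expzeta_def e by (simp only: mult_ac)
    have "norm (?f n t) = norm (of_real t powr (s2 - 1) * expsum t) * norm (of_nat (Suc n) powr (- s1) * exp (- (of_nat (Suc n) * complex_of_real t)))" for n
      unfolding e by (simp only: norm_mult mult_ac)
    then show "summable (\<lambda>n. norm (?f n t))" using summable_mult[OF sm(1)] by (simp only:)
  qed
  have AE: "AE t in pos_lborel. summable (\<lambda>n. norm (?f n t))" by (intro AE_I2 AEs) simp
  have val: "(\<Sum>n. \<integral>t. ?f n t \<partial>pos_lborel) = mellin_double (s1, s2)"
    unfolding integral_suminf[OF intf AE sn, symmetric] mellin_double_def fst_conv snd_conv
    by (intro Bochner_Integration.integral_cong refl sums_unique[OF sums, symmetric]) simp
  let ?S = "\<lambda>m1. \<Sum>\<^sub>\<infinity>m2\<in>{1..}. double_term (\<lambda>_. 1) c s1 s2 m1 m2"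
  have S: "?S (Suc n) = rGamma s2 * (\<integral>t. ?f n t \<partial>pos_lborel)" for n by (rule double_series_inner[OF b2])
  have smn: "summable (\<lambda>n. norm (?S (Suc n)))"
  proof (rule summable_comparison_test'[where N = 0])
    show "summable (\<lambda>n. norm (rGamma s2) * (\<integral>t. norm (?f n t) \<partial>pos_lborel))" by (intro summable_mult sn)
    show "norm (norm (?S (Suc n))) \<le> norm (rGamma s2) * (\<integral>t. norm (?f n t) \<partial>pos_lborel)" for n
      unfolding S norm_mult[of "rGamma s2"] using integral_norm_bound[of pos_lborel "?f n"] by (simp add: mult_left_mono)
  qed
  show ?thesis
    unfolding infsum_from_1[OF smn] S
    using suminf_mult[OF sums_summable[OF sums_integral[OF intf AE sn]], of "rGamma s2"] val by simp
qed

end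

section \<open>Continuation of the double series\<close>

lemma quot2_on_entire_affine:
  fixes f :: "complex \<Rightarrow> complex"
  assumes "f holomorphic_on UNIV" "a \<noteq> 0 \<or> b \<noteq> 0" "open V"
  shows "quot2_on (\<lambda>p. f (a * fst p + b * snd p + c)) V"
  by (rule quot2_on_affine[of f "\<lambda>_. 1" 0]) (use assms in auto)

text \<open>Multiplying numerator and denominator by \<open>u\<close> frees the values on the zero
  set of \<open>u\<close>.\<close>

lemma quot2_on_modify:
  assumes G: "quot2_on G V" and u: "u holomorphic2_on V" "dense_in (\<lambda>x. u x \<noteq> 0) V"
    and H: "\<And>x. x \<in> V \<Longrightarrow> u x \<noteq> 0 \<Longrightarrow> H x = G x"
  shows "quot2_on H V"
proof -
  obtain g h where 1: "open V" "g holomorphic2_on V" "h holomorphic2_on V"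
    "dense_in (\<lambda>x. h x \<noteq> 0) V" "open {x\<in>V. h x \<noteq> 0}" "\<And>x. x \<in> V \<Longrightarrow> h x \<noteq> 0 \<Longrightarrow> G x = g x / h x"
    by (rule quot2_onE[OF G]) blast
  show ?thesis
  proof (rule quot2_onI[where g = "\<lambda>x. g x * u x" and h = "\<lambda>x. h x * u x"])
    have "dense_in (\<lambda>x. h x \<noteq> 0 \<and> u x \<noteq> 0) V" by (rule dense_in_conj[OF 1(4) u(2) 1(1,5)])
    then show "dense_in (\<lambda>x. h x * u x \<noteq> 0) V" by (rule dense_in_mono) simp
    show "H x = g x * u x / (h x * u x)" if "x \<in> V" "h x * u x \<noteq> 0" for x
      using H[of x] 1(6)[of x] that by simp
  qed (intro holomorphic2_on_mult 1 u)+
qed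

lemma holomorphic_on_gbinomial [holomorphic_intros]:
  "f holomorphic_on A \<Longrightarrow> (\<lambda>z. f z gchoose k :: complex) holomorphic_on A"
  unfolding gbinomial_prod_rev by (intro holomorphic_intros) auto

text \<open>Gamma(s + k) / Gamma(s) is a rising factorial, hence (-1)^k k! times a binomial
  coefficient; in this form the coefficient is a polynomial in \<open>s\<close>.\<close>

lemma gbinomial_rGamma:
  fixes s :: complex
  assumes "Re s + real k > 0"
  shows "rGamma s * ((-1) ^ k / fact k * Gamma (s + of_nat k)) = (- s) gchoose k"
proof -
  have "s + of_nat k \<notin> \<int>\<^sub>\<le>\<^sub>0" using assms by (auto elim!: nonpos_Ints_cases simp: complex_eq_iff)
  then have "rGamma (s + of_nat k) * Gamma (s + of_nat k) = 1"
    by (simp add: rGamma_inverse_Gamma Gamma_eq_zero_iff)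
  then have "rGamma s * Gamma (s + of_nat k) = pochhammer s k"
    using pochhammer_rGamma[of s k] by simp
  then show ?thesis by (simp add: gbinomial_pochhammer mult_ac)
qed

lemma not_nonpos_Ints_imp_zeta_cont:
  assumes "1 - s \<notin> \<int>\<^sub>\<le>\<^sub>0"
  shows "zeta_cont (s - of_nat k) = zeta (s - of_nat k)"
proof -
  have "s - of_nat k \<noteq> 1"
  proof
    assume "s - of_nat k = 1"
    then have "1 - s = - of_nat k" by (simp add: algebra_simps)
    then show False using assms by simp
  qed
  then show ?thesis by (simp add: zeta_eq_zeta_cont)
qed

locale dirichlet_quotient = dirichlet_coeffs +
  fixes N D :: "complex \<Rightarrow> complex" and x0 :: complex
  assumes N: "N holomorphic_on UNIV" and D: "D holomorphic_on UNIV" and D_x0: "D x0 \<noteq> 0"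
    and Q_eq: "\<And>s. D s \<noteq> 0 \<Longrightarrow> Q s = N s / D s"
begin

definition cont_part :: "nat \<Rightarrow> complex \<times> complex \<Rightarrow> complex" where
  "cont_part K p = (\<Sum>k<K. ((- snd p) gchoose k) * zeta (fst p - of_nat k) * Q (snd p + of_nat k)) +
     Gamma (fst p + snd p - 1) * Gamma (1 - fst p) * rGamma (snd p) * Q (fst p + snd p - 1) +
     rGamma (snd p) * mellin_rem K p"

lemma quot2_on_cont_part: "quot2_on (cont_part K) (rem_domain K)"
proof -
  let ?V = "rem_domain K"
  note V = open_rem_domain[of K]
  have Ga: "Gamma x = 1 / rGamma x" for x :: complex by (simp add: rGamma_inverse_Gamma divide_inverse)
  have rG: "(rGamma :: complex \<Rightarrow> complex) holomorphic_on UNIV" by (intro holomorphic_intros)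
  have rG1: "rGamma 1 \<noteq> (0 :: complex)" by simp
  have gb: "(\<lambda>z::complex. (- z) gchoose k) holomorphic_on UNIV" for k by (intro holomorphic_intros)
  have 1: "quot2_on (\<lambda>p. (- snd p) gchoose k) ?V" for k
    using quot2_on_entire_affine[OF gb, of 0 1 ?V 0] V by simp
  have "quot2_on (\<lambda>p. zeta (1 * fst p + 0 * snd p + (- of_nat k))) ?V" for k
    by (rule quot2_on_affine[OF holomorphic_on_zeta_num, of "\<lambda>s. s - 1" 0])
       (auto intro!: holomorphic_intros simp: zeta_eq)
  then have 2: "quot2_on (\<lambda>p. zeta (fst p - of_nat k)) ?V" for k by simp
  have 3: "quot2_on (\<lambda>p. Q (snd p + of_nat k)) ?V" for k
    using quot2_on_affine[OF N D D_x0 Q_eq, of 0 1 ?V "of_nat k"] V by simp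
  have 4: "quot2_on (\<lambda>p. Q (fst p + snd p - 1)) ?V"
    using quot2_on_affine[OF N D D_x0 Q_eq, of 1 1 ?V "-1"] V by simp
  have 5: "quot2_on (\<lambda>p. Gamma (fst p + snd p - 1)) ?V"
    using quot2_on_affine[OF holomorphic_on_const[of 1] rG rG1 Ga, of 1 1 ?V "-1"] V by simp
  have "quot2_on (\<lambda>p. Gamma (- 1 * fst p + 0 * snd p + 1)) ?V"
    by (rule quot2_on_affine[OF holomorphic_on_const[of 1] rG rG1 Ga]) (use V in auto)
  then have 6: "quot2_on (\<lambda>p. Gamma (1 - fst p)) ?V" by simp
  have 7: "quot2_on (\<lambda>p. rGamma (snd p)) ?V"
    using quot2_on_entire_affine[OF rG, of 0 1 ?V 0] V by simp
  have 8: "quot2_on (mellin_rem K) ?V" by (rule quot2_on_holomorphic[OF holomorphic2_on_mellin_rem V])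
  show ?thesis
    unfolding cont_part_def
    by (intro quot2_on_add quot2_on_mult quot2_on_sum 1 2 3 4 5 6 7 8 V) simp
qed

text \<open>The expansion of order K is inserted under the integral, where each power has a
  convergent Mellin transform. At s1 = 1, 2, ... the expansion degenerates, since a pole of Gamma(1
  - s1) meets one of zeta(s1 - k).\<close>

lemma mellin_double_eq_cont_part:
  assumes p: "p \<in> series_domain" "p \<in> rem_domain K" and K: "K \<ge> 2" and np: "1 - fst p \<notin> \<int>\<^sub>\<le>\<^sub>0"
  shows "rGamma (snd p) * mellin_double p = cont_part K p"
proof -
  obtain s1 s2 where s: "p = (s1, s2)" by force
  have re: "Re s2 > 2 * \<sigma>" "Re (s1 + s2) > 2 * \<sigma>" "Re s1 < real K"
    using p by (auto simp: s series_domain_def rem_domain_def)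
  have np': "1 - s1 \<notin> \<int>\<^sub>\<le>\<^sub>0" using np by (simp add: s)
  let ?P = "\<lambda>z t. of_real t powr (z - 1) * expsum t"
  let ?b = "\<lambda>k. zeta (s1 - of_nat k) * ((-1) ^ k / fact k)"
  have eq: "of_real t powr (s2 - 1) * expsum t * expzeta s1 (of_real t) =
     (Gamma (1 - s1) * ?P (s1 + s2 - 1) t + (\<Sum>k<K. ?b k * ?P (s2 + of_nat k) t)) +
      of_real t powr (s2 - 1) * expsum t * expzeta_rem K s1 t" if t: "t > 0" for t
  proof -
    have p1: "of_real t powr (s2 - 1) * of_real t powr (s1 - 1) = complex_of_real t powr (s1 + s2 - 1 - 1)"
    proof -
      have e: "s1 + s2 - 1 - 1 = (s2 - 1) + (s1 - 1)" by simp
      show ?thesis unfolding e powr_add by simp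
    qed
    have p2: "of_real t powr (s2 - 1) * (- of_real t) ^ k = (-1) ^ k * complex_of_real t powr (s2 + of_nat k - 1)" for k
    proof -
      have e: "s2 + of_nat k - 1 = (s2 - 1) + of_nat k" by simp
      have "complex_of_real t powr (of_nat k) = of_real t ^ k" using t by simp
      then show ?thesis unfolding e powr_add by (subst power_minus) simp
    qed
    have "of_real t powr (s2 - 1) * expsum t * expzeta s1 (of_real t) =
       expsum t * (Gamma (1 - s1) * (of_real t powr (s2 - 1) * of_real t powr (s1 - 1)) +
         (\<Sum>k<K. zeta_cont (s1 - of_nat k) * (of_real t powr (s2 - 1) * (- of_real t) ^ k) / fact k) +
         of_real t powr (s2 - 1) * expzeta_rem K s1 t)"
      unfolding expzeta_eq_expansion[OF re(3) K np' t] expzeta_expansion_def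
      by (simp add: distrib_left sum_distrib_left mult_ac)
    then show ?thesis
      unfolding p1 p2 not_nonpos_Ints_imp_zeta_cont[OF np']
      by (simp add: distrib_left sum_distrib_left mult_ac)
  qed
  have i1: "integrable pos_lborel (?P (s1 + s2 - 1))" using re sigma_ge by (intro integrable_mellin) auto
  have i2: "integrable pos_lborel (?P (s2 + of_nat k))" for k using re sigma_ge by (intro integrable_mellin) auto
  have i3: "integrable pos_lborel (\<lambda>t. of_real t powr (s2 - 1) * expsum t * expzeta_rem K s1 t)"
    using integrable_mellin_rem[OF p(2)] by (simp add: s)
  have v1: "(\<integral>t. ?P (s1 + s2 - 1) t \<partial>pos_lborel) = Gamma (s1 + s2 - 1) * Q (s1 + s2 - 1)"
    using re sigma_ge by (intro integral_mellin) auto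
  have v2: "(\<integral>t. ?P (s2 + of_nat k) t \<partial>pos_lborel) = Gamma (s2 + of_nat k) * Q (s2 + of_nat k)" for k
    using re sigma_ge by (intro integral_mellin) auto
  have isum: "integrable pos_lborel (\<lambda>t. \<Sum>k<K. ?b k * ?P (s2 + of_nat k) t)"
    by (intro Bochner_Integration.integrable_sum integrable_mult_right i2)
  have "mellin_double p = (\<integral>t. (Gamma (1 - s1) * ?P (s1 + s2 - 1) t + (\<Sum>k<K. ?b k * ?P (s2 + of_nat k) t)) +
      of_real t powr (s2 - 1) * expsum t * expzeta_rem K s1 t \<partial>pos_lborel)"
    unfolding mellin_double_def s fst_conv snd_conv
    by (intro Bochner_Integration.integral_cong refl eq) simp
  also have "\<dots> = (\<integral>t. Gamma (1 - s1) * ?P (s1 + s2 - 1) t + (\<Sum>k<K. ?b k * ?P (s2 + of_nat k) t) \<partial>pos_lborel) + mellin_rem K p"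
    unfolding mellin_rem_def s fst_conv snd_conv
    by (rule Bochner_Integration.integral_add[OF Bochner_Integration.integrable_add[OF integrable_mult_right[OF i1] isum] i3])
  also have "(\<integral>t. Gamma (1 - s1) * ?P (s1 + s2 - 1) t + (\<Sum>k<K. ?b k * ?P (s2 + of_nat k) t) \<partial>pos_lborel) =
     Gamma (1 - s1) * (Gamma (s1 + s2 - 1) * Q (s1 + s2 - 1)) + (\<integral>t. (\<Sum>k<K. ?b k * ?P (s2 + of_nat k) t) \<partial>pos_lborel)"
    unfolding Bochner_Integration.integral_add[OF integrable_mult_right[OF i1] isum] integral_mult_right_zero v1 ..
  also have "(\<integral>t. (\<Sum>k<K. ?b k * ?P (s2 + of_nat k) t) \<partial>pos_lborel) = (\<Sum>k<K. ?b k * (Gamma (s2 + of_nat k) * Q (s2 + of_nat k)))"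
    unfolding v2[symmetric] integral_mult_right_zero[symmetric]
    by (intro Bochner_Integration.integral_sum integrable_mult_right i2)
  finally have "rGamma s2 * mellin_double p = Gamma (s1 + s2 - 1) * Gamma (1 - s1) * rGamma s2 * Q (s1 + s2 - 1) +
     (\<Sum>k<K. (rGamma s2 * ((-1) ^ k / fact k * Gamma (s2 + of_nat k))) * zeta (s1 - of_nat k) * Q (s2 + of_nat k)) + rGamma s2 * mellin_rem K p"
    by (simp add: distrib_left sum_distrib_left mult_ac)
  also have "(\<Sum>k<K. (rGamma s2 * ((-1) ^ k / fact k * Gamma (s2 + of_nat k))) * zeta (s1 - of_nat k) * Q (s2 + of_nat k)) =
    (\<Sum>k<K. ((- s2) gchoose k) * zeta (s1 - of_nat k) * Q (s2 + of_nat k))"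
  proof (rule sum.cong[OF refl])
    fix k
    have g: "rGamma s2 * ((-1) ^ k / fact k * Gamma (s2 + of_nat k)) = (- s2) gchoose k"
      by (rule gbinomial_rGamma) (use re sigma_ge in linarith)
    show "(rGamma s2 * ((-1) ^ k / fact k * Gamma (s2 + of_nat k))) * zeta (s1 - of_nat k) * Q (s2 + of_nat k) =
      ((- s2) gchoose k) * zeta (s1 - of_nat k) * Q (s2 + of_nat k)" by (simp only: g)
  qed
  finally show ?thesis unfolding cont_part_def s by simp
qed

text \<open>One power of t moves from the remainder to the explicit sum; on the smaller domain its
  Mellin transform converges and equals Gamma(s2 + K) Q(s2 + K).\<close>

lemma cont_part_Suc:
  assumes p: "p \<in> rem_domain K" and K: "K \<ge> 2" and np: "1 - fst p \<notin> \<int>\<^sub>\<le>\<^sub>0"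
  shows "cont_part (Suc K) p = cont_part K p"
proof -
  obtain s1 s2 where s: "p = (s1, s2)" by force
  have re: "Re s1 < real K" "Re (s2 + of_nat K) \<ge> \<sigma>" using p by (auto simp: s rem_domain_def)
  have np': "1 - s1 \<notin> \<int>\<^sub>\<le>\<^sub>0" using np by (simp add: s)
  have p': "p \<in> rem_domain (Suc K)" using p rem_domain_mono by blast
  let ?b = "zeta (s1 - of_nat K) * ((-1) ^ K / fact K)"
  let ?P = "\<lambda>t. of_real t powr (s2 + of_nat K - 1) * expsum t"
  have eq: "of_real t powr (s2 - 1) * expsum t * expzeta_rem K s1 t =
     ?b * ?P t + of_real t powr (s2 - 1) * expsum t * expzeta_rem (Suc K) s1 t" if t: "t > 0" for t
  proof -
    have re': "Re s1 < real (Suc K)" "Suc K \<ge> 2" using re K by auto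
    have "expzeta_expansion K zeta_cont s1 t = expzeta_expansion (Suc K) zeta_cont s1 t"
      using expzeta_eq_expansion[OF re(1) K np' t] expzeta_eq_expansion[OF re' np' t] by simp
    then have rem: "expzeta_rem K s1 t = zeta (s1 - of_nat K) * (- of_real t) ^ K / fact K + expzeta_rem (Suc K) s1 t"
      unfolding expzeta_expansion_def not_nonpos_Ints_imp_zeta_cont[OF np'] by (simp del: expzeta_rem.simps)
    have e: "s2 + of_nat K - 1 = (s2 - 1) + of_nat K" by simp
    have "complex_of_real t powr (of_nat K) = of_real t ^ K" using t by simp
    moreover have "(- complex_of_real t) ^ K = (-1) ^ K * of_real t ^ K" by (rule power_minus)
    ultimately show ?thesis unfolding rem e powr_add by (simp add: distrib_left mult_ac del: expzeta_rem.simps)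
  qed
  have i1: "integrable pos_lborel ?P" by (rule integrable_mellin[OF re(2)])
  have i2: "integrable pos_lborel (\<lambda>t. of_real t powr (s2 - 1) * expsum t * expzeta_rem (Suc K) s1 t)"
    using integrable_mellin_rem[OF p'] by (simp add: s del: expzeta_rem.simps)
  have "mellin_rem K p = (\<integral>t. ?b * ?P t + of_real t powr (s2 - 1) * expsum t * expzeta_rem (Suc K) s1 t \<partial>pos_lborel)"
    unfolding mellin_rem_def s fst_conv snd_conv by (intro Bochner_Integration.integral_cong refl eq) simp
  also have "\<dots> = ?b * (Gamma (s2 + of_nat K) * Q (s2 + of_nat K)) + mellin_rem (Suc K) p"
    unfolding Bochner_Integration.integral_add[OF integrable_mult_right[OF i1] i2] integral_mult_right_zero integral_mellin[OF re(2)]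
    by (simp add: mellin_rem_def s del: expzeta_rem.simps)
  finally have "rGamma s2 * mellin_rem K p =
     (rGamma s2 * ((-1) ^ K / fact K * Gamma (s2 + of_nat K))) * zeta (s1 - of_nat K) * Q (s2 + of_nat K) + rGamma s2 * mellin_rem (Suc K) p"
    by (simp add: distrib_left mult_ac)
  also have "rGamma s2 * ((-1) ^ K / fact K * Gamma (s2 + of_nat K)) = (- s2) gchoose K"
    using re(2) sigma_ge by (intro gbinomial_rGamma) simp
  finally show ?thesis unfolding cont_part_def s by simp
qed

text \<open>Glues the formulas of all orders: every point lies in \<open>rem_domain K\<close> for
  large K, and off the lines s1 = 1, 2, ... the value does not depend on K.\<close>

definition double_cont :: "complex \<times> complex \<Rightarrow> complex" where
  "double_cont p = cont_part (LEAST K. K \<ge> 2 \<and> p \<in> rem_domain K) p"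

lemma double_cont_eq:
  assumes p: "p \<in> rem_domain K" and K: "K \<ge> 2" and np: "1 - fst p \<notin> \<int>\<^sub>\<le>\<^sub>0"
  shows "double_cont p = cont_part K p"
proof -
  define L where "L = (LEAST K. K \<ge> 2 \<and> p \<in> rem_domain K)"
  have L: "L \<ge> 2" "p \<in> rem_domain L" using LeastI[of "\<lambda>K. K \<ge> 2 \<and> p \<in> rem_domain K" K] p K by (auto simp: L_def)
  have "L \<le> K" unfolding L_def by (rule Least_le) (use p K in simp)
  then have "p \<in> rem_domain K \<and> cont_part K p = cont_part L p"
  proof (induction K rule: dec_induct)
    case base
    then show ?case using L by simp
  next
    case (step k)
    then show ?case using cont_part_Suc[of p k] L(1) np rem_domain_mono[of k] by auto
  qed
  then show ?thesis unfolding double_cont_def L_def by simp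
qed

lemma ex_rem_domain: obtains K where "K \<ge> 2" "p \<in> rem_domain K"
proof -
  obtain K :: nat where "max (max (Re (fst p)) (\<sigma> - Re (snd p))) 2 < real K" using reals_Archimedean2 by blast
  then have "K \<ge> 2" "p \<in> rem_domain K" by (auto simp: rem_domain_def)
  then show thesis by (rule that)
qed

text \<open>The excluded lines s1 = 1, 2, ... are the zeros of the entire function 1 / Gamma(1 -
  s1).\<close>

lemma dense_in_regular_first: "open V \<Longrightarrow> dense_in (\<lambda>p. 1 - fst p \<notin> \<int>\<^sub>\<le>\<^sub>0) (V :: (complex \<times> complex) set)"
proof -
  assume V: "open V"
  have "dense_in (\<lambda>p. rGamma (- 1 * fst p + 0 * snd p + 1) \<noteq> (0::complex)) V"
    by (rule dense_in_nonzero_affine[of rGamma 1]) (use V in \<open>auto intro!: holomorphic_intros\<close>)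
  then show ?thesis by (rule dense_in_mono) (auto simp: rGamma_eq_zero_iff)
qed

text \<open>The least order in \<open>double_cont\<close> varies with the point; off the zeros of 1
  / Gamma(1 - s1) one fixed K may replace it, and \<open>quot2_on_modify\<close> takes care of those
  zeros.\<close>

lemma quot2_on_double_cont: "\<exists>V. p \<in> V \<and> quot2_on double_cont V"
proof -
  obtain K where K: "K \<ge> 2" "p \<in> rem_domain K" by (rule ex_rem_domain)
  have "quot2_on double_cont (rem_domain K)"
  proof (rule quot2_on_modify[OF quot2_on_cont_part])
    have "(rGamma :: complex \<Rightarrow> complex) holomorphic_on UNIV" by (intro holomorphic_intros)
    from holomorphic2_on_compose_affine[OF this open_UNIV, of "rem_domain K" "-1" 0 1]
    show "(\<lambda>p. rGamma (1 - fst p)) holomorphic2_on rem_domain K" by (simp add: case_prod_unfold)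
    show "dense_in (\<lambda>p. rGamma (1 - fst p) \<noteq> (0::complex)) (rem_domain K)"
      by (rule dense_in_mono[OF dense_in_regular_first[OF open_rem_domain]]) (simp add: rGamma_eq_zero_iff)
    show "double_cont p = cont_part K p" if "p \<in> rem_domain K" "rGamma (1 - fst p) \<noteq> 0" for p
      using that K(1) by (intro double_cont_eq) (auto simp: rGamma_eq_zero_iff)
  qed
  then show ?thesis using K by blast
qed

lemma double_cont_series:
  assumes p: "(s1, s2) \<in> series_domain" and np: "1 - s1 \<notin> \<int>\<^sub>\<le>\<^sub>0"
  shows "double_cont (s1, s2) = (\<Sum>\<^sub>\<infinity>m1\<in>{1..}. \<Sum>\<^sub>\<infinity>m2\<in>{1..}. double_term (\<lambda>_. 1) c s1 s2 m1 m2)"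
proof -
  obtain K where K: "K \<ge> 2" "(s1, s2) \<in> rem_domain K" by (rule ex_rem_domain)
  show ?thesis
    unfolding double_series_eq[OF p] using double_cont_eq[OF K(2,1)] mellin_double_eq_cont_part[OF p K(2,1)] np by simp
qed

text \<open>On the lines s1 = 1, 2, ... the formula carries no information; filling restores the
  values of the series, because 1 / Gamma(s2) times the Mellin integral is holomorphic on all of
  \<open>series_domain\<close>.\<close>

lemma double_continuation_exists: "double_continuation (\<lambda>_. 1) c (fill_removable double_cont)"
  unfolding double_continuation_def
proof (intro conjI exI allI impI)
  show "nicely_meromorphic2 (fill_removable double_cont)"
    by (rule nicely_meromorphic2_fill_removable[OF quot2_on_double_cont])
  fix s1 s2 assume "Re s2 > 2 * \<sigma> \<and> Re (s1 + s2) > 2 * \<sigma>"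
  then have p: "(s1, s2) \<in> series_domain" by (simp add: series_domain_def)
  then show "(\<lambda>(m1, m2). norm (double_term (\<lambda>_. 1) c s1 s2 m1 m2)) summable_on ({1..} \<times> {1..})"
    by (rule double_term_summable)
  let ?S = "\<lambda>p. rGamma (snd p) * mellin_double p"
  have "(rGamma :: complex \<Rightarrow> complex) holomorphic_on UNIV" by (intro holomorphic_intros)
  from holomorphic2_on_compose_affine[OF this open_UNIV, of series_domain 0 1 0]
  have "(\<lambda>p. rGamma (snd p)) holomorphic2_on series_domain" by (simp add: case_prod_unfold)
  from holomorphic2_on_mult[OF this holomorphic2_on_mellin_double]
  have hol: "?S holomorphic2_on series_domain" .
  have "fill_removable double_cont (s1, s2) = ?S (s1, s2)"
  proof (rule fill_removable_eq[OF quot2_on_double_cont open_series_domain p hol])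
    show "dense_in (\<lambda>p. double_cont p = ?S p) series_domain"
    proof (rule dense_in_mono[OF dense_in_regular_first[OF open_series_domain]])
      fix q assume q: "q \<in> series_domain" "1 - fst q \<notin> \<int>\<^sub>\<le>\<^sub>0"
      obtain K where K: "K \<ge> 2" "q \<in> rem_domain K" by (rule ex_rem_domain)
      show "double_cont q = ?S q"
        using double_cont_eq[OF K(2,1) q(2)] mellin_double_eq_cont_part[OF q(1) K(2,1) q(2)] by simp
    qed
  qed
  then show "fill_removable double_cont (s1, s2) = (\<Sum>\<^sub>\<infinity>m1\<in>{1..}. \<Sum>\<^sub>\<infinity>m2\<in>{1..}. double_term (\<lambda>_. 1) c s1 s2 m1 m2)"
    unfolding double_series_eq[OF p] by simp
qed

text \<open>Whichever continuation \<open>SOME\<close> picks, it equals the series somewhere and so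
  agrees with \<open>double_cont\<close> on an open set. A holomorphic \<open>g\<close> that equals
  \<open>cont_part\<close> off the lines s1 = 1, 2, ... then gives its value, also on these
  lines.\<close>

theorem Phi2_eqI:
  assumes V: "open V" "(s1, s2) \<in> V" "V \<subseteq> rem_domain K" and K: "K \<ge> 2" and g: "g holomorphic2_on V"
    and eq: "\<And>p. p \<in> V \<Longrightarrow> 1 - fst p \<notin> \<int>\<^sub>\<le>\<^sub>0 \<Longrightarrow> cont_part K p = g p"
  shows "Phi2 s1 s2 (\<lambda>_. 1) c = g (s1, s2)"
proof -
  define F where "F = (SOME F. double_continuation (\<lambda>_. 1) c F)"
  have F: "double_continuation (\<lambda>_. 1) c F"
    unfolding F_def by (rule someI[of "double_continuation (\<lambda>_. 1) c"]) (rule double_continuation_exists)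
  then obtain \<rho> where nice: "nicely_meromorphic2 F"
    and ser: "\<And>s1 s2. Re s2 > \<rho> \<Longrightarrow> Re (s1 + s2) > \<rho> \<Longrightarrow>
      F (s1, s2) = (\<Sum>\<^sub>\<infinity>m1\<in>{1..}. \<Sum>\<^sub>\<infinity>m2\<in>{1..}. double_term (\<lambda>_. 1) c s1 s2 m1 m2)"
    unfolding double_continuation_def by blast
  define M where "M = max \<rho> (2 * \<sigma>)"
  \<comment> \<open>Re s1 < 1 keeps \<open>W\<close> off those lines, and \<open>M\<close> places it
    where the chosen continuation and \<open>double_cont\<close> both equal the series.\<close>
  define W where "W = {p :: complex \<times> complex. Re (snd p) > M \<and> Re (fst p + snd p) > M \<and> Re (fst p) < 1}"
  have W: "open W" unfolding W_def by (intro open_Collect_conj open_Collect_less continuous_intros)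
  have "(0, of_real (M + 1)) \<in> W" by (simp add: W_def)
  then have W0: "W \<noteq> {}" by blast
  have FG: "F p = double_cont p" if p: "p \<in> W" for p
  proof -
    obtain s1 s2 where s: "p = (s1, s2)" by force
    have np: "1 - s1 \<notin> \<int>\<^sub>\<le>\<^sub>0" using p by (auto elim!: nonpos_Ints_cases simp: complex_eq_iff W_def s)
    have "(s1, s2) \<in> series_domain" using p by (auto simp: W_def M_def s series_domain_def)
    moreover have "Re s2 > \<rho>" "Re (s1 + s2) > \<rho>" using p by (auto simp: W_def M_def s)
    ultimately show ?thesis using ser double_cont_series[OF _ np] s by simp
  qed
  have "F (s1, s2) = g (s1, s2)"
  proof (rule nicely_meromorphic2_eqI[OF nice quot2_on_double_cont W W0 FG V(1) g _ V(2)])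
    show "dense_in (\<lambda>p. double_cont p = g p) V"
    proof (rule dense_in_mono[OF dense_in_regular_first[OF V(1)]])
      fix p assume p: "p \<in> V" "1 - fst p \<notin> \<int>\<^sub>\<le>\<^sub>0"
      then show "double_cont p = g p" using double_cont_eq[of p K] eq[of p] V(3) K by auto
    qed
  qed
  then show ?thesis by (simp add: Phi2_def F_def)
qed

end

section \<open>Behaviour at the integer points\<close>

lemma holomorphic2_on_compose_pair:
  assumes f: "f holomorphic2_on A" and A: "open A" and g: "g1 holomorphic2_on U" "g2 holomorphic2_on U"
    and sub: "\<And>x. x \<in> U \<Longrightarrow> (g1 x, g2 x) \<in> A"
  shows "(\<lambda>x. f (g1 x, g2 x)) holomorphic2_on U"
  unfolding holomorphic2_on_def
proof
  fix p assume p: "p \<in> U"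
  obtain a1 b1 where d1: "(g1 has_derivative (\<lambda>(u, v). a1 * u + b1 * v)) (at p within U)"
    using g(1) p unfolding holomorphic2_on_def by meson
  obtain a2 b2 where d2: "(g2 has_derivative (\<lambda>(u, v). a2 * u + b2 * v)) (at p within U)"
    using g(2) p unfolding holomorphic2_on_def by meson
  obtain a b where d: "(f has_derivative (\<lambda>(u, v). a * u + b * v)) (at (g1 p, g2 p))"
    using holomorphic2_onD[OF f A sub[OF p]] by blast
  from has_derivative_compose[OF has_derivative_Pair[OF d1 d2] d]
  show "\<exists>a b. ((\<lambda>x. f (g1 x, g2 x)) has_derivative (\<lambda>(u, v). a * u + b * v)) (at p within U)"
    by (intro exI[of _ "a * a1 + b * a2"] exI[of _ "a * b1 + b * b2"]) (simp add: case_prod_unfold algebra_simps)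
qed

lemma holomorphic_on_slice_snd:
  assumes "f holomorphic2_on U" "open U" "\<And>z. z \<in> A \<Longrightarrow> (a, b + z) \<in> U"
  shows "(\<lambda>z. f (a, b + z)) holomorphic_on A"
  unfolding holomorphic_on_def
proof
  fix z assume "z \<in> A"
  then obtain u v where d: "(f has_derivative (\<lambda>(x, y). u * x + v * y)) (at (a, b + z))"
    using holomorphic2_onD[OF assms(1,2) assms(3)] by blast
  have "((\<lambda>z. (a, b + z)) has_derivative (\<lambda>h. (0, h))) (at z)"
    by (auto intro!: derivative_eq_intros)
  from has_derivative_compose[OF this d]
  have "((\<lambda>z. f (a, b + z)) has_field_derivative v) (at z)"
    by (simp add: has_field_derivative_def)
  then show "(\<lambda>z. f (a, b + z)) field_differentiable at z within A"
    using field_differentiable_at_within field_differentiable_def by blast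
qed

text \<open>With the derivative on the diagonal the quotient is jointly holomorphic; it expresses
  the cancellation of poles at positive integers s1.\<close>

definition diff_quot :: "(complex \<Rightarrow> complex) \<Rightarrow> complex \<Rightarrow> complex \<Rightarrow> complex" where
  "diff_quot f x y = (if x = y then deriv f y else (f x - f y) / (x - y))"

lemma diff_quot_commute: "diff_quot f x y = diff_quot f y x"
proof (cases "x = y")
  case False
  then have "(f x - f y) / (x - y) = (f y - f x) / (y - x)"
    by (simp add: frac_eq_eq algebra_simps)
  then show ?thesis using False by (simp add: diff_quot_def)
qed (simp add: diff_quot_def)

lemma holomorphic_on_diff_quot:
  "f holomorphic_on S \<Longrightarrow> open S \<Longrightarrow> (\<lambda>x. diff_quot f x y) holomorphic_on S"
  unfolding diff_quot_def by (rule pole_lemma_open)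

text \<open>Holomorphy in each variable is the removal of one singularity, and the quotient is
  symmetric; on a smaller ball the mean value inequality bounds it by the supremum of |f'|, so
  Osgood's lemma applies.\<close>

lemma holomorphic2_on_diff_quot:
  assumes f: "f holomorphic_on ball w \<rho>"
  shows "(\<lambda>p. diff_quot f (fst p) (snd p)) holomorphic2_on ball w \<rho> \<times> ball w \<rho>"
proof (rule holomorphic2_onI_separate)
  show "open (ball w \<rho> \<times> ball w \<rho>)" by (intro open_Times open_ball)
  fix p :: "complex \<times> complex" assume p: "p \<in> ball w \<rho> \<times> ball w \<rho>"
  define \<mu> where "\<mu> = max (dist w (fst p)) (dist w (snd p))"
  have "\<mu> < \<rho>" using p by (auto simp: \<mu>_def)
  then obtain \<rho>' where \<rho>': "\<mu> < \<rho>'" "\<rho>' < \<rho>" using dense by blast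
  have sub: "cball w \<rho>' \<subseteq> ball w \<rho>" using \<rho>' by auto
  have "continuous_on (cball w \<rho>') (deriv f)"
    using holomorphic_deriv[OF f open_ball] sub holomorphic_on_imp_continuous_on continuous_on_subset by blast
  then have "bounded (deriv f ` cball w \<rho>')" by (intro compact_imp_bounded compact_continuous_image) auto
  then obtain B where B: "\<forall>y\<in>deriv f ` cball w \<rho>'. norm y \<le> B" unfolding bounded_iff by blast
  have der: "(f has_field_derivative deriv f z) (at z within ball w \<rho>')" if "z \<in> ball w \<rho>'" for z
  proof -
    have "z \<in> ball w \<rho>" using that \<rho>' by simp
    then have "(f has_field_derivative deriv f z) (at z)" by (rule holomorphic_derivI[OF f open_ball])
    then show ?thesis by (rule has_field_derivative_at_within)
  qed
  have bd: "norm (diff_quot f x y) \<le> B" if x: "x \<in> ball w \<rho>'" and y: "y \<in> ball w \<rho>'" for x y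
  proof (cases "x = y")
    case True
    then show ?thesis using B y by (auto simp: diff_quot_def)
  next
    case False
    have "norm (f x - f y) \<le> B * norm (x - y)"
      by (rule field_differentiable_bound[OF convex_ball der _ x y]) (use B in auto)
    then show ?thesis using False by (simp add: diff_quot_def norm_divide divide_le_eq)
  qed
  show "\<exists>V B. open V \<and> p \<in> V \<and> V \<subseteq> ball w \<rho> \<times> ball w \<rho> \<and> (\<forall>x\<in>V. norm (diff_quot f (fst x) (snd x)) \<le> B)"
  proof (rule exI[of _ "ball w \<rho>' \<times> ball w \<rho>'"], rule exI[of _ B], intro conjI ballI)
    show "open (ball w \<rho>' \<times> ball w \<rho>')" by (intro open_Times open_ball)
    show "p \<in> ball w \<rho>' \<times> ball w \<rho>'" using \<rho>'(1) by (cases p) (auto simp: \<mu>_def)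
    show "ball w \<rho>' \<times> ball w \<rho>' \<subseteq> ball w \<rho> \<times> ball w \<rho>" using \<rho>'(2) by auto
    show "norm (diff_quot f (fst x) (snd x)) \<le> B" if "x \<in> ball w \<rho>' \<times> ball w \<rho>'" for x
      using that by (intro bd) auto
  qed
next
  fix a b assume ab: "(a, b) \<in> ball w \<rho> \<times> ball w \<rho>"
  have "(\<lambda>z. diff_quot f z b) holomorphic_on ball w \<rho>" by (rule holomorphic_on_diff_quot[OF f open_ball])
  then show "(\<lambda>z. diff_quot f (fst (z, b)) (snd (z, b))) field_differentiable at a"
    using ab holomorphic_on_imp_differentiable_at[OF _ open_ball] by auto
  have "(\<lambda>z. diff_quot f z a) holomorphic_on ball w \<rho>" by (rule holomorphic_on_diff_quot[OF f open_ball])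
  then have "(\<lambda>z. diff_quot f a z) holomorphic_on ball w \<rho>" by (simp only: diff_quot_commute[of f a])
  then show "(\<lambda>z. diff_quot f (fst (a, z)) (snd (a, z))) field_differentiable at b"
    using ab holomorphic_on_imp_differentiable_at[OF _ open_ball] by auto
qed

text \<open>(H(z) - H(0)) / z has a limit at 0. The case k = 0 serves the simple pole in eps, k = 1
  the double one.\<close>

lemma bigo_simple_pole:
  fixes f :: "real \<Rightarrow> complex"
  assumes H: "H field_differentiable at 0" and r: "r > 0"
    and f: "\<And>\<epsilon>. 0 < \<epsilon> \<Longrightarrow> \<epsilon> < r \<Longrightarrow> f \<epsilon> = H (of_real \<epsilon>) / of_real \<epsilon> ^ Suc k"
  shows "(\<lambda>\<epsilon>. f \<epsilon> - H 0 / of_real \<epsilon> ^ Suc k) \<in> O[at_right 0](\<lambda>\<epsilon>. 1 / of_real \<epsilon> ^ k)"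
proof -
  obtain d where d: "(H has_field_derivative d) (at 0)" using H field_differentiable_def by blast
  have flim: "filterlim complex_of_real (at 0) (at_right 0)"
    unfolding filterlim_at
  proof (intro conjI)
    show "\<forall>\<^sub>F x in at_right 0. complex_of_real x \<in> UNIV \<and> complex_of_real x \<noteq> 0"
      using eventually_at_right_less[of 0] by eventually_elim auto
    have "(complex_of_real \<longlongrightarrow> of_real 0) (at_right 0)" by (intro tendsto_intros)
    then show "(complex_of_real \<longlongrightarrow> 0) (at_right 0)" by simp
  qed
  have "((\<lambda>z. (H z - H 0) / z) \<longlongrightarrow> d) (at 0)" using d by (simp add: has_field_derivative_iff)
  then have lim: "((\<lambda>\<epsilon>. (H (of_real \<epsilon>) - H 0) / of_real \<epsilon>) \<longlongrightarrow> d) (at_right 0)"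
    by (rule filterlim_compose[OF _ flim])
  have ev: "\<forall>\<^sub>F \<epsilon> in at_right 0. 0 < \<epsilon> \<and> \<epsilon> < r"
    using r by (simp add: eventually_at_right_field) (meson dense)
  show ?thesis
  proof (rule bigoI_tendsto)
    show "((\<lambda>\<epsilon>. (f \<epsilon> - H 0 / of_real \<epsilon> ^ Suc k) / (1 / of_real \<epsilon> ^ k)) \<longlongrightarrow> d) (at_right 0)"
    proof (rule Lim_transform_eventually[OF lim])
      show "\<forall>\<^sub>F \<epsilon> in at_right 0. (H (of_real \<epsilon>) - H 0) / of_real \<epsilon> = (f \<epsilon> - H 0 / of_real \<epsilon> ^ Suc k) / (1 / of_real \<epsilon> ^ k)"
        using ev by eventually_elim (simp add: f divide_simps)
    qed
    show "\<forall>\<^sub>F \<epsilon> in at_right 0. 1 / complex_of_real \<epsilon> ^ k \<noteq> 0"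
      using ev by eventually_elim simp
  qed
qed

lemma norm_of_int_lt_1: "norm (of_int j :: complex) < 1 \<Longrightarrow> j = 0"
  by (metis norm_of_int of_int_abs of_int_less_1_iff zabs_less_one_iff)

lemma punctured_ball_not_Int:
  fixes w :: complex
  assumes "w \<in> ball (of_int j) 1 - {of_int j}"
  shows "w \<notin> \<int>"
proof
  assume "w \<in> \<int>"
  then obtain i where i: "w = of_int i" by (elim Ints_cases)
  have "norm (of_int (j - i) :: complex) < 1" using assms i by (simp add: dist_norm)
  then have "j = i" using norm_of_int_lt_1 by fastforce
  then show False using assms i by simp
qed

lemma Re_ball:
  assumes "z \<in> ball a r"
  shows "Re a - r < Re z" "Re z < Re a + r"
  using abs_Re_le_cmod[of "a - z"] assms unfolding mem_ball dist_norm minus_complex.sel by linarith+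

lemma Re_pos_not_nonpos_Ints: "Re z > 0 \<Longrightarrow> z \<notin> \<int>\<^sub>\<le>\<^sub>0"
  by (auto elim: nonpos_Ints_cases)

text \<open>
  A neighbourhood of \<open>(a, b + \<epsilon>)\<close> on which \<open>y \<noteq> b\<close> and \<open>x + y \<noteq> a + b\<close>, so that it
  avoids the polar lines \<open>s\<^sub>2 = b\<close> and \<open>s\<^sub>1 + s\<^sub>2 = a + b\<close> when \<open>a\<close> and \<open>b\<close> are integers.
\<close>

definition corner :: "complex \<Rightarrow> complex \<Rightarrow> real \<Rightarrow> real \<Rightarrow> (complex \<times> complex) set" where
  "corner a b r \<epsilon> = ball a (min \<epsilon> (r - \<epsilon>) / 2) \<times> ball (b + of_real \<epsilon>) (min \<epsilon> (r - \<epsilon>) / 2)"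

lemma
  assumes e: "0 < \<epsilon>" "\<epsilon> < r"
  shows open_corner: "open (corner a b r \<epsilon>)" and corner_centre: "(a, b + of_real \<epsilon>) \<in> corner a b r \<epsilon>"
  using e by (auto simp: corner_def intro: open_Times)

lemma
  assumes e: "0 < \<epsilon>" "\<epsilon> < r" and xy: "(x, y) \<in> corner a b r \<epsilon>"
  shows corner_fst: "x \<in> ball a r"
    and corner_snd: "y + w \<in> ball (b + w) r - {b + w}"
    and corner_snd_near: "y + w \<in> ball (b + w + of_real \<epsilon>) (min \<epsilon> (r - \<epsilon>))"
    and corner_sum_near: "x + y + w \<in> ball (a + b + w + of_real \<epsilon>) (min \<epsilon> (r - \<epsilon>))"
    and corner_sum: "x + y + w \<in> ball (a + b + w) r - {a + b + w}"
proof -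
  \<comment> \<open>The bound eps keeps a point within delta of v + eps away from v, the bound r -
    eps keeps it in the ball of radius r about v. Coordinates are held within delta / 2 so that
    their sum is within delta.\<close>
  define \<delta> where "\<delta> = min \<epsilon> (r - \<epsilon>)"
  have d: "\<delta> \<le> \<epsilon>" "\<delta> \<le> r - \<epsilon>" "\<delta> > 0" using e by (auto simp: \<delta>_def)
  have x: "norm (x - a) < \<delta> / 2" and y: "norm (y - (b + of_real \<epsilon>)) < \<delta> / 2"
    using xy by (auto simp: corner_def \<delta>_def dist_norm norm_minus_commute)
  show "x \<in> ball a r" using x d e by (simp add: dist_norm norm_minus_commute)
  have key: "u \<in> ball v r - {v}" if "norm (u - (v + of_real \<epsilon>)) < \<delta>" for u v :: complex
  proof -
    have "norm (u - v) \<le> norm (u - (v + of_real \<epsilon>)) + norm (of_real \<epsilon> :: complex)"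
      using norm_triangle_ineq[of "u - (v + of_real \<epsilon>)" "of_real \<epsilon>"] by simp
    then have "norm (u - v) < r" using that d e by simp
    moreover have "u \<noteq> v" using that d e by auto
    ultimately show ?thesis by (simp add: dist_norm norm_minus_commute)
  qed
  have y1: "norm ((y + w) - ((b + w) + of_real \<epsilon>)) < \<delta>" using y d by (simp add: algebra_simps)
  then show "y + w \<in> ball (b + w) r - {b + w}" by (rule key)
  show "y + w \<in> ball (b + w + of_real \<epsilon>) (min \<epsilon> (r - \<epsilon>))"
    using y1 unfolding mem_ball dist_norm \<delta>_def[symmetric] by (subst norm_minus_commute)
  have "norm ((x - a) + (y - (b + of_real \<epsilon>))) < \<delta> / 2 + \<delta> / 2"
    using norm_triangle_lt x y by (meson add_strict_mono norm_triangle_ineq order_le_less_trans)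
  then have s1: "norm ((x + y + w) - ((a + b + w) + of_real \<epsilon>)) < \<delta>" by (simp add: algebra_simps)
  then show "x + y + w \<in> ball (a + b + w) r - {a + b + w}" by (rule key)
  show "x + y + w \<in> ball (a + b + w + of_real \<epsilon>) (min \<epsilon> (r - \<epsilon>))"
    using s1 unfolding mem_ball dist_norm \<delta>_def[symmetric] by (subst norm_minus_commute)
qed

lemma holomorphic2_on_compose_fst:
  assumes "f holomorphic_on A" "open A" "\<And>p. p \<in> U \<Longrightarrow> fst p + c \<in> A"
  shows "(\<lambda>p. f (fst p + c)) holomorphic2_on U"
  using holomorphic2_on_compose_affine[OF assms(1,2), of U 1 0 c] assms(3) by (force simp: case_prod_unfold)

lemma holomorphic2_on_compose_snd:
  assumes "f holomorphic_on A" "open A" "\<And>p. p \<in> U \<Longrightarrow> snd p + c \<in> A"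
  shows "(\<lambda>p. f (snd p + c)) holomorphic2_on U"
  using holomorphic2_on_compose_affine[OF assms(1,2), of U 0 1 c] assms(3) by (force simp: case_prod_unfold)

lemma holomorphic2_on_compose_sum:
  assumes "f holomorphic_on A" "open A" "\<And>p. p \<in> U \<Longrightarrow> fst p + snd p + c \<in> A"
  shows "(\<lambda>p. f (fst p + snd p + c)) holomorphic2_on U"
  using holomorphic2_on_compose_affine[OF assms(1,2), of U 1 1 c] assms(3) by (force simp: case_prod_unfold)

lemma holomorphic_on_zeta: "zeta holomorphic_on - {1}"
  unfolding zeta_eq by (intro holomorphic_intros holomorphic_on_subset[OF holomorphic_on_zeta_num]) auto

lemma Gamma_pochhammer:
  fixes s :: complex
  assumes "s + of_nat k \<notin> \<int>\<^sub>\<le>\<^sub>0"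
  shows "Gamma s = Gamma (s + of_nat k) / pochhammer s k"
  using pochhammer_rGamma[of s k] assms
  by (simp add: rGamma_inverse_Gamma field_simps inverse_eq_divide) (metis divide_divide_eq_right inverse_eq_divide inverse_inverse_eq inverse_mult_distrib mult.commute mult_1_right)

text \<open>\<open>Psi j\<close> is z Q(j + z) made holomorphic at z = 0, so \<open>Psi j 0\<close>
  is the residue of Q at j, and 0 if there is no pole.\<close>

locale dirichlet_quotient_int = dirichlet_quotient +
  fixes Psi :: "int \<Rightarrow> complex \<Rightarrow> complex" and rad :: "int \<Rightarrow> real"
  assumes rad_pos: "rad j > 0" and Psi: "Psi j holomorphic_on ball 0 (rad j)"
    and Q_Psi: "\<And>z. z \<in> ball 0 (rad j) \<Longrightarrow> z \<noteq> 0 \<Longrightarrow> Q (of_int j + z) = Psi j z / z"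
begin

lemma holomorphic_on_Q:
  assumes "r \<le> rad j"
  shows "Q holomorphic_on ball (of_int j) r - {of_int j}"
proof -
  have "(\<lambda>s. Psi j (s - of_int j)) holomorphic_on ball (of_int j) r - {of_int j}"
    by (rule holomorphic_on_compose_gen[OF _ Psi, unfolded o_def])
       (use assms in \<open>auto intro!: holomorphic_intros simp: dist_norm norm_minus_commute\<close>)
  then have "(\<lambda>s. Psi j (s - of_int j) / (s - of_int j)) holomorphic_on ball (of_int j) r - {of_int j}"
    by (intro holomorphic_intros) auto
  then show ?thesis
  proof (rule holomorphic_transform)
    fix s :: complex assume "s \<in> ball (of_int j) r - {of_int j}"
    then show "Psi j (s - of_int j) / (s - of_int j) = Q s"
      using Q_Psi[of "s - of_int j" j] assms by (simp add: dist_norm norm_minus_commute)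
  qed
qed

text \<open>A ball of radius at most 1 around an integer contains no other integer, so the puncture
  removes every pole of Gamma.\<close>

lemma holomorphic_on_Gamma_Q:
  assumes "r \<le> rad j" "r \<le> 1"
  shows "(\<lambda>w. Gamma w * Q w) holomorphic_on ball (of_int j) r - {of_int j}"
proof (rule holomorphic_on_mult[OF holomorphic_Gamma holomorphic_on_Q[OF assms(1)]])
  show "(ball (of_int j) r - {of_int j}) \<inter> \<int>\<^sub>\<le>\<^sub>0 = ({} :: complex set)"
  proof -
    have "w \<notin> \<int>\<^sub>\<le>\<^sub>0" if "w \<in> ball (of_int j) r - {of_int j}" for w :: complex
      using punctured_ball_not_Int[of w j] that assms(2) nonpos_Ints_Int[of w] by auto
    then show ?thesis by blast
  qed
qed

lemma common_radius:
  assumes "finite J"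
  obtains r where "r > 0" "r \<le> 1/2" "\<And>j. j \<in> J \<Longrightarrow> r \<le> rad j"
proof (rule that[of "Min (insert (1/2) (rad ` J))"])
  show "Min (insert (1/2) (rad ` J)) > 0" using assms rad_pos by auto
  show "Min (insert (1/2) (rad ` J)) \<le> rad j" if "j \<in> J" for j using assms that by (intro Min_le) auto
  show "Min (insert (1/2) (rad ` J)) \<le> 1/2" using assms by (intro Min_le) auto
qed

lemma holomorphic2_on_rGamma_mellin_rem:
  "V \<subseteq> rem_domain K \<Longrightarrow> (\<lambda>p. rGamma (snd p) * mellin_rem K p) holomorphic2_on V"
  using holomorphic2_on_compose_snd[OF holomorphic_rGamma open_UNIV, of V 0]
  by (intro holomorphic2_on_mult holomorphic2_on_subset[OF holomorphic2_on_mellin_rem]) auto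

lemma holomorphic2_on_gbinomial_snd: "(\<lambda>p. (- snd p) gchoose k) holomorphic2_on V"
proof -
  have "(\<lambda>z::complex. (- z) gchoose k) holomorphic_on UNIV" by (intro holomorphic_intros)
  from holomorphic2_on_compose_snd[OF this open_UNIV, of V 0] show ?thesis by simp
qed

text \<open>At s1 = -m both Gamma(1 - s1) and zeta(s1 - k) are regular, and the poles of Gamma(s1 +
  s2 - 1) and Gamma(s2) cancel to the reciprocal of a rising factorial, nonzero because m < 2 l.
  What remains are the simple poles of Q: at k - n from the sum and at - 2 l from the Gamma
  term.\<close>

theorem Phi2_nonneg:
  fixes m n l :: nat
  assumes mn: "m + n + 1 = 2 * l"
  shows "(\<lambda>\<epsilon>::real. Phi2 (- of_nat m) (- of_nat n + of_real \<epsilon>) (\<lambda>_. 1) c -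
     ((\<Sum>k\<le>n. of_nat (n choose k) * zeta (- of_nat m - of_nat k) * Psi (int k - int n) 0) +
       fact m / pochhammer (- of_nat (2 * l)) (m + 1) * Psi (- int (2 * l)) 0) / of_real \<epsilon>) \<in> O[at_right 0](\<lambda>_. 1)"
proof -
  obtain K0 :: nat where K0: "\<sigma> + real n < real K0" using reals_Archimedean2 by blast
  \<comment> \<open>Large enough for (-m, -n) to lie in \<open>rem_domain K\<close> and for every k
    <= n to occur in the explicit sum.\<close>
  define K where "K = K0 + n + 2"
  have K: "K \<ge> 2" "K > n" "\<sigma> - real K < - real n" using K0 by (auto simp: K_def)
  \<comment> \<open>The integers near which Q is evaluated: s2 + k is close to k - n, and s1 + s2 -
    1 to - 2 l.\<close>
  define J where "J = insert (- int (2 * l)) ((\<lambda>k. int k - int n) ` {..<K})"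
  obtain r where r: "r > 0" "r \<le> 1/2" and rJ: "\<And>j. j \<in> J \<Longrightarrow> r \<le> rad j"
    by (rule common_radius[of J]) (auto simp: J_def)
  have rk: "r \<le> rad (int k - int n)" if "k < K" for k by (rule rJ) (use that in \<open>auto simp: J_def\<close>)
  have rl: "r \<le> rad (- int (2 * l))" by (rule rJ) (simp add: J_def)
  let ?a = "- of_nat m :: complex" and ?b = "- of_nat n :: complex"
  have ab: "?a + ?b + (-1) = of_int (- int (2 * l))"
  proof -
    have e: "(of_int (- int (2 * l)) :: complex) = - of_nat (m + n + 1)" unfolding mn by simp
    show ?thesis unfolding e by simp
  qed
  have bk: "?b + of_nat k = of_int (int k - int n)" for k by simp
  have val: "Phi2 ?a (?b + of_real \<epsilon>) (\<lambda>_. 1) c = cont_part K (?a, ?b + of_real \<epsilon>)" if e: "0 < \<epsilon>" "\<epsilon> < r" for \<epsilon>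
  proof (rule Phi2_eqI[OF open_corner[OF e] corner_centre[OF e] _ K(1)])
    let ?V = "corner ?a ?b r \<epsilon>"
    have fst_lt: "Re (fst p) < 1" if "p \<in> ?V" for p
    proof -
      have "fst p \<in> ball ?a r" using corner_fst[OF e, of "fst p" "snd p"] that by simp
      then show ?thesis using Re_ball(2)[of "fst p" ?a r] r(2) by simp
    qed
    have sndk: "snd p + of_nat k \<in> ball (of_int (int k - int n)) r - {of_int (int k - int n)}" if "p \<in> ?V" for p k
      using corner_snd[OF e, of "fst p" "snd p" ?a ?b "of_nat k"] that unfolding bk by simp
    have sum: "fst p + snd p + (-1) \<in> ball (of_int (- int (2 * l))) r - {of_int (- int (2 * l))}" if "p \<in> ?V" for p
      using corner_sum[OF e, of "fst p" "snd p" ?a ?b "-1"] that unfolding ab by simp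
    show sub: "?V \<subseteq> rem_domain K"
    proof
      fix p assume p: "p \<in> ?V"
      have "snd p \<in> ball (?b + of_real \<epsilon>) (min \<epsilon> (r - \<epsilon>))"
        using corner_snd_near[OF e, of "fst p" "snd p" ?a ?b 0] p by simp
      from Re_ball(1)[OF this] have "Re (snd p) > - real n" by simp
      then show "p \<in> rem_domain K" using fst_lt[OF p] K by (simp add: rem_domain_def)
    qed
    have h1: "(\<lambda>p. zeta (fst p + (- of_nat k))) holomorphic2_on ?V" for k
      by (rule holomorphic2_on_compose_fst[OF holomorphic_on_zeta]) (use fst_lt in \<open>fastforce simp: complex_eq_iff\<close>)+
    have h2: "(\<lambda>p. Q (snd p + of_nat k)) holomorphic2_on ?V" if "k < K" for k
      by (rule holomorphic2_on_compose_snd[OF holomorphic_on_Q[OF rk[OF that]] _ sndk]) (auto intro: open_delete)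
    have h3: "(\<lambda>p. (\<lambda>w. Gamma w * Q w) (fst p + snd p + (-1))) holomorphic2_on ?V"
      by (rule holomorphic2_on_compose_sum[OF holomorphic_on_Gamma_Q[OF rl] _ sum]) (use r in \<open>auto intro: open_delete\<close>)
    have "(\<lambda>p. (\<lambda>x. Gamma (1 - x)) (fst p + 0)) holomorphic2_on ?V"
      by (rule holomorphic2_on_compose_fst[OF Gamma_one_minus_holomorphic open_halfspace_Re_lt]) (use fst_lt in auto)
    then have h4: "(\<lambda>p. Gamma (1 - fst p)) holomorphic2_on ?V" by simp
    have h5: "(\<lambda>p. rGamma (snd p)) holomorphic2_on ?V"
      using holomorphic2_on_compose_snd[OF holomorphic_rGamma open_UNIV, of ?V 0] by simp
    have "(\<lambda>p. (\<Sum>k<K. ((- snd p) gchoose k) * zeta (fst p + (- of_nat k)) * Q (snd p + of_nat k)) +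
       (\<lambda>w. Gamma w * Q w) (fst p + snd p + (-1)) * Gamma (1 - fst p) * rGamma (snd p) + rGamma (snd p) * mellin_rem K p) holomorphic2_on ?V"
      by (intro holomorphic2_on_add holomorphic2_on_sum holomorphic2_on_mult[OF holomorphic2_on_mult]
            holomorphic2_on_gbinomial_snd h1 h2 h3 h4 h5 holomorphic2_on_rGamma_mellin_rem[OF sub]) simp
    then show "cont_part K holomorphic2_on ?V"
      by (rule holomorphic2_on_cong) (simp add: cont_part_def mult_ac)
  qed simp
  \<comment> \<open>On the slice s1 = -m, s2 = -n + z this is z times \<open>cont_part\<close>,
    written so as to be holomorphic at z = 0; H(0) is the coefficient of 1 / eps.\<close>
  define H where "H z = (\<Sum>k<K. ((of_nat n - z) gchoose k) * zeta (?a - of_nat k) * Psi (int k - int n) z) +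
     Gamma (1 + of_nat m) / pochhammer (- of_nat (2 * l) + z) (m + 1) * Psi (- int (2 * l)) z +
     z * (rGamma (?b + z) * mellin_rem K (?a, ?b + z))" for z
  have poch: "pochhammer (- of_nat (2 * l) + z) (m + 1) \<noteq> 0" if z: "z \<in> ball 0 r" for z :: complex
  proof
    assume "pochhammer (- of_nat (2 * l) + z) (m + 1) = 0"
    then obtain k where k: "k < m + 1" "- of_nat (2 * l) + z = - of_nat k" by (auto simp: pochhammer_eq_0_iff)
    then have ze: "z = of_int (int (2 * l) - int k)" by (simp add: algebra_simps)
    have "norm z < 1" using z r by simp
    then have "int (2 * l) - int k = 0" unfolding ze by (rule norm_of_int_lt_1)
    then show False using k(1) mn by simp
  qed
  have "H holomorphic_on ball 0 r"
  proof -
    have P: "Psi j holomorphic_on ball 0 r" if "j \<in> J" for j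
      by (rule holomorphic_on_subset[OF Psi]) (use rJ[OF that] in auto)
    have "(\<lambda>z. mellin_rem K (?a, ?b + z)) holomorphic_on ball 0 r"
    proof (rule holomorphic_on_slice_snd[OF holomorphic2_on_mellin_rem open_rem_domain])
      fix z assume "z \<in> ball (0::complex) r"
      from Re_ball[OF this] r(2) have "-(1/2) < Re z" "Re z < 1/2" by simp_all
      then show "(?a, ?b + z) \<in> rem_domain K" using K0 by (simp add: rem_domain_def K_def)
    qed
    moreover have "(\<lambda>z. pochhammer (- of_nat (2 * l) + z) (m + 1)) holomorphic_on ball 0 r"
      by (intro holomorphic_intros)
    ultimately show ?thesis
      unfolding H_def by (intro holomorphic_intros P poch) (auto simp: J_def)
  qed
  then have diff: "H field_differentiable at 0"
    using r(1) by (intro holomorphic_on_imp_differentiable_at[OF _ open_ball]) auto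
  have "cont_part K (?a, ?b + of_real \<epsilon>) = H (of_real \<epsilon>) / of_real \<epsilon> ^ Suc 0" if e: "0 < \<epsilon>" "\<epsilon> < r" for \<epsilon>
  proof -
    define z where "z = complex_of_real \<epsilon>"
    have z: "z \<in> ball 0 r" "z \<noteq> 0" using e by (auto simp: z_def)
    have Qk: "Q (?b + z + of_nat k) = Psi (int k - int n) z / z" if "k < K" for k
      using Q_Psi[of z "int k - int n"] z rk[OF that] by (simp add: algebra_simps)
    have Ql: "Q (?a + (?b + z) - 1) = Psi (- int (2 * l)) z / z"
    proof -
      have e: "?a + (?b + z) - 1 = of_int (- int (2 * l)) + z" using ab by (simp add: algebra_simps)
      show ?thesis unfolding e by (rule Q_Psi) (use z rl in auto)
    qed
    have nI: "?b + z \<notin> \<int>\<^sub>\<le>\<^sub>0"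
      using punctured_ball_not_Int[of "?b + z" "- int n"] z r nonpos_Ints_Int by (auto simp: dist_norm)
    have G: "Gamma (?a + (?b + z) - 1) * rGamma (?b + z) = 1 / pochhammer (- of_nat (2 * l) + z) (m + 1)"
    proof -
      have e1: "?a + (?b + z) - 1 = - of_nat (2 * l) + z" using ab by (simp add: algebra_simps)
      have "of_nat m + of_nat n + 1 = (of_nat (2 * l) :: complex)"
        using arg_cong[OF mn, of "of_nat :: nat \<Rightarrow> complex"] by (simp only: of_nat_add of_nat_1)
      then have e2: "- of_nat (2 * l) + z + of_nat (m + 1) = ?b + z" by (simp add: algebra_simps)
      have "Gamma (- of_nat (2 * l) + z) = Gamma (?b + z) / pochhammer (- of_nat (2 * l) + z) (m + 1)"
        using Gamma_pochhammer[of "- of_nat (2 * l) + z" "m + 1"] nI unfolding e2 by simp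
      then show ?thesis unfolding e1 using nI by (simp add: rGamma_inverse_Gamma Gamma_eq_zero_iff)
    qed
    have "cont_part K (?a, ?b + z) = (\<Sum>k<K. ((of_nat n - z) gchoose k) * zeta (?a - of_nat k) * (Psi (int k - int n) z / z)) +
       (Gamma (?a + (?b + z) - 1) * rGamma (?b + z)) * Gamma (1 + of_nat m) * (Psi (- int (2 * l)) z / z) +
       rGamma (?b + z) * mellin_rem K (?a, ?b + z)"
      unfolding cont_part_def fst_conv snd_conv Ql using Qk by (simp add: mult_ac)
    also have "\<dots> = H z / z"
      unfolding G H_def using z(2) by (simp add: add_divide_distrib sum_divide_distrib)
    finally show ?thesis by (simp add: z_def)
  qed
  then have "(\<lambda>\<epsilon>::real. Phi2 ?a (?b + of_real \<epsilon>) (\<lambda>_. 1) c - H 0 / of_real \<epsilon> ^ Suc 0) \<in> O[at_right 0](\<lambda>\<epsilon>. 1 / of_real \<epsilon> ^ 0)"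
    using val by (intro bigo_simple_pole[OF diff r(1)]) simp
  moreover have "H 0 = (\<Sum>k\<le>n. of_nat (n choose k) * zeta (?a - of_nat k) * Psi (int k - int n) 0) +
       fact m / pochhammer (- of_nat (2 * l)) (m + 1) * Psi (- int (2 * l)) 0"
  proof -
    \<comment> \<open>At z = 0 the binomial coefficient is that of the integer n, which vanishes for
      k > n.\<close>
    have "(\<Sum>k<K. ((of_nat n - 0) gchoose k) * zeta (?a - of_nat k) * Psi (int k - int n) 0) =
       (\<Sum>k\<le>n. of_nat (n choose k) * zeta (?a - of_nat k) * Psi (int k - int n) 0)"
      by (rule sum.mono_neutral_cong_right) (use K(2) in \<open>auto simp: binomial_gbinomial[symmetric] binomial_eq_0\<close>)
    moreover have "Gamma (1 + of_nat m) = (fact m :: complex)" by (rule Gamma_fact)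
    ultimately show ?thesis by (simp add: H_def)
  qed
  ultimately show ?thesis by simp
qed

text \<open>
  The poles of \<open>Gamma (1 - s\<^sub>1)\<close> and of \<open>zeta (s\<^sub>1 - M)\<close> along \<open>s\<^sub>1 = M + 1\<close> cancel in \<open>cont_part\<close>. The double pole
  of \<open>Gamma w * Q w\<close> at \<open>w = -2l\<close>, differentiated by this cancellation and multiplied by a simple zero of
  \<open>rGamma s\<^sub>2\<close>, produces the double pole in \<open>\<epsilon>\<close>.
\<close>

theorem Phi2_neg:
  fixes M n l :: nat
  assumes n: "n = M + 2 * l" and l: "l \<ge> 1"
  shows "(\<lambda>\<epsilon>::real. Phi2 (of_nat (Suc M)) (- of_nat n + of_real \<epsilon>) (\<lambda>_. 1) c -
     2 * Psi (- int (2 * l)) 0 * of_nat (n choose (2 * l)) / of_real \<epsilon> ^ 2) \<in> O[at_right 0](\<lambda>\<epsilon>. 1 / of_real \<epsilon>)"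
proof -
  obtain K0 :: nat where K0: "\<sigma> + real n < real K0" using reals_Archimedean2 by blast
  \<comment> \<open>As n >= M + 2, this order also exceeds M + 2, so a neighbourhood of s1 = M + 1
    is in the range of the remainder.\<close>
  define K where "K = K0 + n + 3"
  have K: "K \<ge> 2" "M < K" "\<sigma> - real K < - real n" "real (Suc M) + 1 < real K"
    using K0 n l sigma_ge by (auto simp: K_def)
  define J where "J = insert (- int (2 * l)) ((\<lambda>k. int k - int n) ` {..<K})"
  obtain r where r: "r > 0" "r \<le> 1/2" and rJ: "\<And>j. j \<in> J \<Longrightarrow> r \<le> rad j"
    by (rule common_radius[of J]) (auto simp: J_def)
  have rk: "r \<le> rad (int k - int n)" if "k < K" for k by (rule rJ) (use that in \<open>auto simp: J_def\<close>)
  have rl: "r \<le> rad (- int (2 * l))" by (rule rJ) (simp add: J_def)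
  let ?a = "of_nat (Suc M) :: complex" and ?b = "- of_nat n :: complex" and ?L = "- int (2 * l)"
  have ab: "?a + ?b + (-1) = of_int ?L" "?b + of_nat M = of_int ?L" using n by simp_all
  have bk: "?b + of_nat k = of_int (int k - int n)" for k by simp
  define B where "B w = Gamma w * Q w" for w
  \<comment> \<open>Near s = M + 1 the recurrence for Gamma, applied M + 1 times, gives Gamma(1 - s)
    = u(s) / (s - (M + 1)) with \<open>u\<close> holomorphic.\<close>
  define u where "u s = - (Gamma (1 - s + ?a) / pochhammer (1 - s) M)" for s
  \<comment> \<open>The regular part zeta(s) - 1 / (s - 1) of zeta at its pole, since
    \<open>zeta_num 1 = 1\<close>.\<close>
  define z0 where "z0 s = diff_quot zeta_num s 1" for s
  have pN: "pochhammer (1 - s) M \<noteq> 0" if s: "s \<in> ball ?a r" for s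
  proof
    assume "pochhammer (1 - s) M = 0"
    then obtain k where k: "k < M" "1 - s = - of_nat k" by (auto simp: pochhammer_eq_0_iff)
    then have se: "?a - s = of_int (int M - int k)" by (simp add: algebra_simps)
    have "norm (?a - s) < 1" using s r by (simp add: dist_norm)
    then have "int M - int k = 0" unfolding se by (rule norm_of_int_lt_1)
    then show False using k(1) by simp
  qed
  have Ga: "1 - s + ?a \<notin> \<int>\<^sub>\<le>\<^sub>0" if s: "s \<in> ball ?a r" for s
  proof -
    have "norm (s - ?a) < 1/2" using s r(2) by (simp add: dist_norm norm_minus_commute)
    then have "Re (s - ?a) < 1/2" using complex_Re_le_cmod[of "s - ?a"] by (rule order_le_less_trans[rotated])
    then have "Re (1 - s + ?a) > 0" by simp
    then show ?thesis by (rule Re_pos_not_nonpos_Ints)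
  qed
  have uh: "u holomorphic_on ball ?a r"
  proof -
    have "(\<lambda>s. Gamma (1 - s + ?a)) holomorphic_on ball ?a r" using Ga by (intro holomorphic_intros) auto
    moreover have "(\<lambda>s. pochhammer (1 - s) M) holomorphic_on ball ?a r" by (intro holomorphic_intros)
    ultimately show ?thesis unfolding u_def using pN by (intro holomorphic_on_minus holomorphic_on_divide)
  qed
  have Gu: "Gamma (1 - s) = u s / (s - ?a)" if s: "s \<in> ball ?a r" "s \<noteq> ?a" for s
  proof -
    have "Gamma (1 - s) = Gamma (1 - s + ?a) / pochhammer (1 - s) (Suc M)"
      by (rule Gamma_pochhammer) (rule Ga[OF s(1)])
    also have "pochhammer (1 - s) (Suc M) = - (pochhammer (1 - s) M * (s - ?a))"
      by (simp add: pochhammer_Suc algebra_simps)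
    finally show ?thesis unfolding u_def by (simp del: of_nat_Suc)
  qed
  have ua: "u ?a = - ((-1) ^ M / fact M)"
  proof -
    have "pochhammer (1 - ?a) M = (-1) ^ M * fact M" by (simp add: pochhammer_same)
    moreover have "(1::complex) - ?a + ?a = 1" by simp
    ultimately show ?thesis unfolding u_def by (simp add: divide_simps)
  qed
  \<comment> \<open>The sum term k = M and the Gamma term are rewritten without their poles at s1 =
    M + 1. Together the polar parts have the numerator u(s1) B(s1 + s2 - 1) - u(M + 1) B(s2 + M)
    over s1 - (M + 1), and the two difference quotients arise from it as in the product
    rule.\<close>
  define g where "g p = (\<Sum>k\<in>{..<K} - {M}. ((- snd p) gchoose k) * zeta (fst p + (- of_nat k)) * Q (snd p + of_nat k)) +
     ((- snd p) gchoose M) * z0 (fst p + (- of_nat M)) * Q (snd p + of_nat M) +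
     rGamma (snd p) * (diff_quot u (fst p) ?a * B (fst p + snd p + (-1)) + u ?a * diff_quot B (fst p + snd p + (-1)) (snd p + of_nat M)) +
     rGamma (snd p) * mellin_rem K p" for p
  have val: "Phi2 ?a (?b + of_real \<epsilon>) (\<lambda>_. 1) c = g (?a, ?b + of_real \<epsilon>)" if e: "0 < \<epsilon>" "\<epsilon> < r" for \<epsilon>
  proof (rule Phi2_eqI[OF open_corner[OF e] corner_centre[OF e] _ K(1)])
    let ?V = "corner ?a ?b r \<epsilon>" and ?w = "of_int ?L + complex_of_real \<epsilon>" and ?\<rho> = "min \<epsilon> (r - \<epsilon>)"
    have fst_ball: "fst p \<in> ball ?a r" if "p \<in> ?V" for p
      using corner_fst[OF e, of "fst p" "snd p"] that by simp
    have sndk: "snd p + of_nat k \<in> ball (of_int (int k - int n)) r - {of_int (int k - int n)}" if "p \<in> ?V" for p k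
      using corner_snd[OF e, of "fst p" "snd p" ?a ?b "of_nat k"] that unfolding bk by simp
    have sum: "fst p + snd p + (-1) \<in> ball ?w ?\<rho>" if "p \<in> ?V" for p
      using corner_sum_near[OF e, of "fst p" "snd p" ?a ?b "-1"] that unfolding ab by simp
    have sndN: "snd p + of_nat M \<in> ball ?w ?\<rho>" if "p \<in> ?V" for p
      using corner_snd_near[OF e, of "fst p" "snd p" ?a ?b "of_nat M"] that unfolding ab by simp
    show sub: "?V \<subseteq> rem_domain K"
    proof
      fix p assume p: "p \<in> ?V"
      have "snd p \<in> ball (?b + of_real \<epsilon>) ?\<rho>"
        using corner_snd_near[OF e, of "fst p" "snd p" ?a ?b 0] p by simp
      from Re_ball(1)[OF this] have "Re (snd p) > - real n" by simp
      moreover have "Re (fst p) < real (Suc M) + 1"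
        using Re_ball(2)[OF fst_ball[OF p]] r(2) by simp
      ultimately show "p \<in> rem_domain K" using K by (simp add: rem_domain_def)
    qed
    \<comment> \<open>Both arguments of the difference quotient of \<open>B\<close> must lie in one
      ball that avoids the pole at - 2 l; centring it at - 2 l + eps achieves this.\<close>
    have wsub: "ball ?w ?\<rho> \<subseteq> ball (of_int ?L) r - {of_int ?L}"
    proof
      fix w assume w: "w \<in> ball ?w ?\<rho>"
      have "norm (w - of_int ?L) \<le> norm (w - ?w) + norm (complex_of_real \<epsilon>)"
        using norm_triangle_ineq[of "w - ?w" "of_real \<epsilon>"] by simp
      then have "norm (w - of_int ?L) < r" using w e by (simp add: dist_norm norm_minus_commute)
      moreover have "w \<noteq> of_int ?L" using w e by (auto simp: dist_norm)
      ultimately show "w \<in> ball (of_int ?L) r - {of_int ?L}" by (simp add: dist_norm norm_minus_commute)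
    qed
    have Bh: "B holomorphic_on ball ?w ?\<rho>"
      unfolding B_def by (rule holomorphic_on_subset[OF holomorphic_on_Gamma_Q[OF rl] wsub]) (use r in simp)
    have h1: "(\<lambda>p. zeta (fst p + (- of_nat k))) holomorphic2_on ?V" if "k \<noteq> M" for k
    proof (rule holomorphic2_on_compose_fst[OF holomorphic_on_zeta])
      show "fst p + (- of_nat k) \<in> - {1}" if p: "p \<in> ?V" for p
      proof
        assume "fst p + (- of_nat k) \<in> {1}"
        then have "?a - fst p = of_int (int M - int k)" by (simp add: algebra_simps)
        moreover have "norm (?a - fst p) < 1" using fst_ball[OF p] r by (simp add: dist_norm)
        ultimately have "int M - int k = 0" using norm_of_int_lt_1 by metis
        then show False using \<open>k \<noteq> M\<close> by simp
      qed
    qed auto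
    have h2: "(\<lambda>p. Q (snd p + of_nat k)) holomorphic2_on ?V" if "k < K" for k
      by (rule holomorphic2_on_compose_snd[OF holomorphic_on_Q[OF rk[OF that]] _ sndk]) (auto intro: open_delete)
    have h3: "(\<lambda>p. z0 (fst p + (- of_nat M))) holomorphic2_on ?V"
      unfolding z0_def by (rule holomorphic2_on_compose_fst[OF holomorphic_on_diff_quot[OF holomorphic_on_zeta_num]]) auto
    have "(\<lambda>p. (\<lambda>x. diff_quot u x ?a) (fst p + 0)) holomorphic2_on ?V"
      by (rule holomorphic2_on_compose_fst[OF holomorphic_on_diff_quot[OF uh open_ball] open_ball]) (use fst_ball in simp)
    then have h4: "(\<lambda>p. diff_quot u (fst p) ?a) holomorphic2_on ?V" by simp
    have h5: "(\<lambda>p. B (fst p + snd p + (-1))) holomorphic2_on ?V"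
      by (rule holomorphic2_on_compose_sum[OF Bh open_ball sum])
    have id: "(\<lambda>z::complex. z) holomorphic_on UNIV" by (rule holomorphic_on_ident)
    have "(\<lambda>p. (\<lambda>q. diff_quot B (fst q) (snd q)) (fst p + snd p + (-1), snd p + of_nat M)) holomorphic2_on ?V"
      by (rule holomorphic2_on_compose_pair[OF holomorphic2_on_diff_quot[OF Bh] _
            holomorphic2_on_compose_sum[OF id open_UNIV] holomorphic2_on_compose_snd[OF id open_UNIV]])
         (use sum sndN in \<open>auto intro: open_Times\<close>)
    then have h6: "(\<lambda>p. diff_quot B (fst p + snd p + (-1)) (snd p + of_nat M)) holomorphic2_on ?V" by simp
    have h7: "(\<lambda>p. rGamma (snd p)) holomorphic2_on ?V"
      using holomorphic2_on_compose_snd[OF holomorphic_rGamma open_UNIV, of ?V 0] by simp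
    have s: "(\<lambda>p. \<Sum>k\<in>{..<K} - {M}. ((- snd p) gchoose k) * zeta (fst p + (- of_nat k)) * Q (snd p + of_nat k)) holomorphic2_on ?V"
    proof (rule holomorphic2_on_sum)
      fix k assume "k \<in> {..<K} - {M}"
      then show "(\<lambda>p. ((- snd p) gchoose k) * zeta (fst p + (- of_nat k)) * Q (snd p + of_nat k)) holomorphic2_on ?V"
        by (intro holomorphic2_on_mult[OF holomorphic2_on_mult] holomorphic2_on_gbinomial_snd h1 h2) auto
    qed
    note s2 = holomorphic2_on_mult[OF holomorphic2_on_mult[OF holomorphic2_on_gbinomial_snd[of M] h3] h2[OF K(2)]]
    note s3 = holomorphic2_on_mult[OF h7 holomorphic2_on_add[OF holomorphic2_on_mult[OF h4 h5] holomorphic2_on_mult[OF holomorphic2_on_const[of "u ?a"] h6]]]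
    show "g holomorphic2_on ?V"
      unfolding g_def by (rule holomorphic2_on_add[OF holomorphic2_on_add[OF holomorphic2_on_add[OF s s2] s3] holomorphic2_on_rGamma_mellin_rem[OF sub]])
    fix p assume p: "p \<in> ?V" and np: "1 - fst p \<notin> \<int>\<^sub>\<le>\<^sub>0"
    obtain s1 s2 where ps: "p = (s1, s2)" by force
    have s1: "s1 \<in> ball ?a r" "s1 \<noteq> ?a"
    proof -
      show "s1 \<in> ball ?a r" using fst_ball[OF p] by (simp add: ps)
      show "s1 \<noteq> ?a" using np by (auto simp: ps)
    qed
    have d0: "s1 - ?a \<noteq> 0" using s1(2) by simp
    have zN: "zeta (s1 - of_nat M) = 1 / (s1 - ?a) + z0 (s1 - of_nat M)"
    proof -
      have e1: "s1 - of_nat M - 1 = s1 - ?a" and ne: "s1 - of_nat M \<noteq> 1" using s1(2) by (auto simp: algebra_simps)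
      have "z0 (s1 - of_nat M) = (zeta_num (s1 - of_nat M) - 1) / (s1 - ?a)"
        using ne by (simp add: z0_def diff_quot_def e1 del: of_nat_Suc)
      then show ?thesis unfolding zeta_eq e1 by (simp add: diff_divide_distrib)
    qed
    have sN: "s1 + s2 - 1 - (s2 + of_nat M) = s1 - ?a" "s1 + s2 - 1 \<noteq> s2 + of_nat M"
      using s1(2) by (auto simp: algebra_simps)
    have DB: "diff_quot B (s1 + s2 - 1) (s2 + of_nat M) = (B (s1 + s2 - 1) - B (s2 + of_nat M)) / (s1 - ?a)"
      using sN by (simp add: diff_quot_def del: of_nat_Suc)
    have Du: "diff_quot u s1 ?a = (u s1 - u ?a) / (s1 - ?a)" using s1(2) by (simp add: diff_quot_def del: of_nat_Suc)
    have s2n: "s2 + of_nat M \<notin> \<int>\<^sub>\<le>\<^sub>0"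
    proof -
      have "s2 + of_nat M \<in> ball (of_int (int M - int n)) 1 - {of_int (int M - int n)}"
        using sndk[OF p, of M] r(2) by (auto simp: ps)
      from punctured_ball_not_Int[OF this] show ?thesis using nonpos_Ints_Int by blast
    qed
    \<comment> \<open>The residues of the two terms match: (-1)^M / M! is minus u(M + 1), and the
      rising factorial of s2 is Gamma(s2 + M) / Gamma(s2).\<close>
    have key: "((- s2) gchoose M) * Q (s2 + of_nat M) = - (u ?a * B (s2 + of_nat M) * rGamma s2)"
    proof -
      have "rGamma (s2 + of_nat M) * Gamma (s2 + of_nat M) = 1"
        using s2n by (simp add: rGamma_inverse_Gamma Gamma_eq_zero_iff)
      then have "rGamma s2 * Gamma (s2 + of_nat M) = pochhammer s2 M" using pochhammer_rGamma[of s2 M] by simp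
      then have "(- s2) gchoose M = (-1) ^ M / fact M * (rGamma s2 * Gamma (s2 + of_nat M))"
        by (simp add: gbinomial_pochhammer)
      then show ?thesis unfolding ua B_def by simp
    qed
    have "cont_part K p = (\<Sum>k\<in>{..<K} - {M}. ((- s2) gchoose k) * zeta (s1 - of_nat k) * Q (s2 + of_nat k)) +
        (((- s2) gchoose M) * zeta (s1 - of_nat M) * Q (s2 + of_nat M) +
        B (s1 + s2 - 1) * Gamma (1 - s1) * rGamma s2) + rGamma s2 * mellin_rem K p"
      unfolding cont_part_def ps fst_conv snd_conv B_def
      by (subst sum.remove[of "{..<K}" M]) (use K(2) in \<open>auto simp: mult_ac\<close>)
    also have "((- s2) gchoose M) * zeta (s1 - of_nat M) * Q (s2 + of_nat M) + B (s1 + s2 - 1) * Gamma (1 - s1) * rGamma s2 =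
        ((- s2) gchoose M) * z0 (s1 - of_nat M) * Q (s2 + of_nat M) +
        rGamma s2 * ((u s1 * B (s1 + s2 - 1) - u ?a * B (s2 + of_nat M)) / (s1 - ?a))"
    proof -
      have "((- s2) gchoose M) * (1 / (s1 - ?a)) * Q (s2 + of_nat M) = (((- s2) gchoose M) * Q (s2 + of_nat M)) / (s1 - ?a)" by simp
      also have "\<dots> = - (u ?a * B (s2 + of_nat M) * rGamma s2) / (s1 - ?a)" unfolding key ..
      finally have "((- s2) gchoose M) * (1 / (s1 - ?a)) * Q (s2 + of_nat M) = - (u ?a * B (s2 + of_nat M) * rGamma s2) / (s1 - ?a)" .
      then show ?thesis unfolding zN Gu[OF s1] by (simp add: algebra_simps diff_divide_distrib del: of_nat_Suc)
    qed
    also have "(u s1 * B (s1 + s2 - 1) - u ?a * B (s2 + of_nat M)) / (s1 - ?a) =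
       diff_quot u s1 ?a * B (s1 + s2 - 1) + u ?a * diff_quot B (s1 + s2 - 1) (s2 + of_nat M)"
      unfolding DB Du using d0 by (simp add: add_divide_distrib[symmetric] algebra_simps del: of_nat_Suc)
    finally show "cont_part K p = g p" by (simp add: g_def ps algebra_simps)
  qed
  \<comment> \<open>Here B(- 2 l + z) = h(z) / z^2, and below 1 / Gamma(- n + z) = z q(z); this
    simple zero lowers the triple pole of the derivative of \<open>B\<close> to a double
    one.\<close>
  define h where "h z = Gamma (1 + z) * Psi ?L z / pochhammer (of_int ?L + z) (2 * l)" for z
  define q where "q z = pochhammer (?b + z) n * rGamma (1 + z)" for z
  \<comment> \<open>This is z^2 g on the slice s1 = M + 1. There the arguments of the difference
    quotient coincide, so the derivative of \<open>B\<close> enters, with leading term - 2 h(z) /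
    z^3; this is the origin of the factor 2.\<close>
  define H where "H z = (\<Sum>k\<in>{..<K} - {M}. ((of_nat n - z) gchoose k) * zeta (?a + (- of_nat k)) * (z * Psi (int k - int n) z)) +
     ((of_nat n - z) gchoose M) * z0 (?a + (- of_nat M)) * (z * Psi (int M - int n) z) +
     q z * (diff_quot u ?a ?a * (z * h z) + u ?a * (z * deriv h z - 2 * h z)) +
     z ^ 2 * (rGamma (?b + z) * mellin_rem K (?a, ?b + z))" for z
  have P: "Psi j holomorphic_on ball 0 r" if "j \<in> J" for j
    by (rule holomorphic_on_subset[OF Psi]) (use rJ[OF that] in auto)
  have poch: "pochhammer (of_int ?L + z) (2 * l) \<noteq> 0" if z: "z \<in> ball 0 r" for z :: complex
  proof
    assume "pochhammer (of_int ?L + z) (2 * l) = 0"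
    then obtain k where k: "k < 2 * l" "of_int ?L + z = - of_nat k" by (auto simp: pochhammer_eq_0_iff)
    then have ze: "z = of_int (int (2 * l) - int k)" by (simp add: algebra_simps)
    have "norm z < 1" using z r by simp
    then have "int (2 * l) - int k = 0" unfolding ze by (rule norm_of_int_lt_1)
    then show False using k(1) by simp
  qed
  have G1: "1 + z \<notin> \<int>\<^sub>\<le>\<^sub>0" if z: "z \<in> ball 0 r" for z :: complex
  proof -
    have "Re (1 + z) > 0" using Re_ball(1)[OF z] r(2) by simp
    then show ?thesis by (rule Re_pos_not_nonpos_Ints)
  qed
  have hh: "h holomorphic_on ball 0 r"
  proof -
    have "(\<lambda>z. Gamma (1 + z)) holomorphic_on ball 0 r" using G1 by (intro holomorphic_intros) auto
    moreover have "(\<lambda>z. pochhammer (of_int ?L + z) (2 * l)) holomorphic_on ball 0 r" by (intro holomorphic_intros)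
    moreover have "Psi ?L holomorphic_on ball 0 r" by (rule P) (simp add: J_def)
    ultimately show ?thesis unfolding h_def using poch by (intro holomorphic_on_divide holomorphic_on_mult)
  qed
  have "H holomorphic_on ball 0 r"
  proof -
    have "(\<lambda>z. mellin_rem K (?a, ?b + z)) holomorphic_on ball 0 r"
    proof (rule holomorphic_on_slice_snd[OF holomorphic2_on_mellin_rem open_rem_domain])
      fix z assume "z \<in> ball (0::complex) r"
      from Re_ball[OF this] r(2) have "-(1/2) < Re z" "Re z < 1/2" by simp_all
      then show "(?a, ?b + z) \<in> rem_domain K" using K0 K(4) by (simp add: rem_domain_def K_def)
    qed
    moreover have "q holomorphic_on ball 0 r" unfolding q_def by (intro holomorphic_intros)
    moreover have "deriv h holomorphic_on ball 0 r" by (rule holomorphic_deriv[OF hh open_ball])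
    ultimately show ?thesis
      unfolding H_def using hh K(2) by (intro holomorphic_intros P) (auto simp: J_def)
  qed
  then have diff: "H field_differentiable at 0"
    using r(1) by (intro holomorphic_on_imp_differentiable_at[OF _ open_ball]) auto
  have Bz: "B (of_int ?L + z) = h z / z ^ 2" if z: "z \<in> ball 0 r" "z \<noteq> 0" for z
  proof -
    have "Gamma (of_int ?L + z) = Gamma (1 + z) / pochhammer (of_int ?L + z) (Suc (2 * l))"
      using Gamma_pochhammer[of "of_int ?L + z" "Suc (2 * l)"] G1[OF z(1)] by (simp add: algebra_simps)
    also have "pochhammer (of_int ?L + z) (Suc (2 * l)) = pochhammer (of_int ?L + z) (2 * l) * z"
      by (simp add: pochhammer_Suc)
    finally show ?thesis
      unfolding B_def h_def using Q_Psi[of z ?L] z rl by (simp add: power2_eq_square)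
  qed
  have dB: "deriv B (of_int ?L + z) = deriv h z / z ^ 2 - 2 * h z / z ^ 3" if z: "z \<in> ball 0 r" "z \<noteq> 0" for z
  proof -
    have op: "open (ball (of_int ?L) r - {of_int ?L :: complex})" by (intro open_delete open_ball)
    have mem: "of_int ?L + z \<in> ball (of_int ?L) r - {of_int ?L :: complex}" using z by (simp add: dist_norm)
    have "(h has_field_derivative deriv h z) (at z)" by (rule holomorphic_derivI[OF hh open_ball z(1)])
    then have "((\<lambda>w. h (w - of_int ?L)) has_field_derivative deriv h z * 1) (at (of_int ?L + z))"
      by (intro DERIV_chain2[where f = h and g = "\<lambda>w. w - of_int ?L"]) (auto intro!: derivative_eq_intros)
    then have "((\<lambda>w. h (w - of_int ?L) / (w - of_int ?L) ^ 2) has_field_derivative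
       (deriv h z * z ^ 2 - h z * (2 * z)) / (z ^ 2 * z ^ 2)) (at (of_int ?L + z))"
      using z(2) by (auto intro!: derivative_eq_intros)
    then have "(B has_field_derivative (deriv h z * z ^ 2 - h z * (2 * z)) / (z ^ 2 * z ^ 2)) (at (of_int ?L + z))"
    proof (rule has_field_derivative_transform_within_open[OF _ op mem])
      have mem0: "x - v \<in> ball 0 r" "x - v \<noteq> 0" if "x \<in> ball v r - {v}" for v x :: complex
        using that by (simp_all add: dist_norm norm_minus_commute)
      fix w assume "w \<in> ball (of_int ?L) r - {of_int ?L :: complex}"
      from Bz[OF mem0[OF this]] show "h (w - of_int ?L) / (w - of_int ?L) ^ 2 = B w" by simp
    qed
    then have "deriv B (of_int ?L + z) = (deriv h z * z ^ 2 - h z * (2 * z)) / (z ^ 2 * z ^ 2)"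
      by (rule DERIV_imp_deriv)
    also have "\<dots> = deriv h z / z ^ 2 - 2 * h z / z ^ 3"
      using z(2) by (simp add: diff_divide_distrib power2_eq_square power3_eq_cube mult_ac)
    finally show ?thesis .
  qed
  have "g (?a, ?b + of_real \<epsilon>) = H (of_real \<epsilon>) / of_real \<epsilon> ^ Suc 1" if e: "0 < \<epsilon>" "\<epsilon> < r" for \<epsilon>
  proof -
    define z where "z = complex_of_real \<epsilon>"
    have z: "z \<in> ball 0 r" "z \<noteq> 0" using e by (auto simp: z_def)
    have Qk: "Q (?b + z + of_nat k) = (z * Psi (int k - int n) z) / z ^ 2" if "k < K" for k
      using Q_Psi[of z "int k - int n"] z rk[OF that] by (simp add: algebra_simps power2_eq_square)
    have e1: "?a + (?b + z) + (-1) = of_int ?L + z" and e2: "?b + z + of_nat M = of_int ?L + z"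
      using n by (simp_all add: algebra_simps)
    have rG: "rGamma (?b + z) = z * q z"
    proof -
      have "rGamma (?b + z) = pochhammer (?b + z) (Suc n) * rGamma (?b + z + of_nat (Suc n))" by (rule pochhammer_rGamma)
      then show ?thesis by (simp add: q_def pochhammer_Suc mult_ac add_ac)
    qed
    have mid: "rGamma (?b + z) * (diff_quot u ?a ?a * B (of_int ?L + z) + u ?a * diff_quot B (of_int ?L + z) (of_int ?L + z)) =
       q z * (diff_quot u ?a ?a * (z * h z) + u ?a * (z * deriv h z - 2 * h z)) / z ^ 2"
    proof -
      have dq: "diff_quot B (of_int ?L + z) (of_int ?L + z) = (z * deriv h z - 2 * h z) / z ^ 3"
        unfolding diff_quot_def dB[OF z] using z(2) by (simp add: diff_divide_distrib power2_eq_square power3_eq_cube mult_ac)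
      show ?thesis unfolding dq Bz[OF z] rG using z(2)
        by (simp add: field_simps power2_eq_square power3_eq_cube)
    qed
    have "g (?a, ?b + z) = (\<Sum>k\<in>{..<K} - {M}. ((of_nat n - z) gchoose k) * zeta (?a + (- of_nat k)) * ((z * Psi (int k - int n) z) / z ^ 2)) +
       ((of_nat n - z) gchoose M) * z0 (?a + (- of_nat M)) * ((z * Psi (int M - int n) z) / z ^ 2) +
       rGamma (?b + z) * (diff_quot u ?a ?a * B (of_int ?L + z) + u ?a * diff_quot B (of_int ?L + z) (of_int ?L + z)) +
       rGamma (?b + z) * mellin_rem K (?a, ?b + z)"
    proof -
      have m: "- (?b + z) = of_nat n - z" by simp
      have "(\<Sum>k\<in>{..<K} - {M}. ((of_nat n - z) gchoose k) * zeta (?a + (- of_nat k)) * Q (?b + z + of_nat k)) =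
        (\<Sum>k\<in>{..<K} - {M}. ((of_nat n - z) gchoose k) * zeta (?a + (- of_nat k)) * ((z * Psi (int k - int n) z) / z ^ 2))"
        by (intro sum.cong refl, subst Qk) auto
      then show ?thesis unfolding g_def fst_conv snd_conv m e1 Qk[OF K(2)] by (simp only: e2)
    qed
    also have "\<dots> = H z / z ^ 2"
      unfolding mid H_def using z(2) by (simp add: add_divide_distrib sum_divide_distrib)
    finally show ?thesis by (simp add: z_def numeral_2_eq_2)
  qed
  then have O: "(\<lambda>\<epsilon>::real. Phi2 ?a (?b + of_real \<epsilon>) (\<lambda>_. 1) c - H 0 / of_real \<epsilon> ^ Suc 1) \<in> O[at_right 0](\<lambda>\<epsilon>. 1 / of_real \<epsilon> ^ 1)"
    using val by (intro bigo_simple_pole[OF diff r(1)]) simp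
  have "H 0 = 2 * Psi ?L 0 * of_nat (n choose (2 * l))"
  proof -
    have q0: "q 0 = (-1) ^ n * fact n" by (simp add: q_def pochhammer_same)
    have h0: "h 0 = Psi ?L 0 / fact (2 * l)"
    proof -
      have "of_int ?L + 0 = (- of_nat (2 * l) :: complex)" by simp
      then have "pochhammer (of_int ?L + 0) (2 * l) = (fact (2 * l) :: complex)" by (simp only: pochhammer_same) simp
      then show ?thesis by (simp add: h_def)
    qed
    have bin: "of_nat (n choose (2 * l)) = (fact n / (fact (2 * l) * fact M) :: complex)"
      using binomial_fact[of "2 * l" n, where ?'a = complex] n by simp
    have sgn: "(-1) ^ M * (-1) ^ n = (1 :: complex)"
      by (simp add: n power_add[symmetric] mult_2[symmetric])
    \<comment> \<open>Only - 2 q(0) u(M + 1) h(0) survives at z = 0, as all other terms carry a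
      factor z; the signs cancel because n and M have the same parity.\<close>
    have "H 0 = 2 * ((-1) ^ M * (-1) ^ n) * Psi ?L 0 * (fact n / (fact (2 * l) * fact M))"
      unfolding H_def q0 h0 ua by (simp add: mult_ac)
    then show ?thesis unfolding sgn bin by simp
  qed
  then show ?thesis using O by (simp add: numeral_2_eq_2)
qed

end

section \<open>Matching the residues with the stated coefficients\<close>

text \<open>The rising factorial of - 2 l is (-1)^(m+1) times that of n + 1, which is (m + n + 1)! /
  n!; the sign equals (-1)^n because m + n + 1 is even.\<close>

lemma fact_div_pochhammer_neg:
  assumes "m + n + 1 = 2 * l"
  shows "fact m / pochhammer (- of_nat (2 * l)) (m + 1) = ((-1) ^ n * (fact m * fact n / fact (m + n + 1)) :: complex)"
proof -
  have "pochhammer (- of_nat (2 * l)) (m + 1) = ((-1) ^ (m + 1) * pochhammer (of_nat (2 * l) - of_nat (m + 1) + 1) (m + 1) :: complex)"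
    by (rule pochhammer_minus)
  also have "of_nat (2 * l) - of_nat (m + 1) + 1 = (of_nat (Suc n) :: complex)"
    unfolding assms[symmetric] by simp
  also have "(-1) ^ (m + 1) = ((-1) ^ n :: complex)"
  proof -
    have "even (m + 1) \<longleftrightarrow> even n" using arg_cong[OF assms, of even] by auto
    then show ?thesis by (simp only: minus_one_power_iff)
  qed
  finally have poch: "pochhammer (- of_nat (2 * l)) (m + 1) = ((-1) ^ n * pochhammer (of_nat (Suc n)) (m + 1) :: complex)" .
  have "fact n * pochhammer (of_nat (Suc n)) (m + 1) = (fact (n + (m + 1)) :: complex)"
    using pochhammer_product'[of "1 :: complex" n "m + 1"] by (simp add: pochhammer_fact)
  then have "pochhammer (of_nat (Suc n)) (m + 1) = (fact (m + n + 1) / fact n :: complex)"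
    by (simp add: field_simps add_ac)
  then show ?thesis
    unfolding poch by (cases "even n") (simp_all add: minus_one_power_iff)
qed

text \<open>In the continuation the index k goes with the pole of Q at -(n - k). Reflection relabels
  the terms by the pole, and only positive even labels contribute.\<close>

lemma sum_reflect_even:
  fixes f :: "nat \<Rightarrow> complex"
  assumes "\<And>k. k \<le> n \<Longrightarrow> \<not> (k > 0 \<and> even k) \<Longrightarrow> f k = 0"
  shows "(\<Sum>k\<le>n. f (n - k)) = (\<Sum>k | k \<in> {1..n} \<and> even k. f k)"
proof -
  have "(\<Sum>k\<le>n. f (n - k)) = (\<Sum>k\<le>n. f k)"
    by (rule sum.reindex_bij_witness[of _ "\<lambda>k. n - k" "\<lambda>k. n - k"]) auto
  also have "\<dots> = (\<Sum>k | k \<in> {1..n} \<and> even k. f k)"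
  proof (rule sum.mono_neutral_right)
    show "\<forall>k\<in>{..n} - {k. k \<in> {1..n} \<and> even k}. f k = 0" using assms by fastforce
  qed auto
  finally show ?thesis .
qed

lemma dirichlet_class_quotient_int:
  assumes "\<alpha> \<in> dirichlet_class"
  obtains \<sigma> N D x0 Psi rad where "dirichlet_quotient_int (alpha_tilde \<alpha>) \<sigma> (quot_series \<alpha>) N D x0 Psi rad"
    and "\<And>i::nat. Psi (- int i) 0 = (if i > 0 \<and> even i then D_coeff \<alpha> i else 0)"
proof -
  obtain \<sigma> where \<sigma>: "\<sigma> \<ge> 2" "summable (\<lambda>n. norm (alpha_tilde \<alpha> (Suc n)) * real (Suc n) powr (- \<sigma>))"
    "\<And>s. Re s \<ge> \<sigma> \<Longrightarrow> (\<Sum>n. dirichlet_term (alpha_tilde \<alpha>) s (Suc n)) = quot_series \<alpha> s"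
    using alpha_tilde_series[OF assms] by metis
  obtain N D x0 where ND: "N holomorphic_on UNIV" "D holomorphic_on UNIV" "D x0 \<noteq> 0"
    "\<And>s. D s \<noteq> 0 \<Longrightarrow> quot_series \<alpha> s = N s / D s"
    using quot_series_eq_quotient[OF assms] by metis
  have "\<exists>\<Psi> r. r > 0 \<and> \<Psi> holomorphic_on ball 0 r \<and>
      (\<forall>z\<in>ball 0 r. z \<noteq> 0 \<longrightarrow> quot_series \<alpha> (of_int j + z) = \<Psi> z / z) \<and>
      (j \<le> 0 \<longrightarrow> \<Psi> 0 = (if j < 0 \<and> even j then D_coeff \<alpha> (nat (- j)) else 0))" for j :: int
    by (rule quot_series_at_int[OF assms, of j]) blast
  then obtain Psi rad where P: "\<And>j::int. rad j > 0 \<and> Psi j holomorphic_on ball 0 (rad j) \<and>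
      (\<forall>z\<in>ball 0 (rad j). z \<noteq> 0 \<longrightarrow> quot_series \<alpha> (of_int j + z) = Psi j z / z) \<and>
      (j \<le> 0 \<longrightarrow> Psi j 0 = (if j < 0 \<and> even j then D_coeff \<alpha> (nat (- j)) else 0))"
    by metis
  show ?thesis
  proof (rule that)
    show "dirichlet_quotient_int (alpha_tilde \<alpha>) \<sigma> (quot_series \<alpha>) N D x0 Psi rad"
      by unfold_locales (use \<sigma> ND P in auto)
    show "Psi (- int i) 0 = (if i > 0 \<and> even i then D_coeff \<alpha> i else 0)" for i
      using P[of "- int i"] by auto
  qed
qed

theorem theorem5p1:
  fixes \<alpha> :: "nat \<Rightarrow> complex" and m :: int and n l :: nat
  assumes "\<alpha> \<in> dirichlet_class"
    and "\<And>\<rho>. \<rho> \<in> nontrivial_zeta_zeros \<Longrightarrow> zorder zeta \<rho> = 1"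
    and "\<exists>B>0. (\<lambda>\<rho>. 1 / deriv zeta \<rho>)
           \<in> O[inf at_infinity (principal nontrivial_zeta_zeros)](\<lambda>\<rho>. of_real (norm \<rho> powr B))"
    and "l \<ge> 1"
    and "m + int n = 2 * int l - 1"
  shows "(m \<ge> 0 \<longrightarrow>
      (\<lambda>\<epsilon>::real. Phi2 (- of_int m) (- of_nat n + of_real \<epsilon>) (\<lambda>_. 1) (alpha_tilde \<alpha>)
         - 1 / of_real \<epsilon> *
           ((-1) ^ n * D_coeff \<alpha> (2 * l) * (fact (nat m) * fact n / fact (nat m + n + 1))
            + (\<Sum>k | k \<in> {1..n} \<and> even k.
                 (-1) ^ k * of_nat (n choose k) * D_coeff \<alpha> k * zeta (- of_int m - of_nat n + of_nat k))))
      \<in> O[at_right 0](\<lambda>_. 1)) \<and>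
    (m \<le> -1 \<longrightarrow>
      (\<lambda>\<epsilon>::real. Phi2 (- of_int m) (- of_nat n + of_real \<epsilon>) (\<lambda>_. 1) (alpha_tilde \<alpha>)
         - 2 * D_coeff \<alpha> (2 * l) / of_real \<epsilon> ^ 2 * of_nat (n choose (2 * l)))
      \<in> O[at_right 0](\<lambda>\<epsilon>. 1 / of_real \<epsilon>))"
proof -
  obtain \<sigma> N D x0 Psi rad where
    loc: "dirichlet_quotient_int (alpha_tilde \<alpha>) \<sigma> (quot_series \<alpha>) N D x0 Psi rad" and
    Psi_0: "\<And>i::nat. Psi (- int i) 0 = (if i > 0 \<and> even i then D_coeff \<alpha> i else 0)"
    using dirichlet_class_quotient_int[OF assms(1)] by metis
  interpret dirichlet_quotient_int "alpha_tilde \<alpha>" \<sigma> "quot_series \<alpha>" N D x0 Psi rad by (rule loc)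
  have Psi_l: "Psi (- int (2 * l)) 0 = D_coeff \<alpha> (2 * l)" using Psi_0[of "2 * l"] assms(4) by simp
  show ?thesis
  proof (intro conjI impI)
    assume "m \<ge> 0"
    then obtain k where m: "m = int k" by (elim nonneg_int_cases)
    have kn: "k + n + 1 = 2 * l" using assms(5) by (simp add: m)
    have S: "(\<Sum>i\<le>n. of_nat (n choose i) * zeta (- of_nat k - of_nat i) * Psi (int i - int n) 0) =
      (\<Sum>i | i \<in> {1..n} \<and> even i. (-1) ^ i * of_nat (n choose i) * D_coeff \<alpha> i * zeta (- of_int m - of_nat n + of_nat i))"
    proof -
      define f where "f i = of_nat (n choose i) * zeta (- of_nat k - of_nat n + of_nat i) * Psi (- int i) 0" for i
      have "(\<Sum>i\<le>n. of_nat (n choose i) * zeta (- of_nat k - of_nat i) * Psi (int i - int n) 0) = (\<Sum>i\<le>n. f (n - i))"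
        by (intro sum.cong refl) (auto simp: f_def of_nat_diff binomial_symmetric[symmetric])
      also have "\<dots> = (\<Sum>i | i \<in> {1..n} \<and> even i. f i)"
        by (rule sum_reflect_even) (auto simp: f_def Psi_0)
      \<comment> \<open>The factor (-1)^i is 1 on the even indices.\<close>
      also have "\<dots> = (\<Sum>i | i \<in> {1..n} \<and> even i. (-1) ^ i * of_nat (n choose i) * D_coeff \<alpha> i * zeta (- of_int m - of_nat n + of_nat i))"
        by (rule sum.cong) (auto simp: f_def Psi_0 m)
      finally show ?thesis .
    qed
    have F: "fact k / pochhammer (- of_nat (2 * l)) (k + 1) * Psi (- int (2 * l)) 0 =
      (-1) ^ n * D_coeff \<alpha> (2 * l) * (fact (nat m) * fact n / fact (nat m + n + 1))"
      unfolding fact_div_pochhammer_neg[OF kn] Psi_l by (simp add: m)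
    have km: "- of_nat k = (- of_int m :: complex)" by (simp add: m)
    show "(\<lambda>\<epsilon>::real. Phi2 (- of_int m) (- of_nat n + of_real \<epsilon>) (\<lambda>_. 1) (alpha_tilde \<alpha>)
         - 1 / of_real \<epsilon> *
           ((-1) ^ n * D_coeff \<alpha> (2 * l) * (fact (nat m) * fact n / fact (nat m + n + 1))
            + (\<Sum>k | k \<in> {1..n} \<and> even k.
                 (-1) ^ k * of_nat (n choose k) * D_coeff \<alpha> k * zeta (- of_int m - of_nat n + of_nat k))))
      \<in> O[at_right 0](\<lambda>_. 1)"
      using Phi2_nonneg[OF kn, unfolded S F, unfolded km] by (simp add: add.commute)
  next
    assume m1: "m \<le> -1"
    \<comment> \<open>The first argument in \<open>Phi2_neg\<close> is Suc k = - m, hence the shift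
      by one, and n = k + 2 l.\<close>
    define k where "k = nat (- m) - 1"
    have m: "m = - int (Suc k)" using m1 by (simp add: k_def)
    have n: "n = k + 2 * l" using assms(5) by (simp add: m)
    have km: "of_nat (Suc k) = (- of_int m :: complex)" by (simp add: m)
    show "(\<lambda>\<epsilon>::real. Phi2 (- of_int m) (- of_nat n + of_real \<epsilon>) (\<lambda>_. 1) (alpha_tilde \<alpha>)
         - 2 * D_coeff \<alpha> (2 * l) / of_real \<epsilon> ^ 2 * of_nat (n choose (2 * l)))
      \<in> O[at_right 0](\<lambda>\<epsilon>. 1 / of_real \<epsilon>)"
      using Phi2_neg[OF n assms(4), unfolded Psi_l, unfolded km] by simp
  qed
qed

end
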